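(* Let $(\mathbb{T},w,x,o)$ be a unimodular Bienaymé-Galton-Watson tree with reproduction law $\pi$, with i.i.d. edge weights of distribution $\omega$ and i.i.d. vertex weights of distribution $\xi$ (all independent), where: (i) $\xi$ is lower bounded, and is either continuous (no atoms) or has its only atom at its minimum $m_\xi\in\mathbb{R}$; (ii) $\omega$ is continuous (no atoms), and its support is locally convex under its maximum $M_\omega\in\mathbb{R}\cup\{+\infty\}$; (iii) $\pi$ has a finite second moment. Let $\mathbb{MD}$ be the almost surely unique optimal monomer-dimer configuration on $(\mathbb{T},w,x,o)$. Let $(G_n,o_n)_{n\in\mathbb{N}}$ be any sequence of finite rooted random graphs that converges locally weakly to $(\mathbb{T},o)$. Draw i.i.d. edge weights $w_n$ with distribution $\omega$ and i.i.d. vertex weights $x_n$ with distribution $\xi$ on $G_n$. Let $\mathrm{MD}_n$ be any optimal monomer-dimer configuration on $(G_n,w_n,x_n)$. Then $(G_n,\mathrm{MD}_n,o_n)$ converges locally weakly to $(\mathbb{T},\mathbb{MD},o)$.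
   Context: Unimodular Bienaymé-Galton-Watson (UBGW) tree with reproduction law $\pi$: $\pi$ is a probability measure on $\mathbb{N}_0=\{0,1,2,\dots\}$ with finite mean $E>0$; $\hat\pi(k)=\frac{(k+1)\pi(k+1)}{E}$ for $k\in\mathbb{N}_0$. The UBGW tree $(\mathbb{T},o)$ is the random rooted tree in which the numbers of children of all vertices are independent, the root $o$ has a number of children distributed as $\pi$, and every non-root vertex has a number of children distributed as $\hat\pi$. "The support of $\omega$ is locally convex under its maximum $M_\omega$" ($M_\omega$ being the supremum of the support) means that the support contains a non-empty open interval with right endpoint $M_\omega$: $(M_\omega-\varepsilon,M_\omega)$ for some $\varepsilon>0$ if $M_\omega<\infty$, or $(A,+\infty)$ for some $A\in\mathbb{R}$ if $M_\omega=+\infty$. A monomer-dimer configuration on a graph $G$ is a set $\mathrm{MD}\subseteq E(G)$ such that every vertex is incident to at most one edge of $\mathrm{MD}$; elements of $\mathrm{MD}$ are dimers, and vertices incident to no edge of $\mathrm{MD}$ are monomers. On a finite weighted graph $(G,w,x)$ (with $w:E(G)\to\mathbb{R}$, $x:V(G)\to\mathbb{R}$), $\mathrm{MD}$ is optimal if it maximises $\sum_{e\text{ dimer}}w(e)+\sum_{v\text{ monomer}}x(v)$. Definition of $\mathbb{MD}$: under (i)–(iii) there is almost surely a unique family $Z$ of messages on the directed edges of $\mathbb{T}$ (both orientations of each edge) such that $Z(u,v)=\max\big(x(v),\max_{u'\sim v,\,u'\ne u}(w(v,u')-Z(v,u'))\big)$ for every directed edge $(u,v)$ (maximum over the empty set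 being $-\infty$). $\mathbb{MD}$ is the configuration on $\mathbb{T}$ in which $\{u,v\}$ is a dimer if and only if $w(u,v)>Z(u,v)+Z(v,u)$. This is the almost surely unique optimal configuration on $(\mathbb{T},w,x,o)$ in the sense that it is the local limit of the optimal configurations of any finite weighted rooted graphs converging locally to $(\mathbb{T},w,x,o)$. For a rooted graph $(G,o)$ and $H\in\mathbb{N}_0$, $B_H(G,o)$ is the subgraph induced on the vertices at distance at most $H+1$ from $o$, rooted at $o$, carrying the restricted configuration when present. Rooted graphs (with configuration) are isomorphic, $\cong$, if there is a root-preserving graph isomorphism preserving membership of edges in the configuration. A sequence converges locally if for every $H$ the balls $B_H$ are eventually isomorphic to the ball $B_H$ of the limit; this defines the (metrisable) local topology. Local weak convergence is weak convergence (convergence in distribution) of random rooted graphs for this topology. *)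

theory Defs
  imports "HOL-Probability.Probability"
begin

section \<open>Rooted graphs with a monomer-dimer configuration\<close>

record 'v rgraph =
  verts :: "'v set"
  edges :: "'v set set"
  root :: 'v

definition rooted_graph :: "'v rgraph \<Rightarrow> bool" where
  "rooted_graph g \<longleftrightarrow> root g \<in> verts g
     \<and> (\<forall>e\<in>edges g. \<exists>u\<in>verts g. \<exists>v\<in>verts g. u \<noteq> v \<and> e = {u, v})
     \<and> (\<forall>v\<in>verts g. finite {u. {u, v} \<in> edges g})"

definition md_config :: "'v rgraph \<Rightarrow> 'v set set \<Rightarrow> bool" where
  "md_config g M \<longleftrightarrow> M \<subseteq> edges g
     \<and> (\<forall>v\<in>verts g. \<forall>e\<in>M. \<forall>e'\<in>M. v \<in> e \<and> v \<in> e' \<longrightarrow> e = e')"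

text \<open>
  Rooted graphs carrying a configuration are pairs \<open>(g, M)\<close>.  A rooted graph without
  configuration is represented by \<open>(g, {})\<close>; isomorphism of such pairs is plain isomorphism
  of rooted graphs.
\<close>

type_synonym 'v mdgraph = "'v rgraph \<times> 'v set set"

definition mdgraphs :: "'v mdgraph set" where
  "mdgraphs = {(g, M). rooted_graph g \<and> md_config g M}"

definition ball_verts :: "nat \<Rightarrow> 'v rgraph \<Rightarrow> 'v set" where
  "ball_verts H g =
     {v\<in>verts g. \<exists>k\<le>H + 1. (root g, v) \<in> {(a, b). {a, b} \<in> edges g} ^^ k}"

definition rball :: "nat \<Rightarrow> 'v mdgraph \<Rightarrow> 'v mdgraph" where
  "rball H = (\<lambda>(g, M).
     (\<lparr>verts = ball_verts H g,
       edges = {e\<in>edges g. e \<subseteq> ball_verts H g},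
       root = root g\<rparr>,
      {e\<in>M. e \<subseteq> ball_verts H g}))"

definition mdgraph_iso :: "'v mdgraph \<Rightarrow> 'v mdgraph \<Rightarrow> bool" (infix "\<cong>\<^sub>r" 50) where
  "G \<cong>\<^sub>r G' \<longleftrightarrow> (case (G, G') of ((g, M), (g', M')) \<Rightarrow>
     \<exists>\<phi>. bij_betw \<phi> (verts g) (verts g') \<and> \<phi> (root g) = root g'
       \<and> (\<forall>u\<in>verts g. \<forall>v\<in>verts g.
             ({u, v} \<in> edges g \<longleftrightarrow> {\<phi> u, \<phi> v} \<in> edges g')
           \<and> ({u, v} \<in> M \<longleftrightarrow> {\<phi> u, \<phi> v} \<in> M')))"


section \<open>Local topology and local weak convergence\<close>

text \<open>
  The topology lives on labelled graphs and does not separate graphs whose balls are all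
  isomorphic; in particular it only sees the connected component of the root.  Its continuous
  functions and Borel sets are those of the quotient by this indistinguishability.
\<close>

definition local_topology :: "'v mdgraph topology" where
  "local_topology = topology_generated_by
     {{G'\<in>mdgraphs. rball H G' \<cong>\<^sub>r rball H G} | G H. G \<in> mdgraphs}"

lemma mdgraph_iso_refl: "G \<cong>\<^sub>r G"
  unfolding mdgraph_iso_def by (cases G) (auto intro: exI[of _ id])

lemma mdgraph_iso_trans:
  assumes "G \<cong>\<^sub>r G'" and "G' \<cong>\<^sub>r G''"
  shows "G \<cong>\<^sub>r G''"
proof -
  obtain g M g' M' g'' M'' where G: "G = (g, M)" "G' = (g', M')" "G'' = (g'', M'')"
    by (cases G, cases G', cases G'') auto
  obtain \<phi> where \<phi>: "bij_betw \<phi> (verts g) (verts g')" "\<phi> (root g) = root g'"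
    "\<forall>u\<in>verts g. \<forall>v\<in>verts g. ({u, v} \<in> edges g \<longleftrightarrow> {\<phi> u, \<phi> v} \<in> edges g')
       \<and> ({u, v} \<in> M \<longleftrightarrow> {\<phi> u, \<phi> v} \<in> M')"
    using assms(1) unfolding G mdgraph_iso_def by auto
  obtain \<psi> where \<psi>: "bij_betw \<psi> (verts g') (verts g'')" "\<psi> (root g') = root g''"
    "\<forall>u\<in>verts g'. \<forall>v\<in>verts g'. ({u, v} \<in> edges g' \<longleftrightarrow> {\<psi> u, \<psi> v} \<in> edges g'')
       \<and> ({u, v} \<in> M' \<longleftrightarrow> {\<psi> u, \<psi> v} \<in> M'')"
    using assms(2) unfolding G mdgraph_iso_def by auto
  have "\<phi> u \<in> verts g'" if "u \<in> verts g" for u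
    using \<phi>(1) that by (auto simp: bij_betw_def)
  then have "\<forall>u\<in>verts g. \<forall>v\<in>verts g.
      ({u, v} \<in> edges g \<longleftrightarrow> {(\<psi> \<circ> \<phi>) u, (\<psi> \<circ> \<phi>) v} \<in> edges g'')
      \<and> ({u, v} \<in> M \<longleftrightarrow> {(\<psi> \<circ> \<phi>) u, (\<psi> \<circ> \<phi>) v} \<in> M'')"
    using \<phi>(3) \<psi>(3) by simp
  moreover have "bij_betw (\<psi> \<circ> \<phi>) (verts g) (verts g'')"
    using \<phi>(1) \<psi>(1) by (rule bij_betw_trans)
  moreover have "(\<psi> \<circ> \<phi>) (root g) = root g''"
    using \<phi>(2) \<psi>(2) by simp
  ultimately show ?thesis
    unfolding G mdgraph_iso_def prod.case by blast
qed

lemma topspace_local_topology: "topspace local_topology = mdgraphs"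
proof
  show "topspace local_topology \<subseteq> (mdgraphs :: 'a mdgraph set)"
    unfolding local_topology_def topology_generated_by_topspace by blast
  show "(mdgraphs :: 'a mdgraph set) \<subseteq> topspace local_topology"
    unfolding local_topology_def topology_generated_by_topspace
  proof
    fix G :: "'a mdgraph"
    assume "G \<in> mdgraphs"
    then show "G \<in> \<Union>{{G'\<in>mdgraphs. rball H G' \<cong>\<^sub>r rball H G} | G H. G \<in> mdgraphs}"
      using mdgraph_iso_refl[of "rball 0 G"] by blast
  qed
qed

lemma limitin_local_topology_iff:
  "limitin local_topology Gs G sequentially \<longleftrightarrow>
     G \<in> mdgraphs \<and> (\<forall>\<^sub>F n in sequentially. Gs n \<in> mdgraphs)
     \<and> (\<forall>H. \<forall>\<^sub>F n in sequentially. rball H (Gs n) \<cong>\<^sub>r rball H G)"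
proof (intro iffI conjI allI)
  let ?C = "{{G'\<in>mdgraphs. rball H G' \<cong>\<^sub>r rball H G} | G H. G \<in> mdgraphs}"
  assume L: "limitin local_topology Gs G sequentially"
  show G: "G \<in> mdgraphs"
    using limitin_topspace[OF L] by (simp add: topspace_local_topology)
  have ev: "\<forall>\<^sub>F n in sequentially. Gs n \<in> {G'\<in>mdgraphs. rball H G' \<cong>\<^sub>r rball H G}" for H
  proof (rule limitinD[OF L])
    show "openin local_topology {G'\<in>mdgraphs. rball H G' \<cong>\<^sub>r rball H G}"
      unfolding local_topology_def
      by (rule topology_generated_by_Basis, rule CollectI) (rule exI[of _ G], rule exI[of _ H], simp add: G)
    show "G \<in> {G'\<in>mdgraphs. rball H G' \<cong>\<^sub>r rball H G}"
      using G by (simp add: mdgraph_iso_refl)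
  qed
  show "\<forall>\<^sub>F n in sequentially. Gs n \<in> mdgraphs"
    using ev[of 0] by (rule eventually_mono) simp
  show "\<forall>\<^sub>F n in sequentially. rball H (Gs n) \<cong>\<^sub>r rball H G" for H
    using ev[of H] by (rule eventually_mono) simp
next
  assume R: "G \<in> mdgraphs \<and> (\<forall>\<^sub>F n in sequentially. Gs n \<in> mdgraphs)
     \<and> (\<forall>H. \<forall>\<^sub>F n in sequentially. rball H (Gs n) \<cong>\<^sub>r rball H G)"
  have "G \<in> U \<longrightarrow> (\<forall>\<^sub>F n in sequentially. Gs n \<in> U)" if "openin local_topology U" for U
    using that unfolding local_topology_def openin_topology_generated_by_iff
  proof (induction rule: generate_topology_on.induct)
    case (UN K)
    show ?case
    proof
      assume "G \<in> \<Union>K"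
      then obtain k where k: "k \<in> K" "G \<in> k" by blast
      then have "\<forall>\<^sub>F n in sequentially. Gs n \<in> k" using UN(2)[OF k(1)] by blast
      then show "\<forall>\<^sub>F n in sequentially. Gs n \<in> \<Union>K"
        by (rule eventually_mono) (use k in auto)
    qed
  next
    case (Basis s)
    then obtain G0 H where s: "s = {G'\<in>mdgraphs. rball H G' \<cong>\<^sub>r rball H G0}" by blast
    show ?case
    proof
      assume "G \<in> s"
      then have iso: "rball H G \<cong>\<^sub>r rball H G0" unfolding s by blast
      from R have "\<forall>\<^sub>F n in sequentially. Gs n \<in> mdgraphs"
        and "\<forall>\<^sub>F n in sequentially. rball H (Gs n) \<cong>\<^sub>r rball H G" by blast+
      then show "\<forall>\<^sub>F n in sequentially. Gs n \<in> s"
      proof eventually_elim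
        case (elim n)
        with mdgraph_iso_trans[OF elim(2) iso] show ?case unfolding s by blast
      qed
    qed
  next
    case Empty
    then show ?case by simp
  next
    case (Int a b)
    then show ?case by (simp add: eventually_conj)
  qed
  then show "limitin local_topology Gs G sequentially"
    using R unfolding limitin_def topspace_local_topology by blast
qed

definition borel_of :: "'a topology \<Rightarrow> 'a measure" where
  "borel_of X = sigma (topspace X) {U. openin X U}"

text \<open>
  Random elements are taken measurable with respect to the completed probability spaces, because
  the limit configuration below and the optimal configurations on finite graphs are only
  determined up to null sets.
\<close>

definition weakly_converges_in ::
  "'a topology \<Rightarrow> (nat \<Rightarrow> 'p measure) \<Rightarrow> (nat \<Rightarrow> 'p \<Rightarrow> 'a) \<Rightarrow> 'q measure \<Rightarrow> ('q \<Rightarrow> 'a) \<Rightarrow> bool" where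
  "weakly_converges_in X P Y Q Y' \<longleftrightarrow>
     (\<forall>n. Y n \<in> completion (P n) \<rightarrow>\<^sub>M borel_of X) \<and> Y' \<in> completion Q \<rightarrow>\<^sub>M borel_of X
     \<and> (\<forall>f. continuous_map X euclideanreal f \<and> bounded (f ` topspace X) \<longrightarrow>
          (\<lambda>n. \<integral>p. f (Y n p) \<partial>completion (P n)) \<longlonglongrightarrow> (\<integral>q. f (Y' q) \<partial>completion Q))"

abbreviation local_weak_conv ::
  "(nat \<Rightarrow> 'p measure) \<Rightarrow> (nat \<Rightarrow> 'p \<Rightarrow> 'v mdgraph) \<Rightarrow> 'q measure \<Rightarrow> ('q \<Rightarrow> 'v mdgraph) \<Rightarrow> bool" where
  "local_weak_conv \<equiv> weakly_converges_in local_topology"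


section \<open>Optimal configurations\<close>

definition md_value :: "'v rgraph \<Rightarrow> ('v set \<Rightarrow> real) \<Rightarrow> ('v \<Rightarrow> real) \<Rightarrow> 'v set set \<Rightarrow> real" where
  "md_value g w x M = (\<Sum>e\<in>M. w e) + (\<Sum>v | v \<in> verts g \<and> (\<forall>e\<in>M. v \<notin> e). x v)"

definition optimal_md :: "'v rgraph \<Rightarrow> ('v set \<Rightarrow> real) \<Rightarrow> ('v \<Rightarrow> real) \<Rightarrow> 'v set set \<Rightarrow> bool" where
  "optimal_md g w x M \<longleftrightarrow>
     md_config g M \<and> (\<forall>M'. md_config g M' \<longrightarrow> md_value g w x M' \<le> md_value g w x M)"

text \<open>
  The vertex weight is a member of the set whose maximum is taken, so that an empty set of further
  neighbours contributes nothing, as does a maximum of \<open>-\<infinity>\<close>.  Extensionality makes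
  uniqueness refer to the values on directed edges only.
\<close>

definition is_messages ::
  "'v rgraph \<Rightarrow> ('v set \<Rightarrow> real) \<Rightarrow> ('v \<Rightarrow> real) \<Rightarrow> ('v \<times> 'v \<Rightarrow> real) \<Rightarrow> bool" where
  "is_messages g w x Z \<longleftrightarrow>
     Z \<in> extensional {(u, v). {u, v} \<in> edges g}
     \<and> (\<forall>u v. {u, v} \<in> edges g \<longrightarrow>
          Z (u, v) = Max (insert (x v) {w {v, u'} - Z (v, u') | u'. {v, u'} \<in> edges g \<and> u' \<noteq> u}))"

definition message_md ::
  "'v rgraph \<Rightarrow> ('v set \<Rightarrow> real) \<Rightarrow> ('v \<Rightarrow> real) \<Rightarrow> 'v set set" where
  "message_md g w x =
     (if \<exists>!Z. is_messages g w x Z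
      then let Z = THE Z. is_messages g w x Z
           in {{u, v} | u v. {u, v} \<in> edges g \<and> w {u, v} > Z (u, v) + Z (v, u)}
      else {})"

lemma md_config_message_md:
  assumes g: "rooted_graph g"
  shows "md_config g (message_md g w x)"
proof (cases "\<exists>!Z. is_messages g w x Z")
  case True
  define Z where "Z = (THE Z. is_messages g w x Z)"
  have Z: "is_messages g w x Z" unfolding Z_def using True by (rule theI')
  have M: "message_md g w x = {{u, v} | u v. {u, v} \<in> edges g \<and> w {u, v} > Z (u, v) + Z (v, u)}"
    using True unfolding message_md_def Z_def Let_def by (simp only: if_True)
  have ge: "w {v, u'} - Z (v, u') \<le> Z (u, v)"
    if e: "{u, v} \<in> edges g" "{v, u'} \<in> edges g" "u' \<noteq> u" for u v u'
  proof -
    let ?S = "{w {v, u'} - Z (v, u') | u'. {v, u'} \<in> edges g \<and> u' \<noteq> u}"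
    have "v \<in> verts g" using g e(1) unfolding rooted_graph_def by (metis insert_iff singletonD)
    then have "finite {u'. {u', v} \<in> edges g}" using g unfolding rooted_graph_def by blast
    moreover have "?S \<subseteq> (\<lambda>u'. w {v, u'} - Z (v, u')) ` {u'. {u', v} \<in> edges g}"
      by (auto simp: insert_commute[of v])
    ultimately have "finite ?S" by (meson finite_imageI finite_subset)
    then have "w {v, u'} - Z (v, u') \<le> Max (insert (x v) ?S)"
      using e by (intro Max_ge) auto
    then show ?thesis using Z e(1) unfolding is_messages_def by simp
  qed
  have uniq: "a = b" if "{v, a} \<in> edges g" "w {v, a} > Z (v, a) + Z (a, v)"
    "{v, b} \<in> edges g" "w {v, b} > Z (v, b) + Z (b, v)" for v a b
  proof (rule ccontr)
    assume "a \<noteq> b"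
    then show False
      using ge[of a v b] ge[of b v a] that by (simp add: insert_commute[of _ v])
  qed
  have edge: "\<exists>a. e = {v, a} \<and> {v, a} \<in> edges g \<and> w {v, a} > Z (v, a) + Z (a, v)"
    if e: "e \<in> message_md g w x" "v \<in> e" for e v
  proof -
    obtain a b where ab: "e = {a, b}" "{a, b} \<in> edges g" "w {a, b} > Z (a, b) + Z (b, a)"
      using e(1) unfolding M by blast
    from e(2) ab(1) consider "v = a" | "v = b" by blast
    then show ?thesis
    proof cases
      case 1
      then show ?thesis using ab by blast
    next
      case 2
      then show ?thesis using ab by (metis add.commute insert_commute)
    qed
  qed
  show ?thesis
    unfolding md_config_def
  proof (intro conjI ballI impI)
    show "message_md g w x \<subseteq> edges g" unfolding M by auto
    show "e = e'" if e: "e \<in> message_md g w x" "e' \<in> message_md g w x" "v \<in> e \<and> v \<in> e'" for v e e'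
    proof -
      obtain a where "e = {v, a}" "{v, a} \<in> edges g" "w {v, a} > Z (v, a) + Z (a, v)"
        using edge[of e v] e by blast
      moreover obtain b where "e' = {v, b}" "{v, b} \<in> edges g" "w {v, b} > Z (v, b) + Z (b, v)"
        using edge[of e' v] e by blast
      ultimately show ?thesis using uniq by blast
    qed
  qed
next
  case False
  then show ?thesis unfolding message_md_def md_config_def by simp
qed


section \<open>Unimodular Bienayme-Galton-Watson trees\<close>

definition size_biased :: "nat pmf \<Rightarrow> nat pmf" where
  "size_biased \<pi> =
     embed_pmf (\<lambda>k. real (k + 1) * pmf \<pi> (k + 1) / measure_pmf.expectation \<pi> real)"

lemma pmf_size_biased:
  assumes int: "integrable (measure_pmf \<pi>) real"
    and pos: "measure_pmf.expectation \<pi> real > 0"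
  shows "pmf (size_biased \<pi>) k = real (k + 1) * pmf \<pi> (k + 1) / measure_pmf.expectation \<pi> real"
proof -
  let ?E = "measure_pmf.expectation \<pi> real"
  let ?h = "\<lambda>k. real k * pmf \<pi> k"
  have "integrable (count_space UNIV) ?h" and E: "?E = (\<integral>k. ?h k \<partial>count_space UNIV)"
    using int unfolding measure_pmf_eq_density
    by (auto simp: integrable_density integral_density mult.commute)
  then have sm: "summable ?h" and E': "?E = (\<Sum>k. ?h k)"
    by (auto simp: integrable_count_space_nat_iff integral_count_space_nat summable_rabs_cancel)
  have "(\<lambda>k. ?h (k + 1)) sums ?E"
    using sums_split_initial_segment[of ?h ?E 1] sm E' by (auto simp: summable_sums)
  then have s: "(\<lambda>k. ?h (k + 1) / ?E) sums 1"
    using sums_divide[of "\<lambda>k. ?h (k + 1)" ?E ?E] pos by simp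
  have "(\<integral>\<^sup>+k. ennreal (?h (k + 1) / ?E) \<partial>count_space UNIV) = (\<Sum>k. ennreal (?h (k + 1) / ?E))"
    by (simp add: nn_integral_count_space_nat)
  also have "\<dots> = ennreal (\<Sum>k. ?h (k + 1) / ?E)"
    using s pos by (intro suminf_ennreal2) (auto simp: sums_iff)
  also have "\<dots> = 1" using s by (simp add: sums_iff)
  finally show ?thesis
    unfolding size_biased_def using pos by (subst pmf_embed_pmf) auto
qed

inductive_set tree_verts :: "(nat list \<Rightarrow> nat) \<Rightarrow> nat list set" for N where
  root: "[] \<in> tree_verts N"
| child: "v \<in> tree_verts N \<Longrightarrow> k < N v \<Longrightarrow> v @ [k] \<in> tree_verts N"

definition offspring_tree :: "(nat list \<Rightarrow> nat) \<Rightarrow> nat list rgraph" where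
  "offspring_tree N =
     \<lparr>verts = tree_verts N, edges = {{v, v @ [k]} | v k. v \<in> tree_verts N \<and> k < N v}, root = []\<rparr>"

lemma rooted_graph_offspring_tree: "rooted_graph (offspring_tree N)"
  unfolding rooted_graph_def
proof (intro conjI ballI)
  show "root (offspring_tree N) \<in> verts (offspring_tree N)"
    by (simp add: offspring_tree_def tree_verts.root)
  show "\<exists>u\<in>verts (offspring_tree N). \<exists>v\<in>verts (offspring_tree N). u \<noteq> v \<and> e = {u, v}"
    if e: "e \<in> edges (offspring_tree N)" for e
  proof -
    obtain v k where v: "e = {v, v @ [k]}" "v \<in> tree_verts N" "k < N v"
      using e unfolding offspring_tree_def rgraph.simps by blast
    have "v @ [k] \<in> tree_verts N" using v(2,3) by (rule tree_verts.child)
    with v show ?thesis unfolding offspring_tree_def rgraph.simps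
      by (intro bexI[of _ v] bexI[of _ "v @ [k]"] conjI) simp_all
  qed
  show "finite {u. {u, v} \<in> edges (offspring_tree N)}" for v
  proof (rule finite_subset)
    show "{u. {u, v} \<in> edges (offspring_tree N)} \<subseteq> insert (butlast v) ((\<lambda>k. v @ [k]) ` {..<N v})"
    proof
      fix u
      assume "u \<in> {u. {u, v} \<in> edges (offspring_tree N)}"
      then obtain a k where a: "{u, v} = {a, a @ [k]}" "k < N a"
        unfolding offspring_tree_def rgraph.simps by blast
      from a(1) consider "u = a" "v = a @ [k]" | "u = a @ [k]" "v = a"
        unfolding doubleton_eq_iff by blast
      then show "u \<in> insert (butlast v) ((\<lambda>k. v @ [k]) ` {..<N v})"
        using a(2) by cases simp_all
    qed
  qed simp
qed

text \<open>
  The tree is realised with Ulam-Harris labels: \<open>N v\<close> is the number of children of \<open>v\<close>,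
  and offspring numbers and weights are attached to all labels, whether or not they belong to the
  tree.  The non-empty labels \<open>v\<close> index the potential edges \<open>{butlast v, v}\<close>; for
  \<open>v = []\<close> this set is \<open>{[]}\<close>, which is not an edge, and its weight is never used.
\<close>

definition weighted_ubgw ::
  "'q measure \<Rightarrow> nat pmf \<Rightarrow> real measure \<Rightarrow> real measure \<Rightarrow>
   ('q \<Rightarrow> nat list \<Rightarrow> nat) \<Rightarrow> ('q \<Rightarrow> nat list set \<Rightarrow> real) \<Rightarrow> ('q \<Rightarrow> nat list \<Rightarrow> real) \<Rightarrow> bool" where
  "weighted_ubgw Q \<pi> \<omega> \<xi> N w x \<longleftrightarrow>
     prob_space Q
     \<and> prob_space.indep_vars Q (\<lambda>v. count_space UNIV \<Otimes>\<^sub>M borel \<Otimes>\<^sub>M borel)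
         (\<lambda>v q. (N q v, w q {butlast v, v}, x q v)) UNIV
     \<and> (\<forall>v. distr Q (count_space UNIV \<Otimes>\<^sub>M borel \<Otimes>\<^sub>M borel)
               (\<lambda>q. (N q v, w q {butlast v, v}, x q v))
             = measure_pmf (if v = [] then \<pi> else size_biased \<pi>) \<Otimes>\<^sub>M \<omega> \<Otimes>\<^sub>M \<xi>)"


section \<open>Weights\<close>

text \<open>
  The weights are i.i.d. conditionally on the random finite graph: given \<open>G = g\<close>, the weights
  of the edges and vertices of \<open>g\<close> are independent with laws \<open>\<omega>\<close> and \<open>\<xi>\<close>.
\<close>

definition iid_weights ::
  "'p measure \<Rightarrow> ('p \<Rightarrow> 'v rgraph) \<Rightarrow> real measure \<Rightarrow> real measure \<Rightarrow>
   ('p \<Rightarrow> 'v set \<Rightarrow> real) \<Rightarrow> ('p \<Rightarrow> 'v \<Rightarrow> real) \<Rightarrow> bool" where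
  "iid_weights P G \<omega> \<xi> w x \<longleftrightarrow>
     (\<forall>g A B. range A \<subseteq> sets borel \<and> range B \<subseteq> sets borel \<longrightarrow>
        (let S = {p\<in>space P. G p = g \<and> (\<forall>e\<in>edges g. w p e \<in> A e) \<and> (\<forall>v\<in>verts g. x p v \<in> B v)}
         in S \<in> sets P
            \<and> measure P S = measure P {p\<in>space P. G p = g}
                * (\<Prod>e\<in>edges g. measure \<omega> (A e)) * (\<Prod>v\<in>verts g. measure \<xi> (B v))))"

definition msupport :: "real measure \<Rightarrow> real set" where
  "msupport \<mu> = {t. \<forall>U. open U \<and> t \<in> U \<longrightarrow> measure \<mu> U > 0}"

definition atomless :: "real measure \<Rightarrow> bool" where
  "atomless \<mu> \<longleftrightarrow> (\<forall>t. measure \<mu> {t} = 0)"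

definition only_atom_at_min :: "real measure \<Rightarrow> bool" where
  "only_atom_at_min \<mu> \<longleftrightarrow> (\<forall>t. measure \<mu> {t} > 0 \<longleftrightarrow> t = Inf (msupport \<mu>))"

definition locally_convex_under_max :: "real measure \<Rightarrow> bool" where
  "locally_convex_under_max \<mu> \<longleftrightarrow>
     (let m = (SUP t\<in>msupport \<mu>. ereal t)
      in \<exists>a::real. ereal a < m \<and> {t. a < t \<and> ereal t < m} \<subseteq> msupport \<mu>)"

end

theory Submission
  imports Defs
begin

text \<open>
  Messages cut off after \<open>n\<close> generations bound the true message alternately from below and from
  above.  This holds for the messages of the tree and, along an isomorphism of a ball, for the
  marginal gains of vertices in a finite graph.  Hence a bounded neighbourhood may force an edge to
  be, or not to be, a dimer, and both the optimal configurations of finite graphs and the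
  configuration of the tree obey it.

  In the tree the limits of the lower and of the upper bounds solve a joint recursive distributional
  equation.  By the symmetry of the two ends of an edge (unimodularity), a child of the root that is
  best for the lower bounds is almost surely best for the upper bounds, too.  If three children have
  positive probability, comparing independent children shows that the gap between the bounds is
  constant on the support of their law.  Closure of the support under the recursion, together
  with an interval of possible edge weights below their maximum, forces the constant to be zero.
  With at most two children the gap is transported unchanged along the tree and the same closure
  argument applies.  As the edge weights have no atoms, almost surely every edge near the root is
  therefore decided by a bounded neighbourhood.

  For a continuous \<open>f \<ge> 0\<close> replace \<open>f\<close> by its infimum over all configurations that look the same
  near the root whenever that part is decided, and by \<open>0\<close> otherwise.  The conditional mean of this
  lower bound given the graph is a locally constant function of the graph, so it passes to the limit,
  and \<open>liminf E f(G\<^sub>n, MD\<^sub>n) \<ge> E f(T, MD)\<close> follows.  Applying this to \<open>C + f\<close> and \<open>C - f\<close> gives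
  convergence.
\<close>

section \<open>Maxima over finite families and supports of measures\<close>

text \<open>The recursion reverses order and is no contraction, so stationarity alone does not make
  the two bounds meet. Counting does. For an edge of weight W between message pairs (l, h) and (l',
  h') consider l + h' < W \<le> h + l'; exchanging the ends gives the same condition with the roles
  of the pairs swapped. Around the root, a child that is best for the lower bounds only always
  forces another child to be best for the upper bounds only, while by the exchange both occur
  equally often on average; so each almost surely implies the other. A threshold c on the gap is
  carried along because the comparison has to see the sizes of gaps. It excludes crossing arms: one
  that is best for the lower bounds and worst for the upper ones.

  The interval of edge weights enters because a step with weight b followed by one with b - t
  translates a point of the support by t. Points with different gaps can thus be moved to a common
  lower entry, where two slightly different edge weights would make them cross.\<close>

definition vmax :: "real \<Rightarrow> nat \<Rightarrow> (nat \<Rightarrow> real) \<Rightarrow> real" where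
  "vmax x k a = Max (insert x (a ` {..<k}))"

lemma vmax_0 [simp]: "vmax x 0 a = x"
  by (simp add: vmax_def)

lemma vmax_Suc: "vmax x (Suc k) a = max (a k) (vmax x k a)"
  by (simp add: vmax_def lessThan_Suc insert_commute[of x])

lemma vmax_le_iff: "vmax x k a \<le> c \<longleftrightarrow> x \<le> c \<and> (\<forall>i<k. a i \<le> c)"
  by (auto simp: vmax_def)

lemma vmax_less_iff: "vmax x k a < c \<longleftrightarrow> x < c \<and> (\<forall>i<k. a i < c)"
  by (auto simp: vmax_def)

lemma vmax_ge_base: "x \<le> vmax x k a"
  by (simp add: vmax_def)

lemma vmax_ge: "i < k \<Longrightarrow> a i \<le> vmax x k a"
  by (simp add: vmax_def)

lemma vmax_attained: "vmax x k a = x \<or> (\<exists>i<k. vmax x k a = a i)"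
  using Max_in[of "insert x (a ` {..<k})"] by (auto simp: vmax_def)

lemma vmax_mono: "x \<le> y \<Longrightarrow> (\<And>i. i < k \<Longrightarrow> a i \<le> b i) \<Longrightarrow> vmax x k a \<le> vmax y k b"
  unfolding vmax_le_iff by (meson order_trans vmax_ge vmax_ge_base)

lemma vmax_cong: "(\<And>i. i < k \<Longrightarrow> a i = b i) \<Longrightarrow> vmax x k a = vmax x k b"
  by (intro antisym vmax_mono) auto

lemma vmax_add: "vmax (x + c) k (\<lambda>i. a i + c) = vmax x k a + c"
  by (induction k) (auto simp: vmax_Suc)

lemma vmax_lipschitz:
  assumes "\<bar>x - y\<bar> \<le> e" "\<And>i. i < k \<Longrightarrow> \<bar>a i - b i\<bar> \<le> e"
  shows "\<bar>vmax x k a - vmax y k b\<bar> \<le> e"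
proof -
  have "vmax x k a \<le> vmax (y + e) k (\<lambda>i. b i + e)"
    using assms by (intro vmax_mono) (auto simp: abs_le_iff algebra_simps)
  moreover have "vmax y k b \<le> vmax (x + e) k (\<lambda>i. a i + e)"
    using assms by (intro vmax_mono) (auto simp: abs_le_iff algebra_simps)
  ultimately show ?thesis by (simp add: vmax_add abs_le_iff)
qed

lemma vmax_const: "0 < k \<Longrightarrow> vmax x k (\<lambda>_. c) = max x c"
  by (simp add: vmax_def image_constant_conv max.commute lessThan_empty_iff)

lemma measurable_vmax [measurable (raw)]:
  assumes "f \<in> borel_measurable M" "\<And>i. g i \<in> borel_measurable M"
  shows "(\<lambda>z. vmax (f z) k (\<lambda>i. g i z)) \<in> borel_measurable M"
  using assms by (induction k) (auto simp: vmax_Suc)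

text \<open>The order-preserving enumeration of all indices other than \<open>i\<close>. Deleting
  child \<open>i\<close> thus leaves a sequence indexed by all natural numbers again, so that an
  i.i.d. family of children stays an i.i.d. family of the same type.\<close>

definition skip :: "nat \<Rightarrow> nat \<Rightarrow> nat" where
  "skip i j = (if j < i then j else Suc j)"

lemma skip_image: "i < k \<Longrightarrow> skip i ` {..<k - 1} = {..<k} - {i}"
proof (intro equalityI subsetI)
  fix j assume i: "i < k" and j: "j \<in> {..<k} - {i}"
  show "j \<in> skip i ` {..<k - 1}"
  proof (cases "j < i")
    case True
    with i j show ?thesis by (intro image_eqI[of _ _ j]) (auto simp: skip_def)
  next
    case False
    with i j show ?thesis by (intro image_eqI[of _ _ "j - 1"]) (auto simp: skip_def)
  qed
qed (auto simp: skip_def)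

lemma vmax_skip_le_iff:
  "i < k \<Longrightarrow> vmax x (k - 1) (\<lambda>j. a (skip i j)) \<le> c \<longleftrightarrow> x \<le> c \<and> (\<forall>j<k. j \<noteq> i \<longrightarrow> a j \<le> c)"
proof -
  assume i: "i < k"
  have "(\<forall>j<k - 1. a (skip i j) \<le> c) \<longleftrightarrow> (\<forall>j\<in>skip i ` {..<k - 1}. a j \<le> c)" by auto
  also have "\<dots> \<longleftrightarrow> (\<forall>j<k. j \<noteq> i \<longrightarrow> a j \<le> c)" unfolding skip_image[OF i] by auto
  finally show ?thesis by (simp add: vmax_le_iff)
qed

lemma vmax_skip_less_iff:
  "i < k \<Longrightarrow> vmax x (k - 1) (\<lambda>j. a (skip i j)) < c \<longleftrightarrow> x < c \<and> (\<forall>j<k. j \<noteq> i \<longrightarrow> a j < c)"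
proof -
  assume i: "i < k"
  have "(\<forall>j<k - 1. a (skip i j) < c) \<longleftrightarrow> (\<forall>j\<in>skip i ` {..<k - 1}. a j < c)" by auto
  also have "\<dots> \<longleftrightarrow> (\<forall>j<k. j \<noteq> i \<longrightarrow> a j < c)" unfolding skip_image[OF i] by auto
  finally show ?thesis by (simp add: vmax_less_iff)
qed

lemma vmax_skip_attained:
  assumes "i < k"
  shows "vmax x (k - 1) (\<lambda>j. a (skip i j)) = x
    \<or> (\<exists>j<k. j \<noteq> i \<and> vmax x (k - 1) (\<lambda>j. a (skip i j)) = a j)"
proof -
  have "skip i j < k \<and> skip i j \<noteq> i" if "j < k - 1" for j
    using assms that by (auto simp: skip_def)
  then show ?thesis
    using vmax_attained[of x "k - 1" "\<lambda>j. a (skip i j)"] by blast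
qed

lemma vmax_skip_ge:
  assumes "i < k" "j < k" "j \<noteq> i"
  shows "a j \<le> vmax x (k - 1) (\<lambda>j. a (skip i j))"
  using vmax_skip_le_iff[OF assms(1), of x a "vmax x (k - 1) (\<lambda>j. a (skip i j))"] assms by simp

section \<open>Supports of measures\<close>

definition supp :: "'a::topological_space measure \<Rightarrow> 'a set" where
  "supp M = {t. \<forall>U. open U \<and> t \<in> U \<longrightarrow> emeasure M U \<noteq> 0}"

lemma suppD: "t \<in> supp M \<Longrightarrow> open U \<Longrightarrow> t \<in> U \<Longrightarrow> emeasure M U \<noteq> 0"
  by (auto simp: supp_def)

lemma msupport_eq_supp: "finite_measure M \<Longrightarrow> msupport M = supp M"
  by (auto simp: msupport_def supp_def finite_measure.emeasure_eq_measure zero_less_measure_iff)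

text \<open>The complement of the support is a union of null open sets; second countability reduces
  it to countably many null basis sets.\<close>

lemma AE_in_supp:
  fixes M :: "'a::second_countable_topology measure"
  assumes [measurable_cong]: "sets M = sets borel"
  shows "AE t in M. t \<in> supp M"
proof -
  obtain B :: "'a set set" where B: "countable B" "topological_basis B"
    using ex_countable_basis by auto
  let ?N = "\<Union>{b\<in>B. emeasure M b = 0}"
  have *: "b \<in> sets M" if "b \<in> B" for b
    using topological_basis_open[OF B(2) that] by (simp add: assms)
  have "?N \<in> null_sets M"
    using B(1) * by (intro null_sets_UN'[where N="\<lambda>x. x" and I="{b\<in>B. emeasure M b = 0}", simplified]) auto
  moreover have "{t\<in>space M. t \<notin> supp M} \<subseteq> ?N"
  proof
    fix t assume "t \<in> {t\<in>space M. t \<notin> supp M}"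
    then obtain U where U: "open U" "t \<in> U" "emeasure M U = 0" by (auto simp: supp_def)
    from topological_basisE[OF B(2) U(1,2)] obtain b where b: "b \<in> B" "t \<in> b" "b \<subseteq> U" by metis
    with U have "emeasure M b = 0"
      using emeasure_mono[of b U M] by (simp add: assms)
    with b show "t \<in> ?N" by auto
  qed
  ultimately show ?thesis by (rule AE_I')
qed

lemma supp_subset_closed:
  fixes M :: "'a::topological_space measure"
  assumes "sets M = sets borel" "closed C" "AE t in M. t \<in> C"
  shows "supp M \<subseteq> C"
proof (rule ccontr)
  assume "\<not> supp M \<subseteq> C"
  then obtain t where t: "t \<in> supp M" "t \<in> - C" by auto
  have "space M = UNIV" using sets_eq_imp_space_eq[OF assms(1)] by simp
  then have "emeasure M (- C) = 0"
    using assms by (subst AE_iff_measurable[symmetric, where P="\<lambda>t. t \<in> C"]) auto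
  with suppD[OF t(1), of "- C"] t(2) assms(2) show False by (auto simp: open_Compl)
qed

text \<open>Almost sure statements whose negation is an open condition become statements about every
  point of the support in this way.\<close>

lemma supp_not_null:
  assumes "sets M = sets borel" "t \<in> supp M" "open U" "t \<in> U" "AE t in M. t \<notin> U"
  shows False
  using supp_subset_closed[OF assms(1), of "- U"] assms by (auto simp: closed_Compl)

lemma closed_supp: "closed (supp M)"
proof -
  have "- supp M = \<Union>{U. open U \<and> emeasure M U = 0}" by (auto simp: supp_def)
  then show ?thesis unfolding closed_def by auto
qed

lemma supp_pair:
  fixes M :: "'a::second_countable_topology measure" and N :: "'b::second_countable_topology measure"
  assumes [measurable_cong]: "sets M = sets borel" "sets N = sets borel"
    and "sigma_finite_measure N" "a \<in> supp M" "b \<in> supp N"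
  shows "(a, b) \<in> supp (M \<Otimes>\<^sub>M N)"
  unfolding supp_def
proof (intro CollectI allI impI)
  interpret N: sigma_finite_measure N by fact
  fix U :: "('a \<times> 'b) set"
  assume U: "open U \<and> (a, b) \<in> U"
  then obtain A B where AB: "open A" "open B" "(a, b) \<in> A \<times> B" "A \<times> B \<subseteq> U"
    using open_prod_elim by blast
  have s: "sets (M \<Otimes>\<^sub>M N) = sets borel"
    unfolding borel_prod[symmetric] by (rule sets_pair_measure_cong) (simp_all add: assms)
  have "emeasure (M \<Otimes>\<^sub>M N) (A \<times> B) = emeasure M A * emeasure N B"
    using AB by (intro N.emeasure_pair_measure_Times) (auto simp: assms)
  also have "\<dots> \<noteq> 0" using AB suppD[OF assms(4), of A] suppD[OF assms(5), of B] by auto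
  finally show "emeasure (M \<Otimes>\<^sub>M N) U \<noteq> 0"
    using emeasure_mono[OF AB(4), of "M \<Otimes>\<^sub>M N"] U by (auto simp: s)
qed

text \<open>Before truncation, a step with \<gamma> followed by one with \<beta> lowers the first
  coordinate by at least \<gamma> - \<beta>. From a point that close to the infimum this ends below
  every first coordinate in \<open>K\<close>, so the maximum with \<open>m\<close> must act; but
  cutting the lower coordinate off from below makes the gap strictly smaller than
  \<open>d\<close>.\<close>

lemma no_constant_gap_closed_set:
  fixes K :: "(real \<times> real) set"
  assumes ne: "p0 \<in> K" and lb: "\<And>p. p \<in> K \<Longrightarrow> m \<le> fst p"
    and gap: "\<And>p. p \<in> K \<Longrightarrow> snd p - fst p = d" and "0 < d" and "\<beta> < \<gamma>"
    and step: "\<And>p W. p \<in> K \<Longrightarrow> W \<in> {\<beta>, \<gamma>} \<Longrightarrow> (max m (W - snd p), max m (W - fst p)) \<in> K"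
  shows False
proof -
  define s where "s = Inf (fst ` K)"
  have bdd: "bdd_below (fst ` K)" using lb by (auto intro!: bdd_belowI[of _ m])
  have "\<exists>p\<in>K. fst p < s + (\<gamma> - \<beta>)"
    using cInf_lessD[of "fst ` K" "s + (\<gamma> - \<beta>)"] ne \<open>\<beta> < \<gamma>\<close> by (auto simp: s_def)
  then obtain p where p: "p \<in> K" "fst p < s + (\<gamma> - \<beta>)" by blast
  define q where "q = (max m (\<gamma> - snd p), max m (\<gamma> - fst p))"
  have q: "q \<in> K" using step[OF p(1), of \<gamma>] by (simp add: q_def)
  have "(max m (\<beta> - snd q), max m (\<beta> - fst q)) \<in> K" (is "?r \<in> K") using step[OF q, of \<beta>] by simp
  then have "snd ?r - fst ?r = d" "s \<le> fst ?r"
    using gap bdd unfolding s_def by (blast intro: cInf_lower)+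
  moreover have "snd q - fst q = d" "\<gamma> - fst p \<le> snd q" using gap[OF q] by (simp_all add: q_def)
  ultimately show False using p(2) \<open>0 < d\<close> by (auto simp: max_def split: if_splits)
qed

section \<open>The recursive distributional equation\<close>

text \<open>An arm \<open>(w, l, h)\<close> consists of the weight of an edge and of a lower and an upper bound for the
  message from its far end; it offers between \<open>w - h\<close> and \<open>w - l\<close>.\<close>

definition arm_lo :: "real \<times> real \<times> real \<Rightarrow> real" where "arm_lo \<alpha> = fst \<alpha> - snd (snd \<alpha>)"
definition arm_hi :: "real \<times> real \<times> real \<Rightarrow> real" where "arm_hi \<alpha> = fst \<alpha> - fst (snd \<alpha>)"

definition rde_step :: "nat \<Rightarrow> real \<Rightarrow> (nat \<Rightarrow> real \<times> real \<times> real) \<Rightarrow> real \<times> real" where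
  "rde_step k x s = (vmax x k (\<lambda>i. arm_lo (s i)), vmax x k (\<lambda>i. arm_hi (s i)))"

text \<open>Let \<open>j\<close> offer the largest \<open>hi\<close> apart from \<open>i\<close>. As
  \<open>i\<close> is not best for \<open>hi\<close> and ties are excluded, \<open>j\<close> is
  strictly best. Once \<open>j\<close> is discarded, \<open>i\<close> still realises the largest
  \<open>lo\<close>, and the largest \<open>hi\<close> is at least \<open>hi i\<close>; hence the
  two remaining maxima are at least as far apart as the two offers of \<open>i\<close>.\<close>

lemma best_in_lo_imp_best_in_hi:
  fixes lo hi :: "nat \<Rightarrow> real"
  assumes le: "\<And>j. j < k \<Longrightarrow> lo j \<le> hi j"
    and no_ties: "\<And>j. j < k \<Longrightarrow> hi j \<noteq> vmax x (k - 1) (\<lambda>l. hi (skip j l))"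
    and i: "i < k" "vmax x (k - 1) (\<lambda>l. lo (skip i l)) < lo i"
      "hi i \<le> vmax x (k - 1) (\<lambda>l. hi (skip i l))" "c < hi i - lo i"
  shows "\<exists>j<k. vmax x (k - 1) (\<lambda>l. hi (skip j l)) < hi j
    \<and> lo j \<le> vmax x (k - 1) (\<lambda>l. lo (skip j l))
    \<and> c < vmax x (k - 1) (\<lambda>l. hi (skip j l)) - vmax x (k - 1) (\<lambda>l. lo (skip j l))"
proof -
  let ?L = "\<lambda>i. vmax x (k - 1) (\<lambda>l. lo (skip i l))"
  let ?H = "\<lambda>i. vmax x (k - 1) (\<lambda>l. hi (skip i l))"
  have Li: "x < lo i" "\<And>j. j < k \<Longrightarrow> j \<noteq> i \<Longrightarrow> lo j < lo i"
    using vmax_skip_less_iff[OF i(1), of x lo "lo i"] i(2) by auto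
  have "?H i \<noteq> x" using Li(1) le[OF i(1)] i(3) by linarith
  then obtain j where j: "j < k" "j \<noteq> i" "?H i = hi j"
    using vmax_skip_attained[OF i(1), of x hi] by blast
  have "x \<le> hi j" "\<And>l. l < k \<Longrightarrow> l \<noteq> i \<Longrightarrow> hi l \<le> hi j"
    using vmax_skip_le_iff[OF i(1), of x hi "hi j"] j(3) by auto
  then have "?H j \<le> hi j"
    using vmax_skip_le_iff[OF j(1), of x hi "hi j"] i(3) j(3) by metis
  with no_ties[OF j(1)] have 1: "?H j < hi j" by simp
  have "?L j \<le> lo i"
    using vmax_skip_le_iff[OF j(1), of x lo "lo i"] Li by (metis less_imp_le order_refl)
  moreover have "lo i \<le> ?L j" using vmax_skip_ge[OF j(1) i(1)] j(2) by blast
  ultimately have 2: "?L j = lo i" by simp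
  have "hi i \<le> ?H j" using vmax_skip_ge[OF j(1) i(1)] j(2) by blast
  with 1 2 j Li(2)[OF j(1,2)] i(4) show ?thesis by (intro exI[of _ j]) auto
qed

text \<open>Arm 0 is best for \<open>lo\<close> and worst for \<open>hi\<close>. Discarding the arm
  \<open>j\<close> with the largest \<open>hi\<close> leaves, besides arm 0, a third arm with larger
  \<open>hi\<close>, so the remaining maxima have a gap strictly above that of arm 0. In the second
  event, however, arm 0 is the only candidate. A threshold between the two gaps separates the
  events; it is rational so that countably many thresholds suffice.\<close>

lemma crossing_arms_break_balance:
  fixes lo hi :: "nat \<Rightarrow> real"
  assumes k: "3 \<le> k"
    and no_ties: "\<And>j. j < k \<Longrightarrow> hi j \<noteq> vmax x (k - 1) (\<lambda>l. hi (skip j l))"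
    and x: "x < lo 0" and lt: "\<And>j. 0 < j \<Longrightarrow> j < k \<Longrightarrow> lo j < lo 0"
    and gt: "\<And>j. 0 < j \<Longrightarrow> j < k \<Longrightarrow> hi 0 < hi j" and "lo 0 \<le> hi 0"
  obtains c :: rat where
    "\<exists>j<k. vmax x (k - 1) (\<lambda>l. hi (skip j l)) < hi j
      \<and> lo j \<le> vmax x (k - 1) (\<lambda>l. lo (skip j l))
      \<and> of_rat c < vmax x (k - 1) (\<lambda>l. hi (skip j l)) - vmax x (k - 1) (\<lambda>l. lo (skip j l))"
    "\<not> (\<exists>j<k. vmax x (k - 1) (\<lambda>l. lo (skip j l)) < lo j
      \<and> hi j \<le> vmax x (k - 1) (\<lambda>l. hi (skip j l)) \<and> of_rat c < hi j - lo j)"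
proof -
  let ?L = "\<lambda>i. vmax x (k - 1) (\<lambda>l. lo (skip i l))"
  let ?H = "\<lambda>i. vmax x (k - 1) (\<lambda>l. hi (skip i l))"
  have "Max (hi ` {..<k}) \<in> hi ` {..<k}" using k by (intro Max_in) (auto simp: lessThan_empty_iff)
  then obtain j where j: "j \<in> {..<k}" "Max (hi ` {..<k}) = hi j" by auto
  then have j: "j \<in> {..<k}" "\<And>l. l \<in> {..<k} \<Longrightarrow> hi l \<le> hi j"
    using Max_ge[of "hi ` {..<k}"] by auto
  have "hi 0 < hi 1" "hi 1 \<le> hi j" using gt[of 1] j(2)[of 1] k by auto
  then have j0: "j \<noteq> 0" by (intro notI) simp
  then have jk: "j < k" "0 < j" using j(1) by auto
  \<comment> \<open>The third arm, distinct from 0 and \<open>j\<close>; this is where three arms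
    are needed.\<close>
  define l where "l = (if j = 1 then 2 else (1::nat))"
  have l: "l < k" "0 < l" "l \<noteq> j" using k by (auto simp: l_def)
  have "?H j \<le> hi j"
    using vmax_skip_le_iff[OF jk(1), of x hi "hi j"] j(2) x \<open>lo 0 \<le> hi 0\<close> gt[OF jk(2,1)] by force
  then have 1: "?H j < hi j" using no_ties[OF jk(1)] by simp
  have "?L j \<le> lo 0"
    using vmax_skip_le_iff[OF jk(1), of x lo "lo 0"] x lt by (metis less_imp_le not_gr_zero order_refl)
  moreover have "lo 0 \<le> ?L j" using vmax_skip_ge[OF jk(1), of 0] j0 k by simp
  ultimately have 2: "?L j = lo 0" by simp
  have "hi 0 < ?H j" using gt[OF l(2,1)] vmax_skip_ge[OF jk(1) l(1) l(3), of hi x] by simp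
  then have "hi 0 - lo 0 < ?H j - ?L j" using 2 by simp
  then obtain c where c: "hi 0 - lo 0 < of_rat c" "of_rat c < ?H j - ?L j"
    using of_rat_dense by blast
  show ?thesis
  proof (rule that[of c])
    show "\<exists>j<k. ?H j < hi j \<and> lo j \<le> ?L j \<and> of_rat c < ?H j - ?L j"
      using jk 1 2 lt[OF jk(2,1)] c(2) by (intro exI[of _ j]) auto
    show "\<not> (\<exists>j<k. ?L j < lo j \<and> hi j \<le> ?H j \<and> of_rat c < hi j - lo j)"
    proof (intro notI, elim exE conjE)
      fix i assume i: "i < k" "?L i < lo i" "hi i \<le> ?H i" "of_rat c < hi i - lo i"
      show False
      proof (cases "i = 0")
        case True
        with i c show False by simp
      next
        case False
        then have "lo 0 \<le> ?L i" using vmax_skip_ge[OF i(1), of 0] k by simp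
        with lt[of i] False i show False by simp
      qed
    qed
  qed
qed

text \<open>The uniqueness argument sees the tree only through \<open>\<mu>\<close>, an ordered
  fixed point of the recursion for pairs of bounds with size-biased degree. That the tree supplies
  such a law is shown in \<open>law_mu\<close>.\<close>

locale message_rde =
  fixes \<pi> :: "nat pmf" and \<omega> \<xi> :: "real measure" and \<mu> :: "(real \<times> real) measure"
  assumes int_pi: "integrable (measure_pmf \<pi>) real" and mean_pos: "measure_pmf.expectation \<pi> real > 0"
    and omega: "real_distribution \<omega>" and xi: "real_distribution \<xi>"
    and atomless: "atomless \<omega>"
    and mu: "prob_space \<mu>" and sets_mu [measurable_cong]: "sets \<mu> = sets borel"
    and law: "distr (measure_pmf (size_biased \<pi>) \<Otimes>\<^sub>M (\<xi> \<Otimes>\<^sub>M (\<Pi>\<^sub>M i\<in>(UNIV::nat set). \<omega> \<Otimes>\<^sub>M \<mu>))) borel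
      (\<lambda>(k, x, s). rde_step k x s) = \<mu>"
    and ordered: "AE p in \<mu>. fst p \<le> snd p"
begin

sublocale omega: real_distribution \<omega> by (rule omega)
sublocale xi: real_distribution \<xi> by (rule xi)
sublocale mu: prob_space \<mu> by (rule mu)

text \<open>\<open>A\<close> is the law of an arm; \<open>S\<close> below is that of infinitely many
  independent arms, and \<open>R\<close> adds the vertex weight. The degree is kept outside
  \<open>R\<close>, so that every fixed degree reads its arms off the same sample.\<close>

abbreviation "A \<equiv> \<omega> \<Otimes>\<^sub>M \<mu>"

sublocale A: pair_prob_space \<omega> \<mu> by unfold_locales
sublocale S: sequence_space A by unfold_locales

abbreviation "S \<equiv> (\<Pi>\<^sub>M i\<in>(UNIV::nat set). A)"
abbreviation "R \<equiv> \<xi> \<Otimes>\<^sub>M S"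

sublocale R: pair_prob_space \<xi> S by unfold_locales

lemma sets_omega [measurable_cong]: "sets \<omega> = sets borel" and sets_xi [measurable_cong]: "sets \<xi> = sets borel"
  by simp_all

lemma sets_A [measurable_cong]: "sets A = sets borel"
proof -
  have "sets A = sets ((borel :: real measure) \<Otimes>\<^sub>M (borel :: (real \<times> real) measure))"
    by (rule sets_pair_measure_cong) (simp_all add: sets_mu)
  then show ?thesis by (simp only: borel_prod)
qed

lemma space_simps [simp]: "space \<mu> = UNIV" "space A = UNIV" "space S = UNIV" "space R = UNIV"
proof -
  show 1: "space \<mu> = UNIV" using sets_eq_imp_space_eq[OF sets_mu] by simp
  then show 2: "space A = UNIV" by (simp add: space_pair_measure)
  then show 3: "space S = UNIV" by (auto simp: space_PiM)
  show "space R = UNIV" using 3 by (simp add: space_pair_measure)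
qed

lemma measurable_arm [measurable]: "arm_lo \<in> borel_measurable A" "arm_hi \<in> borel_measurable A"
  unfolding measurable_cong_sets[OF sets_A refl] arm_lo_def[abs_def] arm_hi_def[abs_def]
  by (intro borel_measurable_continuous_onI continuous_intros)+

lemma measurable_arm_borel [measurable]:
  "arm_lo \<in> borel_measurable borel" "arm_hi \<in> borel_measurable borel"
  using measurable_arm unfolding measurable_cong_sets[OF sets_A refl] by auto

lemma measurable_rde_step [measurable]:
  assumes [measurable]: "f \<in> borel_measurable M" "\<And>i. (\<lambda>z. g z i) \<in> M \<rightarrow>\<^sub>M A"
  shows "(\<lambda>z. rde_step k (f z) (g z)) \<in> borel_measurable M"
  unfolding rde_step_def by measurable

lemma measurable_rde_step_joint:
  "(\<lambda>(k, x, s). rde_step k x s) \<in> borel_measurable (measure_pmf (size_biased \<pi>) \<Otimes>\<^sub>M R)"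
proof -
  have "(\<lambda>(k, x, s). rde_step k x s) \<in> borel_measurable (count_space UNIV \<Otimes>\<^sub>M R)"
    by (rule measurable_pair_measure_countable1) (simp_all add: split_beta' measurable_rde_step)
  then show ?thesis by (simp cong: measurable_cong_sets add: sets_pair_measure_cong)
qed

lemma AE_law_iff:
  assumes [measurable]: "Measurable.pred borel P"
  shows "(AE p in \<mu>. P p) \<longleftrightarrow>
    (\<forall>k. pmf (size_biased \<pi>) k \<noteq> 0 \<longrightarrow> (AE z in R. P (rde_step k (fst z) (snd z))))"
proof -
  interpret PR: pair_sigma_finite "measure_pmf (size_biased \<pi>)" R by unfold_locales
  note [measurable] = measurable_rde_step_joint
  have "(AE p in \<mu>. P p) \<longleftrightarrow> (AE kz in measure_pmf (size_biased \<pi>) \<Otimes>\<^sub>M R. P (case kz of (k, x, s) \<Rightarrow> rde_step k x s))"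
    by (subst law[symmetric], subst AE_distr_iff) simp_all
  also have "\<dots> \<longleftrightarrow> (AE kz in measure_pmf (size_biased \<pi>) \<Otimes>\<^sub>M R. P (rde_step (fst kz) (fst (snd kz)) (snd (snd kz))))"
    by (simp add: split_beta')
  also have "\<dots> \<longleftrightarrow> (AE k in measure_pmf (size_biased \<pi>). AE z in R. P (rde_step k (fst z) (snd z)))"
  proof (rule PR.AE_pair_iff[symmetric])
    have "Measurable.pred (measure_pmf (size_biased \<pi>) \<Otimes>\<^sub>M R) (\<lambda>kz. P (case kz of (k, x, s) \<Rightarrow> rde_step k x s))"
      by measurable
    then show "{x \<in> space (measure_pmf (size_biased \<pi>) \<Otimes>\<^sub>M R). P (rde_step (fst x) (fst (snd x)) (snd (snd x)))}
        \<in> sets (measure_pmf (size_biased \<pi>) \<Otimes>\<^sub>M R)"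
      by (simp add: split_beta' pred_def)
  qed
  finally show ?thesis by (simp add: AE_measure_pmf_iff set_pmf_iff Ball_def)
qed

lemma measurable_reindex_arms [measurable]: "(\<lambda>s j. s (f j)) \<in> S \<rightarrow>\<^sub>M S"
  by (rule measurable_abs_UNIV) measurable

text \<open>The map sending 0 to \<open>i\<close> and \<open>Suc j\<close> to
  \<open>skip i j\<close> is injective, and reindexing an i.i.d. sequence by an injection does not
  change its law.\<close>

lemma distr_remove_arm: "distr S (A \<Otimes>\<^sub>M S) (\<lambda>s. (s i, \<lambda>j. s (skip i j))) = A \<Otimes>\<^sub>M S"
proof -
  define f where "f = case_nat i (skip i)"
  have inj: "inj_on f UNIV"
    by (auto simp: inj_on_def f_def skip_def split: nat.splits if_splits)
  have re: "distr S S (\<lambda>s. \<lambda>n\<in>UNIV. s (f n)) = S"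
    by (rule distr_PiM_reindex) (auto simp: inj intro: A.prob_space_axioms)
  have hd: "distr S (A \<Otimes>\<^sub>M S) (\<lambda>s. (s 0, \<lambda>j. s (Suc j))) = A \<Otimes>\<^sub>M S"
  proof -
    have "distr S (A \<Otimes>\<^sub>M S) (\<lambda>s. (s 0, \<lambda>j. s (Suc j))) =
      distr (distr (A \<Otimes>\<^sub>M S) S (\<lambda>(s, \<omega>). case_nat s \<omega>)) (A \<Otimes>\<^sub>M S) (\<lambda>s. (s 0, \<lambda>j. s (Suc j)))"
      by (simp add: S.PiM_iter)
    also have "\<dots> = distr (A \<Otimes>\<^sub>M S) (A \<Otimes>\<^sub>M S) (\<lambda>z. z)"
      by (subst distr_distr) (auto simp: comp_def split_beta' intro!: distr_cong)
    finally show ?thesis by (simp add: distr_id)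
  qed
  have "distr S (A \<Otimes>\<^sub>M S) (\<lambda>s. (s i, \<lambda>j. s (skip i j))) =
    distr (distr S S (\<lambda>s. \<lambda>n\<in>UNIV. s (f n))) (A \<Otimes>\<^sub>M S) (\<lambda>s. (s 0, \<lambda>j. s (Suc j)))"
    by (subst distr_distr) (auto simp: comp_def f_def intro!: distr_cong)
  then show ?thesis by (simp add: re hd)
qed

text \<open>The probability that an arm, together with the message pair of a vertex having
  \<open>k\<close> further independent arms, lies in \<open>B\<close>: the vertex as seen from the
  removed arm.\<close>

definition cavity :: "nat \<Rightarrow> ((real \<times> real \<times> real) \<times> real \<times> real) set \<Rightarrow> ennreal" where
  "cavity k B = (\<integral>\<^sup>+z. emeasure A {\<alpha>. (\<alpha>, rde_step k (fst z) (snd z)) \<in> B} \<partial>R)"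

lemma sets_AB: "sets (A \<Otimes>\<^sub>M (borel :: (real \<times> real) measure)) = sets borel" "sets (A \<Otimes>\<^sub>M \<mu>) = sets borel"
proof -
  have "sets (A \<Otimes>\<^sub>M (borel :: (real \<times> real) measure)) =
      sets ((borel :: (real \<times> real \<times> real) measure) \<Otimes>\<^sub>M (borel :: (real \<times> real) measure))"
    by (rule sets_pair_measure_cong[OF sets_A refl])
  then show 1: "sets (A \<Otimes>\<^sub>M (borel :: (real \<times> real) measure)) = sets borel" by (simp only: borel_prod)
  have "sets (A \<Otimes>\<^sub>M \<mu>) = sets (A \<Otimes>\<^sub>M (borel :: (real \<times> real) measure))"
    by (rule sets_pair_measure_cong[OF refl sets_mu])
  with 1 show "sets (A \<Otimes>\<^sub>M \<mu>) = sets borel" by (simp only:)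
qed

text \<open>Averaging over a size-biased \<open>k\<close> is exactly the recursion for
  \<open>\<mu>\<close>, so the pair of the vertex becomes a sample of \<open>\<mu>\<close>
  independent of the arm.\<close>

lemma nn_integral_cavity:
  assumes B: "B \<in> sets borel"
  shows "(\<integral>\<^sup>+k. cavity k B \<partial>measure_pmf (size_biased \<pi>)) = emeasure (A \<Otimes>\<^sub>M \<mu>) B"
proof -
  interpret Am: pair_sigma_finite A \<mu> by unfold_locales
  have B': "B \<in> sets (A \<Otimes>\<^sub>M \<mu>)" using B by (simp only: sets_AB)
  note [measurable] = measurable_rde_step_joint
  have m [measurable]: "(\<lambda>p. emeasure A {\<alpha>. (\<alpha>, p) \<in> B}) \<in> borel_measurable borel"
    using Am.measurable_emeasure_Pair2[OF B'] by (simp add: vimage_def measurable_cong_sets[OF sets_mu refl])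
  have "emeasure (A \<Otimes>\<^sub>M \<mu>) B = (\<integral>\<^sup>+p. emeasure A {\<alpha>. (\<alpha>, p) \<in> B} \<partial>\<mu>)"
    by (subst Am.emeasure_pair_measure_alt2[OF B']) (simp add: vimage_def)
  also have "\<dots> = (\<integral>\<^sup>+kz. emeasure A {\<alpha>. (\<alpha>, case kz of (k, x, s) \<Rightarrow> rde_step k x s) \<in> B}
      \<partial>(measure_pmf (size_biased \<pi>) \<Otimes>\<^sub>M R))"
    by (subst law[symmetric], subst nn_integral_distr) simp_all
  also have "\<dots> = (\<integral>\<^sup>+k. \<integral>\<^sup>+z. emeasure A {\<alpha>. (\<alpha>, case (k, z) of (k, x, s) \<Rightarrow> rde_step k x s) \<in> B} \<partial>R
      \<partial>measure_pmf (size_biased \<pi>))"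
    by (rule R.P.nn_integral_fst[symmetric]) measurable
  finally show ?thesis by (simp add: cavity_def split_beta')
qed

lemma emeasure_remove_arm:
  assumes B: "B \<in> sets borel"
  shows "emeasure R {z. (snd z i, rde_step k (fst z) (\<lambda>j. snd z (skip i j))) \<in> B} = cavity k B"
proof -
  interpret AS: pair_sigma_finite A S by unfold_locales
  have [measurable]: "B \<in> sets (A \<Otimes>\<^sub>M borel)" using B by (simp only: sets_AB)
  let ?Z = "{z\<in>space R. (snd z i, rde_step k (fst z) (\<lambda>j. snd z (skip i j))) \<in> B}"
  have Z: "?Z \<in> sets R" by measurable
  have "emeasure R ?Z = (\<integral>\<^sup>+x. emeasure S {s. (s i, rde_step k x (\<lambda>j. s (skip i j))) \<in> B} \<partial>\<xi>)"
    by (subst S.P.emeasure_pair_measure_alt[OF Z]) (simp add: vimage_def)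
  also have "\<dots> = (\<integral>\<^sup>+x. \<integral>\<^sup>+s. emeasure A {\<alpha>. (\<alpha>, rde_step k x s) \<in> B} \<partial>S \<partial>\<xi>)"
  proof (rule nn_integral_cong)
    fix x
    let ?E = "{z\<in>space (A \<Otimes>\<^sub>M S). (fst z, rde_step k x (snd z)) \<in> B}"
    have E: "?E \<in> sets (A \<Otimes>\<^sub>M S)" by measurable
    have "emeasure S {s. (s i, rde_step k x (\<lambda>j. s (skip i j))) \<in> B} =
        emeasure (distr S (A \<Otimes>\<^sub>M S) (\<lambda>s. (s i, \<lambda>j. s (skip i j)))) ?E"
      by (subst emeasure_distr[OF _ E]) (auto intro!: arg_cong2[where f=emeasure] simp: space_pair_measure)
    also have "\<dots> = (\<integral>\<^sup>+s. emeasure A {\<alpha>. (\<alpha>, rde_step k x s) \<in> B} \<partial>S)"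
      unfolding distr_remove_arm
      by (subst AS.emeasure_pair_measure_alt2[OF E]) (simp add: vimage_def space_pair_measure)
    finally show "emeasure S {s. (s i, rde_step k x (\<lambda>j. s (skip i j))) \<in> B} =
      (\<integral>\<^sup>+s. emeasure A {\<alpha>. (\<alpha>, rde_step k x s) \<in> B} \<partial>S)" .
  qed
  also have "\<dots> = cavity k B"
    unfolding cavity_def
  proof (subst S.P.nn_integral_fst[symmetric])
    have "(\<lambda>z. emeasure A (Pair z -` {u\<in>space (R \<Otimes>\<^sub>M A). (snd u, rde_step k (fst (fst u)) (snd (fst u))) \<in> B}))
      \<in> borel_measurable R"
      by (rule A.P.measurable_emeasure_Pair) measurable
    then show "(\<lambda>z. emeasure A {\<alpha>. (\<alpha>, rde_step k (fst z) (snd z)) \<in> B}) \<in> borel_measurable R"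
      by (simp add: vimage_def space_pair_measure)
  qed simp
  finally show ?thesis by simp
qed

text \<open>This is k \<pi>(k) = E \<pi>'(k - 1) for the size-biased law \<pi>': choosing one child
  of the root leaves a size-biased number of siblings. At \<open>k = 0\<close> the factor
  \<open>k\<close> vanishes, so the truncated difference is harmless.\<close>

lemma nn_integral_degree_shift:
  "(\<integral>\<^sup>+k. ennreal (real k) * f (k - 1) \<partial>measure_pmf \<pi>)
    = ennreal (measure_pmf.expectation \<pi> real) * (\<integral>\<^sup>+k. f k \<partial>measure_pmf (size_biased \<pi>))"
proof -
  let ?E = "measure_pmf.expectation \<pi> real"
  let ?g = "\<lambda>k. ennreal (pmf \<pi> k) * (ennreal (real k) * f (k - 1))"
  have "(\<integral>\<^sup>+k. ennreal (real k) * f (k - 1) \<partial>measure_pmf \<pi>) = (\<Sum>k. ?g k)"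
    by (simp add: nn_integral_measure_pmf nn_integral_count_space_nat)
  also have "\<dots> = (\<Sum>k. ?g (Suc k))"
    using suminf_offset[of ?g "Suc 0"] by simp
  also have "\<dots> = (\<Sum>k. ennreal ?E * (ennreal (pmf (size_biased \<pi>) k) * f k))"
  proof (rule suminf_cong)
    fix k
    have "ennreal (pmf \<pi> (Suc k)) * ennreal (real (Suc k)) = ennreal ?E * ennreal (pmf (size_biased \<pi>) k)"
      using mean_pos by (simp only: ennreal_mult[symmetric] pmf_nonneg of_nat_0_le_iff less_imp_le)
        (simp add: pmf_size_biased[OF int_pi mean_pos] mult.commute)
    then show "?g (Suc k) = ennreal ?E * (ennreal (pmf (size_biased \<pi>) k) * f k)"
      by (simp add: mult.assoc[symmetric])
  qed
  also have "\<dots> = ennreal ?E * (\<Sum>k. ennreal (pmf (size_biased \<pi>) k) * f k)"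
    by (rule ennreal_suminf_cmult)
  also have "(\<Sum>k. ennreal (pmf (size_biased \<pi>) k) * f k) = (\<integral>\<^sup>+k. f k \<partial>measure_pmf (size_biased \<pi>))"
    by (simp add: nn_integral_measure_pmf nn_integral_count_space_nat)
  finally show ?thesis .
qed

end

section \<open>Exchange of the ends of an edge and balance at the root\<close>

lemma AE_pair_snd:
  assumes "sigma_finite_measure N" "AE y in N. P y"
  shows "AE z in M \<Otimes>\<^sub>M N. P (snd z)"
proof -
  interpret sigma_finite_measure N by fact
  obtain N0 where "{y\<in>space N. \<not> P y} \<subseteq> N0" "emeasure N N0 = 0" "N0 \<in> sets N"
    using assms(2) by (rule AE_E)
  then show ?thesis
    by (intro AE_I[of _ _ "space M \<times> N0"]) (auto simp: space_pair_measure emeasure_pair_measure_Times)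
qed

lemma AE_eq_of_integral_eq:
  fixes f g :: "'a \<Rightarrow> real"
  assumes "integrable M f" "integrable M g" "integral\<^sup>L M f = integral\<^sup>L M g" "AE x in M. f x \<le> g x"
  shows "AE x in M. f x = g x"
proof -
  have "AE x in M. g x - f x = 0"
    using assms by (subst integral_nonneg_eq_0_iff_AE[symmetric]) auto
  then show ?thesis by eventually_elim simp
qed

context message_rde
begin

text \<open>For an arm (W, l, h) and a pair y = (l', h') the condition reads l + h' < W \<le> h +
  l', with the gap h' - l' above \<open>c\<close>. Exchanging (l, h) and (l', h') gives
  \<open>in_only\<close>, where the gap is that of the arm.\<close>

definition out_only :: "real \<Rightarrow> ((real \<times> real \<times> real) \<times> real \<times> real) set" where
  "out_only c = {(\<alpha>, y). snd y < arm_hi \<alpha> \<and> arm_lo \<alpha> \<le> fst y \<and> c < snd y - fst y}"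

definition in_only :: "real \<Rightarrow> ((real \<times> real \<times> real) \<times> real \<times> real) set" where
  "in_only c = {(\<alpha>, y). fst y < arm_lo \<alpha> \<and> arm_hi \<alpha> \<le> snd y \<and> c < arm_hi \<alpha> - arm_lo \<alpha>}"

lemma sets_out_in [measurable]: "out_only c \<in> sets borel" "in_only c \<in> sets borel"
proof -
  have [measurable]: "fst \<in> borel_measurable (borel :: (real \<times> real) measure)"
    "snd \<in> borel_measurable (borel :: (real \<times> real) measure)"
    by (intro borel_measurable_continuous_onI continuous_intros)+
  have "{z\<in>space (A \<Otimes>\<^sub>M (borel :: (real \<times> real) measure)).
      snd (snd z) < arm_hi (fst z) \<and> arm_lo (fst z) \<le> fst (snd z) \<and> c < snd (snd z) - fst (snd z)}
    \<in> sets (A \<Otimes>\<^sub>M (borel :: (real \<times> real) measure))" by measurable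
  moreover have "{z\<in>space (A \<Otimes>\<^sub>M (borel :: (real \<times> real) measure)).
      fst (snd z) < arm_lo (fst z) \<and> arm_hi (fst z) \<le> snd (snd z) \<and> c < arm_hi (fst z) - arm_lo (fst z)}
    \<in> sets (A \<Otimes>\<^sub>M (borel :: (real \<times> real) measure))" by measurable
  moreover have "out_only c = {z\<in>space (A \<Otimes>\<^sub>M (borel :: (real \<times> real) measure)).
      snd (snd z) < arm_hi (fst z) \<and> arm_lo (fst z) \<le> fst (snd z) \<and> c < snd (snd z) - fst (snd z)}"
    by (auto simp: out_only_def space_pair_measure)
  moreover have "in_only c = {z\<in>space (A \<Otimes>\<^sub>M (borel :: (real \<times> real) measure)).
      fst (snd z) < arm_lo (fst z) \<and> arm_hi (fst z) \<le> snd (snd z) \<and> c < arm_hi (fst z) - arm_lo (fst z)}"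
    by (auto simp: in_only_def space_pair_measure)
  ultimately show "out_only c \<in> sets borel" "in_only c \<in> sets borel"
    by (simp_all only: sets_AB)
qed

text \<open>The involution exchanging the two ends of an edge is what unimodularity provides.\<close>

lemma emeasure_out_eq_in: "emeasure (A \<Otimes>\<^sub>M \<mu>) (out_only c) = emeasure (A \<Otimes>\<^sub>M \<mu>) (in_only c)"
proof -
  interpret Mm: pair_prob_space \<mu> \<mu> by unfold_locales
  interpret OM: pair_prob_space \<omega> "\<mu> \<Otimes>\<^sub>M \<mu>" by unfold_locales
  have *: "emeasure (A \<Otimes>\<^sub>M \<mu>) B = (\<integral>\<^sup>+w. \<integral>\<^sup>+p. indicator B ((w, fst p), snd p) \<partial>(\<mu> \<Otimes>\<^sub>M \<mu>) \<partial>\<omega>)"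
    if B: "B \<in> sets borel" for B :: "((real \<times> real \<times> real) \<times> real \<times> real) set"
  proof -
    have B': "B \<in> sets (A \<Otimes>\<^sub>M \<mu>)" using B by (simp only: sets_AB)
    note [measurable] = B'
    have "emeasure (A \<Otimes>\<^sub>M \<mu>) B = (\<integral>\<^sup>+z. indicator B z \<partial>(A \<Otimes>\<^sub>M \<mu>))" using B' by simp
    also have "\<dots> = (\<integral>\<^sup>+\<alpha>. \<integral>\<^sup>+y. indicator B (\<alpha>, y) \<partial>\<mu> \<partial>A)"
      by (rule mu.nn_integral_fst[symmetric]) measurable
    also have "\<dots> = (\<integral>\<^sup>+w. \<integral>\<^sup>+x. \<integral>\<^sup>+y. indicator B ((w, x), y) \<partial>\<mu> \<partial>\<mu> \<partial>\<omega>)"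
      by (rule mu.nn_integral_fst[symmetric]) measurable
    also have "\<dots> = (\<integral>\<^sup>+w. \<integral>\<^sup>+p. indicator B ((w, fst p), snd p) \<partial>(\<mu> \<Otimes>\<^sub>M \<mu>) \<partial>\<omega>)"
      by (intro nn_integral_cong, subst mu.nn_integral_fst[symmetric]) auto
    finally show ?thesis .
  qed
  have "(\<integral>\<^sup>+p. (indicator (out_only c) ((w, fst p), snd p) :: ennreal) \<partial>(\<mu> \<Otimes>\<^sub>M \<mu>)) =
    (\<integral>\<^sup>+p. indicator (in_only c) ((w, fst p), snd p) \<partial>(\<mu> \<Otimes>\<^sub>M \<mu>))" for w
  proof -
    have B': "out_only c \<in> sets (A \<Otimes>\<^sub>M \<mu>)" using sets_out_in(1) by (simp only: sets_AB)
    note [measurable] = B'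
    have "(\<integral>\<^sup>+p. (indicator (out_only c) ((w, fst p), snd p) :: ennreal) \<partial>(\<mu> \<Otimes>\<^sub>M \<mu>)) =
      (\<integral>\<^sup>+p. indicator (out_only c) ((w, fst p), snd p) \<partial>distr (\<mu> \<Otimes>\<^sub>M \<mu>) (\<mu> \<Otimes>\<^sub>M \<mu>) (\<lambda>(x, y). (y, x)))"
      by (subst Mm.distr_pair_swap[symmetric]) simp
    also have "\<dots> = (\<integral>\<^sup>+p. indicator (out_only c) ((w, snd p), fst p) \<partial>(\<mu> \<Otimes>\<^sub>M \<mu>))"
      by (subst nn_integral_distr) (auto simp: split_beta')
    also have "\<dots> = (\<integral>\<^sup>+p. indicator (in_only c) ((w, fst p), snd p) \<partial>(\<mu> \<Otimes>\<^sub>M \<mu>))"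
      by (intro nn_integral_cong)
        (auto simp: indicator_def out_only_def in_only_def arm_lo_def arm_hi_def algebra_simps)
    finally show ?thesis .
  qed
  then show ?thesis by (simp add: *)
qed

definition root_event :: "nat \<Rightarrow> ((real \<times> real \<times> real) \<times> real \<times> real) set \<Rightarrow> (real \<times> (nat \<Rightarrow> real \<times> real \<times> real)) set" where
  "root_event k B = {z. \<exists>i<k. (snd z i, rde_step (k - 1) (fst z) (\<lambda>j. snd z (skip i j))) \<in> B}"

lemma rde_step_skip:
  "rde_step k x (\<lambda>j. s (skip i j)) = (vmax x k (\<lambda>l. arm_lo (s (skip i l))), vmax x k (\<lambda>l. arm_hi (s (skip i l))))"
  by (simp add: rde_step_def)

lemma sets_single_event:
  assumes "B \<in> sets borel"
  shows "{z. (snd z i, rde_step k (fst z) (\<lambda>j. snd z (skip i j))) \<in> B} \<in> sets R"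
proof -
  have [measurable]: "B \<in> sets (A \<Otimes>\<^sub>M borel)" using assms by (simp only: sets_AB)
  have "{z\<in>space R. (snd z i, rde_step k (fst z) (\<lambda>j. snd z (skip i j))) \<in> B} \<in> sets R" by measurable
  then show ?thesis by simp
qed

lemma sets_root_event: "B \<in> sets borel \<Longrightarrow> root_event k B \<in> sets R"
proof -
  assume "B \<in> sets borel"
  then have "(\<Union>i<k. {z. (snd z i, rde_step (k - 1) (fst z) (\<lambda>j. snd z (skip i j))) \<in> B}) \<in> sets R"
    by (intro sets.finite_UN finite_lessThan sets_single_event)
  moreover have "root_event k B = (\<Union>i<k. {z. (snd z i, rde_step (k - 1) (fst z) (\<lambda>j. snd z (skip i j))) \<in> B})"
    by (auto simp: root_event_def)
  ultimately show ?thesis by simp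
qed

text \<open>Two different children cannot both strictly beat all others, so the events for the
  single children are disjoint and their probabilities add up.\<close>

lemma emeasure_root_event:
  assumes B: "B \<in> sets borel"
    and best: "B \<subseteq> {(\<alpha>, y). snd y < arm_hi \<alpha>} \<or> B \<subseteq> {(\<alpha>, y). fst y < arm_lo \<alpha>}"
  shows "emeasure R (root_event k B) = ennreal (real k) * cavity (k - 1) B"
proof -
  let ?F = "\<lambda>i. {z. (snd z i, rde_step (k - 1) (fst z) (\<lambda>j. snd z (skip i j))) \<in> B}"
  have disj: "disjoint_family_on ?F {..<k}"
    unfolding disjoint_family_on_def
  proof (intro ballI impI)
    fix i j assume ij: "i \<in> {..<k}" "j \<in> {..<k}" "i \<noteq> j"
    have False if z: "z \<in> ?F i" "z \<in> ?F j" for z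
    proof -
      have *: "f i \<le> vmax (fst z) (k - 1) (\<lambda>l. f (skip j l))" "f j \<le> vmax (fst z) (k - 1) (\<lambda>l. f (skip i l))" for f
        using ij vmax_skip_ge[of j k i f] vmax_skip_ge[of i k j f] by auto
      from best show False
      proof
        assume "B \<subseteq> {(\<alpha>, y). snd y < arm_hi \<alpha>}"
        with z have "vmax (fst z) (k - 1) (\<lambda>l. arm_hi (snd z (skip i l))) < arm_hi (snd z i)"
          "vmax (fst z) (k - 1) (\<lambda>l. arm_hi (snd z (skip j l))) < arm_hi (snd z j)"
          by (auto simp: rde_step_skip)
        with *[of "\<lambda>i. arm_hi (snd z i)"] show False by simp
      next
        assume "B \<subseteq> {(\<alpha>, y). fst y < arm_lo \<alpha>}"
        with z have "vmax (fst z) (k - 1) (\<lambda>l. arm_lo (snd z (skip i l))) < arm_lo (snd z i)"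
          "vmax (fst z) (k - 1) (\<lambda>l. arm_lo (snd z (skip j l))) < arm_lo (snd z j)"
          by (auto simp: rde_step_skip)
        with *[of "\<lambda>i. arm_lo (snd z i)"] show False by simp
      qed
    qed
    then show "?F i \<inter> ?F j = {}" by blast
  qed
  have "root_event k B = (\<Union>i<k. ?F i)" by (auto simp: root_event_def)
  then have "emeasure R (root_event k B) = (\<Sum>i<k. emeasure R (?F i))"
    using sum_emeasure[OF image_subsetI[OF sets_single_event[OF B]] disj finite_lessThan] by simp
  also have "\<dots> = (\<Sum>i<k. cavity (k - 1) B)" by (simp add: emeasure_remove_arm[OF B])
  finally show ?thesis by (simp add: ennreal_of_nat_eq_real_of_nat)
qed

text \<open>The offer of child \<open>i\<close> contains the weight of its own edge, which has no
  atoms and is independent of the vertex weight and of the other arms.\<close>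

lemma AE_no_ties: "AE z in R. \<forall>i<k. arm_hi (snd z i) \<noteq> vmax (fst z) (k - 1) (\<lambda>l. arm_hi (snd z (skip i l)))"
proof -
  let ?B = "{(\<alpha>, y). arm_hi \<alpha> = snd y} :: ((real \<times> real \<times> real) \<times> real \<times> real) set"
  have m [measurable]: "snd \<in> borel_measurable (borel :: (real \<times> real) measure)"
    by (intro borel_measurable_continuous_onI continuous_intros)
  have "{z\<in>space (A \<Otimes>\<^sub>M (borel :: (real \<times> real) measure)). arm_hi (fst z) = snd (snd z)}
    \<in> sets (A \<Otimes>\<^sub>M (borel :: (real \<times> real) measure))" by measurable
  moreover have "?B = {z\<in>space (A \<Otimes>\<^sub>M (borel :: (real \<times> real) measure)). arm_hi (fst z) = snd (snd z)}"
    by (auto simp: space_pair_measure)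
  ultimately have B: "?B \<in> sets borel" by (simp only: sets_AB)
  have "emeasure A {\<alpha>. (\<alpha>, y) \<in> ?B} = 0" for y
  proof -
    have "{\<alpha>\<in>space A. arm_hi \<alpha> = snd y} \<in> sets A" by measurable
    then have s: "{\<alpha>. arm_hi \<alpha> = snd y} \<in> sets A" by simp
    have "emeasure A {\<alpha>. arm_hi \<alpha> = snd y} = (\<integral>\<^sup>+x. emeasure \<omega> {snd y + fst x} \<partial>\<mu>)"
      by (subst A.emeasure_pair_measure_alt2[OF s])
        (auto intro!: nn_integral_cong arg_cong2[where f=emeasure] simp: arm_hi_def)
    also have "\<dots> = 0" using atomless by (simp add: atomless_def omega.emeasure_eq_measure)
    finally show ?thesis by simp
  qed
  then have "cavity (k - 1) ?B = 0" by (simp add: cavity_def)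
  then have "emeasure R {z. (snd z i, rde_step (k - 1) (fst z) (\<lambda>j. snd z (skip i j))) \<in> ?B} = 0" for i
    by (simp only: emeasure_remove_arm[OF B])
  then have "AE z in R. (snd z i, rde_step (k - 1) (fst z) (\<lambda>j. snd z (skip i j))) \<notin> ?B" for i
    using sets_single_event[OF B] by (intro AE_I'[where N="{z. (snd z i, rde_step (k - 1) (fst z) (\<lambda>j. snd z (skip i j))) \<in> ?B}"]) auto
  then show ?thesis by (simp add: rde_step_skip AE_all_countable)
qed

lemma AE_ordered: "AE z in R. \<forall>i. arm_lo (snd z i) \<le> arm_hi (snd z i)"
proof -
  have "AE p in A. fst (snd p) \<le> snd (snd p)"
    by (rule AE_pair_snd[OF mu.sigma_finite_measure_axioms ordered])
  then have "AE \<alpha> in A. arm_lo \<alpha> \<le> arm_hi \<alpha>" by (simp add: arm_lo_def arm_hi_def)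
  then have "AE s in S. arm_lo (s i) \<le> arm_hi (s i)" for i
    by (intro AE_PiM_component A.prob_space_axioms) auto
  then have "AE s in S. \<forall>i. arm_lo (s i) \<le> arm_hi (s i)" by (simp add: AE_all_countable)
  then show ?thesis by (rule AE_pair_snd[OF S.P.sigma_finite_measure_axioms])
qed

text \<open>The opposite implication holds for every ordered sample without ties by
  \<open>best_in_lo_imp_best_in_hi\<close>. Under the root law \<pi> both events have the same mean,
  by the exchange of edge ends and the degree shift, so they agree up to null sets for each degree
  of positive mass.\<close>

lemma AE_root_balance:
  assumes k: "pmf \<pi> k \<noteq> 0"
  shows "AE z in R. z \<in> root_event k (out_only c) \<longrightarrow> z \<in> root_event k (in_only c)"
proof -
  have e: "emeasure R (root_event j (out_only c)) = ennreal (real j) * cavity (j - 1) (out_only c)"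
    "emeasure R (root_event j (in_only c)) = ennreal (real j) * cavity (j - 1) (in_only c)" for j
    by (intro emeasure_root_event sets_out_in; force simp: out_only_def in_only_def)+
  have sub: "AE z in R. z \<in> root_event j (in_only c) \<longrightarrow> z \<in> root_event j (out_only c)" for j
    using AE_no_ties[of j] AE_ordered
  proof eventually_elim
    case (elim z)
    show ?case
    proof
      assume "z \<in> root_event j (in_only c)"
      then obtain i where "i < j" "vmax (fst z) (j - 1) (\<lambda>l. arm_lo (snd z (skip i l))) < arm_lo (snd z i)"
        "arm_hi (snd z i) \<le> vmax (fst z) (j - 1) (\<lambda>l. arm_hi (snd z (skip i l)))"
        "c < arm_hi (snd z i) - arm_lo (snd z i)"
        by (auto simp: root_event_def in_only_def rde_step_skip)
      from best_in_lo_imp_best_in_hi[where lo="\<lambda>i. arm_lo (snd z i)" and hi="\<lambda>i. arm_hi (snd z i)", OF _ _ this] elim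
      show "z \<in> root_event j (out_only c)"
        by (auto simp: root_event_def out_only_def rde_step_skip)
    qed
  qed
  have s: "root_event j (out_only c) \<in> sets R" "root_event j (in_only c) \<in> sets R" for j
    by (intro sets_root_event sets_out_in)+
  let ?f = "\<lambda>j. measure R (root_event j (in_only c))" and ?g = "\<lambda>j. measure R (root_event j (out_only c))"
  have le: "?f j \<le> ?g j" for j
    by (rule R.finite_measure_mono_AE[OF sub s(1)])
  \<comment> \<open>Both integrals equal the mean degree times the mass that \<open>A\<close> and an
    independent \<open>\<mu>\<close> give to the two exchanged sets.\<close>
  have nn: "(\<integral>\<^sup>+j. ennreal (?f j) \<partial>measure_pmf \<pi>) = (\<integral>\<^sup>+j. ennreal (?g j) \<partial>measure_pmf \<pi>)"
    using nn_integral_degree_shift[of "\<lambda>j. cavity j (in_only c)"]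
      nn_integral_degree_shift[of "\<lambda>j. cavity j (out_only c)"]
    by (simp only: R.emeasure_eq_measure[symmetric] e nn_integral_cavity sets_out_in emeasure_out_eq_in)
  have i: "integrable (measure_pmf \<pi>) ?f" "integrable (measure_pmf \<pi>) ?g"
    by (auto intro!: measure_pmf.integrable_const_bound[where B=1])
  have "integral\<^sup>L (measure_pmf \<pi>) ?f = integral\<^sup>L (measure_pmf \<pi>) ?g"
    using nn by (simp add: integral_eq_nn_integral)
  from AE_eq_of_integral_eq[OF i this] le have "AE j in measure_pmf \<pi>. ?f j = ?g j" by simp
  with k have eq: "?f k = ?g k" by (simp add: AE_measure_pmf_iff set_pmf_iff)
  let ?a = "\<lambda>z. indicat_real (root_event k (in_only c)) z" and ?b = "\<lambda>z. indicat_real (root_event k (out_only c)) z"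
  have "AE z in R. ?a z = ?b z"
  proof (rule AE_eq_of_integral_eq)
    show "integrable R ?a" "integrable R ?b" using s by (auto simp: R.emeasure_eq_measure)
    show "integral\<^sup>L R ?a = integral\<^sup>L R ?b" using eq by (simp add: s)
    show "AE z in R. ?a z \<le> ?b z" using sub[of k] by eventually_elim (auto simp: indicator_def)
  qed
  then show ?thesis by eventually_elim (auto simp: indicator_def split: if_splits)
qed

section \<open>Crossing arms\<close>

definition crossing :: "real \<times> real \<times> real \<Rightarrow> real \<times> real \<times> real \<Rightarrow> real \<Rightarrow> bool" where
  "crossing \<alpha> \<beta> x \<longleftrightarrow> x < arm_lo \<alpha> \<and> arm_lo \<beta> < arm_lo \<alpha> \<and> arm_hi \<alpha> < arm_hi \<beta>"

text \<open>If an arm \<open>\<alpha>\<close> were crossed with positive probability, then by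
  independence all other \<open>k - 1\<close> arms at a root of degree \<open>k\<close> would cross
  it simultaneously with positive probability, which contradicts the balance.\<close>

lemma AE_not_crossing:
  assumes k: "3 \<le> k" "pmf \<pi> k \<noteq> 0"
  shows "AE x in \<xi>. AE \<alpha> in A. AE \<beta> in A. \<not> crossing \<alpha> \<beta> x"
proof -
  have "AE z in R. \<forall>c::rat. z \<in> root_event k (out_only (of_rat c)) \<longrightarrow> z \<in> root_event k (in_only (of_rat c))"
    unfolding AE_all_countable by (intro allI AE_root_balance k(2))
  with AE_no_ties[of k] AE_ordered
  have "AE z in R. \<not> (\<forall>j<k - 1. crossing (snd z 0) (snd z (Suc j)) (fst z))"
  proof eventually_elim
    case (elim z)
    show ?case
    proof
      assume *: "\<forall>j<k - 1. crossing (snd z 0) (snd z (Suc j)) (fst z)"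
      have **: "crossing (snd z 0) (snd z j) (fst z)" if "0 < j" "j < k" for j
        using *[rule_format, of "j - 1"] that by auto
      have x: "fst z < arm_lo (snd z 0)" using **[of 1] k by (auto simp: crossing_def)
      obtain c :: rat where c: "z \<in> root_event k (out_only (of_rat c))" "z \<notin> root_event k (in_only (of_rat c))"
        by (rule crossing_arms_break_balance[of k "\<lambda>i. arm_hi (snd z i)" "fst z" "\<lambda>i. arm_lo (snd z i)"])
          (use k x ** elim(1,2) in \<open>auto simp: crossing_def root_event_def out_only_def in_only_def rde_step_skip\<close>)
      with elim(3) show False by blast
    qed
  qed
  then have "AE x in \<xi>. AE s in S. \<not> (\<forall>j<k - 1. crossing (s 0) (s (Suc j)) x)"
    by (rule R.AE_pair[of "\<lambda>z. \<not> (\<forall>j<k - 1. crossing (snd z 0) (snd z (Suc j)) (fst z))", simplified fst_conv snd_conv])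
  then show ?thesis
  proof eventually_elim
    case (elim x)
    interpret AS: pair_prob_space A S by unfold_locales
    from elim have "AE s in distr (A \<Otimes>\<^sub>M S) S (\<lambda>(s, \<omega>). case_nat s \<omega>). \<not> (\<forall>j<k - 1. crossing (s 0) (s (Suc j)) x)"
      by (simp only: S.PiM_iter)
    then have "AE z in A \<Otimes>\<^sub>M S. \<not> (\<forall>j<k - 1. crossing ((case z of (s, \<omega>) \<Rightarrow> case_nat s \<omega>) 0) ((case z of (s, \<omega>) \<Rightarrow> case_nat s \<omega>) (Suc j)) x)"
      by (rule AE_distrD[rotated]) measurable
    then have "AE z in A \<Otimes>\<^sub>M S. \<not> (\<forall>j<k - 1. crossing (fst z) (snd z j) x)"
      by (simp add: split_beta')
    then have "AE \<alpha> in A. AE s in S. \<not> (\<forall>j<k - 1. crossing \<alpha> (s j) x)"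
      by (rule AS.AE_pair[of "\<lambda>z. \<not> (\<forall>j<k - 1. crossing (fst z) (snd z j) x)", simplified fst_conv snd_conv])
    then show ?case
    proof eventually_elim
      case (elim \<alpha>)
      have "{\<beta>\<in>space A. crossing \<alpha> \<beta> x} \<in> sets A" unfolding crossing_def by measurable
      then have c: "{\<beta>. crossing \<alpha> \<beta> x} \<in> sets A" by simp
      have "{s\<in>space S. \<forall>j\<in>{..<k - 1}. s j \<in> {\<beta>. crossing \<alpha> \<beta> x}} \<in> sets S"
        using c by measurable
      then have "emeasure S {s\<in>space S. \<forall>j\<in>{..<k - 1}. s j \<in> {\<beta>. crossing \<alpha> \<beta> x}} = 0"
        using elim by (subst AE_iff_measurable[symmetric, where P="\<lambda>s. \<not> (\<forall>j<k - 1. crossing \<alpha> (s j) x)"]) auto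
      \<comment> \<open>Given \<open>\<alpha>\<close> and \<open>x\<close>, the \<open>k - 1\<close>
        events are independent and equally likely, so the vanishing of their product forces each of
        them to be null.\<close>
      then have "emeasure A {\<beta>. crossing \<alpha> \<beta> x} ^ (k - 1) = 0"
        using c by (subst (asm) S.emeasure_PiM_Collect) auto
      then have "emeasure A {\<beta>. crossing \<alpha> \<beta> x} = 0" by (simp add: power_eq_0_iff)
      then show ?case using c by (intro AE_I'[where N="{\<beta>. crossing \<alpha> \<beta> x}"]) auto
    qed
  qed
qed

text \<open>Crossing is an open condition on the vertex weight and the two arms, so its almost sure
  failure extends to all triples of support points.\<close>

lemma not_crossing_in_supp:
  assumes k: "3 \<le> k" "pmf \<pi> k \<noteq> 0" and "x \<in> supp \<xi>" "\<alpha> \<in> supp A" "\<beta> \<in> supp A"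
  shows "\<not> crossing \<alpha> \<beta> x"
proof
  assume cr: "crossing \<alpha> \<beta> x"
  let ?O = "{z :: real \<times> (real \<times> real \<times> real) \<times> (real \<times> real \<times> real).
    crossing (fst (snd z)) (snd (snd z)) (fst z)}"
  interpret AA: pair_prob_space A A by unfold_locales
  interpret XA: pair_prob_space \<xi> "A \<Otimes>\<^sub>M A" by unfold_locales
  have sAA: "sets (A \<Otimes>\<^sub>M A) = sets borel"
    unfolding borel_prod[symmetric, where 'a="real \<times> real \<times> real" and 'b="real \<times> real \<times> real"]
    by (rule sets_pair_measure_cong[OF sets_A sets_A])
  have sX: "sets (\<xi> \<Otimes>\<^sub>M (A \<Otimes>\<^sub>M A)) = sets borel"
    unfolding borel_prod[symmetric, where 'a="real" and 'b="(real \<times> real \<times> real) \<times> real \<times> real \<times> real"]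
    by (rule sets_pair_measure_cong[OF sets_xi sAA])
  have op: "open ?O"
    unfolding crossing_def arm_lo_def arm_hi_def
    by (intro open_Collect_conj open_Collect_less continuous_intros)
  have m: "{z\<in>space (A \<Otimes>\<^sub>M A). \<not> crossing (fst z) (snd z) x} \<in> sets (A \<Otimes>\<^sub>M A)" for x
    unfolding crossing_def by measurable
  have m2: "{z\<in>space (\<xi> \<Otimes>\<^sub>M (A \<Otimes>\<^sub>M A)). \<not> crossing (fst (snd z)) (snd (snd z)) (fst z)}
    \<in> sets (\<xi> \<Otimes>\<^sub>M (A \<Otimes>\<^sub>M A))"
    unfolding crossing_def by measurable
  have "AE x in \<xi>. AE z in A \<Otimes>\<^sub>M A. \<not> crossing (fst z) (snd z) x"
    using AE_not_crossing[OF k] by eventually_elim (subst (asm) AA.AE_pair_iff[OF m], simp)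
  then have "AE z in \<xi> \<Otimes>\<^sub>M (A \<Otimes>\<^sub>M A). \<not> crossing (fst (snd z)) (snd (snd z)) (fst z)"
    by (subst (asm) XA.AE_pair_iff[OF m2]) simp
  moreover have "(x, \<alpha>, \<beta>) \<in> supp (\<xi> \<Otimes>\<^sub>M (A \<Otimes>\<^sub>M A))"
    using assms by (intro supp_pair sAA AA.sigma_finite_measure_axioms A.sigma_finite_measure_axioms sets_A sets_xi)
  ultimately show False
    using supp_not_null[OF sX, of "(x, \<alpha>, \<beta>)" ?O] op cr by simp
qed

end

section \<open>Uniqueness of the messages\<close>

lemma AE_pair_fst:
  assumes "sigma_finite_measure N" "AE x in M. P x"
  shows "AE z in M \<Otimes>\<^sub>M N. P (fst z)"
proof -
  interpret sigma_finite_measure N by fact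
  obtain N0 where "{x\<in>space M. \<not> P x} \<subseteq> N0" "emeasure M N0 = 0" "N0 \<in> sets M"
    using assms(2) by (rule AE_E)
  then show ?thesis
    by (intro AE_I[of _ _ "N0 \<times> space N"]) (auto simp: space_pair_measure emeasure_pair_measure_Times)
qed

locale message_rde_locally_convex = message_rde +
  assumes bdd: "bdd_below (msupport \<xi>)" and convex_max: "locally_convex_under_max \<omega>"
begin

section \<open>The support of the fixed-point law\<close>

definition low :: real where "low = Inf (supp \<xi>)"

lemma bdd_supp: "bdd_below (supp \<xi>)"
  using bdd by (simp add: msupport_eq_supp[OF xi.finite_measure_axioms])

lemma supp_xi_nonempty: "supp \<xi> \<noteq> {}"
proof
  assume "supp \<xi> = {}"
  then have "AE t in \<xi>. False" using AE_in_supp[OF sets_xi] by simp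
  then show False using xi.AE_False by simp
qed

lemma low_in_supp: "low \<in> supp \<xi>"
  unfolding low_def by (rule closed_contains_Inf[OF supp_xi_nonempty bdd_supp closed_supp])

lemma AE_ge_low: "AE x in \<xi>. low \<le> x"
  using AE_in_supp[OF sets_xi] by eventually_elim (simp add: low_def cInf_lower bdd_supp)

lemma AE_mu_ge_low: "AE p in \<mu>. low \<le> fst p"
proof -
  have [measurable]: "fst \<in> borel_measurable (borel :: (real \<times> real) measure)"
    by (intro borel_measurable_continuous_onI continuous_intros)
  have "Measurable.pred borel (\<lambda>p :: real \<times> real. low \<le> fst p)" by measurable
  then show ?thesis
  proof (subst AE_law_iff, safe)
    fix k
    show "AE z in R. low \<le> fst (rde_step k (fst z) (snd z))"
      using AE_pair_fst[OF S.P.sigma_finite_measure_axioms AE_ge_low]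
      by eventually_elim (auto simp: rde_step_def intro: order_trans[OF _ vmax_ge_base])
  qed
qed

lemma supp_mu_ordered: "p \<in> supp \<mu> \<Longrightarrow> low \<le> fst p \<and> fst p \<le> snd p"
proof -
  assume p: "p \<in> supp \<mu>"
  have "closed {p :: real \<times> real. low \<le> fst p \<and> fst p \<le> snd p}"
    by (intro closed_Collect_conj closed_Collect_le continuous_intros)
  from supp_subset_closed[OF sets_mu this] AE_mu_ge_low ordered p show ?thesis by auto
qed

lemma AE_arms: "AE \<alpha> in A. P \<alpha> \<Longrightarrow> AE z in R. \<forall>i. P (snd z i)"
  unfolding AE_all_countable
  by (intro allI AE_pair_snd[OF S.P.sigma_finite_measure_axioms] AE_PiM_component A.prob_space_axioms) auto

text \<open>If a pair has a positive gap, its upper entry exceeds the vertex weight and is therefore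
  the offer \<open>W - l\<close> of some arm, with \<open>W \<le> M\<close> and
  \<open>low \<le> l\<close>.\<close>

lemma supp_mu_le:
  assumes M: "AE w in \<omega>. w \<le> M" and p: "p \<in> supp \<mu>" "fst p < snd p"
  shows "snd p \<le> M - low"
proof (rule ccontr)
  assume "\<not> snd p \<le> M - low"
  have [measurable]: "fst \<in> borel_measurable (borel :: (real \<times> real) measure)"
    "snd \<in> borel_measurable (borel :: (real \<times> real) measure)"
    by (intro borel_measurable_continuous_onI continuous_intros)+
  have "Measurable.pred borel (\<lambda>p :: real \<times> real. \<not> (fst p < snd p \<and> M - low < snd p))" by measurable
  then have "AE p in \<mu>. \<not> (fst p < snd p \<and> M - low < snd p)"
  proof (subst AE_law_iff, safe del: notI)
    fix k
    have "AE z in R. \<forall>i. fst (snd z i) \<le> M"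
      by (intro AE_arms AE_pair_fst M mu.sigma_finite_measure_axioms)
    moreover have "AE z in R. \<forall>i. low \<le> fst (snd (snd z i))"
      by (intro AE_arms AE_pair_snd AE_mu_ge_low mu.sigma_finite_measure_axioms)
    ultimately show "AE z in R. \<not> (fst (rde_step k (fst z) (snd z)) < snd (rde_step k (fst z) (snd z))
        \<and> M - low < snd (rde_step k (fst z) (snd z)))"
    proof eventually_elim
      case (elim z)
      have "arm_hi (snd z i) \<le> M - low" for i
        using elim by (auto simp: arm_hi_def intro: diff_mono)
      moreover have "fst z \<le> vmax (fst z) k (\<lambda>i. arm_lo (snd z i))" by (rule vmax_ge_base)
      ultimately show ?case
        using vmax_attained[of "fst z" k "\<lambda>i. arm_hi (snd z i)"]
        by (auto simp: rde_step_def not_less)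
    qed
  qed
  then have "AE p in \<mu>. p \<notin> {p. fst p < snd p \<and> M - low < snd p}" by simp
  moreover have "open {p :: real \<times> real. fst p < snd p \<and> M - low < snd p}"
    by (intro open_Collect_conj open_Collect_less continuous_intros)
  ultimately show False
    using supp_not_null[OF sets_mu p(1), of "{p. fst p < snd p \<and> M - low < snd p}"] p(2) \<open>\<not> snd p \<le> M - low\<close>
    by auto
qed

text \<open>Independence allows the vertex weight and finitely many arms to be steered into
  neighbourhoods of support points at once: the mass of this event is a product of positive factors,
  so it meets every almost sure event.\<close>

lemma AE_near:
  assumes P: "AE z in R. P z"
    and U: "open U" "x \<in> U" "x \<in> supp \<xi>" and V: "open V" "\<alpha> \<in> V" "\<alpha> \<in> supp A"
  shows "\<exists>z. fst z \<in> U \<and> (\<forall>i<k. snd z i \<in> V) \<and> P z"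
proof (rule ccontr)
  assume n: "\<not> ?thesis"
  have sV: "V \<in> sets A" using V(1) by (simp only: sets_A borel_open)
  have sU: "U \<in> sets \<xi>" using U(1) by simp
  let ?F = "{s\<in>space S. \<forall>i\<in>{..<k}. s i \<in> V}"
  have F: "?F \<in> sets S" using sV by measurable
  have "AE z in R. z \<notin> U \<times> ?F"
    using P by eventually_elim (use n in auto)
  moreover have UF: "U \<times> ?F \<in> sets R" using sU F by (rule pair_measureI)
  ultimately have "emeasure R (U \<times> ?F) = 0"
    by (subst AE_iff_measurable[symmetric, where P="\<lambda>z. z \<notin> U \<times> ?F"]) auto
  then have "emeasure \<xi> U * emeasure S ?F = 0"
    using S.P.emeasure_pair_measure_Times[OF sU F] by simp
  moreover have "emeasure S ?F = emeasure A V ^ k"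
    using sV by (subst S.emeasure_PiM_Collect) auto
  ultimately show False
    using suppD[OF U(3,1,2)] suppD[OF V(3,1,2)] by simp
qed

lemma arm_in_supp: "W \<in> supp \<omega> \<Longrightarrow> p \<in> supp \<mu> \<Longrightarrow> (W, p) \<in> supp A"
  by (intro supp_pair mu.sigma_finite_measure_axioms sets_mu sets_omega)

text \<open>Take the vertex weight close to \<open>low\<close> and all \<open>k\<close> arms close
  to \<open>(W, p)\<close>; the maximum is Lipschitz, so the outcome is close to the target. The
  condition \<open>0 < k\<close> ensures that an arm is present.\<close>

lemma supp_mu_step:
  assumes p: "p \<in> supp \<mu>" and W: "W \<in> supp \<omega>" and k: "0 < k" "pmf (size_biased \<pi>) k \<noteq> 0"
  shows "(max low (W - snd p), max low (W - fst p)) \<in> supp \<mu>" (is "?t \<in> _")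
  unfolding supp_def
proof (intro CollectI allI impI notI)
  fix U assume U: "open U \<and> ?t \<in> U" and 0: "emeasure \<mu> U = 0"
  then obtain e where e: "0 < e" "\<And>q. dist q ?t \<le> e \<Longrightarrow> q \<in> U"
    unfolding open_contains_cball by (metis mem_cball dist_commute subsetD)
  have sU: "U \<in> sets \<mu>" using U by (simp add: sets_mu)
  have "AE q in \<mu>. q \<notin> U"
    using 0 sU by (subst AE_iff_measurable[OF sU]) auto
  moreover have "- U \<in> sets borel" using U by (intro borel_comp borel_open) simp
  then have "Measurable.pred borel (\<lambda>q. q \<notin> U)" unfolding pred_def Compl_eq by simp
  ultimately have AE: "AE z in R. rde_step k (fst z) (snd z) \<notin> U"
    using AE_law_iff[of "\<lambda>q. q \<notin> U"] k(2) by blast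
  define C where "C = {\<alpha> :: real \<times> real \<times> real. \<bar>arm_lo \<alpha> - (W - snd p)\<bar> < e / 2 \<and> \<bar>arm_hi \<alpha> - (W - fst p)\<bar> < e / 2}"
  have oC: "open C" unfolding C_def arm_lo_def arm_hi_def
    by (intro open_Collect_conj open_Collect_less continuous_intros)
  have wC: "(W, p) \<in> C" using e(1) by (simp add: C_def arm_lo_def arm_hi_def)
  have oU: "open {x. \<bar>x - low\<bar> < e / 2}" by (intro open_Collect_less continuous_intros)
  have lU: "low \<in> {x. \<bar>x - low\<bar> < e / 2}" using e(1) by simp
  have "\<exists>z. fst z \<in> {x. \<bar>x - low\<bar> < e / 2} \<and> (\<forall>i<k. snd z i \<in> C) \<and> rde_step k (fst z) (snd z) \<notin> U"
    by (rule AE_near[OF AE oU lU low_in_supp oC wC arm_in_supp[OF W p]])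
  then obtain z where z: "\<bar>fst z - low\<bar> < e / 2" "\<And>i. i < k \<Longrightarrow> snd z i \<in> C" "rde_step k (fst z) (snd z) \<notin> U"
    by blast
  have t: "?t = (vmax low k (\<lambda>_. W - snd p), vmax low k (\<lambda>_. W - fst p))"
    using k(1) by (simp add: vmax_const)
  have "dist (rde_step k (fst z) (snd z)) ?t \<le>
      dist (vmax (fst z) k (\<lambda>i. arm_lo (snd z i))) (vmax low k (\<lambda>_. W - snd p))
      + dist (vmax (fst z) k (\<lambda>i. arm_hi (snd z i))) (vmax low k (\<lambda>_. W - fst p))"
    unfolding t rde_step_def dist_prod_def fst_conv snd_conv
    by (rule sqrt_sum_squares_le_sum) simp_all
  also have "\<dots> \<le> e / 2 + e / 2"
    unfolding dist_real_def
    using z(1,2) by (intro add_mono vmax_lipschitz) (auto simp: C_def less_imp_le)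
  finally have "rde_step k (fst z) (snd z) \<in> U" using e(2) by simp
  with z(3) show False by simp
qed

text \<open>A step with \<open>b\<close> followed by a step with \<open>b - t\<close> translates a
  point downwards by \<open>t\<close>, as long as no maximum with \<open>low\<close> acts; this is
  what the interval of edge weights is for. Finitely many short translations bring the lower entry
  to \<open>low\<close> and keep the gap.\<close>

lemma supp_mu_shift:
  assumes k: "0 < k" "pmf (size_biased \<pi>) k \<noteq> 0" and ab: "a < b" "{a<..b} \<subseteq> supp \<omega>"
    and p: "p \<in> supp \<mu>" "snd p \<le> b - low"
  shows "(low, low + (snd p - fst p)) \<in> supp \<mu>"
proof -
  have one: "(fst q - t, snd q - t) \<in> supp \<mu>"
    if q: "q \<in> supp \<mu>" "snd q \<le> b - low" and t: "0 \<le> t" "t < b - a" "low \<le> fst q - t" for q t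
  proof -
    have o: "low \<le> fst q" "fst q \<le> snd q" using supp_mu_ordered[OF q(1)] by auto
    have "(b - snd q, b - fst q) \<in> supp \<mu>"
      using supp_mu_step[OF q(1) _ k, of b] ab q(2) o by (auto simp: max_def split: if_splits)
    from supp_mu_step[OF this _ k, of "b - t"] ab t o
    show ?thesis by (auto simp: max_def subset_iff split: if_splits)
  qed
  have "(fst q - t, snd q - t) \<in> supp \<mu>"
    if "q \<in> supp \<mu>" "snd q \<le> b - low" "0 \<le> t" "t \<le> real n * ((b - a) / 2)" "low \<le> fst q - t" for q t n
    using that
  proof (induction n arbitrary: q t)
    case 0
    then show ?case by simp
  next
    case (Suc n)
    show ?case
    proof (cases "t \<le> (b - a) / 2")
      case True
      with Suc.prems ab(1) show ?thesis by (intro one) auto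
    next
      case False
      \<comment> \<open>Half the length of the interval, so that \<open>b - h\<close> stays strictly
        above \<open>a\<close>.\<close>
      define h where "h = (b - a) / 2"
      have h: "0 < h" "h < b - a" "h < t" using False ab(1) by (auto simp: h_def)
      have "(fst q - h, snd q - h) \<in> supp \<mu>"
        using Suc.prems h by (intro one) auto
      moreover have "t - h \<le> real n * ((b - a) / 2)"
        using Suc.prems(4) unfolding h_def[symmetric] by (simp add: algebra_simps)
      ultimately show ?thesis
        using Suc.IH[of "(fst q - h, snd q - h)" "t - h"] Suc.prems h by simp
    qed
  qed note many = this
  obtain n where "fst p - low \<le> real n * ((b - a) / 2)"
    using ab(1) reals_Archimedean3[of "(b - a) / 2"] by (metis diff_gt_0_iff_gt half_gt_zero less_imp_le)
  from many[OF p _ this] supp_mu_ordered[OF p(1)] show ?thesis by (auto simp: algebra_simps)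
qed

text \<open>If the edge weights are unbounded above, \<open>b\<close> can be taken as large as
  desired. If their maximum is M, the closed support contains M, and \<open>supp_mu_le\<close> gives
  the bounds with b = M. That lemma speaks only of points with a gap, which is why \<open>r\<close>
  has a second alternative.\<close>

lemma interval_below_max:
  assumes p: "p \<in> supp \<mu>" "fst p < snd p" and r: "r \<in> supp \<mu>"
  obtains a b where "a < b" "{a<..b} \<subseteq> supp \<omega>" "snd p \<le> b - low" "snd r \<le> b - low \<or> fst r = snd r"
proof -
  have ms: "msupport \<omega> = supp \<omega>" by (rule msupport_eq_supp[OF omega.finite_measure_axioms])
  define m where "m = (SUP t\<in>supp \<omega>. ereal t)"
  obtain a :: real where a: "ereal a < m" "{t. a < t \<and> ereal t < m} \<subseteq> supp \<omega>"
    using convex_max by (auto simp: locally_convex_under_max_def ms m_def Let_def)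
  show ?thesis
  proof (cases m)
    case PInf
    define b where "b = max (a + 1) (max (snd p + low) (snd r + low))"
    show ?thesis
      by (rule that[of a b]) (use a PInf in \<open>auto simp: b_def\<close>)
  next
    case MInf
    with a show ?thesis by simp
  next
    case (real M)
    have le: "t \<le> M" if "t \<in> supp \<omega>" for t
    proof -
      have "ereal t \<le> m" unfolding m_def using that by (intro SUP_upper)
      with real show ?thesis by simp
    qed
    have "AE w in \<omega>. w \<le> M" using AE_in_supp[OF sets_omega] by eventually_elim (rule le)
    note up = supp_mu_le[OF this]
    have aM: "a < M" using a real by simp
    have "{a<..<M} \<subseteq> supp \<omega>" using a real by auto
    then have "closure {a<..<M} \<subseteq> supp \<omega>" by (intro closure_minimal closed_supp)
    then have "{a<..M} \<subseteq> supp \<omega>" using aM by (auto simp: subset_iff)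
    then show ?thesis
      using aM up[OF p] up[OF r] supp_mu_ordered[OF r] by (intro that[of a M]) auto
  qed
qed

text \<open>Both points are first moved to lower entry \<open>low\<close> with their gaps kept. Then
  the larger gap on an edge of weight \<open>b\<close> and the smaller one on an edge of weight
  \<open>b - t\<close> form crossing arms: for the upper bounds the larger weight wins, and for the
  lower bounds the smaller gap outweighs the loss \<open>t\<close>.\<close>

lemma gap_constant:
  assumes k: "3 \<le> k" "pmf \<pi> k \<noteq> 0" and p: "p \<in> supp \<mu>" and r: "r \<in> supp \<mu>"
  shows "\<not> snd r - fst r < snd p - fst p"
proof
  assume gap: "snd r - fst r < snd p - fst p"
  have o: "low \<le> fst p" "fst p \<le> snd p" "low \<le> fst r" "fst r \<le> snd r"
    using supp_mu_ordered[OF p] supp_mu_ordered[OF r] by auto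
  with gap have "fst p < snd p" by simp
  then obtain a b where ab: "a < b" "{a<..b} \<subseteq> supp \<omega>" "snd p \<le> b - low" "snd r \<le> b - low \<or> fst r = snd r"
    using interval_below_max[OF p _ r] by blast
  have k': "0 < k - 1" "pmf (size_biased \<pi>) (k - 1) \<noteq> 0"
    using k mean_pos by (auto simp: pmf_size_biased[OF int_pi mean_pos])
  have p': "(low, low + (snd p - fst p)) \<in> supp \<mu>" by (rule supp_mu_shift[OF k' ab(1,2) p ab(3)])
  have r': "(low, low + (snd r - fst r)) \<in> supp \<mu>"
  proof (cases "snd r \<le> b - low")
    case True
    then show ?thesis by (rule supp_mu_shift[OF k' ab(1,2) r])
  next
    \<comment> \<open>Now \<open>r\<close> has no gap and lies above \<open>b - low\<close>, so one
      step with \<open>b\<close> truncates both entries to \<open>low\<close>.\<close>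
    case False
    with ab(4) supp_mu_step[OF r _ k', of b] ab(1,2) show ?thesis
      by (auto simp: max_def split: if_splits)
  qed
  define t where "t = min (b - a) ((snd p - fst p) - (snd r - fst r)) / 2"
  have t: "0 < t" "t < b - a" "t < (snd p - fst p) - (snd r - fst r)"
    using gap ab(1) by (auto simp: t_def min_def)
  have "(b, low, low + (snd p - fst p)) \<in> supp A" "(b - t, low, low + (snd r - fst r)) \<in> supp A"
    using t ab(1,2) p' r' by (auto intro!: arm_in_supp)
  from not_crossing_in_supp[OF k low_in_supp this(2,1)] t o ab(3)
  show False by (auto simp: crossing_def arm_lo_def arm_hi_def)
qed

text \<open>A vertex with at most one child never has a larger gap than its first arm, since
  truncation only shrinks it. Both gaps have the same law, so a bounded increasing function of them
  has equal means and the inequality is almost surely an equality. This is a closed condition and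
  hence holds at \<open>(low, W, p)\<close>.\<close>

lemma gap_preserved_on_line:
  assumes line: "\<And>k. 3 \<le> k \<Longrightarrow> pmf \<pi> k = 0" and one: "pmf (size_biased \<pi>) 1 \<noteq> 0"
    and p: "p \<in> supp \<mu>" and W: "W \<in> supp \<omega>"
  shows "max low (W - fst p) - max low (W - snd p) = snd p - fst p"
proof (rule ccontr)
  assume neq: "\<not> ?thesis"
  let ?\<nu> = "measure_pmf (size_biased \<pi>) \<Otimes>\<^sub>M R"
  interpret PR: pair_prob_space "measure_pmf (size_biased \<pi>)" R by unfold_locales
  \<comment> \<open>Gaps need not be integrable; \<open>arctan\<close> is strictly increasing and
    bounded, and adding 2, which exceeds half of pi, makes it non-negative.\<close>
  define g where "g p = arctan (snd p - fst p) + 2" for p :: "real \<times> real"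
  have g_nonneg: "0 \<le> g p" and g_le: "g p \<le> 4" for p
    using arctan_bounded[of "snd p - fst p"] pi_less_4 by (auto simp: g_def)
  have g_abs: "\<bar>g p\<bar> \<le> 4" for p using g_nonneg[of p] g_le[of p] by simp
  have gm: "g \<in> borel_measurable borel"
    unfolding g_def[abs_def] by (intro borel_measurable_continuous_onI continuous_intros)
  note [measurable] = gm measurable_rde_step_joint
  have gA [measurable]: "(\<lambda>\<alpha>. g (snd \<alpha>)) \<in> borel_measurable A"
    unfolding measurable_cong_sets[OF sets_A refl] g_def
    by (intro borel_measurable_continuous_onI continuous_intros)
  have gmu [measurable]: "g \<in> borel_measurable \<mu>" unfolding measurable_cong_sets[OF sets_mu refl] by (rule gm)
  \<comment> \<open>\<open>?h\<close> reads the pair of arm 0 even at degree 0: the arm is always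
    sampled, and its pair has law \<open>\<mu>\<close>.\<close>
  let ?f = "\<lambda>kz. g (case kz of (k, x, s) \<Rightarrow> rde_step k x s)" and ?h = "\<lambda>kz. g (snd (snd (snd kz) 0))"
  have fm: "?f \<in> borel_measurable ?\<nu>" by measurable
  have hm: "?h \<in> borel_measurable ?\<nu>" by measurable
  have size: "k \<le> 1" if "k \<in> set_pmf (size_biased \<pi>)" for k
    using that line[of "Suc k"] mean_pos by (cases "k \<le> 1") (auto simp: pmf_size_biased[OF int_pi mean_pos] set_pmf_iff)
  have le: "AE kz in ?\<nu>. ?f kz \<le> ?h kz"
  proof -
    have "AE k in measure_pmf (size_biased \<pi>). k \<le> 1" using size by (simp add: AE_measure_pmf_iff)
    from AE_pair_fst[OF R.sigma_finite_measure_axioms this] AE_pair_snd[OF R.sigma_finite_measure_axioms AE_ordered]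
    show ?thesis
    proof eventually_elim
      case (elim kz)
      obtain k x s where kz: "kz = (k, x, s)" by (cases kz) auto
      have o: "arm_lo (s 0) \<le> arm_hi (s 0)" using elim kz by simp
      have d: "arm_hi (s 0) - arm_lo (s 0) = snd (snd (s 0)) - fst (snd (s 0))" by (simp add: arm_lo_def arm_hi_def)
      consider "k = 0" | "k = 1" using elim kz by force
      then have "snd (rde_step k x s) - fst (rde_step k x s) \<le> snd (snd (s 0)) - fst (snd (s 0))"
        using o unfolding d[symmetric] by cases (auto simp: rde_step_def vmax_Suc)
      then show ?case by (simp add: g_def kz arctan_le_iff)
    qed
  qed
  have "(\<integral>\<^sup>+kz. ennreal (?f kz) \<partial>?\<nu>) = (\<integral>\<^sup>+p. ennreal (g p) \<partial>\<mu>)"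
    by (subst law[symmetric], subst nn_integral_distr) auto
  also have "\<dots> = (\<integral>\<^sup>+w. \<integral>\<^sup>+p. ennreal (g p) \<partial>\<mu> \<partial>\<omega>)"
    using omega.emeasure_space_1 by simp
  also have "\<dots> = (\<integral>\<^sup>+\<alpha>. ennreal (g (snd \<alpha>)) \<partial>A)"
    by (subst mu.nn_integral_fst[symmetric]) auto
  also have "\<dots> = (\<integral>\<^sup>+\<alpha>. ennreal (g (snd \<alpha>)) \<partial>distr S A (\<lambda>s. s 0))"
    by (subst distr_PiM_component) (auto intro: A.prob_space_axioms)
  also have "\<dots> = (\<integral>\<^sup>+s. ennreal (g (snd (s 0))) \<partial>S)"
    by (subst nn_integral_distr) auto
  also have "\<dots> = (\<integral>\<^sup>+x. \<integral>\<^sup>+s. ennreal (g (snd (s 0))) \<partial>S \<partial>\<xi>)"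
    using xi.emeasure_space_1 by simp
  also have "\<dots> = (\<integral>\<^sup>+z. ennreal (g (snd (snd z 0))) \<partial>R)"
    by (subst S.P.nn_integral_fst[symmetric]) auto
  also have "\<dots> = (\<integral>\<^sup>+k. \<integral>\<^sup>+z. ennreal (g (snd (snd z 0))) \<partial>R \<partial>measure_pmf (size_biased \<pi>))"
    by (simp add: measure_pmf.emeasure_space_1)
  also have "\<dots> = (\<integral>\<^sup>+kz. ennreal (?h kz) \<partial>?\<nu>)"
    by (subst R.nn_integral_fst[symmetric]) auto
  finally have nn: "(\<integral>\<^sup>+kz. ennreal (?f kz) \<partial>?\<nu>) = (\<integral>\<^sup>+kz. ennreal (?h kz) \<partial>?\<nu>)" .
  have "AE kz in ?\<nu>. ?f kz = ?h kz"
  proof (rule AE_eq_of_integral_eq)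
    show "integrable ?\<nu> ?f" "integrable ?\<nu> ?h"
      by (intro PR.integrable_const_bound[where B=4] AE_I2 fm hm; simp add: g_abs)+
    show "integral\<^sup>L ?\<nu> ?f = integral\<^sup>L ?\<nu> ?h"
      using nn by (subst (1 2) integral_eq_nn_integral[OF _ AE_I2]) (auto simp: fm hm g_nonneg)
  qed (rule le)
  then have "AE k in measure_pmf (size_biased \<pi>). AE z in R. ?f (k, z) = ?h (k, z)" by (rule PR.AE_pair)
  then have "AE z in R. ?f (1, z) = ?h (1, z)" using one by (simp add: AE_measure_pmf_iff set_pmf_iff)
  then have AE: "AE z in R. max (fst z) (arm_hi (snd z 0)) - max (fst z) (arm_lo (snd z 0))
      = arm_hi (snd z 0) - arm_lo (snd z 0)"
    by eventually_elim
      (auto simp: g_def split_beta' arctan_eq_iff rde_step_def vmax_Suc arm_hi_def arm_lo_def max.commute)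
  let ?O = "{y :: real \<times> real \<times> real \<times> real. max (fst y) (arm_hi (snd y)) - max (fst y) (arm_lo (snd y))
      \<noteq> arm_hi (snd y) - arm_lo (snd y)}"
  have "open ?O" unfolding arm_hi_def arm_lo_def
    by (intro open_Collect_neq continuous_intros)
  moreover have "(low, W, p) \<in> ?O" using neq by (simp add: arm_lo_def arm_hi_def)
  ultimately obtain U V where UV: "open U" "open V" "(low, W, p) \<in> U \<times> V" "U \<times> V \<subseteq> ?O"
    using open_prod_elim by blast
  have low: "low \<in> U" "low \<in> supp \<xi>" and arm: "(W, p) \<in> V" "(W, p) \<in> supp A"
    using UV(3) low_in_supp arm_in_supp[OF W p] by auto
  have "\<exists>z. fst z \<in> U \<and> (\<forall>i<1::nat. snd z i \<in> V) \<and>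
      max (fst z) (arm_hi (snd z 0)) - max (fst z) (arm_lo (snd z 0)) = arm_hi (snd z 0) - arm_lo (snd z 0)"
    using AE_near[OF AE UV(1) low UV(2) arm, of 1] .
  with UV(4) show False by auto
qed

theorem messages_coincide: "AE p in \<mu>. fst p = snd p"
proof -
  have eq: "fst p = snd p" if p: "p \<in> supp \<mu>" for p
  proof (rule ccontr)
    assume "fst p \<noteq> snd p"
    with supp_mu_ordered[OF p] have pos: "0 < snd p - fst p" by simp
    then have "fst p < snd p" by simp
    then obtain a b where "a < b" "{a<..b} \<subseteq> supp \<omega>" using interval_below_max[OF p _ p] by blast
    \<comment> \<open>Two distinct possible edge weights are all that
      \<open>no_constant_gap_closed_set\<close> asks for.\<close>
    then have bg: "(a + b) / 2 < b" "(a + b) / 2 \<in> supp \<omega>" "b \<in> supp \<omega>" by (auto simp: subset_iff)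
    show False
    proof (cases "\<exists>k\<ge>3. pmf \<pi> k \<noteq> 0")
      case True
      then obtain k where k: "3 \<le> k" "pmf \<pi> k \<noteq> 0" by auto
      have k': "0 < k - 1" "pmf (size_biased \<pi>) (k - 1) \<noteq> 0"
        using k mean_pos by (auto simp: pmf_size_biased[OF int_pi mean_pos])
      show False
      proof (rule no_constant_gap_closed_set[OF p _ _ pos bg(1)])
        show "low \<le> fst q" if "q \<in> supp \<mu>" for q using supp_mu_ordered[OF that] by simp
        show "snd q - fst q = snd p - fst p" if "q \<in> supp \<mu>" for q
          using gap_constant[OF k p that] gap_constant[OF k that p] by simp
        show "(max low (W - snd q), max low (W - fst q)) \<in> supp \<mu>"
          if "q \<in> supp \<mu>" "W \<in> {(a + b) / 2, b}" for q W
        proof -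
          have "W \<in> supp \<omega>" using bg(2,3) that(2) by blast
          then show ?thesis by (rule supp_mu_step[OF that(1) _ k'])
        qed
      qed
    next
      case False
      then have line: "\<And>k. 3 \<le> k \<Longrightarrow> pmf \<pi> k = 0" by auto
      show False
      proof (cases "pmf (size_biased \<pi>) 1 = 0")
        case True
        have [measurable]: "fst \<in> borel_measurable (borel :: (real \<times> real) measure)"
          "snd \<in> borel_measurable (borel :: (real \<times> real) measure)"
          by (intro borel_measurable_continuous_onI continuous_intros)+
        have "Measurable.pred borel (\<lambda>q :: real \<times> real. fst q = snd q)" by measurable
        then have "AE q in \<mu>. fst q = snd q"
        proof (subst AE_law_iff, safe)
          fix k assume k: "pmf (size_biased \<pi>) k \<noteq> 0"
          \<comment> \<open>In this case every non-root vertex is a leaf, and both bounds are its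
            vertex weight.\<close>
          have "k = 0"
          proof (rule ccontr)
            assume "k \<noteq> 0"
            moreover have "k \<noteq> 1" using k True by auto
            ultimately show False using line[of "Suc k"] k by (simp add: pmf_size_biased[OF int_pi mean_pos])
          qed
          then show "AE z in R. fst (rde_step k (fst z) (snd z)) = snd (rde_step k (fst z) (snd z))"
            by (simp add: rde_step_def)
        qed
        moreover have "closed {q :: real \<times> real. fst q = snd q}"
          by (intro closed_Collect_eq continuous_intros)
        ultimately have "supp \<mu> \<subseteq> {q. fst q = snd q}" by (intro supp_subset_closed sets_mu) auto
        with p pos show False by auto
      next
        case one: False
        show False
        \<comment> \<open>Here the gap is not known to be constant on the support. The set therefore
          consists only of the support points with the gap of \<open>p\<close>, and
          \<open>gap_preserved_on_line\<close> keeps the steps inside it.\<close>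
        proof (rule no_constant_gap_closed_set[of p "{q\<in>supp \<mu>. snd q - fst q = snd p - fst p}", OF _ _ _ pos bg(1)])
          show "low \<le> fst q" if "q \<in> {q\<in>supp \<mu>. snd q - fst q = snd p - fst p}" for q
            using supp_mu_ordered[of q] that by simp
          show "(max low (W - snd q), max low (W - fst q)) \<in> {q\<in>supp \<mu>. snd q - fst q = snd p - fst p}"
            if "q \<in> {q\<in>supp \<mu>. snd q - fst q = snd p - fst p}" "W \<in> {(a + b) / 2, b}" for q W
          proof -
            have "W \<in> supp \<omega>" using bg(2,3) that(2) by blast
            with that(1) supp_mu_step[of q W 1] one gap_preserved_on_line[OF line one, of q W]
            show ?thesis by auto
          qed
        qed (use p in auto)
      qed
    qed
  qed
  show ?thesis using AE_in_supp[OF sets_mu] by eventually_elim (rule eq)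
qed

end

section \<open>Truncated messages on labelled trees\<close>

fun zmsg :: "(nat list \<Rightarrow> nat) \<Rightarrow> (nat list \<Rightarrow> real) \<Rightarrow> (nat list \<Rightarrow> real) \<Rightarrow> nat \<Rightarrow> nat list \<Rightarrow> real" where
  "zmsg b W X 0 v = X v"
| "zmsg b W X (Suc n) v = vmax (X v) (b v) (\<lambda>i. W (v @ [i]) - zmsg b W X n (v @ [i]))"

text \<open>Level 0 lies below every level because the vertex weight is one of the candidates, and
  each further level reverses the order because the messages of the children enter with a minus
  sign.\<close>

lemma zmsg_alternating:
  "n \<le> m \<Longrightarrow> (even n \<longrightarrow> zmsg b W X n v \<le> zmsg b W X m v) \<and> (odd n \<longrightarrow> zmsg b W X m v \<le> zmsg b W X n v)"
proof (induction n arbitrary: m v)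
  case 0
  then show ?case by (cases m) (auto simp: vmax_ge_base)
next
  case (Suc n)
  then obtain m' where m: "m = Suc m'" "n \<le> m'" by (cases m) auto
  with Suc.IH[OF m(2)] show ?case by (auto intro!: vmax_mono)
qed

lemma zmsg_append: "zmsg b W X n (v @ u) = zmsg (\<lambda>u. b (v @ u)) (\<lambda>u. W (v @ u)) (\<lambda>u. X (v @ u)) n u"
  by (induction n arbitrary: u) simp_all

lemma zmsg_cong:
  assumes "\<And>u. length (v @ u) < length v + n \<Longrightarrow> b (v @ u) = b' (v @ u)"
    and "\<And>u. length (v @ u) \<le> length v + n \<Longrightarrow> X (v @ u) = X' (v @ u)"
    and "\<And>u. u \<noteq> [] \<Longrightarrow> length (v @ u) \<le> length v + n \<Longrightarrow> W (v @ u) = W' (v @ u)"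
  shows "zmsg b W X n v = zmsg b' W' X' n v"
  using assms
proof (induction n arbitrary: v)
  case 0
  from 0(2)[of "[]"] show ?case by simp
next
  case (Suc n)
  have "zmsg b W X n (v @ [i]) = zmsg b' W' X' n (v @ [i])" for i
    using Suc.prems(1)[of "i # u" for u] Suc.prems(2)[of "i # u" for u] Suc.prems(3)[of "i # u" for u]
    by (intro Suc.IH) auto
  moreover have "b v = b' v" "X v = X' v" "W (v @ [i]) = W' (v @ [i])" for i
    using Suc.prems(1)[of "[]"] Suc.prems(2)[of "[]"] Suc.prems(3)[of "[i]"] by auto
  ultimately show ?case by simp
qed

definition zlo where "zlo b W X v = lim (\<lambda>k. zmsg b W X (2 * k) v)"
definition zhi where "zhi b W X v = lim (\<lambda>k. zmsg b W X (2 * k + 1) v)"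

lemma zlo_append: "zlo b W X (v @ u) = zlo (\<lambda>u. b (v @ u)) (\<lambda>u. W (v @ u)) (\<lambda>u. X (v @ u)) u"
  and zhi_append: "zhi b W X (v @ u) = zhi (\<lambda>u. b (v @ u)) (\<lambda>u. W (v @ u)) (\<lambda>u. X (v @ u)) u"
  by (simp_all only: zlo_def zhi_def zmsg_append)

lemma tendsto_zlo: "(\<lambda>k. zmsg b W X (2 * k) v) \<longlonglongrightarrow> zlo b W X v"
proof -
  have "convergent (\<lambda>k. zmsg b W X (2 * k) v)"
  proof (rule Bseq_mono_convergent)
    show "Bseq (\<lambda>k. zmsg b W X (2 * k) v)"
    proof (rule BseqI')
      fix k
      have "X v \<le> zmsg b W X (2 * k) v"
        using zmsg_alternating[of 0 "2 * k" b W X v] by simp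
      moreover have "zmsg b W X (2 * k) v \<le> max (X v) (zmsg b W X 1 v)"
        using zmsg_alternating[of 1 "2 * k" b W X v] by (cases k) auto
      ultimately show "norm (zmsg b W X (2 * k) v) \<le> max \<bar>X v\<bar> \<bar>max (X v) (zmsg b W X 1 v)\<bar>"
        unfolding real_norm_def by linarith
    qed
    show "\<forall>m n. m \<le> n \<longrightarrow> zmsg b W X (2 * m) v \<le> zmsg b W X (2 * n) v"
      using zmsg_alternating by auto
  qed
  then show ?thesis unfolding zlo_def by (simp add: convergent_LIMSEQ_iff)
qed

lemma tendsto_vmax:
  assumes "\<And>i. i < k \<Longrightarrow> ((\<lambda>n. a n i) \<longlongrightarrow> l i) F"
  shows "((\<lambda>n. vmax x k (a n)) \<longlongrightarrow> vmax x k l) F"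
  using assms by (induction k) (auto simp: vmax_Suc intro!: tendsto_max)

text \<open>Odd levels are one recursion step after even ones, so their convergence and the
  recursion for their limit both follow from \<open>tendsto_zlo\<close>.\<close>

lemma tendsto_zhi: "(\<lambda>k. zmsg b W X (2 * k + 1) v) \<longlonglongrightarrow> zhi b W X v"
  and zhi_rec: "zhi b W X v = vmax (X v) (b v) (\<lambda>i. W (v @ [i]) - zlo b W X (v @ [i]))"
proof -
  have *: "(\<lambda>k. zmsg b W X (2 * k + 1) v) \<longlonglongrightarrow> vmax (X v) (b v) (\<lambda>i. W (v @ [i]) - zlo b W X (v @ [i]))"
    by (auto intro!: tendsto_vmax tendsto_intros tendsto_zlo)
  then show "zhi b W X v = vmax (X v) (b v) (\<lambda>i. W (v @ [i]) - zlo b W X (v @ [i]))"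
    unfolding zhi_def by (rule limI)
  with * show "(\<lambda>k. zmsg b W X (2 * k + 1) v) \<longlonglongrightarrow> zhi b W X v" by simp
qed

lemma zlo_rec: "zlo b W X v = vmax (X v) (b v) (\<lambda>i. W (v @ [i]) - zhi b W X (v @ [i]))"
proof -
  have "(\<lambda>k. zmsg b W X (Suc (2 * k + 1)) v) \<longlonglongrightarrow> vmax (X v) (b v) (\<lambda>i. W (v @ [i]) - zhi b W X (v @ [i]))"
    unfolding zmsg.simps by (intro tendsto_vmax tendsto_intros tendsto_zhi)
  moreover have "(\<lambda>k. zmsg b W X (2 * Suc k) v) \<longlonglongrightarrow> zlo b W X v"
    using tendsto_zlo by (rule LIMSEQ_Suc)
  ultimately show ?thesis by (auto intro: LIMSEQ_unique)
qed

lemma zlo_le_zhi: "zlo b W X v \<le> zhi b W X v"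
proof (rule LIMSEQ_le[OF tendsto_zlo tendsto_zhi], intro exI[of _ 0] allI impI)
  show "zmsg b W X (2 * n) v \<le> zmsg b W X (2 * n + 1) v" for n
    using zmsg_alternating[of "2 * n" "2 * n + 1" b W X v] by simp
qed

text \<open>A labelled tree assigns to each Ulam-Harris label its offspring number, the weight of the
  edge to its parent and its vertex weight.\<close>

type_synonym ltree = "nat list \<Rightarrow> nat \<times> real \<times> real"

definition kids :: "ltree \<Rightarrow> nat list \<Rightarrow> nat" where "kids t v = fst (t v)"
definition ew :: "ltree \<Rightarrow> nat list \<Rightarrow> real" where "ew t v = fst (snd (t v))"
definition vw :: "ltree \<Rightarrow> nat list \<Rightarrow> real" where "vw t v = snd (snd (t v))"

abbreviation "tmsg t \<equiv> zmsg (kids t) (ew t) (vw t)"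
abbreviation "tlo t \<equiv> zlo (kids t) (ew t) (vw t)"
abbreviation "thi t \<equiv> zhi (kids t) (ew t) (vw t)"

definition subtree :: "nat list \<Rightarrow> ltree \<Rightarrow> ltree" where "subtree v t u = t (v @ u)"

lemma subtree_msg: "tlo (subtree v t) u = tlo t (v @ u)" "thi (subtree v t) u = thi t (v @ u)"
  by (simp_all add: zlo_append zhi_append subtree_def[abs_def] kids_def[abs_def] ew_def[abs_def] vw_def[abs_def])

definition msg_pair :: "ltree \<Rightarrow> real \<times> real" where "msg_pair t = (tlo t [], thi t [])"

definition arm :: "ltree \<Rightarrow> real \<times> real \<times> real" where "arm t = (ew t [], msg_pair t)"

lemma msg_pair_rec: "msg_pair t = rde_step (kids t []) (vw t []) (\<lambda>i. arm (subtree [i] t))"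
proof -
  have "tlo t [] = vmax (vw t []) (kids t []) (\<lambda>i. ew t [i] - thi t [i])"
    using zlo_rec[of "kids t" "ew t" "vw t" "[]"] by simp
  moreover have "thi t [] = vmax (vw t []) (kids t []) (\<lambda>i. ew t [i] - tlo t [i])"
    using zhi_rec[of "kids t" "ew t" "vw t" "[]"] by simp
  moreover have "ew (subtree [i] t) [] = ew t [i]" for i by (simp add: ew_def subtree_def)
  ultimately show ?thesis
    by (simp add: msg_pair_def rde_step_def arm_def arm_lo_def arm_hi_def subtree_msg)
qed

text \<open>Reassembles a labelled tree from its root label and the subtrees of all potential
  children, whether or not the offspring number admits them; this keeps the set of coordinates
  deterministic.\<close>

definition graft :: "(nat \<times> real \<times> real) \<Rightarrow> (nat \<Rightarrow> ltree) \<Rightarrow> ltree" where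
  "graft a s u = (case u of [] \<Rightarrow> a | i # u' \<Rightarrow> s i u')"

lemma graft_simps: "kids (graft a s) [] = fst a" "ew (graft a s) [] = fst (snd a)" "vw (graft a s) [] = snd (snd a)"
  "subtree [i] (graft a s) = s i"
  by (auto simp: graft_def kids_def ew_def vw_def subtree_def)

abbreviation "node \<rho> \<omega> \<xi> \<equiv> measure_pmf \<rho> \<Otimes>\<^sub>M \<omega> \<Otimes>\<^sub>M \<xi>"

section \<open>The law of the messages on a homogeneous tree\<close>

lemma distr_PiM_compose:
  assumes "prob_space M" and [measurable]: "f \<in> M \<rightarrow>\<^sub>M N"
  shows "distr (\<Pi>\<^sub>M i\<in>UNIV. M) (\<Pi>\<^sub>M i\<in>UNIV. N) (\<lambda>s i. f (s i)) = (\<Pi>\<^sub>M i\<in>UNIV. distr M N f)"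
proof -
  interpret M: prob_space M by fact
  interpret D: prob_space "distr M N f" by (rule M.prob_space_distr) simp
  interpret PM: product_prob_space "\<lambda>_. M" UNIV by unfold_locales
  interpret PD: product_prob_space "\<lambda>_. distr M N f" UNIV by unfold_locales
  show ?thesis
  proof (rule PD.PiM_eq)
    show "sets (distr (\<Pi>\<^sub>M i\<in>UNIV. M) (\<Pi>\<^sub>M i\<in>UNIV. N) (\<lambda>s i. f (s i))) = sets (\<Pi>\<^sub>M i\<in>UNIV. distr M N f)"
      by (simp cong: sets_PiM_cong)
    fix J :: "'c set" and F assume J: "finite J" "J \<subseteq> UNIV" and F: "\<And>j. j \<in> J \<Longrightarrow> F j \<in> sets (distr M N f)"
    have m: "(\<lambda>s i. f (s i)) \<in> (\<Pi>\<^sub>M i\<in>UNIV. M) \<rightarrow>\<^sub>M (\<Pi>\<^sub>M i\<in>(UNIV::'c set). N)"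
      by (rule measurable_abs_UNIV) measurable
    have pe: "prod_emb UNIV (\<lambda>_. N) J (Pi\<^sub>E J F) \<in> sets (\<Pi>\<^sub>M i\<in>UNIV. N)"
      using J F by (intro sets_PiM_I) auto
    have e: "prod_emb UNIV (\<lambda>_. distr M N f) J (Pi\<^sub>E J F) = prod_emb UNIV (\<lambda>_. N) J (Pi\<^sub>E J F)"
      by (simp add: prod_emb_def)
    have "emeasure (distr (\<Pi>\<^sub>M i\<in>UNIV. M) (\<Pi>\<^sub>M i\<in>UNIV. N) (\<lambda>s i. f (s i))) (prod_emb UNIV (\<lambda>_. N) J (Pi\<^sub>E J F))
        = emeasure (\<Pi>\<^sub>M i\<in>UNIV. M) {s\<in>space (\<Pi>\<^sub>M i\<in>UNIV. M). \<forall>j\<in>J. s j \<in> f -` F j \<inter> space M}"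
      by (subst emeasure_distr[OF m pe])
        (auto intro!: arg_cong2[where f=emeasure] simp: prod_emb_def space_PiM PiE_iff Pi_iff
          dest: measurable_space[OF assms(2)])
    also have "\<dots> = (\<Prod>j\<in>J. emeasure M (f -` F j \<inter> space M))"
      using J F by (intro PM.emeasure_PiM_Collect) auto
    also have "\<dots> = (\<Prod>j\<in>J. emeasure (distr M N f) (F j))"
      using F by (intro prod.cong) (auto simp: emeasure_distr)
    finally show "emeasure (distr (\<Pi>\<^sub>M i\<in>UNIV. M) (\<Pi>\<^sub>M i\<in>UNIV. N) (\<lambda>s i. f (s i))) (prod_emb UNIV (\<lambda>_. distr M N f) J (Pi\<^sub>E J F))
        = (\<Prod>j\<in>J. emeasure (distr M N f) (F j))"
      unfolding e .
  qed
qed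

text \<open>All vertices, the root included, have offspring law \<open>\<rho>\<close>. With
  \<open>\<rho>\<close> size biased this is the tree hanging below a non-root vertex, and its
  self-similarity yields the fixed-point equation.\<close>

locale tree_law =
  fixes \<rho> :: "nat pmf" and \<omega> \<xi> :: "real measure"
  assumes omega: "real_distribution \<omega>" and xi: "real_distribution \<xi>"
begin

sublocale omega: real_distribution \<omega> by (rule omega)
sublocale xi: real_distribution \<xi> by (rule xi)

abbreviation "V \<equiv> node \<rho> \<omega> \<xi>"
abbreviation "T \<equiv> (\<Pi>\<^sub>M v\<in>(UNIV :: nat list set). V)"
abbreviation "F \<equiv> (\<Pi>\<^sub>M i\<in>(UNIV :: nat set). T)"

lemma sets_omega [measurable_cong]: "sets \<omega> = sets borel" and sets_xi [measurable_cong]: "sets \<xi> = sets borel"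
  by simp_all

sublocale OX: pair_prob_space \<omega> \<xi> by unfold_locales
sublocale V: pair_prob_space "measure_pmf \<rho>" "\<omega> \<Otimes>\<^sub>M \<xi>" by unfold_locales
sublocale T: product_prob_space "\<lambda>_. V" "UNIV :: nat list set" by unfold_locales
sublocale F: product_prob_space "\<lambda>_. T" "UNIV :: nat set" by unfold_locales
sublocale VF: pair_prob_space V F by unfold_locales

lemma measurable_graft [measurable]: "(\<lambda>z. graft (fst z) (snd z)) \<in> V \<Otimes>\<^sub>M F \<rightarrow>\<^sub>M T"
proof (rule measurable_abs_UNIV)
  fix u :: "nat list"
  show "(\<lambda>z. graft (fst z) (snd z) u) \<in> V \<Otimes>\<^sub>M F \<rightarrow>\<^sub>M V"
  proof (cases u)
    case Nil
    then show ?thesis by (simp add: graft_def)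
  next
    case (Cons i u')
    have "(\<lambda>z. snd z i) \<in> V \<Otimes>\<^sub>M F \<rightarrow>\<^sub>M T" by measurable
    from measurable_compose[OF this measurable_component_singleton[of u' UNIV]] Cons
    show ?thesis by (simp add: graft_def)
  qed
qed

text \<open>Every label is either empty or uniquely of the form \<open>i # u\<close>, so a finite
  product of coordinate events splits into one factor for the root and one for each subtree
  involved.\<close>

lemma distr_graft: "distr (V \<Otimes>\<^sub>M F) T (\<lambda>z. graft (fst z) (snd z)) = T"
proof (rule T.PiM_eq)
  fix J :: "nat list set" and E assume J: "finite J" "J \<subseteq> UNIV" and E: "\<And>j. j \<in> J \<Longrightarrow> E j \<in> sets V"
  have sp: "space V = UNIV" "space T = UNIV" "space F = UNIV"
    by (auto simp: space_pair_measure space_PiM)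
  define E0 where "E0 = (if [] \<in> J then E [] else UNIV)"
  define I where "I = hd ` (J - {[]})"
  define Ji where "Ji i = {u. i # u \<in> J}" for i
  have fin: "finite I" "finite (Ji i)" for i
  proof -
    show "finite I" using J by (simp add: I_def)
    have "inj_on (Cons i) (Ji i)" by (simp add: inj_on_def)
    moreover have "Cons i ` Ji i \<subseteq> J" by (auto simp: Ji_def)
    ultimately show "finite (Ji i)" using J(1) by (metis finite_imageD finite_subset)
  qed
  define G where "G i = {t. \<forall>u\<in>Ji i. t u \<in> E (i # u)}" for i
  have sG: "G i \<in> sets T" and eG: "emeasure T (G i) = (\<Prod>u\<in>Ji i. emeasure V (E (i # u)))" for i
  proof -
    have "{t\<in>space T. \<forall>u\<in>Ji i. t u \<in> E (i # u)} \<in> sets T"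
      using fin(2)[of i] E by (intro sets.sets_Collect_finite_All sets_Collect_single) (auto simp: Ji_def sp)
    then show "G i \<in> sets T" by (simp add: G_def sp)
    show "emeasure T (G i) = (\<Prod>u\<in>Ji i. emeasure V (E (i # u)))"
    proof -
      have "E (i # u) \<in> sets V" if "u \<in> Ji i" for u using E that by (simp add: Ji_def)
      from T.emeasure_PiM_Collect[OF subset_UNIV fin(2) this] show ?thesis by (simp add: G_def sp)
    qed
  qed
  have sE0: "E0 \<in> sets V" using E sets.top[of V] by (auto simp: E0_def sp)
  have eF: "emeasure F {s\<in>space F. \<forall>i\<in>I. s i \<in> G i} = (\<Prod>i\<in>I. emeasure T (G i))"
    using sG fin(1) by (intro F.emeasure_PiM_Collect) auto
  have sF: "{s\<in>space F. \<forall>i\<in>I. s i \<in> G i} \<in> sets F"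
    using sG fin(1) by (intro sets.sets_Collect_finite_All sets_Collect_single) auto
  have set: "(\<lambda>z. graft (fst z) (snd z)) -` prod_emb UNIV (\<lambda>_. V) J (Pi\<^sub>E J E) \<inter> space (V \<Otimes>\<^sub>M F)
      = E0 \<times> {s\<in>space F. \<forall>i\<in>I. s i \<in> G i}"
  proof -
    have "(\<forall>j\<in>J. graft a s j \<in> E j) \<longleftrightarrow> a \<in> E0 \<and> (\<forall>i\<in>I. s i \<in> G i)" for a s
    proof
      assume *: "\<forall>j\<in>J. graft a s j \<in> E j"
      then have "graft a s (i # u) \<in> E (i # u)" if "i # u \<in> J" for i u using that by blast
      moreover have "[] \<in> J \<Longrightarrow> graft a s [] \<in> E []" using * by blast
      ultimately show "a \<in> E0 \<and> (\<forall>i\<in>I. s i \<in> G i)" by (auto simp: E0_def G_def Ji_def graft_def)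
    next
      assume *: "a \<in> E0 \<and> (\<forall>i\<in>I. s i \<in> G i)"
      show "\<forall>j\<in>J. graft a s j \<in> E j"
      proof
        fix j assume j: "j \<in> J"
        show "graft a s j \<in> E j"
        proof (cases j)
          case Nil
          with * j show ?thesis by (simp add: E0_def graft_def)
        next
          case (Cons i u)
          then have "i \<in> I" using j by (force simp: I_def)
          with * j Cons show ?thesis by (auto simp: G_def Ji_def graft_def)
        qed
      qed
    qed
    then show ?thesis
      by (auto simp: prod_emb_def space_PiM PiE_iff Pi_iff space_pair_measure sp)
  qed
  have "emeasure (distr (V \<Otimes>\<^sub>M F) T (\<lambda>z. graft (fst z) (snd z))) (prod_emb UNIV (\<lambda>_. V) J (Pi\<^sub>E J E))
      = emeasure V E0 * (\<Prod>i\<in>I. \<Prod>u\<in>Ji i. emeasure V (E (i # u)))"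
    by (subst emeasure_distr[OF measurable_graft sets_PiM_I[OF J(1,2) ballI[OF E]]], assumption)
      (simp add: set F.P.emeasure_pair_measure_Times[OF sE0 sF] eF eG)
  also have "(\<Prod>i\<in>I. \<Prod>u\<in>Ji i. emeasure V (E (i # u))) = (\<Prod>(i, u)\<in>Sigma I Ji. emeasure V (E (i # u)))"
    using fin by (intro prod.Sigma) auto
  also have "\<dots> = (\<Prod>j\<in>J - {[]}. emeasure V (E j))"
  proof (rule prod.reindex_bij_witness[where j="\<lambda>(i, u). i # u" and i="\<lambda>j. (hd j, tl j)"])
    fix j assume "j \<in> J - {[]}"
    then show "(hd j, tl j) \<in> Sigma I Ji" by (auto simp: I_def Ji_def)
  qed (auto simp: Ji_def)
  also have "emeasure V E0 * \<dots> = (\<Prod>j\<in>J. emeasure V (E j))"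
    using J V.emeasure_space_1 by (auto simp: E0_def prod.remove[of J "[]"] sp)
  finally show "emeasure (distr (V \<Otimes>\<^sub>M F) T (\<lambda>z. graft (fst z) (snd z))) (prod_emb UNIV (\<lambda>_. V) J (Pi\<^sub>E J E))
      = (\<Prod>j\<in>J. emeasure V (E j))" .
qed simp

end

context tree_law
begin

lemma space_simps [simp]: "space V = UNIV" "space T = UNIV" "space F = UNIV"
  by (auto simp: space_pair_measure space_PiM)

lemma measurable_node [measurable]:
  "(\<lambda>a. fst a) \<in> V \<rightarrow>\<^sub>M count_space UNIV" "(\<lambda>a. fst (snd a)) \<in> borel_measurable V" "(\<lambda>a. snd (snd a)) \<in> borel_measurable V"
proof -
  have "fst \<in> V \<rightarrow>\<^sub>M measure_pmf \<rho>" by measurable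
  then show "(\<lambda>a. fst a) \<in> V \<rightarrow>\<^sub>M count_space UNIV" by simp
  have "(\<lambda>a. fst (snd a)) \<in> V \<rightarrow>\<^sub>M \<omega>" by measurable
  then show "(\<lambda>a. fst (snd a)) \<in> borel_measurable V" by simp
  have "(\<lambda>a. snd (snd a)) \<in> V \<rightarrow>\<^sub>M \<xi>" by measurable
  then show "(\<lambda>a. snd (snd a)) \<in> borel_measurable V" by simp
qed

lemma measurable_labels [measurable]:
  "(\<lambda>t. kids t v) \<in> T \<rightarrow>\<^sub>M count_space UNIV" "(\<lambda>t. ew t v) \<in> borel_measurable T" "(\<lambda>t. vw t v) \<in> borel_measurable T"
  unfolding kids_def ew_def vw_def by measurable

end

lemma measurable_vmax_random [measurable (raw)]:
  assumes [measurable]: "f \<in> borel_measurable M" "\<And>i. g i \<in> borel_measurable M" and k: "k \<in> M \<rightarrow>\<^sub>M count_space UNIV"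
  shows "(\<lambda>z. vmax (f z) (k z) (\<lambda>i. g i z)) \<in> borel_measurable M"
  by (rule measurable_compose_countable[OF _ k]) measurable

lemma measurable_zmsg:
  assumes [measurable]: "\<And>v. (\<lambda>z. b z v) \<in> M \<rightarrow>\<^sub>M count_space UNIV"
    "\<And>v. (\<lambda>z. W z v) \<in> borel_measurable M" "\<And>v. (\<lambda>z. X z v) \<in> borel_measurable M"
  shows "(\<lambda>z. zmsg (b z) (W z) (X z) n v) \<in> borel_measurable M"
  by (induction n arbitrary: v) auto

context tree_law
begin

lemma measurable_msg [measurable]: "(\<lambda>t. tmsg t n v) \<in> borel_measurable T"
  by (rule measurable_zmsg) measurable

lemma measurable_lo_hi [measurable]: "(\<lambda>t. tlo t v) \<in> borel_measurable T" "(\<lambda>t. thi t v) \<in> borel_measurable T"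
  unfolding zlo_def zhi_def by measurable

lemma measurable_msg_pair [measurable]: "msg_pair \<in> borel_measurable T"
  unfolding msg_pair_def[abs_def] by measurable

definition \<mu> :: "(real \<times> real) measure" where "\<mu> = distr T borel msg_pair"

lemma prob_space_mu: "prob_space \<mu>"
  unfolding \<mu>_def by (rule T.P.prob_space_distr) measurable

lemma sets_mu [measurable_cong]: "sets \<mu> = sets borel" by (simp add: \<mu>_def)

sublocale mu: prob_space \<mu> by (rule prob_space_mu)

lemma ordered_mu: "AE p in \<mu>. fst p \<le> snd p"
proof -
  have "closed {p :: real \<times> real. fst p \<le> snd p}" by (intro closed_Collect_le continuous_intros)
  then have "{p :: real \<times> real. fst p \<le> snd p} \<in> sets borel" by (rule borel_closed)
  then show ?thesis unfolding \<mu>_def by (subst AE_distr_iff) (auto simp: msg_pair_def zlo_le_zhi)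
qed

abbreviation "A \<equiv> \<omega> \<Otimes>\<^sub>M \<mu>"

lemma sets_A: "sets A = sets (\<omega> \<Otimes>\<^sub>M (borel :: (real \<times> real) measure))"
  by (rule sets_pair_measure_cong[OF refl sets_mu])

lemma measurable_arm_A [measurable]: "arm \<in> T \<rightarrow>\<^sub>M A"
proof -
  have "(\<lambda>t. ew t []) \<in> T \<rightarrow>\<^sub>M \<omega>" "msg_pair \<in> T \<rightarrow>\<^sub>M \<mu>"
    by (simp_all add: measurable_cong_sets[OF refl sets_mu])
  then show ?thesis unfolding arm_def[abs_def] by measurable
qed

lemma measurable_arm_lo_hi [measurable]: "arm_lo \<in> borel_measurable A" "arm_hi \<in> borel_measurable A"
proof -
  have [measurable]: "fst \<in> borel_measurable \<mu>" "snd \<in> borel_measurable \<mu>"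
    unfolding measurable_cong_sets[OF sets_mu refl]
    by (intro borel_measurable_continuous_onI continuous_intros)+
  show "arm_lo \<in> borel_measurable A" "arm_hi \<in> borel_measurable A"
    unfolding arm_lo_def[abs_def] arm_hi_def[abs_def] by measurable
qed

lemma measurable_step [measurable]:
  assumes [measurable]: "f \<in> borel_measurable M" "\<And>i. (\<lambda>z. g z i) \<in> M \<rightarrow>\<^sub>M A" and k [measurable]: "k \<in> M \<rightarrow>\<^sub>M count_space UNIV"
  shows "(\<lambda>z. rde_step (k z) (f z) (g z)) \<in> borel_measurable M"
  unfolding rde_step_def by measurable

definition child_law :: "nat \<Rightarrow> real \<Rightarrow> (real \<times> real) set \<Rightarrow> ennreal" where
  "child_law k x B = emeasure F {s. rde_step k x (\<lambda>i. arm (s i)) \<in> B}"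

text \<open>The weight at the root label belongs to the edge above the tree. It is independent of
  the offspring number, the vertex weight and the subtrees, from which alone \<open>msg_pair\<close>
  is computed.\<close>

lemma emeasure_arm:
  assumes C: "C \<in> sets \<omega>" and B: "B \<in> sets borel"
  shows "emeasure T {t. ew t [] \<in> C \<and> msg_pair t \<in> B} =
    emeasure \<omega> C * (\<integral>\<^sup>+k. \<integral>\<^sup>+x. child_law k x B \<partial>\<xi> \<partial>measure_pmf \<rho>)"
proof -
  note [measurable] = C B
  let ?E = "{t\<in>space T. ew t [] \<in> C \<and> msg_pair t \<in> B}"
  let ?D = "{z\<in>space (V \<Otimes>\<^sub>M F). fst (snd (fst z)) \<in> C \<and> rde_step (fst (fst z)) (snd (snd (fst z))) (\<lambda>i. arm (snd z i)) \<in> B}"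
  have "(\<lambda>t. ew t []) \<in> T \<rightarrow>\<^sub>M \<omega>" by simp
  then have E: "?E \<in> sets T" by measurable
  have "(\<lambda>z. fst (snd (fst z))) \<in> V \<Otimes>\<^sub>M F \<rightarrow>\<^sub>M \<omega>"
    using measurable_compose[OF measurable_fst measurable_node(2)] by simp
  then have D: "?D \<in> sets (V \<Otimes>\<^sub>M F)" by measurable
  have "emeasure T ?E = emeasure (distr (V \<Otimes>\<^sub>M F) T (\<lambda>z. graft (fst z) (snd z))) ?E" by (simp only: distr_graft)
  also have "\<dots> = emeasure (V \<Otimes>\<^sub>M F) ?D"
    using E by (subst emeasure_distr)
      (auto intro!: arg_cong2[where f=emeasure] simp: graft_simps msg_pair_rec space_pair_measure)
  also have "\<dots> = (\<integral>\<^sup>+a. emeasure F (Pair a -` ?D) \<partial>V)"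
    by (rule F.P.emeasure_pair_measure_alt[OF D])
  also have "\<dots> = (\<integral>\<^sup>+a. indicator C (fst (snd a)) * child_law (fst a) (snd (snd a)) B \<partial>V)"
    by (intro nn_integral_cong) (auto simp: child_law_def indicator_def space_pair_measure)
  also have "\<dots> = (\<integral>\<^sup>+k. \<integral>\<^sup>+wx. indicator C (fst wx) * child_law k (snd wx) B \<partial>(\<omega> \<Otimes>\<^sub>M \<xi>) \<partial>measure_pmf \<rho>)"
  proof (subst OX.nn_integral_fst[symmetric])
    have m: "(\<lambda>a. emeasure F (Pair a -` ?D)) \<in> borel_measurable V"
      by (rule F.P.measurable_emeasure_Pair[OF D])
    have *: "emeasure F (Pair a -` ?D) = indicator C (fst (snd a)) * child_law (fst a) (snd (snd a)) B" for a
      by (auto simp: child_law_def indicator_def space_pair_measure)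
    show "(\<lambda>a. indicator C (fst (snd a)) * child_law (fst a) (snd (snd a)) B) \<in> borel_measurable V"
      using m unfolding * .
  qed simp
  also have "\<dots> = (\<integral>\<^sup>+k. emeasure \<omega> C * (\<integral>\<^sup>+x. child_law k x B \<partial>\<xi>) \<partial>measure_pmf \<rho>)"
  proof (rule nn_integral_cong)
    fix k
    have m [measurable]: "(\<lambda>x. child_law k x B) \<in> borel_measurable \<xi>"
    proof -
      have "{z\<in>space (\<xi> \<Otimes>\<^sub>M F). rde_step k (fst z) (\<lambda>i. arm (snd z i)) \<in> B} \<in> sets (\<xi> \<Otimes>\<^sub>M F)"
        by measurable
      from F.P.measurable_emeasure_Pair[OF this] show ?thesis
        by (simp add: child_law_def space_pair_measure)
    qed
    have "(\<integral>\<^sup>+wx. indicator C (fst wx) * child_law k (snd wx) B \<partial>(\<omega> \<Otimes>\<^sub>M \<xi>)) =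
        (\<integral>\<^sup>+w. \<integral>\<^sup>+x. indicator C w * child_law k x B \<partial>\<xi> \<partial>\<omega>)"
      by (subst xi.nn_integral_fst[symmetric]) auto
    also have "\<dots> = (\<integral>\<^sup>+w. indicator C w * (\<integral>\<^sup>+x. child_law k x B \<partial>\<xi>) \<partial>\<omega>)"
      by (intro nn_integral_cong nn_integral_cmult) measurable
    also have "\<dots> = emeasure \<omega> C * (\<integral>\<^sup>+x. child_law k x B \<partial>\<xi>)"
      using C by (subst nn_integral_multc) (auto simp: nn_integral_indicator[OF C])
    finally show "(\<integral>\<^sup>+wx. indicator C (fst wx) * child_law k (snd wx) B \<partial>(\<omega> \<Otimes>\<^sub>M \<xi>)) =
        emeasure \<omega> C * (\<integral>\<^sup>+x. child_law k x B \<partial>\<xi>)" .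
  qed
  also have "\<dots> = emeasure \<omega> C * (\<integral>\<^sup>+k. \<integral>\<^sup>+x. child_law k x B \<partial>\<xi> \<partial>measure_pmf \<rho>)"
    by (rule nn_integral_cmult) simp
  finally show ?thesis by simp
qed

lemma emeasure_mu: "B \<in> sets borel \<Longrightarrow> emeasure \<mu> B = (\<integral>\<^sup>+k. \<integral>\<^sup>+x. child_law k x B \<partial>\<xi> \<partial>measure_pmf \<rho>)"
  using emeasure_arm[of UNIV B] omega.emeasure_space_1
  by (simp add: \<mu>_def emeasure_distr vimage_def)

lemma distr_arm: "distr T A arm = A"
proof -
  have "A = distr T A arm"
  proof (rule pair_measure_eqI)
    fix C B assume C: "C \<in> sets \<omega>" and B: "B \<in> sets \<mu>"
    then have "C \<times> B \<in> sets A" by (rule pair_measureI)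
    then have "emeasure (distr T A arm) (C \<times> B) = emeasure T (arm -` (C \<times> B) \<inter> space T)"
      by (intro emeasure_distr measurable_arm_A)
    also have "arm -` (C \<times> B) \<inter> space T = {t. ew t [] \<in> C \<and> msg_pair t \<in> B}"
      by (auto simp: arm_def)
    also have "emeasure T \<dots> = emeasure \<omega> C * emeasure \<mu> B"
      using emeasure_arm[OF C, of B] emeasure_mu[of B] B by (simp add: sets_mu)
    finally show "emeasure \<omega> C * emeasure \<mu> B = emeasure (distr T A arm) (C \<times> B)" ..
  qed (simp_all add: omega.sigma_finite_measure_axioms mu.sigma_finite_measure_axioms)
  then show ?thesis ..
qed

text \<open>By \<open>distr_graft\<close> the subtrees of the children are independent copies of the
  whole tree, so their arms form an i.i.d. sequence with law \<open>A\<close>.\<close>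

lemma law_mu: "distr (measure_pmf \<rho> \<Otimes>\<^sub>M (\<xi> \<Otimes>\<^sub>M (\<Pi>\<^sub>M i\<in>(UNIV::nat set). A))) borel
  (\<lambda>(k, x, s). rde_step k x s) = \<mu>"
proof (rule measure_eqI)
  let ?S = "\<Pi>\<^sub>M i\<in>(UNIV::nat set). A"
  interpret OM: pair_prob_space \<omega> \<mu> by unfold_locales
  interpret S: prob_space ?S by (rule prob_space_PiM) (rule OM.prob_space_axioms)
  interpret XS: pair_prob_space \<xi> ?S by unfold_locales
  fix B assume "B \<in> sets (distr (measure_pmf \<rho> \<Otimes>\<^sub>M (\<xi> \<Otimes>\<^sub>M ?S)) borel (\<lambda>(k, x, s). rde_step k x s))"
  then have B [measurable]: "B \<in> sets borel" by simp
  have m: "(\<lambda>(k, x, s). rde_step k x s) \<in> borel_measurable (measure_pmf \<rho> \<Otimes>\<^sub>M (\<xi> \<Otimes>\<^sub>M ?S))"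
  proof -
    have "(\<lambda>z. rde_step (fst z) (fst (snd z)) (snd (snd z))) \<in> borel_measurable (measure_pmf \<rho> \<Otimes>\<^sub>M (\<xi> \<Otimes>\<^sub>M ?S))"
    proof (rule measurable_step)
      have "fst \<in> measure_pmf \<rho> \<Otimes>\<^sub>M (\<xi> \<Otimes>\<^sub>M ?S) \<rightarrow>\<^sub>M measure_pmf \<rho>" by measurable
      then show "(\<lambda>z. fst z) \<in> measure_pmf \<rho> \<Otimes>\<^sub>M (\<xi> \<Otimes>\<^sub>M ?S) \<rightarrow>\<^sub>M count_space UNIV" by simp
    qed measurable
    then show ?thesis by (simp add: split_beta')
  qed
  let ?D = "(\<lambda>(k, x, s). rde_step k x s) -` B \<inter> space (measure_pmf \<rho> \<Otimes>\<^sub>M (\<xi> \<Otimes>\<^sub>M ?S))"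
  have D: "?D \<in> sets (measure_pmf \<rho> \<Otimes>\<^sub>M (\<xi> \<Otimes>\<^sub>M ?S))" using m B by (rule measurable_sets)
  have sS: "space ?S = UNIV"
    using sets_eq_imp_space_eq[OF sets_mu] by (auto simp: space_PiM space_pair_measure)
  have c: "emeasure ?S {s. rde_step k x s \<in> B} = child_law k x B" for k x
  proof -
    have "?S = (\<Pi>\<^sub>M i\<in>(UNIV::nat set). distr T A arm)" by (simp only: distr_arm)
    also have "\<dots> = distr F ?S (\<lambda>s i. arm (s i))"
      by (rule distr_PiM_compose[symmetric]) (simp_all add: T.P.prob_space_axioms)
    finally have S: "?S = distr F ?S (\<lambda>s i. arm (s i))" .
    have "{s\<in>space ?S. rde_step k x s \<in> B} \<in> sets ?S" by measurable
    then have s: "{s. rde_step k x s \<in> B} \<in> sets ?S" by (simp add: sS)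
    have "(\<lambda>s i. arm (s i)) \<in> F \<rightarrow>\<^sub>M ?S" by (rule measurable_abs_UNIV) measurable
    from emeasure_distr[OF this s] show ?thesis
      unfolding S[symmetric] by (simp add: child_law_def vimage_def)
  qed
  have "emeasure (distr (measure_pmf \<rho> \<Otimes>\<^sub>M (\<xi> \<Otimes>\<^sub>M ?S)) borel (\<lambda>(k, x, s). rde_step k x s)) B
      = emeasure (measure_pmf \<rho> \<Otimes>\<^sub>M (\<xi> \<Otimes>\<^sub>M ?S)) ?D"
    by (rule emeasure_distr[OF m B])
  also have "\<dots> = (\<integral>\<^sup>+k. emeasure (\<xi> \<Otimes>\<^sub>M ?S) (Pair k -` ?D) \<partial>measure_pmf \<rho>)"
    by (rule XS.emeasure_pair_measure_alt[OF D])
  also have "\<dots> = (\<integral>\<^sup>+k. \<integral>\<^sup>+x. child_law k x B \<partial>\<xi> \<partial>measure_pmf \<rho>)"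
  proof (rule nn_integral_cong)
    fix k
    have "Pair k -` ?D \<in> sets (\<xi> \<Otimes>\<^sub>M ?S)" using D by (rule sets_Pair1)
    then have "emeasure (\<xi> \<Otimes>\<^sub>M ?S) (Pair k -` ?D) = (\<integral>\<^sup>+x. emeasure ?S (Pair x -` Pair k -` ?D) \<partial>\<xi>)"
      by (rule S.emeasure_pair_measure_alt)
    also have "\<dots> = (\<integral>\<^sup>+x. child_law k x B \<partial>\<xi>)"
      by (simp add: c[symmetric] vimage_def space_pair_measure sS)
    finally show "emeasure (\<xi> \<Otimes>\<^sub>M ?S) (Pair k -` ?D) = (\<integral>\<^sup>+x. child_law k x B \<partial>\<xi>)" .
  qed
  also have "\<dots> = emeasure \<mu> B" by (simp add: emeasure_mu)
  finally show "emeasure (distr (measure_pmf \<rho> \<Otimes>\<^sub>M (\<xi> \<Otimes>\<^sub>M ?S)) borel (\<lambda>(k, x, s). rde_step k x s)) B = emeasure \<mu> B" .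
qed (simp add: sets_mu)

end

lemma AE_tree_messages_coincide:
  assumes "integrable (measure_pmf \<pi>) real" "measure_pmf.expectation \<pi> real > 0"
    and "real_distribution \<omega>" "real_distribution \<xi>" "atomless \<omega>"
    and "bdd_below (msupport \<xi>)" "locally_convex_under_max \<omega>"
  shows "AE t in (\<Pi>\<^sub>M v\<in>UNIV. node (size_biased \<pi>) \<omega> \<xi>). tlo t [] = thi t []"
proof -
  interpret tree_law "size_biased \<pi>" \<omega> \<xi> by (rule tree_law.intro) fact+
  have "message_rde_locally_convex \<pi> \<omega> \<xi> \<mu>"
    by (intro message_rde_locally_convex.intro message_rde.intro message_rde_locally_convex_axioms.intro
        assms prob_space_mu sets_mu law_mu ordered_mu)
  then have "AE p in \<mu>. fst p = snd p" by (rule message_rde_locally_convex.messages_coincide)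
  then have "AE t in T. fst (msg_pair t) = snd (msg_pair t)"
    unfolding \<mu>_def by (rule AE_distrD[OF measurable_msg_pair])
  then show ?thesis by (simp add: msg_pair_def)
qed

text \<open>The message sent down along the edge above a label \<open>v\<close>: it is produced by the parent
  \<open>p\<close> of \<open>v\<close> from its own weight, the messages of the siblings of \<open>v\<close>, and the message that
  \<open>p\<close> receives from above.  The flag selects the upper or the lower bound.\<close>

function down :: "(nat list \<Rightarrow> nat) \<Rightarrow> (nat list \<Rightarrow> real) \<Rightarrow> (nat list \<Rightarrow> real) \<Rightarrow> (bool \<Rightarrow> nat list \<Rightarrow> real)
    \<Rightarrow> bool \<Rightarrow> nat list \<Rightarrow> real" where
  "down b W X d s v = (if v = [] then 0 else
     let p = butlast v; x = (if p = [] then X p else max (X p) (W p - down b W X d (\<not> s) p))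
     in vmax x (b p) (\<lambda>i. if i = last v then x else W (p @ [i]) - d (\<not> s) (p @ [i])))"
  by pat_completeness auto
termination by (relation "Wellfounded.measure (\<lambda>(b, W, X, d, s, v). length v)") auto

declare down.simps [simp del]

text \<open>What \<open>p\<close> has to offer without its children: its own weight or the edge to
  its parent. The flag is negated because the incoming message is subtracted, which turns an upper
  into a lower bound.\<close>

definition above where
  "above b W X d s p = (if p = [] then X p else max (X p) (W p - down b W X d (\<not> s) p))"

text \<open>The discarded child \<open>c\<close> stays in the index set; its entry is replaced by
  the base value, which leaves the maximum over the other children.\<close>

lemma down_snoc: "down b W X d s (p @ [c]) =
  vmax (above b W X d s p) (b p) (\<lambda>i. if i = c then above b W X d s p else W (p @ [i]) - d (\<not> s) (p @ [i]))"
  by (subst down.simps) (simp add: above_def Let_def cong: if_cong)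

text \<open>Neither the edge above \<open>v\<close> nor any label below \<open>v\<close> is
  mentioned: the message sent down to \<open>v\<close> is produced on the other side of that edge.
  Of the path from the root to \<open>v\<close> only the edges of proper ancestors matter.\<close>

lemma down_cong:
  assumes "\<And>u. length u < length v \<Longrightarrow> b u = b' u"
    and "\<And>u. length u < length v \<Longrightarrow> X u = X' u"
    and "\<And>u. length u < length v \<Longrightarrow> (\<exists>r. v = u @ r) \<Longrightarrow> u \<noteq> [] \<Longrightarrow> W u = W' u"
    and "\<And>u. length u \<le> length v \<Longrightarrow> \<not> (\<exists>r. v = u @ r) \<Longrightarrow> W u = W' u"
    and "\<And>s u. length u \<le> length v \<Longrightarrow> \<not> (\<exists>r. v = u @ r) \<Longrightarrow> d s u = d' s u"
  shows "down b W X d s v = down b' W' X' d' s v"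
  using assms
proof (induction v arbitrary: s rule: rev_induct)
  case Nil
  then show ?case by (simp add: down.simps)
next
  case (snoc c p)
  have IH: "down b W X d s p = down b' W' X' d' s p" for s
  proof (rule snoc.IH)
    fix u r assume "length u \<le> length p" "\<not> (\<exists>r. p = u @ r)"
    then have n: "\<not> (\<exists>r. p @ [c] = u @ r)" "length u \<le> length (p @ [c])"
      by (auto simp: append_eq_append_conv2)
    show "W u = W' u" "d s u = d' s u" for s using snoc.prems(4,5) n by blast+
  next
    fix u assume u: "length u < length p" "\<exists>r. p = u @ r" "u \<noteq> []"
    then have "\<exists>r. p @ [c] = u @ r" by auto
    with u show "W u = W' u" using snoc.prems(3)[of u] by simp
  qed (use snoc.prems(1,2) in auto)
  have a: "above b W X d s p = above b' W' X' d' s p" for s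
  proof (cases "p = []")
    case True
    with snoc.prems(2)[of "[]"] show ?thesis by (simp add: above_def)
  next
    case False
    with snoc.prems(2,3)[of p] IH show ?thesis by (simp add: above_def)
  qed
  have "(if i = c then above b W X d s p else W (p @ [i]) - d (\<not> s) (p @ [i])) =
      (if i = c then above b' W' X' d' s p else W' (p @ [i]) - d' (\<not> s) (p @ [i]))" for i
    using snoc.prems(4,5)[of "p @ [i]"] a by auto
  then show ?case using snoc.prems(1)[of p] a by (simp add: down_snoc)
qed

lemma measurable_down:
  assumes [measurable]: "\<And>v. (\<lambda>z. b z v) \<in> M \<rightarrow>\<^sub>M count_space UNIV"
    "\<And>v. (\<lambda>z. W z v) \<in> borel_measurable M" "\<And>v. (\<lambda>z. X z v) \<in> borel_measurable M"
    "\<And>s v. (\<lambda>z. d z s v) \<in> borel_measurable M"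
  shows "(\<lambda>z. down (b z) (W z) (X z) (d z) s v) \<in> borel_measurable M"
proof (induction v arbitrary: s rule: rev_induct)
  case Nil
  then show ?case by (simp add: down.simps)
next
  case (snoc c p)
  note [measurable] = snoc
  have [measurable]: "(\<lambda>z. above (b z) (W z) (X z) (d z) s p) \<in> borel_measurable M" for s
    by (cases "p = []") (simp_all add: above_def)
  show ?case unfolding down_snoc by measurable
qed

lemma tendsto_down:
  assumes "\<And>s v. (\<lambda>n. d n s v) \<longlonglongrightarrow> d' s v"
  shows "(\<lambda>n. down b W X (d n) s v) \<longlonglongrightarrow> down b W X d' s v"
proof (induction v arbitrary: s rule: rev_induct)
  case Nil
  then show ?case by (simp add: down.simps)
next
  case (snoc c p)
  have a: "(\<lambda>n. above b W X (d n) s p) \<longlonglongrightarrow> above b W X d' s p" for s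
    using snoc by (cases "p = []") (auto simp: above_def intro!: tendsto_intros tendsto_max)
  have vm: "(\<lambda>n. vmax (y n) k (g n)) \<longlonglongrightarrow> vmax z k h" if "y \<longlonglongrightarrow> z" "\<And>i. (\<lambda>n. g n i) \<longlonglongrightarrow> h i"
    for y z k and g :: "nat \<Rightarrow> nat \<Rightarrow> real" and h
    using that by (induction k) (auto simp: vmax_Suc intro!: tendsto_max)
  define g where "g n i = (if i = c then above b W X (d n) s p else W (p @ [i]) - d n (\<not> s) (p @ [i]))" for n i
  define h where "h i = (if i = c then above b W X d' s p else W (p @ [i]) - d' (\<not> s) (p @ [i]))" for i
  have "(\<lambda>n. g n i) \<longlonglongrightarrow> h i" for i
    by (cases "i = c") (auto simp: g_def h_def intro!: a tendsto_intros assms)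
  from vm[OF a this] show ?case unfolding down_snoc g_def h_def .
qed

section \<open>Almost sure properties of the weighted tree\<close>

lemma AE_pair_swapI:
  assumes "sigma_finite_measure M" "sigma_finite_measure N"
    and m: "{z\<in>space (M \<Otimes>\<^sub>M N). P z} \<in> sets (M \<Otimes>\<^sub>M N)"
    and ae: "AE y in N. AE x in M. P (x, y)"
  shows "AE z in M \<Otimes>\<^sub>M N. P z"
proof -
  interpret pair_sigma_finite M N using assms(1,2) by (rule pair_sigma_finite.intro)
  have "{z\<in>space (M \<Otimes>\<^sub>M N). (\<lambda>x y. P (x, y)) (fst z) (snd z)} \<in> sets (M \<Otimes>\<^sub>M N)" using m by simp
  from AE_commute[OF this] ae have "AE x in M. AE y in N. P (x, y)" by simp
  then show ?thesis by (rule AE_pair_measure[OF m])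
qed

lemma zlo_cong:
  assumes "\<And>u. b (v @ u) = b' (v @ u)" "\<And>u. X (v @ u) = X' (v @ u)" "\<And>u. u \<noteq> [] \<Longrightarrow> W (v @ u) = W' (v @ u)"
  shows "zlo b W X v = zlo b' W' X' v"
  unfolding zlo_def by (intro arg_cong[where f=lim] ext zmsg_cong) (auto simp: assms)

abbreviation "tdown t \<equiv> down (kids t) (ew t) (vw t) (\<lambda>_. tlo t) True"

text \<open>The edge above \<open>v\<close> separates the tree: \<open>tlo\<close> at
  \<open>v\<close> uses only what lies below it and \<open>tdown\<close> only what lies on the other
  side.\<close>

lemma edge_weight_irrelevant:
  "tlo (t(v := (k, c, x))) v + tdown (t(v := (k, c, x))) v = tlo (t(v := (k, c', x))) v + tdown (t(v := (k, c', x))) v"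
proof -
  let ?t = "t(v := (k, c, x))" and ?t' = "t(v := (k, c', x))"
  have same: "kids ?t u = kids ?t' u" "vw ?t u = vw ?t' u" for u
    by (simp_all add: kids_def vw_def)
  have e: "ew ?t u = ew ?t' u" if "u \<noteq> v" for u using that by (simp add: ew_def)
  have lo: "tlo ?t u = tlo ?t' u" if "\<And>r. r \<noteq> [] \<Longrightarrow> v \<noteq> u @ r" for u
    using that by (intro zlo_cong same e) metis
  have "tdown ?t v = tdown ?t' v"
  proof (rule down_cong)
    fix u assume "\<not> (\<exists>r. v = u @ r)"
    then show "ew ?t u = ew ?t' u" "tlo ?t u = tlo ?t' u" by (auto intro!: e lo simp del: fun_upd_apply)
  qed (auto intro!: same e simp del: fun_upd_apply)
  moreover have "tlo ?t v = tlo ?t' v" by (intro lo) simp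
  ultimately show ?thesis by simp
qed

locale ubgw_law =
  fixes \<pi> :: "nat pmf" and \<omega> \<xi> :: "real measure"
  assumes int_pi: "integrable (measure_pmf \<pi>) real" and mean_pos: "measure_pmf.expectation \<pi> real > 0"
    and omega: "real_distribution \<omega>" and xi: "real_distribution \<xi>"
    and atomless: "atomless \<omega>" and bdd: "bdd_below (msupport \<xi>)" and convex_max: "locally_convex_under_max \<omega>"
begin

sublocale omega: real_distribution \<omega> by (rule omega)
sublocale xi: real_distribution \<xi> by (rule xi)

definition V :: "nat list \<Rightarrow> (nat \<times> real \<times> real) measure" where
  "V v = node (if v = [] then \<pi> else size_biased \<pi>) \<omega> \<xi>"

abbreviation "T \<equiv> (\<Pi>\<^sub>M v\<in>(UNIV :: nat list set). V v)"

lemma prob_space_V: "prob_space (V v)"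
proof -
  interpret OX: pair_prob_space \<omega> \<xi> by unfold_locales
  interpret pair_prob_space "measure_pmf (if v = [] then \<pi> else size_biased \<pi>)" "\<omega> \<Otimes>\<^sub>M \<xi>" by unfold_locales
  show ?thesis unfolding V_def by (rule prob_space_axioms)
qed

sublocale T: product_prob_space V UNIV
  by (rule product_prob_spaceI) (rule prob_space_V)

lemma sets_V [measurable_cong]: "sets (V v) = sets (count_space UNIV \<Otimes>\<^sub>M borel \<Otimes>\<^sub>M borel)"
  unfolding V_def by (intro sets_pair_measure_cong) simp_all

lemma space_V [simp]: "space (V v) = UNIV" "space T = UNIV"
  using sets_eq_imp_space_eq[OF sets_V] by (auto simp: space_pair_measure space_PiM)

lemma measurable_node [measurable]:
  "(\<lambda>a. fst a) \<in> V v \<rightarrow>\<^sub>M count_space UNIV" "(\<lambda>a. fst (snd a)) \<in> borel_measurable (V v)" "(\<lambda>a. snd (snd a)) \<in> borel_measurable (V v)"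
  unfolding measurable_cong_sets[OF sets_V refl] by measurable

lemma measurable_labels [measurable]:
  "(\<lambda>t. kids t v) \<in> T \<rightarrow>\<^sub>M count_space UNIV" "(\<lambda>t. ew t v) \<in> borel_measurable T" "(\<lambda>t. vw t v) \<in> borel_measurable T"
  unfolding kids_def ew_def vw_def by measurable

lemma measurable_msg [measurable]: "(\<lambda>t. tmsg t n v) \<in> borel_measurable T"
  by (rule measurable_zmsg) measurable

lemma measurable_lo_hi [measurable]: "(\<lambda>t. tlo t v) \<in> borel_measurable T" "(\<lambda>t. thi t v) \<in> borel_measurable T"
  unfolding zlo_def zhi_def by measurable

lemma measurable_tdown [measurable]: "(\<lambda>t. tdown t v) \<in> borel_measurable T"
  by (rule measurable_down) measurable

text \<open>Below a non-root vertex hangs a homogeneous size-biased tree, where the bounds coincide.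
  The root, whose offspring law differs, follows by one step of the recursion.\<close>

lemma AE_lo_eq_hi: "AE t in T. \<forall>v. tlo t v = thi t v"
proof -
  have ne: "AE t in T. tlo t v = thi t v" if v: "v \<noteq> []" for v
  proof -
    have inj: "inj_on (\<lambda>u. v @ u) UNIV" by (simp add: inj_on_def)
    have Vu: "V (v @ u) = node (size_biased \<pi>) \<omega> \<xi>" for u using v by (simp add: V_def)
    have "distr T (\<Pi>\<^sub>M u\<in>UNIV. V (v @ u)) (\<lambda>t. \<lambda>u\<in>UNIV. t (v @ u)) = (\<Pi>\<^sub>M u\<in>UNIV. V (v @ u))"
      by (rule distr_PiM_reindex[OF prob_space_V inj]) simp
    moreover have "AE t in (\<Pi>\<^sub>M u\<in>UNIV. V (v @ u)). tlo t [] = thi t []"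
      unfolding Vu by (rule AE_tree_messages_coincide) (fact int_pi mean_pos omega xi atomless bdd convex_max)+
    ultimately have "AE t in distr T (\<Pi>\<^sub>M u\<in>UNIV. V (v @ u)) (\<lambda>t. \<lambda>u\<in>UNIV. t (v @ u)). tlo t [] = thi t []"
      by (simp only:)
    then have "AE t in T. tlo (\<lambda>u\<in>UNIV. t (v @ u)) [] = thi (\<lambda>u\<in>UNIV. t (v @ u)) []"
      by (rule AE_distrD[rotated]) (rule measurable_restrict, measurable)
    moreover have "(\<lambda>u\<in>UNIV. t (v @ u)) = subtree v t" for t by (simp add: subtree_def fun_eq_iff)
    ultimately show ?thesis by (simp add: subtree_msg)
  qed
  have "AE t in T. \<forall>v. v \<noteq> [] \<longrightarrow> tlo t v = thi t v"
    unfolding AE_all_countable using ne by auto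
  then show ?thesis
  proof eventually_elim
    case (elim t)
    have "tlo t [] = vmax (vw t []) (kids t []) (\<lambda>i. ew t ([] @ [i]) - thi t ([] @ [i]))" by (rule zlo_rec)
    also have "\<dots> = vmax (vw t []) (kids t []) (\<lambda>i. ew t ([] @ [i]) - tlo t ([] @ [i]))"
      by (intro vmax_cong) (simp add: elim)
    also have "\<dots> = thi t []" by (rule zhi_rec[symmetric])
    finally show ?case using elim by metis
  qed
qed

text \<open>Given everything except the weight of the edge, the threshold is a constant, and the
  weight has no atoms. The comparison at each edge is thus strict, which lets a truncation decide
  it.\<close>

lemma AE_no_edge_ties: "AE t in T. \<forall>v. v \<noteq> [] \<longrightarrow> ew t v \<noteq> tlo t v + tdown t v"
  unfolding AE_all_countable
proof
  fix v :: "nat list"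
  define T' where "T' = (\<Pi>\<^sub>M u\<in>UNIV - {v}. V u)"
  interpret T': prob_space T' unfolding T'_def by (rule prob_space_PiM) (rule prob_space_V)
  interpret Vv: prob_space "V v" by (rule prob_space_V)
  let ?ins = "\<lambda>(y, t). t(v := y)"
  have ins: "distr (V v \<Otimes>\<^sub>M T') T ?ins = T"
    using distr_pair_PiM_eq_PiM[of "UNIV - {v}" V v] prob_space_V unfolding T'_def
    by (simp add: insert_Diff_if insert_UNIV insert_absorb)
  have m: "?ins \<in> V v \<Otimes>\<^sub>M T' \<rightarrow>\<^sub>M T"
    unfolding T'_def split_beta'
    by (rule measurable_fun_upd[where J="UNIV - {v}"]) (auto intro: measurable_snd measurable_fst)
  define g where "g t = tlo t v + tdown t v" for t
  have gm [measurable]: "g \<in> borel_measurable T" unfolding g_def[abs_def] by measurable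
  \<comment> \<open>Weight 0 is a reference value: it expresses the threshold without the weight
    that is averaged over.\<close>
  have irr: "g (t(v := (k, c, x))) = g (t(v := (k, 0, x)))" for t k c x
    unfolding g_def by (rule edge_weight_irrelevant)
  have meas: "(\<lambda>z. g (?ins z)) \<in> borel_measurable (V v \<Otimes>\<^sub>M T')"
    by (rule measurable_compose[OF m gm])
  have "AE z in V v \<Otimes>\<^sub>M T'. fst (snd (fst z)) \<noteq> g (?ins z)"
  proof (rule AE_pair_swapI)
    have [measurable]: "(\<lambda>z. fst (snd (fst z))) \<in> borel_measurable (V v \<Otimes>\<^sub>M T')"
      by (rule measurable_compose[OF measurable_fst measurable_node(2)])
    note [measurable] = meas
    show "{z\<in>space (V v \<Otimes>\<^sub>M T'). fst (snd (fst z)) \<noteq> g (?ins z)} \<in> sets (V v \<Otimes>\<^sub>M T')" by measurable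
    show "AE t in T'. AE y in V v. fst (snd (fst (y, t))) \<noteq> g (?ins (y, t))"
    proof (rule AE_I2)
      fix t assume t: "t \<in> space T'"
      let ?\<rho> = "if v = [] then \<pi> else size_biased \<pi>"
      interpret OX: pair_prob_space \<omega> \<xi> by unfold_locales
      interpret N: pair_prob_space "measure_pmf ?\<rho>" "\<omega> \<Otimes>\<^sub>M \<xi>" by unfold_locales
      have gy [measurable]: "(\<lambda>y. g (t(v := y))) \<in> borel_measurable (V v)"
        using measurable_compose[OF measurable_Pair2'[OF t] meas] by simp
      have V: "V v = measure_pmf ?\<rho> \<Otimes>\<^sub>M \<omega> \<Otimes>\<^sub>M \<xi>" by (simp add: V_def)
      have s: "{y\<in>space (V v). fst (snd y) \<noteq> g (t(v := y))} \<in> sets (V v)" by measurable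
      have "AE y in measure_pmf ?\<rho> \<Otimes>\<^sub>M \<omega> \<Otimes>\<^sub>M \<xi>. fst (snd y) \<noteq> g (t(v := y))"
      proof (rule N.AE_pair_measure)
        show "{y\<in>space (measure_pmf ?\<rho> \<Otimes>\<^sub>M \<omega> \<Otimes>\<^sub>M \<xi>). fst (snd y) \<noteq> g (t(v := y))} \<in> sets (measure_pmf ?\<rho> \<Otimes>\<^sub>M \<omega> \<Otimes>\<^sub>M \<xi>)"
          using s unfolding V .
        show "AE k in measure_pmf ?\<rho>. AE wx in \<omega> \<Otimes>\<^sub>M \<xi>. fst (snd (k, wx)) \<noteq> g (t(v := (k, wx)))"
        proof (rule AE_I2)
          fix k
          have gk: "(\<lambda>wx. g (t(v := (k, wx)))) \<in> borel_measurable (\<omega> \<Otimes>\<^sub>M \<xi>)"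
          proof -
            have "Pair k \<in> \<omega> \<Otimes>\<^sub>M \<xi> \<rightarrow>\<^sub>M V v" unfolding V by simp
            from measurable_compose[OF this gy] show ?thesis .
          qed
          note [measurable] = gk
          have [measurable]: "fst \<in> borel_measurable (\<omega> \<Otimes>\<^sub>M \<xi>)"
            using measurable_fst[of \<omega> \<xi>] by simp
          have "AE wx in \<omega> \<Otimes>\<^sub>M \<xi>. fst wx \<noteq> g (t(v := (k, wx)))"
          proof (rule AE_pair_swapI)
            show "{wx\<in>space (\<omega> \<Otimes>\<^sub>M \<xi>). fst wx \<noteq> g (t(v := (k, wx)))} \<in> sets (\<omega> \<Otimes>\<^sub>M \<xi>)" by measurable
            show "AE x in \<xi>. AE w in \<omega>. fst (w, x) \<noteq> g (t(v := (k, w, x)))"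
            proof (rule AE_I2)
              fix x
              have "AE w in \<omega>. w \<noteq> g (t(v := (k, 0, x)))"
                using atomless
                by (intro AE_I'[where N="{g (t(v := (k, 0, x)))}"])
                  (auto simp: atomless_def null_sets_def omega.emeasure_eq_measure)
              then show "AE w in \<omega>. fst (w, x) \<noteq> g (t(v := (k, w, x)))"
              proof eventually_elim
                case (elim w)
                then show ?case using irr[of t k w x] by simp
              qed
            qed
          qed (rule omega.sigma_finite_measure_axioms xi.sigma_finite_measure_axioms)+
          then show "AE wx in \<omega> \<Otimes>\<^sub>M \<xi>. fst (snd (k, wx)) \<noteq> g (t(v := (k, wx)))" by simp
        qed
      qed
      then show "AE y in V v. fst (snd (fst (y, t))) \<noteq> g (?ins (y, t))" unfolding V by simp
    qed
  qed (rule prob_space_imp_sigma_finite[OF prob_space_V] T'.sigma_finite_measure_axioms)+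
  then have ae: "AE z in V v \<Otimes>\<^sub>M T'. ew (?ins z) v \<noteq> g (?ins z)"
    by (simp add: ew_def split_beta')
  have "{t\<in>space T. ew t v \<noteq> g t} \<in> sets T"
    by (rule borel_measurable_neq[OF measurable_labels(2) gm])
  with ae have "AE t in distr (V v \<Otimes>\<^sub>M T') T ?ins. ew t v \<noteq> g t"
    by (simp only: AE_distr_iff[OF m])
  then show "AE t in T. v \<noteq> [] \<longrightarrow> ew t v \<noteq> tlo t v + tdown t v"
    unfolding ins g_def by eventually_elim simp
qed

end

section \<open>Edge decisions in a ball\<close>

lemma tree_verts_snoc: "v @ [i] \<in> tree_verts b \<longleftrightarrow> v \<in> tree_verts b \<and> i < b v"
proof
  assume "v @ [i] \<in> tree_verts b"
  then show "v \<in> tree_verts b \<and> i < b v" by cases auto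
qed (auto intro: tree_verts.intros)

lemma tree_verts_Nil: "[] \<in> tree_verts b"
  by (rule tree_verts.root)

lemma tree_verts_butlast: "v \<in> tree_verts b \<Longrightarrow> butlast v \<in> tree_verts b"
  by (cases v rule: rev_cases) (auto simp: tree_verts_snoc)

definition tnb :: "(nat list \<Rightarrow> nat) \<Rightarrow> nat list \<Rightarrow> nat list set" where
  "tnb b v = (\<lambda>i. v @ [i]) ` {..<b v} \<union> (if v = [] then {} else {butlast v})"

text \<open>Edge weights are stored at the lower endpoint, the longer of the two labels.\<close>

definition tree_weight :: "(nat list \<Rightarrow> real) \<Rightarrow> nat list \<Rightarrow> nat list \<Rightarrow> real" where
  "tree_weight W v u = (if length v < length u then W u else W v)"

text \<open>The maximum of \<open>x\<close> and of \<open>f\<close> over \<open>S\<close>, described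
  by bounds and attainment instead of \<open>Max\<close>; this is the form in which optimality
  delivers it and in which it carries over along a chart.\<close>

definition best :: "real \<Rightarrow> real \<Rightarrow> 'a set \<Rightarrow> ('a \<Rightarrow> real) \<Rightarrow> bool" where
  "best r x S f \<longleftrightarrow> x \<le> r \<and> (\<forall>u\<in>S. f u \<le> r) \<and> (r = x \<or> (\<exists>u\<in>S. r = f u))"

lemma tnb_finite: "finite (tnb b v)"
  by (simp add: tnb_def)

lemma tnb_in_tree: "v \<in> tree_verts b \<Longrightarrow> u \<in> tnb b v \<Longrightarrow> u \<in> tree_verts b"
  by (auto simp: tnb_def tree_verts_snoc tree_verts_snoc[of "[]", simplified] tree_verts_butlast split: if_splits)

lemma length_tnb: "u \<in> tnb b v \<Longrightarrow> length u \<le> Suc (length v)"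
  by (auto simp: tnb_def split: if_splits)

lemma butlast_neq_snoc: "butlast v \<noteq> v @ [i]"
proof
  assume "butlast v = v @ [i]"
  then have "length (butlast v) = length (v @ [i])" by simp
  then show False by simp
qed

lemma tnb_minus_parent: "v \<noteq> [] \<Longrightarrow> tnb b v - {butlast v} = (\<lambda>i. v @ [i]) ` {..<b v}"
  using butlast_neq_snoc[of v] by (auto simp: tnb_def) metis

lemma tnb_minus_child: "tnb b v - {v @ [c]} =
    (\<lambda>i. v @ [i]) ` ({..<b v} - {c}) \<union> (if v = [] then {} else {butlast v})"
  using butlast_neq_snoc[of v] by (auto simp: tnb_def split: if_splits)

text \<open>A message system on the ball of radius \<open>L\<close> of a tree: \<open>Msg u v r\<close> says that \<open>r\<close> is an
  admissible value of the message produced by \<open>v\<close> when its neighbour \<open>u\<close> is discarded.\<close>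

locale message_system =
  fixes L :: nat and b :: "nat list \<Rightarrow> nat" and W X :: "nat list \<Rightarrow> real"
    and Msg :: "nat list \<Rightarrow> nat list \<Rightarrow> real \<Rightarrow> bool"
  assumes base: "Msg u v r \<Longrightarrow> v \<in> tree_verts b \<Longrightarrow> length v \<le> L \<Longrightarrow> X v \<le> r"
    and step: "Msg u v r \<Longrightarrow> v \<in> tree_verts b \<Longrightarrow> length v < L \<Longrightarrow> u \<in> tnb b v \<Longrightarrow>
      \<exists>f. (\<forall>u'\<in>tnb b v - {u}. Msg v u' (f u')) \<and> best r (X v) (tnb b v - {u}) (\<lambda>u'. tree_weight W v u' - f u')"
begin

lemma zmsg_bounds:
  assumes "Msg (butlast v) v r" "v \<noteq> []" "v \<in> tree_verts b" "length v + n \<le> L"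
  shows "(even n \<longrightarrow> zmsg b W X n v \<le> r) \<and> (odd n \<longrightarrow> r \<le> zmsg b W X n v)"
  using assms
proof (induction n arbitrary: v r)
  case 0
  then show ?case using base by auto
next
  case (Suc n)
  have "butlast v \<in> tnb b v" using Suc.prems(2) by (simp add: tnb_def)
  with step[OF Suc.prems(1,3)] Suc.prems(4) obtain f where
    f: "\<And>u'. u' \<in> tnb b v - {butlast v} \<Longrightarrow> Msg v u' (f u')"
    and r: "best r (X v) (tnb b v - {butlast v}) (\<lambda>u'. tree_weight W v u' - f u')" by auto
  have S: "tnb b v - {butlast v} = (\<lambda>i. v @ [i]) ` {..<b v}" using Suc.prems(2) by (rule tnb_minus_parent)
  have IH: "(even n \<longrightarrow> zmsg b W X n (v @ [i]) \<le> f (v @ [i])) \<and> (odd n \<longrightarrow> f (v @ [i]) \<le> zmsg b W X n (v @ [i]))"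
    if "i < b v" for i
    using f[of "v @ [i]"] that Suc.prems(3,4) unfolding S by (intro Suc.IH) (auto simp: tree_verts_snoc)
  have r': "X v \<le> r" "\<And>i. i < b v \<Longrightarrow> W (v @ [i]) - f (v @ [i]) \<le> r"
    "r = X v \<or> (\<exists>i<b v. r = W (v @ [i]) - f (v @ [i]))"
    using r unfolding S best_def by (auto simp: tree_weight_def)
  show ?case
  proof (intro conjI impI)
    assume "even (Suc n)"
    then have "f (v @ [i]) \<le> zmsg b W X n (v @ [i])" if "i < b v" for i using IH[OF that] by simp
    then show "zmsg b W X (Suc n) v \<le> r"
      using r'(1,2) by (fastforce simp: vmax_le_iff)
  next
    assume "odd (Suc n)"
    then have *: "zmsg b W X n (v @ [i]) \<le> f (v @ [i])" if "i < b v" for i using IH[OF that] by simp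
    from r'(3) show "r \<le> zmsg b W X (Suc n) v"
    proof
      assume "\<exists>i<b v. r = W (v @ [i]) - f (v @ [i])"
      then obtain i where i: "i < b v" "r = W (v @ [i]) - f (v @ [i])" by auto
      with *[OF i(1)] have "r \<le> W (v @ [i]) - zmsg b W X n (v @ [i])" by simp
      also have "\<dots> \<le> zmsg b W X (Suc n) v"
        using i(1) vmax_ge[of i "b v" "\<lambda>i. W (v @ [i]) - zmsg b W X n (v @ [i])"] by simp
      finally show ?thesis .
    qed (simp add: vmax_ge_base)
  qed
qed

text \<open>Induction along the path to the root: messages from the siblings are bounded by
  \<open>zmsg_bounds\<close>, the one from the parent of \<open>p\<close> by the induction
  hypothesis. Children of \<open>p\<close> are at level \<open>length p + 1\<close>, and the upper
  bound looks \<open>2 * k + 1\<close> levels further, whence the radius.\<close>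

lemma down_bounds:
  assumes f: "\<And>u'. u' \<in> tnb b p - {p @ [c]} \<Longrightarrow> Msg p u' (f u')"
    and r: "best r (X p) (tnb b p - {p @ [c]}) (\<lambda>u'. tree_weight W p u' - f u')"
    and p: "p \<in> tree_verts b" "length p + 2 * k + 2 \<le> L"
  shows "down b W X (\<lambda>s. zmsg b W X (2 * k + of_bool s)) False (p @ [c]) \<le> r
    \<and> r \<le> down b W X (\<lambda>s. zmsg b W X (2 * k + of_bool s)) True (p @ [c])"
  using assms
proof (induction p arbitrary: c r f rule: length_induct)
  case (1 p)
  let ?d = "\<lambda>s. zmsg b W X (2 * k + of_bool s)"
  have kid: "?d False (p @ [i]) \<le> f (p @ [i])" "f (p @ [i]) \<le> ?d True (p @ [i])" if i: "i < b p" "i \<noteq> c" for i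
  proof -
    have m: "Msg p (p @ [i]) (f (p @ [i]))" using i by (intro 1(2)) (simp add: tnb_def)
    have t: "p @ [i] \<in> tree_verts b" using i 1(4) by (simp add: tree_verts_snoc)
    show "?d False (p @ [i]) \<le> f (p @ [i])" "f (p @ [i]) \<le> ?d True (p @ [i])"
      using zmsg_bounds[of "p @ [i]" "f (p @ [i])" "2 * k"] zmsg_bounds[of "p @ [i]" "f (p @ [i])" "2 * k + 1"] m t 1(5)
      by auto
  qed
  have par: "down b W X ?d False p \<le> f (butlast p) \<and> f (butlast p) \<le> down b W X ?d True p" if ne: "p \<noteq> []"
  proof -
    obtain q e where q: "p = q @ [e]" using ne by (metis rev_exhaust)
    have m: "Msg p q (f q)"
      using q ne butlast_neq_snoc[of p c] by (intro 1(2)) (auto simp: tnb_def)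
    have qt: "q \<in> tree_verts b" "e < b q" using 1(4) q by (auto simp: tree_verts_snoc)
    have "p \<in> tnb b q" using qt q by (auto simp: tnb_def)
    with step[OF m qt(1)] 1(5) q obtain f' where
      f': "\<And>u'. u' \<in> tnb b q - {q @ [e]} \<Longrightarrow> Msg q u' (f' u')"
      and r': "best (f q) (X q) (tnb b q - {q @ [e]}) (\<lambda>u'. tree_weight W q u' - f' u')" by auto
    have "length q < length p" using q by simp
    from 1(1)[rule_format, OF this f' r' qt(1)] 1(5) q show ?thesis by simp
  qed
  have S: "tnb b p - {p @ [c]} = (\<lambda>i. p @ [i]) ` ({..<b p} - {c}) \<union> (if p = [] then {} else {butlast p})"
    by (rule tnb_minus_child)
  have r: "X p \<le> r" "\<And>i. i < b p \<Longrightarrow> i \<noteq> c \<Longrightarrow> W (p @ [i]) - f (p @ [i]) \<le> r"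
    "p \<noteq> [] \<Longrightarrow> W p - f (butlast p) \<le> r"
    "r = X p \<or> (\<exists>i<b p. i \<noteq> c \<and> r = W (p @ [i]) - f (p @ [i])) \<or> (p \<noteq> [] \<and> r = W p - f (butlast p))"
    using 1(3) unfolding S best_def by (auto simp: tree_weight_def split: if_splits)
  let ?a = "above b W X ?d"
  have lo: "?a False p \<le> r"
    using r(1) r(3) par by (cases "p = []") (fastforce simp: above_def)+
  have 1: "down b W X ?d False (p @ [c]) \<le> r"
    unfolding down_snoc vmax_le_iff
  proof (intro conjI lo allI impI)
    fix i assume i: "i < b p"
    show "(if i = c then ?a False p else W (p @ [i]) - ?d (\<not> False) (p @ [i])) \<le> r"
      using lo kid(2)[OF i] r(2)[OF i] by (cases "i = c") auto
  qed
  let ?g = "\<lambda>i. if i = c then ?a True p else W (p @ [i]) - ?d (\<not> True) (p @ [i])"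
  have ge: "?a True p \<le> down b W X ?d True (p @ [c])" unfolding down_snoc by (rule vmax_ge_base)
  from r(4) have 2: "r \<le> down b W X ?d True (p @ [c])"
  proof (elim disjE exE conjE)
    assume "r = X p"
    then show ?thesis using ge by (auto simp: above_def split: if_splits)
  next
    fix i assume i: "i < b p" "i \<noteq> c" "r = W (p @ [i]) - f (p @ [i])"
    then have "r \<le> ?g i" using kid(1)[OF i(1,2)] by simp
    also have "?g i \<le> down b W X ?d True (p @ [c])" unfolding down_snoc using i(1) by (rule vmax_ge)
    finally show ?thesis .
  next
    assume "p \<noteq> []" "r = W p - f (butlast p)"
    then show ?thesis using ge par by (auto simp: above_def)
  qed
  from 1 2 show ?case ..
qed

end

text \<open>Both messages across the edge are replaced by their upper bounds here, and by their
  lower bounds in \<open>edge_no\<close>; either strict inequality settles how \<open>W v\<close>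
  compares with the sum of the true messages.\<close>

definition edge_yes where
  "edge_yes b W X k v \<longleftrightarrow> zmsg b W X (2 * k + 1) v + down b W X (\<lambda>s. zmsg b W X (2 * k + of_bool s)) True v < W v"

definition edge_no where
  "edge_no b W X k v \<longleftrightarrow> W v < zmsg b W X (2 * k) v + down b W X (\<lambda>s. zmsg b W X (2 * k + of_bool s)) False v"

text \<open>Neighbourhoods are prescribed only up to level \<open>L - 1\<close>. Vertices at level
  \<open>L\<close> may have arbitrary further edges, even among themselves, as in a ball of a graph
  with cycles.\<close>

definition tree_chart :: "nat \<Rightarrow> (nat list \<Rightarrow> nat) \<Rightarrow> (nat list \<Rightarrow> 'v) \<Rightarrow> 'v rgraph \<Rightarrow> bool" where
  "tree_chart L b \<phi> g \<longleftrightarrow> \<phi> [] = root g \<and> inj_on \<phi> {v\<in>tree_verts b. length v \<le> L}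
     \<and> \<phi> ` {v\<in>tree_verts b. length v \<le> L} \<subseteq> verts g
     \<and> (\<forall>v\<in>tree_verts b. length v < L \<longrightarrow> {u. {\<phi> v, u} \<in> edges g} = \<phi> ` tnb b v)"

definition pull :: "(nat list \<Rightarrow> 'v) \<Rightarrow> ('v set \<Rightarrow> real) \<Rightarrow> nat list \<Rightarrow> real" where
  "pull \<phi> w v = w {\<phi> (butlast v), \<phi> v}"

lemma tree_weight_pull: "u \<in> tnb b v \<Longrightarrow> tree_weight (pull \<phi> w) v u = w {\<phi> v, \<phi> u}"
  by (auto simp: tnb_def tree_weight_def pull_def insert_commute split: if_splits)

section \<open>Optimal configurations of finite graphs\<close>

lemma best_Max: "finite S \<Longrightarrow> best (Max (insert x (f ` S))) x S f"
  using Max_in[of "insert x (f ` S)"] by (auto simp: best_def)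

lemma best_imp_Max: "finite S \<Longrightarrow> best r x S f \<Longrightarrow> r = Max (insert x (f ` S))"
  unfolding best_def by (intro Max_eqI[symmetric]) auto

lemma best_image: "best r x (\<phi> ` S) f \<longleftrightarrow> best r x S (\<lambda>u. f (\<phi> u))"
  by (auto simp: best_def)

lemma best_cong: "(\<And>u. u \<in> S \<Longrightarrow> f u = f' u) \<Longrightarrow> best r x S f \<longleftrightarrow> best r x S f'"
  by (auto simp: best_def)

definition md_within :: "'v rgraph \<Rightarrow> 'v set \<Rightarrow> 'v set set set" where
  "md_within g A = {M. md_config g M \<and> (\<forall>e\<in>M. e \<subseteq> A)}"

definition val_within :: "('v set \<Rightarrow> real) \<Rightarrow> ('v \<Rightarrow> real) \<Rightarrow> 'v set \<Rightarrow> 'v set set \<Rightarrow> real" where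
  "val_within w x A M = (\<Sum>e\<in>M. w e) + (\<Sum>v | v \<in> A \<and> (\<forall>e\<in>M. v \<notin> e). x v)"

definition opt :: "'v rgraph \<Rightarrow> ('v set \<Rightarrow> real) \<Rightarrow> ('v \<Rightarrow> real) \<Rightarrow> 'v set \<Rightarrow> real" where
  "opt g w x A = Max (val_within w x A ` md_within g A)"

text \<open>The finite counterpart of a message: what \<open>v\<close> adds to the optimum when only
  the vertices in \<open>A\<close> are left. Discarding a neighbour becomes its removal from
  \<open>A\<close>, which yields the message recursion on any finite graph.\<close>

definition marginal :: "'v rgraph \<Rightarrow> ('v set \<Rightarrow> real) \<Rightarrow> ('v \<Rightarrow> real) \<Rightarrow> 'v set \<Rightarrow> 'v \<Rightarrow> real" where
  "marginal g w x A v = opt g w x A - opt g w x (A - {v})"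

lemma rooted_edge:
  assumes "rooted_graph g" "{u, v} \<in> edges g"
  shows "u \<in> verts g" "v \<in> verts g" "u \<noteq> v"
proof -
  obtain a b where "a \<in> verts g" "b \<in> verts g" "a \<noteq> b" "{u, v} = {a, b}"
    using assms unfolding rooted_graph_def by blast
  then show "u \<in> verts g" "v \<in> verts g" "u \<noteq> v" by (auto simp: doubleton_eq_iff)
qed

lemma rooted_edges_pair:
  assumes "rooted_graph g" "e \<in> edges g"
  obtains a b where "e = {a, b}" "a \<in> verts g" "b \<in> verts g" "a \<noteq> b"
  using assms unfolding rooted_graph_def by blast

lemma md_config_unique:
  assumes "md_config g M" "z \<in> verts g" "e \<in> M" "e' \<in> M" "z \<in> e" "z \<in> e'"
  shows "e = e'"
  using assms unfolding md_config_def by simp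

locale finite_rooted_graph =
  fixes g :: "'v rgraph" and w :: "'v set \<Rightarrow> real" and x :: "'v \<Rightarrow> real"
  assumes rooted: "rooted_graph g" and fin: "finite (verts g)"
begin

lemma edge_subset: "e \<in> edges g \<Longrightarrow> e \<subseteq> verts g"
  using rooted unfolding rooted_graph_def by fastforce

lemma finite_edges: "finite (edges g)"
proof (rule finite_subset)
  show "edges g \<subseteq> Pow (verts g)" using edge_subset by blast
  show "finite (Pow (verts g))" using fin by simp
qed

lemma finite_config: "md_config g M \<Longrightarrow> finite M"
  using finite_edges by (auto simp: md_config_def intro: finite_subset)

lemma finite_md_within: "finite (md_within g A)"
proof (rule finite_subset)
  show "md_within g A \<subseteq> Pow (edges g)" by (auto simp: md_within_def md_config_def)
qed (use finite_edges in simp)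

lemma md_within_nonempty: "md_within g A \<noteq> {}"
  by (auto simp: md_within_def md_config_def intro!: exI[of _ "{}"])

lemma opt_ge: "M \<in> md_within g A \<Longrightarrow> val_within w x A M \<le> opt g w x A"
  unfolding opt_def by (intro Max_ge) (auto simp: finite_md_within)

lemma opt_attained: obtains M where "M \<in> md_within g A" "val_within w x A M = opt g w x A"
  using Max_in[of "val_within w x A ` md_within g A"] finite_md_within md_within_nonempty
  unfolding opt_def by (metis (no_types, lifting) finite_imageI image_iff image_is_empty)

lemma val_monomer:
  assumes "A \<subseteq> verts g" "v \<in> A" "\<forall>e\<in>M. v \<notin> e"
  shows "val_within w x A M = x v + val_within w x (A - {v}) M"
proof -
  have "{u \<in> A. \<forall>e\<in>M. u \<notin> e} = insert v {u \<in> A - {v}. \<forall>e\<in>M. u \<notin> e}" using assms by auto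
  moreover have "finite {u \<in> A - {v}. \<forall>e\<in>M. u \<notin> e}" using fin assms(1) by (auto intro: finite_subset)
  ultimately show ?thesis by (simp add: val_within_def)
qed

lemma val_dimer:
  assumes "{v, u} \<notin> M" "finite M"
  shows "val_within w x A (insert {v, u} M) = w {v, u} + val_within w x (A - {v, u}) M"
proof -
  have "{z \<in> A. \<forall>e\<in>insert {v, u} M. z \<notin> e} = {z \<in> A - {v, u}. \<forall>e\<in>M. z \<notin> e}" by auto
  then show ?thesis using assms by (simp add: val_within_def)
qed

lemma opt_monomer:
  assumes A: "A \<subseteq> verts g" "v \<in> A"
  shows "x v + opt g w x (A - {v}) \<le> opt g w x A"
proof -
  obtain M where M: "M \<in> md_within g (A - {v})" "val_within w x (A - {v}) M = opt g w x (A - {v})"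
    by (rule opt_attained)
  then have "\<forall>e\<in>M. v \<notin> e" "M \<in> md_within g A" by (auto simp: md_within_def)
  with M val_monomer[OF A, of M] opt_ge[of M A] show ?thesis by simp
qed

lemma opt_dimer:
  assumes A: "v \<in> A" "u \<in> A" "{v, u} \<in> edges g"
  shows "w {v, u} + opt g w x (A - {v, u}) \<le> opt g w x A"
proof -
  obtain M where M: "M \<in> md_within g (A - {v, u})" "val_within w x (A - {v, u}) M = opt g w x (A - {v, u})"
    by (rule opt_attained)
  have out: "v \<notin> e" "u \<notin> e" if "e \<in> M" for e using M(1) that by (auto simp: md_within_def)
  then have n: "{v, u} \<notin> M" by auto
  have "insert {v, u} M \<in> md_within g A"
    using M(1) A out by (auto simp: md_within_def md_config_def)
  from opt_ge[OF this] val_dimer[OF n] M show ?thesis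
    using finite_config by (auto simp: md_within_def)
qed

lemma opt_dimer_le:
  assumes M: "M \<in> md_within g A" "val_within w x A M = opt g w x A" and e: "{v, u} \<in> M"
  shows "opt g w x A \<le> w {v, u} + opt g w x (A - {v, u})"
proof -
  have c: "md_config g M" using M(1) by (simp add: md_within_def)
  have ed: "{v, u} \<in> edges g" using c e by (auto simp: md_config_def)
  have dis: "v \<notin> e' \<and> u \<notin> e'" if e': "e' \<in> M - {{v, u}}" for e'
    using md_config_unique[OF c rooted_edge(1)[OF rooted ed] e, of e']
      md_config_unique[OF c rooted_edge(2)[OF rooted ed] e, of e'] e' by auto
  have "M - {{v, u}} \<in> md_within g (A - {v, u})"
    using M(1) dis by (auto simp: md_within_def md_config_def)
  from opt_ge[OF this] have "val_within w x (A - {v, u}) (M - {{v, u}}) \<le> opt g w x (A - {v, u})" .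
  moreover have "val_within w x A (insert {v, u} (M - {{v, u}})) = w {v, u} + val_within w x (A - {v, u}) (M - {{v, u}})"
    using finite_config[OF c] by (intro val_dimer) auto
  ultimately show ?thesis using M(2) e by (simp add: insert_absorb)
qed

text \<open>An optimal \<open>M\<close> leaves \<open>v\<close> alone or matches it with some
  \<open>u\<close>. Deleting \<open>v\<close>, or both \<open>v\<close> and \<open>u\<close>, leaves
  an optimum of the rest, and differences of the optimal values give the stated terms.\<close>

lemma marginal_cases:
  assumes M: "M \<in> md_within g A" "val_within w x A M = opt g w x A" and A: "A \<subseteq> verts g" "v \<in> A"
  shows "marginal g w x A v = x v \<and> (\<forall>e\<in>M. v \<notin> e)
    \<or> (\<exists>u\<in>A. {v, u} \<in> M \<and> {v, u} \<in> edges g \<and> marginal g w x A v = w {v, u} - marginal g w x (A - {v}) u)"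
proof (cases "\<forall>e\<in>M. v \<notin> e")
  case True
  then have "M \<in> md_within g (A - {v})" using M(1) by (auto simp: md_within_def)
  from opt_ge[OF this] val_monomer[OF A True] M(2) opt_monomer[OF A] True
  show ?thesis by (simp add: marginal_def)
next
  case False
  then obtain e where e: "e \<in> M" "v \<in> e" by auto
  then have "e \<in> edges g" using M(1) by (auto simp: md_within_def md_config_def)
  then obtain a b where "e = {a, b}" using rooted_edges_pair[OF rooted] by metis
  then obtain u where u: "e = {v, u}" using e(2) by auto
  have uA: "u \<in> A" using e u M(1) by (auto simp: md_within_def)
  have "opt g w x A \<le> w {v, u} + opt g w x (A - {v, u})"
    using e u by (intro opt_dimer_le[OF M]) simp
  moreover have "w {v, u} + opt g w x (A - {v, u}) \<le> opt g w x A"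
    using \<open>e \<in> edges g\<close> u uA A by (intro opt_dimer) auto
  moreover have "A - {v} - {u} = A - {v, u}" by auto
  ultimately show ?thesis using uA e u \<open>e \<in> edges g\<close> by (auto simp: marginal_def)
qed

lemma marginal_ge:
  assumes A: "A \<subseteq> verts g" "v \<in> A"
  shows "x v \<le> marginal g w x A v"
    and "u \<in> A \<Longrightarrow> {v, u} \<in> edges g \<Longrightarrow> w {v, u} - marginal g w x (A - {v}) u \<le> marginal g w x A v"
proof -
  show "x v \<le> marginal g w x A v" using opt_monomer[OF A] by (simp add: marginal_def)
  have "A - {v} - {u} = A - {v, u}" by auto
  then show "u \<in> A \<Longrightarrow> {v, u} \<in> edges g \<Longrightarrow> w {v, u} - marginal g w x (A - {v}) u \<le> marginal g w x A v"
    using opt_dimer[OF A(2), of u] by (simp add: marginal_def)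
qed

lemma marginal_best:
  assumes A: "A \<subseteq> verts g" "v \<in> A"
  shows "best (marginal g w x A v) (x v) {u\<in>A. {v, u} \<in> edges g} (\<lambda>u. w {v, u} - marginal g w x (A - {v}) u)"
proof -
  obtain M where "M \<in> md_within g A" "val_within w x A M = opt g w x A" by (rule opt_attained)
  from marginal_cases[OF this A] marginal_ge[OF A] show ?thesis unfolding best_def by blast
qed

lemma optimal_within:
  assumes "optimal_md g w x M"
  shows "M \<in> md_within g (verts g)" "val_within w x (verts g) M = opt g w x (verts g)"
proof -
  have within: "md_config g M' \<Longrightarrow> M' \<in> md_within g (verts g)" for M'
    using edge_subset unfolding md_within_def md_config_def by blast
  have v: "md_value g w x M' = val_within w x (verts g) M'" for M'
    by (simp add: md_value_def val_within_def)
  show M: "M \<in> md_within g (verts g)" using assms within by (simp add: optimal_md_def)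
  obtain M' where M': "M' \<in> md_within g (verts g)" "val_within w x (verts g) M' = opt g w x (verts g)"
    by (rule opt_attained)
  then have "opt g w x (verts g) \<le> val_within w x (verts g) M"
    using assms unfolding optimal_md_def v[symmetric] by (auto simp: md_within_def v)
  with opt_ge[OF M] show "val_within w x (verts g) M = opt g w x (verts g)" by simp
qed

end

text \<open>The component of \<open>v\<close> after the edge between \<open>u\<close> and
  \<open>v\<close> is cut: everything not below \<open>u\<close> if \<open>v\<close> is its parent,
  and otherwise everything below \<open>v\<close>.\<close>

definition side :: "nat list \<Rightarrow> nat list \<Rightarrow> nat list set" where
  "side u v = (if u \<noteq> [] \<and> v = butlast u then {z. \<not> (\<exists>r. z = u @ r)} else {z. \<exists>r. z = v @ r})"

lemma side_step:
  assumes "u \<in> tnb b v" "u' \<in> tnb b v" "u' \<noteq> u"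
  shows "u' \<in> side u v" "side v u' \<subseteq> side u v" "v \<notin> side v u'"
proof -
  have c: "side (v @ [i]) v = {z. \<not> (\<exists>r. z = v @ [i] @ r)}" for i by (simp add: side_def)
  have d: "side v (v @ [i]) = {z. \<exists>r. z = v @ [i] @ r}" for i
    using butlast_neq_snoc[of v i] by (auto simp: side_def)
  have e: "side (butlast v) v = {z. \<exists>r. z = v @ r}" if "v \<noteq> []"
  proof -
    have "v \<noteq> butlast (butlast v)"
    proof
      assume "v = butlast (butlast v)"
      then have "length v = length (butlast (butlast v))" by (rule arg_cong)
      moreover have "0 < length v" using that by simp
      ultimately show False unfolding length_butlast by linarith
    qed
    then show ?thesis by (simp add: side_def)
  qed
  have f: "side v (butlast v) = {z. \<not> (\<exists>r. z = v @ r)}" if "v \<noteq> []" using that by (simp add: side_def)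
  have bl: "\<nexists>r. butlast v = v @ r" if "v \<noteq> []"
  proof
    assume "\<exists>r. butlast v = v @ r"
    then obtain r where "length (butlast v) = length (v @ r)" by metis
    moreover have "0 < length v" using that by simp
    ultimately show False unfolding length_butlast length_append by linarith
  qed
  from assms(1,2) consider
      (a) i j where "u = v @ [i]" "u' = v @ [j]"
    | (b) i where "u = v @ [i]" "u' = butlast v" "v \<noteq> []"
    | (c) j where "u = butlast v" "u' = v @ [j]" "v \<noteq> []"
    using assms(3) by (auto simp: tnb_def split: if_splits)
  then have "u' \<in> side u v \<and> side v u' \<subseteq> side u v \<and> v \<notin> side v u'"
  proof cases
    case a
    with assms(3) show ?thesis unfolding a c d by auto
  next
    case b
    then show ?thesis unfolding b(1,2) c f[OF b(3)] using bl[OF b(3)] by auto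
  next
    case c
    then show ?thesis unfolding c(1,2) d e[OF c(3)] by auto
  qed
  then show "u' \<in> side u v" "side v u' \<subseteq> side u v" "v \<notin> side v u'" by auto
qed

lemma tnb_irrefl: "v \<notin> tnb b v"
proof
  assume "v \<in> tnb b v"
  then have "v \<noteq> []" "v = butlast v" by (auto simp: tnb_def split: if_splits)
  then have "length v = length (butlast v)" by simp
  moreover have "0 < length v" using \<open>v \<noteq> []\<close> by simp
  ultimately show False unfolding length_butlast by linarith
qed

lemma tnb_sym: "u \<in> tnb b v \<Longrightarrow> v \<in> tree_verts b \<Longrightarrow> v \<in> tnb b u"
proof -
  assume u: "u \<in> tnb b v" and v: "v \<in> tree_verts b"
  from u consider (a) i where "u = v @ [i]" | (b) "u = butlast v" "v \<noteq> []"
    by (auto simp: tnb_def split: if_splits)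
  then show "v \<in> tnb b u"
  proof cases
    case a
    then have "u \<noteq> []" "butlast u = v" by simp_all
    then show ?thesis by (simp add: tnb_def)
  next
    case b
    then have "v = u @ [last v]" by simp
    moreover from this v have "last v < b u" by (metis tree_verts_snoc)
    ultimately show ?thesis unfolding tnb_def by blast
  qed
qed

lemma chart_inj:
  "tree_chart L b \<phi> g \<Longrightarrow> u \<in> tree_verts b \<Longrightarrow> v \<in> tree_verts b \<Longrightarrow> length u \<le> L \<Longrightarrow> length v \<le> L \<Longrightarrow>
    \<phi> u = \<phi> v \<longleftrightarrow> u = v"
  by (auto simp: tree_chart_def inj_on_def)

lemma chart_verts: "tree_chart L b \<phi> g \<Longrightarrow> v \<in> tree_verts b \<Longrightarrow> length v \<le> L \<Longrightarrow> \<phi> v \<in> verts g"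
  by (auto simp: tree_chart_def)

lemma chart_nbrs: "tree_chart L b \<phi> g \<Longrightarrow> v \<in> tree_verts b \<Longrightarrow> length v < L \<Longrightarrow>
    {\<phi> v, u} \<in> edges g \<longleftrightarrow> (\<exists>u'\<in>tnb b v. u = \<phi> u')"
  unfolding tree_chart_def by blast

text \<open>Let \<open>p\<close> be the parent of \<open>v\<close>. Matching them gives
  \<open>p\<close> the gain w - f(v), where f(v) is the marginal of \<open>v\<close> without
  \<open>p\<close>, while \<open>r\<close> is the best \<open>p\<close> can get otherwise. A strict
  comparison of w with f(v) + r makes one of the two choices incompatible with optimality.\<close>

lemma optimal_edge_decision:
  assumes "rooted_graph g" "finite (verts g)" and chart: "tree_chart L b \<phi> g"
    and opt: "optimal_md g w x M"
    and v: "v \<in> tree_verts b" "v \<noteq> []" "length v + 2 * k + 1 \<le> L"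
  shows "edge_yes b (pull \<phi> w) (\<lambda>v. x (\<phi> v)) k v \<Longrightarrow> {\<phi> (butlast v), \<phi> v} \<in> M"
    and "edge_no b (pull \<phi> w) (\<lambda>v. x (\<phi> v)) k v \<Longrightarrow> {\<phi> (butlast v), \<phi> v} \<notin> M"
proof -
  interpret finite_rooted_graph g w x by (rule finite_rooted_graph.intro) fact+
  \<comment> \<open>The set \<open>A\<close> is not determined by \<open>u\<close> and
    \<open>v\<close>, since it depends on the vertices deleted before. It only has to contain the
    side of \<open>v\<close> within the ball and to miss \<open>u\<close>; outside the ball the
    graph is arbitrary. This is why messages form a relation.\<close>
  define Msg where "Msg u v r \<longleftrightarrow> u \<in> tnb b v \<and> (\<exists>A\<subseteq>verts g. \<phi> v \<in> A \<and> \<phi> u \<notin> A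
      \<and> \<phi> ` {z\<in>tree_verts b. length z \<le> L \<and> z \<in> side u v} \<subseteq> A \<and> r = marginal g w x A (\<phi> v))" for u v r
  interpret message_system L b "pull \<phi> w" "\<lambda>v. x (\<phi> v)" Msg
  proof
    show "x (\<phi> v) \<le> r" if "Msg u v r" for u v r
      using that marginal_ge(1) by (auto simp: Msg_def)
    fix u v r assume m: "Msg u v r" and v: "v \<in> tree_verts b" "length v < L" "u \<in> tnb b v"
    from m obtain A where A: "A \<subseteq> verts g" "\<phi> v \<in> A" "\<phi> u \<notin> A"
      "\<phi> ` {z\<in>tree_verts b. length z \<le> L \<and> z \<in> side u v} \<subseteq> A" "r = marginal g w x A (\<phi> v)"
      by (auto simp: Msg_def)
    let ?f = "\<lambda>u'. marginal g w x (A - {\<phi> v}) (\<phi> u')"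
    have inA: "\<phi> z \<in> A" if "z \<in> tree_verts b" "length z \<le> L" "z \<in> side u v" for z using A(4) that by blast
    have tn: "z \<in> tree_verts b" "length z \<le> L" if "z \<in> tnb b v" for z
      using tnb_in_tree[OF v(1) that] length_tnb[OF that] v(2) by auto
    have nb: "{y\<in>A. {\<phi> v, y} \<in> edges g} = \<phi> ` (tnb b v - {u})"
    proof (intro equalityI subsetI)
      fix y assume "y \<in> {y\<in>A. {\<phi> v, y} \<in> edges g}"
      then show "y \<in> \<phi> ` (tnb b v - {u})" using chart_nbrs[OF chart v(1,2)] A(3) by auto
    next
      fix y assume "y \<in> \<phi> ` (tnb b v - {u})"
      then obtain u' where u': "u' \<in> tnb b v" "u' \<noteq> u" "y = \<phi> u'" by auto
      then show "y \<in> {y\<in>A. {\<phi> v, y} \<in> edges g}"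
        using chart_nbrs[OF chart v(1,2)] side_step(1)[OF v(3) u'(1,2)] inA tn by auto
    qed
    have "best r (x (\<phi> v)) (tnb b v - {u}) (\<lambda>u'. w {\<phi> v, \<phi> u'} - ?f u')"
      using marginal_best[OF A(1,2)] unfolding nb A(5) best_image .
    then have "best r (x (\<phi> v)) (tnb b v - {u}) (\<lambda>u'. tree_weight (pull \<phi> w) v u' - ?f u')"
      by (subst best_cong) (auto simp: tree_weight_pull)
    moreover have "Msg v u' (?f u')" if u': "u' \<in> tnb b v - {u}" for u'
      unfolding Msg_def
    proof (intro conjI exI[of _ "A - {\<phi> v}"])
      have ss: "u' \<in> side u v" "side v u' \<subseteq> side u v" "v \<notin> side v u'" using side_step[OF v(3)] u' by auto
      have ne: "u' \<noteq> v" using u' tnb_irrefl by blast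
      show "v \<in> tnb b u'" using tnb_sym u' v(1) by blast
      show "\<phi> u' \<in> A - {\<phi> v}" using inA[OF tn ss(1)] u' ne chart_inj[OF chart, of u' v] tn[of u'] v by auto
      show "\<phi> ` {z \<in> tree_verts b. length z \<le> L \<and> z \<in> side v u'} \<subseteq> A - {\<phi> v}"
      proof
        fix y assume "y \<in> \<phi> ` {z \<in> tree_verts b. length z \<le> L \<and> z \<in> side v u'}"
        then obtain z where z: "z \<in> tree_verts b" "length z \<le> L" "z \<in> side v u'" "y = \<phi> z" by auto
        then have "z \<noteq> v" using ss(3) by auto
        with z inA[OF z(1,2)] ss(2) chart_inj[OF chart z(1) v(1)] v(2) show "y \<in> A - {\<phi> v}" by auto
      qed
    qed (use A(1) in auto)
    ultimately show "\<exists>f. (\<forall>u'\<in>tnb b v - {u}. Msg v u' (f u')) \<and>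
        best r (x (\<phi> v)) (tnb b v - {u}) (\<lambda>u'. tree_weight (pull \<phi> w) v u' - f u')"
      by (intro exI[of _ ?f]) auto
  qed
  obtain p c where pc: "v = p @ [c]" using v(2) by (metis rev_exhaust)
  then have p: "p \<in> tree_verts b" "c < b p" "length p < L" using v by (auto simp: tree_verts_snoc)
  let ?f = "\<lambda>u'. marginal g w x (verts g - {\<phi> p}) (\<phi> u')"
  have pv: "\<phi> p \<in> verts g" using chart_verts[OF chart p(1)] p(3) by simp
  have msg: "Msg p u' (?f u')" if u': "u' \<in> tnb b p" for u'
    unfolding Msg_def
  proof (intro conjI exI[of _ "verts g - {\<phi> p}"])
    have t: "u' \<in> tree_verts b" "length u' \<le> L" using tnb_in_tree[OF p(1) u'] length_tnb[OF u'] p(3) by auto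
    have ne: "u' \<noteq> p" using u' tnb_irrefl by blast
    have ps: "p \<notin> side p u'"
    proof -
      have "\<not> (\<exists>r. p = u' @ r)" if "u' = p @ [i]" for i using that by auto
      then show ?thesis using u' by (auto simp: tnb_def side_def split: if_splits)
    qed
    show "p \<in> tnb b u'" using tnb_sym u' p(1) by blast
    show "\<phi> u' \<in> verts g - {\<phi> p}" using chart_verts[OF chart t] ne chart_inj[OF chart t(1) p(1) t(2)] p(3) by auto
    show "\<phi> ` {z \<in> tree_verts b. length z \<le> L \<and> z \<in> side p u'} \<subseteq> verts g - {\<phi> p}"
    proof
      fix y assume "y \<in> \<phi> ` {z \<in> tree_verts b. length z \<le> L \<and> z \<in> side p u'}"
      then obtain z where z: "z \<in> tree_verts b" "length z \<le> L" "z \<in> side p u'" "y = \<phi> z" by auto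
      then have "z \<noteq> p" using ps by auto
      with z chart_verts[OF chart z(1,2)] chart_inj[OF chart z(1) p(1)] p(3) show "y \<in> verts g - {\<phi> p}" by auto
    qed
  qed auto
  define r where "r = Max (insert (x (\<phi> p)) ((\<lambda>u'. tree_weight (pull \<phi> w) p u' - ?f u') ` (tnb b p - {v})))"
  have r: "best r (x (\<phi> p)) (tnb b p - {v}) (\<lambda>u'. tree_weight (pull \<phi> w) p u' - ?f u')"
    unfolding r_def by (rule best_Max) (simp add: tnb_finite)
  have db: "down b (pull \<phi> w) (\<lambda>v. x (\<phi> v)) (\<lambda>s. zmsg b (pull \<phi> w) (\<lambda>v. x (\<phi> v)) (2 * k + of_bool s)) False v \<le> r"
    "r \<le> down b (pull \<phi> w) (\<lambda>v. x (\<phi> v)) (\<lambda>s. zmsg b (pull \<phi> w) (\<lambda>v. x (\<phi> v)) (2 * k + of_bool s)) True v"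
    using down_bounds[of p c ?f r k] msg r p(1) v(3) unfolding pc by auto
  have vp: "v \<in> tnb b p" using p(2) pc by (auto simp: tnb_def)
  have zb: "zmsg b (pull \<phi> w) (\<lambda>v. x (\<phi> v)) (2 * k) v \<le> ?f v" "?f v \<le> zmsg b (pull \<phi> w) (\<lambda>v. x (\<phi> v)) (2 * k + 1) v"
    using zmsg_bounds[of v "?f v" "2 * k"] zmsg_bounds[of v "?f v" "2 * k + 1"] msg[OF vp] pc v by auto
  have ev: "{\<phi> p, \<phi> u'} \<in> edges g" "\<phi> u' \<in> verts g" if "u' \<in> tnb b p" for u'
    using chart_nbrs[OF chart p(1,3)] that rooted_edge(2)[OF rooted] by blast+
  have wv: "pull \<phi> w v = w {\<phi> p, \<phi> v}" by (simp add: pull_def pc)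
  have marg_ge: "r \<le> marginal g w x (verts g) (\<phi> p)"
    using r marginal_ge[OF order_refl pv] ev unfolding best_def
    by (auto simp: tree_weight_pull)
  have v_le: "w {\<phi> p, \<phi> v} - ?f v \<le> marginal g w x (verts g) (\<phi> p)"
    using marginal_ge(2)[OF order_refl pv] ev[OF vp] by blast
  note cases = marginal_cases[OF optimal_within[OF opt] order_refl pv]
  have config: "md_config g M" using opt by (simp add: optimal_md_def)
  show "edge_no b (pull \<phi> w) (\<lambda>v. x (\<phi> v)) k v \<Longrightarrow> {\<phi> (butlast v), \<phi> v} \<notin> M"
  proof
    assume no: "edge_no b (pull \<phi> w) (\<lambda>v. x (\<phi> v)) k v" and "{\<phi> (butlast v), \<phi> v} \<in> M"
    then have e: "{\<phi> p, \<phi> v} \<in> M" by (simp add: pc)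
    from cases have "marginal g w x (verts g) (\<phi> p) = w {\<phi> p, \<phi> v} - ?f v"
    proof
      assume "\<exists>u\<in>verts g. {\<phi> p, u} \<in> M \<and> {\<phi> p, u} \<in> edges g \<and>
        marginal g w x (verts g) (\<phi> p) = w {\<phi> p, u} - marginal g w x (verts g - {\<phi> p}) u"
      then obtain u where u: "{\<phi> p, u} \<in> M"
        "marginal g w x (verts g) (\<phi> p) = w {\<phi> p, u} - marginal g w x (verts g - {\<phi> p}) u" by auto
      then have "{\<phi> p, u} = {\<phi> p, \<phi> v}" using md_config_unique[OF config pv u(1) e] by simp
      then have "u = \<phi> v" by (auto simp: doubleton_eq_iff)
      with u(2) show ?thesis by simp
    qed (use e in auto)
    with marg_ge db zb no wv show False by (simp add: edge_no_def)
  qed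
  show "edge_yes b (pull \<phi> w) (\<lambda>v. x (\<phi> v)) k v \<Longrightarrow> {\<phi> (butlast v), \<phi> v} \<in> M"
  proof (rule ccontr)
    assume yes: "edge_yes b (pull \<phi> w) (\<lambda>v. x (\<phi> v)) k v" and "{\<phi> (butlast v), \<phi> v} \<notin> M"
    then have ne: "{\<phi> p, \<phi> v} \<notin> M" by (simp add: pc)
    from cases have "marginal g w x (verts g) (\<phi> p) \<le> r"
    proof (elim disjE conjE bexE)
      assume "marginal g w x (verts g) (\<phi> p) = x (\<phi> p)"
      then show ?thesis using r by (simp add: best_def)
    next
      fix u assume u: "{\<phi> p, u} \<in> M" "{\<phi> p, u} \<in> edges g"
        "marginal g w x (verts g) (\<phi> p) = w {\<phi> p, u} - marginal g w x (verts g - {\<phi> p}) u"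
      then obtain u' where u': "u' \<in> tnb b p" "u = \<phi> u'" using chart_nbrs[OF chart p(1,3)] by blast
      then have "u' \<noteq> v" using u(1) ne by auto
      with r u' have "tree_weight (pull \<phi> w) p u' - ?f u' \<le> r" by (auto simp: best_def)
      with u(3) u' show ?thesis by (simp add: tree_weight_pull)
    qed
    with v_le db zb yes wv show False by (simp add: edge_yes_def)
  qed
qed

section \<open>Configurations defined by messages\<close>

lemma finite_nbrs: "rooted_graph g \<Longrightarrow> v \<in> verts g \<Longrightarrow> finite {u. {v, u} \<in> edges g}"
proof -
  assume "rooted_graph g" "v \<in> verts g"
  then have "finite {u. {u, v} \<in> edges g}" unfolding rooted_graph_def by blast
  moreover have "{v, u} = {u, v}" for u by (rule insert_commute)
  ultimately show ?thesis by simp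
qed

lemma messages_best:
  assumes g: "rooted_graph g" and Z: "is_messages g w x Z" and e: "{u, v} \<in> edges g"
  shows "best (Z (u, v)) (x v) ({u'. {v, u'} \<in> edges g} - {u}) (\<lambda>u'. w {v, u'} - Z (v, u'))"
proof -
  have "finite {u'. {v, u'} \<in> edges g}" using finite_nbrs[OF g] rooted_edge(2)[OF g e] by simp
  then have f: "finite ({u'. {v, u'} \<in> edges g} - {u})" by simp
  have eq: "{w {v, u'} - Z (v, u') |u'. {v, u'} \<in> edges g \<and> u' \<noteq> u} =
      (\<lambda>u'. w {v, u'} - Z (v, u')) ` ({u'. {v, u'} \<in> edges g} - {u})" by auto
  have "Z (u, v) = Max (insert (x v) {w {v, u'} - Z (v, u') |u'. {v, u'} \<in> edges g \<and> u' \<noteq> u})"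
    using Z e unfolding is_messages_def by blast
  then have zeq: "Z (u, v) = Max (insert (x v) ((\<lambda>u'. w {v, u'} - Z (v, u')) ` ({u'. {v, u'} \<in> edges g} - {u})))"
    unfolding eq .
  show ?thesis by (subst zeq) (rule best_Max[OF f])
qed

lemma chart_messages_system:
  assumes g: "rooted_graph g" and chart: "tree_chart L b \<phi> g" and Z: "is_messages g w x Z"
  shows "message_system L b (pull \<phi> w) (\<lambda>v. x (\<phi> v))
    (\<lambda>u v r. u \<in> tnb b v \<and> {\<phi> u, \<phi> v} \<in> edges g \<and> u \<in> tree_verts b \<and> length u \<le> L \<and> r = Z (\<phi> u, \<phi> v))"
proof
  show "x (\<phi> v) \<le> r" if "u \<in> tnb b v \<and> {\<phi> u, \<phi> v} \<in> edges g \<and> u \<in> tree_verts b \<and> length u \<le> L \<and> r = Z (\<phi> u, \<phi> v)" for u v r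
    using messages_best[OF g Z, of "\<phi> u" "\<phi> v"] that by (simp add: best_def)
  fix u v r
  assume a: "u \<in> tnb b v \<and> {\<phi> u, \<phi> v} \<in> edges g \<and> u \<in> tree_verts b \<and> length u \<le> L \<and> r = Z (\<phi> u, \<phi> v)"
    and v: "v \<in> tree_verts b" "length v < L"
  have tn: "z \<in> tree_verts b" "length z \<le> L" if "z \<in> tnb b v" for z
    using tnb_in_tree[OF v(1) that] length_tnb[OF that] v(2) by auto
  have "{u'. {\<phi> v, u'} \<in> edges g} = \<phi> ` tnb b v"
    using chart v unfolding tree_chart_def by simp
  moreover have "\<phi> ` tnb b v - {\<phi> u} = \<phi> ` (tnb b v - {u})"
    using a tn chart_inj[OF chart] by auto
  ultimately have "best r (x (\<phi> v)) (tnb b v - {u}) (\<lambda>u'. w {\<phi> v, \<phi> u'} - Z (\<phi> v, \<phi> u'))"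
    using messages_best[OF g Z, of "\<phi> u" "\<phi> v"] a by (simp add: best_image)
  then have "best r (x (\<phi> v)) (tnb b v - {u}) (\<lambda>u'. tree_weight (pull \<phi> w) v u' - Z (\<phi> v, \<phi> u'))"
    by (subst best_cong) (auto simp: tree_weight_pull)
  moreover have "v \<in> tnb b u' \<and> {\<phi> v, \<phi> u'} \<in> edges g \<and> v \<in> tree_verts b \<and> length v \<le> L" if "u' \<in> tnb b v - {u}" for u'
    using that v tnb_sym[of u' b v] chart_nbrs[OF chart v] by auto
  ultimately show "\<exists>f. (\<forall>u'\<in>tnb b v - {u}. v \<in> tnb b u' \<and> {\<phi> v, \<phi> u'} \<in> edges g \<and> v \<in> tree_verts b \<and> length v \<le> L \<and> f u' = Z (\<phi> v, \<phi> u'))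
      \<and> best r (x (\<phi> v)) (tnb b v - {u}) (\<lambda>u'. tree_weight (pull \<phi> w) v u' - f u')"
    by (intro exI[of _ "\<lambda>u'. Z (\<phi> v, \<phi> u')"]) blast
qed

lemma messages_bounds:
  assumes g: "rooted_graph g" and chart: "tree_chart L b \<phi> g" and Z: "is_messages g w x Z"
    and v: "v \<in> tree_verts b" "v \<noteq> []" "length v + 2 * k + 1 \<le> L"
  defines "W \<equiv> pull \<phi> w" and "X \<equiv> \<lambda>v. x (\<phi> v)"
  shows "zmsg b W X (2 * k) v \<le> Z (\<phi> (butlast v), \<phi> v)" "Z (\<phi> (butlast v), \<phi> v) \<le> zmsg b W X (2 * k + 1) v"
    "down b W X (\<lambda>s. zmsg b W X (2 * k + of_bool s)) False v \<le> Z (\<phi> v, \<phi> (butlast v))"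
    "Z (\<phi> v, \<phi> (butlast v)) \<le> down b W X (\<lambda>s. zmsg b W X (2 * k + of_bool s)) True v"
proof -
  interpret message_system L b "pull \<phi> w" "\<lambda>v. x (\<phi> v)"
    "\<lambda>u v r. u \<in> tnb b v \<and> {\<phi> u, \<phi> v} \<in> edges g \<and> u \<in> tree_verts b \<and> length u \<le> L \<and> r = Z (\<phi> u, \<phi> v)"
    by (rule chart_messages_system[OF g chart Z])
  obtain p c where pc: "v = p @ [c]" using v(2) by (metis rev_exhaust)
  then have p: "p \<in> tree_verts b" "c < b p" "length p < L" using v by (auto simp: tree_verts_snoc)
  have vp: "v \<in> tnb b p" using p(2) pc by (auto simp: tnb_def)
  have pv: "p \<in> tnb b v" using pc by (simp add: tnb_def)
  have e: "{\<phi> p, \<phi> v} \<in> edges g" using chart_nbrs[OF chart p(1,3)] vp by blast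
  have m1: "p \<in> tnb b v \<and> {\<phi> p, \<phi> v} \<in> edges g \<and> p \<in> tree_verts b \<and> length p \<le> L \<and> Z (\<phi> p, \<phi> v) = Z (\<phi> p, \<phi> v)"
    using pv e p by simp
  show "zmsg b W X (2 * k) v \<le> Z (\<phi> (butlast v), \<phi> v)" "Z (\<phi> (butlast v), \<phi> v) \<le> zmsg b W X (2 * k + 1) v"
    using zmsg_bounds[of v "Z (\<phi> p, \<phi> v)" "2 * k"] zmsg_bounds[of v "Z (\<phi> p, \<phi> v)" "2 * k + 1"] m1 pc v
    unfolding W_def X_def by auto
  have m2: "v \<in> tnb b p \<and> {\<phi> v, \<phi> p} \<in> edges g \<and> v \<in> tree_verts b \<and> length v \<le> L \<and> Z (\<phi> v, \<phi> p) = Z (\<phi> v, \<phi> p)"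
    using vp e v by (simp add: insert_commute)
  from step[OF m2 p(1,3) vp] obtain f where
    f: "\<And>u'. u' \<in> tnb b p - {v} \<Longrightarrow> p \<in> tnb b u' \<and> {\<phi> p, \<phi> u'} \<in> edges g \<and> p \<in> tree_verts b \<and> length p \<le> L \<and> f u' = Z (\<phi> p, \<phi> u')"
    and r: "best (Z (\<phi> v, \<phi> p)) (x (\<phi> p)) (tnb b p - {v}) (\<lambda>u'. tree_weight (pull \<phi> w) p u' - f u')"
    by blast
  have "length p + 2 * k + 2 \<le> L" using v(3) pc by simp
  from down_bounds[OF f[unfolded pc] r[unfolded pc] p(1) this]
  show "down b W X (\<lambda>s. zmsg b W X (2 * k + of_bool s)) False v \<le> Z (\<phi> v, \<phi> (butlast v))"
    "Z (\<phi> v, \<phi> (butlast v)) \<le> down b W X (\<lambda>s. zmsg b W X (2 * k + of_bool s)) True v"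
    unfolding W_def X_def pc by simp_all
qed

lemma message_md_iff:
  assumes "\<exists>!Z. is_messages g w x Z" and Z: "is_messages g w x Z"
  shows "{u, v} \<in> message_md g w x \<longleftrightarrow> {u, v} \<in> edges g \<and> Z (u, v) + Z (v, u) < w {u, v}"
proof -
  have "(THE Z. is_messages g w x Z) = Z" by (rule the1_equality[of "is_messages g w x", OF assms(1) Z])
  then have M: "message_md g w x = {{u, v} | u v. {u, v} \<in> edges g \<and> w {u, v} > Z (u, v) + Z (v, u)}"
    using assms(1) by (simp add: message_md_def Let_def)
  show ?thesis
  proof
    assume "{u, v} \<in> message_md g w x"
    then obtain a b where ab: "{u, v} = {a, b}" "{a, b} \<in> edges g" "w {a, b} > Z (a, b) + Z (b, a)"
      unfolding M by blast
    from ab(1) consider "u = a" "v = b" | "u = b" "v = a" by (auto simp: doubleton_eq_iff)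
    then show "{u, v} \<in> edges g \<and> Z (u, v) + Z (v, u) < w {u, v}"
      using ab by cases (auto simp: insert_commute add.commute)
  qed (unfold M, blast)
qed

lemma message_edge_decision:
  assumes g: "rooted_graph g" and chart: "tree_chart L b \<phi> g" and ex: "\<exists>!Z. is_messages g w x Z"
    and v: "v \<in> tree_verts b" "v \<noteq> []" "length v + 2 * k + 1 \<le> L"
  shows "edge_yes b (pull \<phi> w) (\<lambda>v. x (\<phi> v)) k v \<Longrightarrow> {\<phi> (butlast v), \<phi> v} \<in> message_md g w x"
    and "edge_no b (pull \<phi> w) (\<lambda>v. x (\<phi> v)) k v \<Longrightarrow> {\<phi> (butlast v), \<phi> v} \<notin> message_md g w x"
proof -
  obtain Z where Z: "is_messages g w x Z" using ex by blast
  obtain p c where pc: "v = p @ [c]" using v(2) by (metis rev_exhaust)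
  then have p: "p \<in> tree_verts b" "c < b p" "length p < L" using v by (auto simp: tree_verts_snoc)
  then have "{\<phi> p, \<phi> v} \<in> edges g" using chart_nbrs[OF chart p(1,3)] pc by (auto simp: tnb_def)
  then have "{\<phi> (butlast v), \<phi> v} \<in> edges g" using pc by simp
  note * = messages_bounds[OF g chart Z v] message_md_iff[OF ex Z, of "\<phi> (butlast v)" "\<phi> v"] this
  show "edge_yes b (pull \<phi> w) (\<lambda>v. x (\<phi> v)) k v \<Longrightarrow> {\<phi> (butlast v), \<phi> v} \<in> message_md g w x"
    using * by (simp add: edge_yes_def pull_def)
  show "edge_no b (pull \<phi> w) (\<lambda>v. x (\<phi> v)) k v \<Longrightarrow> {\<phi> (butlast v), \<phi> v} \<notin> message_md g w x"
    using * by (simp add: edge_no_def pull_def)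
qed

lemma offspring_tree_edge:
  "{u, v} \<in> edges (offspring_tree b) \<longleftrightarrow> u \<in> tree_verts b \<and> v \<in> tnb b u"
proof
  assume "{u, v} \<in> edges (offspring_tree b)"
  then obtain a k where a: "{u, v} = {a, a @ [k]}" "a \<in> tree_verts b" "k < b a"
    unfolding offspring_tree_def by auto
  from a(1) consider "u = a" "v = a @ [k]" | "u = a @ [k]" "v = a" by (auto simp: doubleton_eq_iff)
  then show "u \<in> tree_verts b \<and> v \<in> tnb b u"
    using a(2,3) by cases (auto simp: tnb_def tree_verts_snoc)
next
  assume uv: "u \<in> tree_verts b \<and> v \<in> tnb b u"
  then consider (a) i where "v = u @ [i]" "i < b u" | (b) "v = butlast u" "u \<noteq> []"
    by (auto simp: tnb_def split: if_splits)
  then show "{u, v} \<in> edges (offspring_tree b)"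
  proof cases
    case a
    then show ?thesis using uv unfolding offspring_tree_def by auto
  next
    case b
    then have u: "u = v @ [last u]" by simp
    then have "v \<in> tree_verts b \<and> last u < b v" using uv by (metis tree_verts_snoc)
    moreover have "{u, v} = {v, v @ [last u]}" using u by (metis insert_commute)
    ultimately show ?thesis unfolding offspring_tree_def by auto
  qed
qed

lemma verts_offspring [simp]: "verts (offspring_tree b) = tree_verts b" "root (offspring_tree b) = []"
  by (simp_all add: offspring_tree_def)

lemma offspring_tree_chart: "tree_chart L b (\<lambda>v. v) (offspring_tree b)"
  unfolding tree_chart_def by (auto simp: offspring_tree_edge)

lemma down_const_flag: "down b W X (\<lambda>_. z) s v = down b W X (\<lambda>_. z) s' v"
proof (induction v arbitrary: s s' rule: rev_induct)
  case Nil
  then show ?case by (simp add: down.simps)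
next
  case (snoc c p)
  have "down b W X (\<lambda>_. z) (\<not> s) p = down b W X (\<lambda>_. z) (\<not> s') p" by (rule snoc)
  then have "above b W X (\<lambda>_. z) s p = above b W X (\<lambda>_. z) s' p" by (simp only: above_def)
  then show ?case by (simp only: down_snoc)
qed

text \<open>Existence: once the bounds agree, \<open>zlo\<close> towards the root and
  \<open>down\<close> away from it solve the recursion. Uniqueness: any family of messages lies
  between the truncated bounds of every order, and these have a common limit.\<close>

lemma messages_exist_unique:
  assumes z: "\<And>v. zlo b W X v = zhi b W X v" and W: "\<And>v. v \<noteq> [] \<Longrightarrow> W v = w {butlast v, v}"
  defines "D \<equiv> down b W X (\<lambda>_. zlo b W X) True"
  obtains Z where "is_messages (offspring_tree b) w X Z" "\<exists>!Z. is_messages (offspring_tree b) w X Z"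
    "\<And>v. v \<in> tree_verts b \<Longrightarrow> v \<noteq> [] \<Longrightarrow> Z (butlast v, v) = zlo b W X v"
    "\<And>v. v \<in> tree_verts b \<Longrightarrow> v \<noteq> [] \<Longrightarrow> Z (v, butlast v) = D v"
proof -
  let ?g = "offspring_tree b" and ?z = "zlo b W X"
  have g: "rooted_graph ?g" by (rule rooted_graph_offspring_tree)
  define Z where "Z = (\<lambda>(u, v). if {u, v} \<in> edges ?g then (if u \<noteq> [] \<and> v = butlast u then D u else ?z v) else undefined)"
  have zrec: "?z v = vmax (X v) (b v) (\<lambda>i. W (v @ [i]) - ?z (v @ [i]))" for v
    using zlo_rec[of b W X v] z by simp
  have e1: "{butlast v, v} \<in> edges ?g" if "v \<in> tree_verts b" "v \<noteq> []" for v
    using that by (subst insert_commute) (simp add: offspring_tree_edge tnb_def)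
  \<comment> \<open>No vertex is its own grandparent, so for pairs directed to the child the case
    distinction in \<open>Z\<close> takes its second branch.\<close>
  have bb: "v \<noteq> butlast (butlast v)" if "v \<noteq> []" for v :: "nat list"
  proof
    assume "v = butlast (butlast v)"
    then have "length v = length (butlast (butlast v))" by (rule arg_cong)
    moreover have "0 < length v" using that by simp
    ultimately show False unfolding length_butlast by linarith
  qed
  have Zdn: "Z (butlast v, v) = ?z v" if "v \<in> tree_verts b" "v \<noteq> []" for v
    using e1[OF that] bb[OF that(2)] by (simp add: Z_def)
  have Zup: "Z (v, butlast v) = D v" if "v \<in> tree_verts b" "v \<noteq> []" for v
    using e1[OF that] that by (simp add: Z_def insert_commute)
  have nb: "{u'. {v, u'} \<in> edges ?g} = tnb b v" if "v \<in> tree_verts b" for v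
    using that by (auto simp: offspring_tree_edge)
  have best: "best (Z (u, v)) (X v) (tnb b v - {u}) (\<lambda>u'. w {v, u'} - Z (v, u'))"
    if e: "{u, v} \<in> edges ?g" for u v
  proof -
    have uv: "u \<in> tree_verts b" "v \<in> tnb b u" using e by (auto simp: offspring_tree_edge)
    have vt: "v \<in> tree_verts b" using tnb_in_tree[OF uv] .
    have kid: "w {v, v @ [i]} - Z (v, v @ [i]) = W (v @ [i]) - ?z (v @ [i])" if "i < b v" for i
      using Zdn[of "v @ [i]"] W[of "v @ [i]"] vt that by (simp add: tree_verts_snoc)
    have par: "w {v, butlast v} - Z (v, butlast v) = W v - D v" if "v \<noteq> []"
      using Zup[OF vt that] W[OF that] by (simp add: insert_commute)
    from uv(2) consider (down) c where "v = u @ [c]" "c < b u" | (up) "v = butlast u" "u \<noteq> []"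
      by (auto simp: tnb_def split: if_splits)
    then show ?thesis
    proof cases
      case down
      then have v: "v \<noteq> []" "u = butlast v" by auto
      have S: "tnb b v - {u} = (\<lambda>i. v @ [i]) ` {..<b v}" using tnb_minus_parent[OF v(1)] v(2) by simp
      have "best (?z v) (X v) {..<b v} (\<lambda>i. W (v @ [i]) - ?z (v @ [i]))"
        unfolding zrec[of v] vmax_def by (rule best_Max) simp
      then have "best (?z v) (X v) {..<b v} (\<lambda>i. w {v, v @ [i]} - Z (v, v @ [i]))"
        by (subst best_cong) (auto simp: kid)
      then show ?thesis using Zdn[OF vt v(1)] v unfolding S best_image by simp
    next
      case up
      then obtain c where c: "u = v @ [c]" by (metis append_butlast_last_id)
      let ?a = "above b W X (\<lambda>_. ?z) True v"
      have S: "tnb b v - {u} = (\<lambda>i. v @ [i]) ` ({..<b v} - {c}) \<union> (if v = [] then {} else {butlast v})"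
        unfolding c by (rule tnb_minus_child)
      have a: "?a = (if v = [] then X v else max (X v) (W v - D v))"
        unfolding above_def D_def using down_const_flag[of b W X ?z False v True] by simp
      let ?h = "\<lambda>i. if i = c then ?a else W (v @ [i]) - ?z (v @ [i])"
      have D: "D u = vmax ?a (b v) ?h" unfolding D_def c by (simp add: down_snoc cong: if_cong)
      have "Z (u, v) = D u" using Zup[OF uv(1) up(2)] up by simp
      moreover have "best (D u) (X v) (tnb b v - {u}) (\<lambda>u'. w {v, u'} - Z (v, u'))"
        unfolding best_def
      proof (intro conjI ballI)
        have ga: "?a \<le> D u" unfolding D by (rule vmax_ge_base)
        then show "X v \<le> D u" unfolding a by (auto split: if_splits)
        show "w {v, u'} - Z (v, u') \<le> D u" if "u' \<in> tnb b v - {u}" for u'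
        proof -
          from that consider (k) i where "u' = v @ [i]" "i < b v" "i \<noteq> c" | (p) "u' = butlast v" "v \<noteq> []"
            unfolding S by (auto split: if_splits)
          then show ?thesis
          proof cases
            case k
            have "?h i \<le> D u" unfolding D using k(2) by (rule vmax_ge)
            with k kid[OF k(2)] show ?thesis by simp
          next
            case p
            with ga a par[OF p(2)] show ?thesis by simp
          qed
        qed
        have at: "?a = X v \<or> (v \<noteq> [] \<and> ?a = W v - D v)" unfolding a by (auto simp: max_def)
        show "D u = X v \<or> (\<exists>u'\<in>tnb b v - {u}. D u = w {v, u'} - Z (v, u'))"
        proof -
          from vmax_attained[of ?a "b v" ?h]
          have "D u = ?a \<or> (\<exists>i<b v. i \<noteq> c \<and> D u = W (v @ [i]) - ?z (v @ [i]))"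
            unfolding D by (auto split: if_splits)
          then show ?thesis
          proof (elim disjE exE conjE)
            assume "D u = ?a"
            with at show ?thesis
            proof (elim disjE conjE)
              assume "v \<noteq> []" "?a = W v - D v" "D u = ?a"
              then show ?thesis using par unfolding S by auto
            qed simp
          next
            fix i assume i: "i < b v" "i \<noteq> c" "D u = W (v @ [i]) - ?z (v @ [i])"
            then have "v @ [i] \<in> tnb b v - {u}" unfolding S by simp
            with i kid[OF i(1)] show ?thesis by (intro disjI2 bexI[of _ "v @ [i]"]) auto
          qed
        qed
      qed
      ultimately show ?thesis by simp
    qed
  qed
  have isZ: "is_messages ?g w X Z"
    unfolding is_messages_def
  proof (intro conjI allI impI)
    show "Z \<in> extensional {(u, v). {u, v} \<in> edges ?g}" by (auto simp: extensional_def Z_def)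
    fix u v assume e: "{u, v} \<in> edges ?g"
    have vt: "v \<in> tree_verts b" using e by (subst (asm) insert_commute) (simp add: offspring_tree_edge)
    have "{w {v, u'} - Z (v, u') |u'. {v, u'} \<in> edges ?g \<and> u' \<noteq> u} = (\<lambda>u'. w {v, u'} - Z (v, u')) ` (tnb b v - {u})"
      using nb[OF vt] by auto
    with best_imp_Max[OF _ best[OF e]] show "Z (u, v) = Max (insert (X v) {w {v, u'} - Z (v, u') |u'. {v, u'} \<in> edges ?g \<and> u' \<noteq> u})"
      by (simp add: tnb_finite)
  qed
  have uniq: "Z' = Z" if Z': "is_messages ?g w X Z'" for Z'
  proof
    have pull: "pull (\<lambda>v. v) w v = W v" if "v \<noteq> []" for v using W[OF that] by (simp add: pull_def)
    define W' where "W' = pull (\<lambda>v. v) w"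
    have W': "W' v = W v" if "v \<noteq> []" for v using pull[OF that] by (simp add: W'_def)
    have zW: "zmsg b W' X n = zmsg b W X n" for n by (rule ext, rule zmsg_cong) (auto intro: W')
    have dW: "down b W' X d s v = down b W X d s v" for d s v
      by (rule down_cong) (auto intro: W')
    have dn: "Z' (butlast v, v) = ?z v" and up: "Z' (v, butlast v) = D v" if v: "v \<in> tree_verts b" "v \<noteq> []" for v
    proof -
      have "zmsg b W X (2 * k) v \<le> Z' (butlast v, v) \<and> Z' (butlast v, v) \<le> zmsg b W X (2 * k + 1) v
        \<and> down b W X (\<lambda>s. zmsg b W X (2 * k + of_bool s)) False v \<le> Z' (v, butlast v)
        \<and> Z' (v, butlast v) \<le> down b W X (\<lambda>s. zmsg b W X (2 * k + of_bool s)) True v" for k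
        using messages_bounds[OF g offspring_tree_chart Z' v order_refl, of k, folded W'_def] by (simp only: zW dW)
      note bd = this
      have d: "(\<lambda>k. zmsg b W X (2 * k + of_bool s) v) \<longlonglongrightarrow> ?z v" for s v
        using tendsto_zlo[of b W X v] tendsto_zhi[of b W X v] z by (cases s) auto
      have "?z v \<le> Z' (butlast v, v)" by (rule LIMSEQ_le_const2[OF d[of False]]) (use bd in auto)
      moreover have "Z' (butlast v, v) \<le> ?z v" by (rule LIMSEQ_le_const[OF d[of True]]) (use bd in auto)
      ultimately show "Z' (butlast v, v) = ?z v" by simp
      have dd: "(\<lambda>k. down b W X (\<lambda>s. zmsg b W X (2 * k + of_bool s)) s v) \<longlonglongrightarrow> down b W X (\<lambda>_. ?z) s v" for s
        by (rule tendsto_down) (rule d)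
      have "down b W X (\<lambda>_. ?z) False v \<le> Z' (v, butlast v)" by (rule LIMSEQ_le_const2[OF dd[of False]]) (use bd in auto)
      moreover have "Z' (v, butlast v) \<le> down b W X (\<lambda>_. ?z) True v" by (rule LIMSEQ_le_const[OF dd[of True]]) (use bd in auto)
      ultimately show "Z' (v, butlast v) = D v"
        unfolding D_def using down_const_flag[of b W X ?z False v True] by simp
    qed
    fix y show "Z' y = Z y"
    proof (cases y)
      case (Pair u v)
      show ?thesis
      proof (cases "{u, v} \<in> edges ?g")
        case True
        then have uv: "u \<in> tree_verts b" "v \<in> tnb b u" by (auto simp: offspring_tree_edge)
        then have vt: "v \<in> tree_verts b" by (rule tnb_in_tree)
        from uv(2) consider c where "v = u @ [c]" "c < b u" | "v = butlast u" "u \<noteq> []"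
          by (auto simp: tnb_def split: if_splits)
        then show ?thesis
        proof cases
          case 1
          then show ?thesis using dn[OF vt] Zdn[OF vt] Pair by simp
        next
          case 2
          then show ?thesis using up[OF uv(1)] Zup[OF uv(1)] Pair by simp
        qed
      next
        case False
        then show ?thesis using Z' isZ Pair unfolding is_messages_def extensional_def by simp
      qed
    qed
  qed
  show ?thesis
  proof (rule that[OF isZ])
    show "\<exists>!Z. is_messages ?g w X Z" using isZ uniq by blast
  qed (fact Zdn Zup)+
qed

section \<open>Balls and charts\<close>

text \<open>The root must be a vertex, because the bijection can be inverted on vertices
  only.\<close>

lemma mdgraph_iso_sym:
  assumes "G \<cong>\<^sub>r G'" and root: "root (fst G) \<in> verts (fst G)"
  shows "G' \<cong>\<^sub>r G"
proof -
  obtain g M g' M' where G: "G = (g, M)" "G' = (g', M')" by (cases G, cases G') auto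
  obtain \<phi> where \<phi>: "bij_betw \<phi> (verts g) (verts g')" "\<phi> (root g) = root g'"
    "\<forall>u\<in>verts g. \<forall>v\<in>verts g. ({u, v} \<in> edges g \<longleftrightarrow> {\<phi> u, \<phi> v} \<in> edges g')
       \<and> ({u, v} \<in> M \<longleftrightarrow> {\<phi> u, \<phi> v} \<in> M')"
    using assms unfolding G mdgraph_iso_def by auto
  define \<psi> where "\<psi> = inv_into (verts g) \<phi>"
  have inj: "inj_on \<phi> (verts g)" using \<phi>(1) by (simp add: bij_betw_def)
  have inv: "\<phi> (\<psi> y) = y" "\<psi> y \<in> verts g" if "y \<in> verts g'" for y
    using \<phi>(1) that by (auto simp: \<psi>_def bij_betw_def f_inv_into_f intro: inv_into_into)
  have "bij_betw \<psi> (verts g') (verts g)" unfolding \<psi>_def by (rule bij_betw_inv_into[OF \<phi>(1)])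
  moreover have "\<psi> (root g') = root g"
    unfolding \<psi>_def \<phi>(2)[symmetric] using root G by (intro inv_into_f_f inj) simp
  moreover have "\<forall>u\<in>verts g'. \<forall>v\<in>verts g'. ({u, v} \<in> edges g' \<longleftrightarrow> {\<psi> u, \<psi> v} \<in> edges g)
      \<and> ({u, v} \<in> M' \<longleftrightarrow> {\<psi> u, \<psi> v} \<in> M)"
  proof (intro ballI)
    fix u v assume "u \<in> verts g'" "v \<in> verts g'"
    with \<phi>(3)[rule_format, of "\<psi> u" "\<psi> v"] inv[of u] inv[of v]
    show "({u, v} \<in> edges g' \<longleftrightarrow> {\<psi> u, \<psi> v} \<in> edges g) \<and> ({u, v} \<in> M' \<longleftrightarrow> {\<psi> u, \<psi> v} \<in> M)" by simp
  qed
  ultimately show ?thesis unfolding G mdgraph_iso_def prod.case by blast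
qed

lemma root_in_ball: "rooted_graph g \<Longrightarrow> root g \<in> ball_verts H g"
  unfolding ball_verts_def rooted_graph_def by (auto intro!: exI[of _ 0])

lemma rball_simps: "verts (fst (rball H (g, M))) = ball_verts H g" "root (fst (rball H (g, M))) = root g"
  "edges (fst (rball H (g, M))) = {e\<in>edges g. e \<subseteq> ball_verts H g}" "snd (rball H (g, M)) = {e\<in>M. e \<subseteq> ball_verts H g}"
  by (simp_all add: rball_def)

lemma rball_iso_sym: "rball H (g, M) \<cong>\<^sub>r G' \<Longrightarrow> rooted_graph g \<Longrightarrow> G' \<cong>\<^sub>r rball H (g, M)"
  by (rule mdgraph_iso_sym) (simp_all add: rball_simps root_in_ball)

lemma rball_iso_iff:
  "rball H (g, M) \<cong>\<^sub>r rball H (g', M') \<longleftrightarrow> (\<exists>\<phi>. bij_betw \<phi> (ball_verts H g) (ball_verts H g') \<and> \<phi> (root g) = root g'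
     \<and> (\<forall>u\<in>ball_verts H g. \<forall>v\<in>ball_verts H g.
        ({u, v} \<in> edges g \<longleftrightarrow> {\<phi> u, \<phi> v} \<in> edges g') \<and> ({u, v} \<in> M \<longleftrightarrow> {\<phi> u, \<phi> v} \<in> M')))"
proof -
  have "(bij_betw \<phi> (ball_verts H g) (ball_verts H g') \<and> \<phi> (root g) = root g'
     \<and> (\<forall>u\<in>ball_verts H g. \<forall>v\<in>ball_verts H g.
        ({u, v} \<in> {e\<in>edges g. e \<subseteq> ball_verts H g} \<longleftrightarrow> {\<phi> u, \<phi> v} \<in> {e\<in>edges g'. e \<subseteq> ball_verts H g'})
        \<and> ({u, v} \<in> {e\<in>M. e \<subseteq> ball_verts H g} \<longleftrightarrow> {\<phi> u, \<phi> v} \<in> {e\<in>M'. e \<subseteq> ball_verts H g'})))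
    \<longleftrightarrow> (bij_betw \<phi> (ball_verts H g) (ball_verts H g') \<and> \<phi> (root g) = root g'
     \<and> (\<forall>u\<in>ball_verts H g. \<forall>v\<in>ball_verts H g.
        ({u, v} \<in> edges g \<longleftrightarrow> {\<phi> u, \<phi> v} \<in> edges g') \<and> ({u, v} \<in> M \<longleftrightarrow> {\<phi> u, \<phi> v} \<in> M')))" for \<phi>
  proof -
    have "\<phi> u \<in> ball_verts H g'" if "bij_betw \<phi> (ball_verts H g) (ball_verts H g')" "u \<in> ball_verts H g" for u
      using that by (auto simp: bij_betw_def)
    then show ?thesis by (intro conj_cong ball_cong refl) simp_all
  qed
  then show ?thesis unfolding mdgraph_iso_def rball_def by simp
qed

lemma chart_path:
  assumes chart: "tree_chart L b \<phi> g" and v: "v \<in> tree_verts b" "length v \<le> L"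
  shows "(root g, \<phi> v) \<in> {(a, b). {a, b} \<in> edges g} ^^ length v"
  using v
proof (induction v rule: rev_induct)
  case Nil
  then show ?case using chart by (simp add: tree_chart_def)
next
  case (snoc c p)
  then have p: "p \<in> tree_verts b" "c < b p" "length p < L" by (auto simp: tree_verts_snoc)
  then have "{\<phi> p, \<phi> (p @ [c])} \<in> edges g" using chart_nbrs[OF chart p(1,3)] by (auto simp: tnb_def)
  with snoc.IH p show ?case by (auto intro: relcompI)
qed

text \<open>A path of length at most \<open>h + 1\<close> leaves only vertices of level at most
  \<open>h\<close>, and at these the chart lists all neighbours; so the path stays in the image of
  the chart.\<close>

lemma ball_verts_chart:
  assumes g: "rooted_graph g" and chart: "tree_chart L b \<phi> g" and h: "h + 1 \<le> L"
  shows "ball_verts h g = \<phi> ` {v\<in>tree_verts b. length v \<le> h + 1}"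
proof (intro equalityI subsetI)
  let ?R = "{(a, b). {a, b} \<in> edges g}"
  have *: "\<exists>v\<in>tree_verts b. length v \<le> k \<and> z = \<phi> v" if "(root g, z) \<in> ?R ^^ k" "k \<le> h + 1" for k z
    using that
  proof (induction k arbitrary: z)
    case 0
    then show ?case using chart by (auto simp: tree_chart_def intro!: bexI[of _ "[]"] tree_verts_Nil)
  next
    case (Suc k)
    then obtain y where y: "(root g, y) \<in> ?R ^^ k" "{y, z} \<in> edges g" by auto
    with Suc obtain v where v: "v \<in> tree_verts b" "length v \<le> k" "y = \<phi> v" by auto
    with y(2) chart_nbrs[OF chart v(1)] Suc.prems h obtain u where u: "u \<in> tnb b v" "z = \<phi> u" by auto
    then show ?case using tnb_in_tree[OF v(1) u(1)] length_tnb[OF u(1)] v(2) by force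
  qed
  fix z assume "z \<in> ball_verts h g"
  then obtain k where "k \<le> h + 1" "(root g, z) \<in> ?R ^^ k" by (auto simp: ball_verts_def)
  with *[of z k] show "z \<in> \<phi> ` {v\<in>tree_verts b. length v \<le> h + 1}" by force
next
  fix z assume "z \<in> \<phi> ` {v\<in>tree_verts b. length v \<le> h + 1}"
  then obtain v where v: "v \<in> tree_verts b" "length v \<le> h + 1" "z = \<phi> v" by auto
  with chart_path[OF chart v(1)] chart_verts[OF chart v(1)] h show "z \<in> ball_verts h g"
    by (auto simp: ball_verts_def)
qed

text \<open>A neighbour of a vertex at level at most \<open>H\<close> is within distance
  \<open>H + 1\<close> of the root, hence in the ball; so the isomorphism sees all neighbours of
  such a vertex.\<close>

lemma chart_of_iso:
  assumes g: "rooted_graph g" and iso: "rball H (offspring_tree b, M) \<cong>\<^sub>r rball H (g, M')"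
  obtains \<phi> where "tree_chart (H + 1) b \<phi> g"
proof -
  let ?B = "{v\<in>tree_verts b. length v \<le> H + 1}"
  have B: "ball_verts H (offspring_tree b) = ?B"
    using ball_verts_chart[OF rooted_graph_offspring_tree offspring_tree_chart, of H "H + 1" b] by simp
  from iso obtain \<phi> where \<phi>: "bij_betw \<phi> ?B (ball_verts H g)" "\<phi> [] = root g"
    "\<And>u v. u \<in> ?B \<Longrightarrow> v \<in> ?B \<Longrightarrow> {u, v} \<in> edges (offspring_tree b) \<longleftrightarrow> {\<phi> u, \<phi> v} \<in> edges g"
    unfolding rball_iso_iff B by auto
  let ?R = "{(a, b). {a, b} \<in> edges g}"
  have path: "(root g, \<phi> v) \<in> ?R ^^ length v" if "v \<in> ?B" for v
    using that
  proof (induction v rule: rev_induct)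
    case Nil
    then show ?case using \<phi>(2) by simp
  next
    case (snoc c p)
    then have p: "p \<in> ?B" "c < b p" by (auto simp: tree_verts_snoc)
    then have "{p, p @ [c]} \<in> edges (offspring_tree b)" by (auto simp: offspring_tree_edge tnb_def)
    with \<phi>(3)[OF p(1) snoc.prems] snoc.IH[OF p(1)] show ?case by (auto intro: relcompI)
  qed
  have "tree_chart (H + 1) b \<phi> g"
    unfolding tree_chart_def
  proof (intro conjI ballI impI)
    show "\<phi> [] = root g" by fact
    show "inj_on \<phi> ?B" using \<phi>(1) by (simp add: bij_betw_def)
    show "\<phi> ` ?B \<subseteq> verts g" using \<phi>(1) by (auto simp: bij_betw_def ball_verts_def)
    fix v assume v: "v \<in> tree_verts b" "length v < H + 1"
    then have vB: "v \<in> ?B" by simp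
    show "{u. {\<phi> v, u} \<in> edges g} = \<phi> ` tnb b v"
    proof (intro equalityI subsetI)
      fix u assume "u \<in> {u. {\<phi> v, u} \<in> edges g}"
      then have u: "{\<phi> v, u} \<in> edges g" by simp
      then have "(root g, u) \<in> ?R ^^ Suc (length v)" using path[OF vB] by (auto intro: relcompI)
      then have "u \<in> ball_verts H g"
        using v(2) rooted_edge(2)[OF g u] unfolding ball_verts_def by (auto intro!: exI[of _ "Suc (length v)"])
      then obtain u' where u': "u' \<in> ?B" "u = \<phi> u'" using \<phi>(1) by (auto simp: bij_betw_def)
      with \<phi>(3)[OF vB u'(1)] u show "u \<in> \<phi> ` tnb b v" by (auto simp: offspring_tree_edge)
    next
      fix u assume "u \<in> \<phi> ` tnb b v"
      then obtain u' where u': "u' \<in> tnb b v" "u = \<phi> u'" by auto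
      have "u' \<in> ?B" using tnb_in_tree[OF v(1) u'(1)] length_tnb[OF u'(1)] v(2) by auto
      with \<phi>(3)[OF vB this] u' v(1) show "u \<in> {u. {\<phi> v, u} \<in> edges g}" by (auto simp: offspring_tree_edge)
    qed
  qed
  then show ?thesis by (rule that)
qed

text \<open>Each edge is named by its lower endpoint, so that a configuration becomes a set of
  labels. For arbitrary \<open>C\<close> the result need not be a monomer-dimer
  configuration.\<close>

definition config_of :: "(nat list \<Rightarrow> nat) \<Rightarrow> nat list set \<Rightarrow> nat list set set" where
  "config_of b C = {{butlast v, v} | v. v \<in> tree_verts b \<and> v \<noteq> [] \<and> v \<in> C}"

lemma parent_edge_inj:
  assumes "v \<noteq> []" "z \<noteq> []" "{butlast v, v} = {butlast z, z}"
  shows "v = z"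
proof (rule ccontr)
  assume "v \<noteq> z"
  with assms(3) have "v = butlast z" "z = butlast v" by (auto simp: doubleton_eq_iff)
  then have "length v = length z - 1" "length z = length v - 1" using length_butlast[of z] length_butlast[of v] by metis+
  moreover have "0 < length v" "0 < length z" using assms by simp_all
  ultimately show False by linarith
qed

lemma config_of_iff:
  "v \<in> tree_verts b \<Longrightarrow> v \<noteq> [] \<Longrightarrow> {butlast v, v} \<in> config_of b C \<longleftrightarrow> v \<in> C"
  unfolding config_of_def using parent_edge_inj by blast

lemma config_of_edges: "config_of b C \<subseteq> edges (offspring_tree b)"
proof
  fix e assume "e \<in> config_of b C"
  then obtain v where v: "e = {v, butlast v}" "v \<in> tree_verts b" "v \<noteq> []" by (auto simp: config_of_def)
  then show "e \<in> edges (offspring_tree b)" by (simp add: offspring_tree_edge tnb_def)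
qed

text \<open>Adjacency must also be known between two vertices at level \<open>h + 1\<close>; with
  \<open>h + 2 \<le> L\<close> these are interior to the chart.\<close>

lemma rball_iso_of_chart:
  assumes g: "rooted_graph g" and chart: "tree_chart L b \<phi> g" and h: "h + 2 \<le> L" and M: "M \<subseteq> edges g"
    and C: "\<And>v. v \<in> tree_verts b \<Longrightarrow> v \<noteq> [] \<Longrightarrow> length v \<le> h + 1 \<Longrightarrow> {\<phi> (butlast v), \<phi> v} \<in> M \<longleftrightarrow> v \<in> C"
  shows "rball h (offspring_tree b, config_of b C) \<cong>\<^sub>r rball h (g, M)"
  unfolding rball_iso_iff
proof (intro exI[of _ \<phi>] conjI ballI)
  let ?B = "{v\<in>tree_verts b. length v \<le> h + 1}"
  have B: "ball_verts h (offspring_tree b) = ?B"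
    using ball_verts_chart[OF rooted_graph_offspring_tree offspring_tree_chart, of h "h + 1" b] by simp
  have Bg: "ball_verts h g = \<phi> ` ?B" using h by (intro ball_verts_chart[OF g chart]) simp
  have "inj_on \<phi> ?B" using chart h by (auto simp: tree_chart_def inj_on_def)
  then show "bij_betw \<phi> (ball_verts h (offspring_tree b)) (ball_verts h g)" unfolding B Bg by (simp add: bij_betw_def)
  show "\<phi> (root (offspring_tree b)) = root g" using chart by (simp add: tree_chart_def)
  fix u v assume "u \<in> ball_verts h (offspring_tree b)" "v \<in> ball_verts h (offspring_tree b)"
  then have uv: "u \<in> tree_verts b" "length u \<le> h + 1" "v \<in> tree_verts b" "length v \<le> h + 1" unfolding B by auto
  show adj: "{u, v} \<in> edges (offspring_tree b) \<longleftrightarrow> {\<phi> u, \<phi> v} \<in> edges g"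
  proof -
    have "{\<phi> u, \<phi> v} \<in> edges g \<longleftrightarrow> (\<exists>u'\<in>tnb b u. \<phi> v = \<phi> u')"
      using uv h by (intro chart_nbrs[OF chart]) auto
    also have "\<dots> \<longleftrightarrow> v \<in> tnb b u"
    proof -
      have "\<phi> v = \<phi> u' \<longleftrightarrow> v = u'" if "u' \<in> tnb b u" for u'
        using uv h tnb_in_tree[OF uv(1) that] length_tnb[OF that] by (intro chart_inj[OF chart]) auto
      then show ?thesis by auto
    qed
    finally show ?thesis using uv(1) by (simp add: offspring_tree_edge)
  qed
  show "{u, v} \<in> config_of b C \<longleftrightarrow> {\<phi> u, \<phi> v} \<in> M"
  proof (cases "{u, v} \<in> edges (offspring_tree b)")
    case False
    then show ?thesis using adj M config_of_edges by blast
  next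
    case True
    then have "v \<in> tnb b u" by (simp add: offspring_tree_edge)
    then consider "u = butlast v" "v \<noteq> []" | "v = butlast u" "u \<noteq> []"
      by (auto simp: tnb_def split: if_splits)
    then show ?thesis
    proof cases
      case 1
      then show ?thesis using C[OF uv(3) _ uv(4)] config_of_iff[OF uv(3)] by simp
    next
      case 2
      then show ?thesis using C[OF uv(1) _ uv(2)] config_of_iff[OF uv(1)] by (simp add: insert_commute)
    qed
  qed
qed

section \<open>Dependence on finitely many labels, and pruned trees\<close>

lemma zmsg_tree_cong:
  assumes "v \<in> tree_verts b"
    and "\<And>u. u \<in> tree_verts b \<Longrightarrow> length u < length v + n \<Longrightarrow> b u = b' u"
    and "\<And>u. u \<in> tree_verts b \<Longrightarrow> length u \<le> length v + n \<Longrightarrow> X u = X' u"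
    and "\<And>u. u \<in> tree_verts b \<Longrightarrow> length u \<le> length v + n \<Longrightarrow> u \<noteq> [] \<Longrightarrow> W u = W' u"
  shows "zmsg b W X n v = zmsg b' W' X' n v"
  using assms
proof (induction n arbitrary: v)
  case 0
  then show ?case by simp
next
  case (Suc n)
  have "zmsg b W X n (v @ [i]) = zmsg b' W' X' n (v @ [i])" if "i < b v" for i
    using Suc.prems that by (intro Suc.IH) (auto simp: tree_verts_snoc)
  moreover have "W (v @ [i]) = W' (v @ [i])" if "i < b v" for i
    using Suc.prems(1,4) that by (simp add: tree_verts_snoc)
  moreover have "b v = b' v" using Suc.prems(1,2) by simp
  ultimately show ?case using Suc.prems(1,3) by (auto intro!: vmax_cong)
qed

lemma down_tree_cong:
  assumes "v \<in> tree_verts b"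
    and "\<And>u. u \<in> tree_verts b \<Longrightarrow> length u < length v \<Longrightarrow> b u = b' u"
    and "\<And>u. u \<in> tree_verts b \<Longrightarrow> length u \<le> length v \<Longrightarrow> X u = X' u"
    and "\<And>u. u \<in> tree_verts b \<Longrightarrow> length u \<le> length v \<Longrightarrow> u \<noteq> [] \<Longrightarrow> W u = W' u"
    and "\<And>u s. u \<in> tree_verts b \<Longrightarrow> length u \<le> length v \<Longrightarrow> d s u = d' s u"
  shows "down b W X d s v = down b' W' X' d' s v"
  using assms
proof (induction v arbitrary: s rule: rev_induct)
  case Nil
  then show ?case by (simp add: down.simps)
next
  case (snoc c p)
  have p: "p \<in> tree_verts b" using snoc.prems(1) by (simp add: tree_verts_snoc)
  have bp: "b p = b' p" using snoc.prems(2) p by simp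
  have IH: "down b W X d s p = down b' W' X' d' s p" for s
  proof (rule snoc.IH[OF p])
    fix u assume u: "u \<in> tree_verts b"
    show "b u = b' u" if "length u < length p" using u that by (intro snoc.prems(2)) simp_all
    assume le: "length u \<le> length p"
    show "X u = X' u" using u le by (intro snoc.prems(3)) simp_all
    show "W u = W' u" if "u \<noteq> []" using u le that by (intro snoc.prems(4)) simp_all
    show "d s u = d' s u" for s using u le by (intro snoc.prems(5)) simp_all
  qed
  have a: "above b W X d s p = above b' W' X' d' s p" for s
    using snoc.prems(3)[OF p] snoc.prems(4)[OF p] IH by (cases "p = []") (auto simp: above_def)
  show ?case
    unfolding down_snoc a bp
  proof (rule vmax_cong)
    fix i assume "i < b' p"
    then have t: "p @ [i] \<in> tree_verts b" "length (p @ [i]) \<le> length (p @ [c])" using p by (auto simp: tree_verts_snoc bp)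
    show "(if i = c then above b' W' X' d' s p else W (p @ [i]) - d (\<not> s) (p @ [i])) =
        (if i = c then above b' W' X' d' s p else W' (p @ [i]) - d' (\<not> s) (p @ [i]))"
      using snoc.prems(4,5)[OF t] by simp
  qed
qed

lemma edge_decision_cong:
  assumes v: "v \<in> tree_verts b" "v \<noteq> []" "length v + 2 * k + 1 \<le> L"
    and b: "\<And>u. u \<in> tree_verts b \<Longrightarrow> length u < L \<Longrightarrow> b u = b' u"
    and X: "\<And>u. u \<in> tree_verts b \<Longrightarrow> length u \<le> L \<Longrightarrow> X u = X' u"
    and W: "\<And>u. u \<in> tree_verts b \<Longrightarrow> length u \<le> L \<Longrightarrow> u \<noteq> [] \<Longrightarrow> W u = W' u"
  shows "edge_yes b W X k v \<longleftrightarrow> edge_yes b' W' X' k v" "edge_no b W X k v \<longleftrightarrow> edge_no b' W' X' k v"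
proof -
  have z: "zmsg b W X n u = zmsg b' W' X' n u" if "u \<in> tree_verts b" "length u \<le> length v" "n \<le> 2 * k + 1" for n u
    using that v by (intro zmsg_tree_cong b X W) auto
  have d: "down b W X (\<lambda>s. zmsg b W X (2 * k + of_bool s)) s v = down b' W' X' (\<lambda>s. zmsg b' W' X' (2 * k + of_bool s)) s v" for s
    using v by (intro down_tree_cong b X W z) auto
  have Wv: "W v = W' v" using v by (intro W) auto
  have z': "zmsg b W X (2 * k) v = zmsg b' W' X' (2 * k) v" "zmsg b W X (2 * k + 1) v = zmsg b' W' X' (2 * k + 1) v"
    by (intro z v(1); simp)+
  show "edge_yes b W X k v \<longleftrightarrow> edge_yes b' W' X' k v" "edge_no b W X k v \<longleftrightarrow> edge_no b' W' X' k v"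
    unfolding edge_yes_def edge_no_def by (simp_all only: d Wv z')
qed

text \<open>Setting the offspring number to zero off the tree makes the pruned tree a canonical
  representative: only countably many values occur, and each is fixed by finitely many offspring
  numbers.\<close>

definition trunc :: "nat \<Rightarrow> (nat list \<Rightarrow> nat) \<Rightarrow> nat list \<Rightarrow> nat" where
  "trunc L N v = (if length v < L \<and> v \<in> tree_verts N then N v else 0)"

lemma tree_verts_trunc: "tree_verts (trunc L N) = {v\<in>tree_verts N. length v \<le> L}"
proof -
  have "v \<in> tree_verts (trunc L N) \<longleftrightarrow> v \<in> tree_verts N \<and> length v \<le> L" for v
    by (induction v rule: rev_induct) (auto simp: tree_verts_Nil tree_verts_snoc trunc_def split: if_splits)
  then show ?thesis by auto
qed

lemma trunc_chart: "tree_chart L (trunc L N) (\<lambda>v. v) (offspring_tree N)"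
proof -
  have "tnb (trunc L N) v = tnb N v" if "v \<in> tree_verts N" "length v < L" for v
    using that by (simp add: tnb_def trunc_def)
  then show ?thesis unfolding tree_chart_def by (auto simp: offspring_tree_edge tree_verts_trunc)
qed

lemma finite_tree_level: "finite {v\<in>tree_verts b. length v \<le> L}"
proof (induction L)
  case 0
  have "{v\<in>tree_verts b. length v \<le> 0} \<subseteq> {[]}" by auto
  then show ?case by (rule finite_subset) simp
next
  case (Suc L)
  have "{v\<in>tree_verts b. length v \<le> Suc L} \<subseteq> {[]} \<union> (\<Union>v\<in>{v\<in>tree_verts b. length v \<le> L}. (\<lambda>i. v @ [i]) ` {..<b v})"
  proof
    fix v assume "v \<in> {v\<in>tree_verts b. length v \<le> Suc L}"
    then show "v \<in> {[]} \<union> (\<Union>v\<in>{v\<in>tree_verts b. length v \<le> L}. (\<lambda>i. v @ [i]) ` {..<b v})"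
      by (cases v rule: rev_cases) (auto simp: tree_verts_snoc)
  qed
  then show ?case by (rule finite_subset) (use Suc in auto)
qed

section \<open>Conditioning and the local topology\<close>

text \<open>Conditioning on a variable with countably many values is done by summing over its level
  sets.\<close>

lemma nn_integral_mono_partition:
  fixes f g :: "'a \<Rightarrow> ennreal" and X :: "'a \<Rightarrow> 'b"
  assumes I: "countable I" and X: "\<And>z. z \<in> space M \<Longrightarrow> X z \<in> I"
    and m: "\<And>i. i \<in> I \<Longrightarrow> {z\<in>space M. X z = i} \<in> sets M"
    and f: "f \<in> borel_measurable M" and g: "g \<in> borel_measurable M"
    and le: "\<And>i. i \<in> I \<Longrightarrow> (\<integral>\<^sup>+z. f z * indicator {z\<in>space M. X z = i} z \<partial>M)
      \<le> (\<integral>\<^sup>+z. g z * indicator {z\<in>space M. X z = i} z \<partial>M)"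
  shows "(\<integral>\<^sup>+z. f z \<partial>M) \<le> (\<integral>\<^sup>+z. g z \<partial>M)"
proof -
  have *: "(\<integral>\<^sup>+z. h z \<partial>M) = (\<integral>\<^sup>+i. (\<integral>\<^sup>+z. h z * indicator {z\<in>space M. X z = i} z \<partial>M) \<partial>count_space I)"
    if h: "h \<in> borel_measurable M" for h
  proof -
    have "(\<integral>\<^sup>+z. h z \<partial>M) = (\<integral>\<^sup>+z. (\<integral>\<^sup>+i. h z * indicator {z\<in>space M. X z = i} z \<partial>count_space I) \<partial>M)"
    proof (rule nn_integral_cong)
      fix z assume z: "z \<in> space M"
      have "(\<integral>\<^sup>+i. h z * indicator {z\<in>space M. X z = i} z \<partial>count_space I) = (\<integral>\<^sup>+i. h z * indicator {X z} i \<partial>count_space I)"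
        using z by (intro nn_integral_cong) (auto simp: indicator_def)
      also have "\<dots> = h z" using X[OF z] by (simp add: nn_integral_cmult_indicator one_ennreal_def[symmetric])
      finally show "h z = (\<integral>\<^sup>+i. h z * indicator {z\<in>space M. X z = i} z \<partial>count_space I)" by simp
    qed
    also have "\<dots> = (\<integral>\<^sup>+i. (\<integral>\<^sup>+z. h z * indicator {z\<in>space M. X z = i} z \<partial>M) \<partial>count_space I)"
      using I h m
      by (intro nn_integral_count_space_nn_integral borel_measurable_times_ennreal borel_measurable_indicator) auto
    finally show ?thesis .
  qed
  show ?thesis unfolding *[OF f] *[OF g] by (rule nn_integral_mono) (use le in simp)
qed

text \<open>The rectangles determine a measure on the finite product, so \<open>rect\<close> says
  that on \<open>E\<close> the family has the product law scaled by the mass of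
  \<open>E\<close>.\<close>

lemma nn_integral_conditional_product:
  fixes y :: "'p \<Rightarrow> 'i \<Rightarrow> real" and \<nu> :: "'i \<Rightarrow> real measure"
  assumes P: "prob_space P" and J: "finite J" and \<nu>: "\<And>i. prob_space (\<nu> i)" "\<And>i. sets (\<nu> i) = sets borel"
    and E: "E \<in> sets P"
    and rect: "\<And>A. (\<And>i. A i \<in> sets borel) \<Longrightarrow> {p\<in>space P. p \<in> E \<and> (\<forall>i\<in>J. y p i \<in> A i)} \<in> sets P
      \<and> measure P {p\<in>space P. p \<in> E \<and> (\<forall>i\<in>J. y p i \<in> A i)} = measure P E * (\<Prod>i\<in>J. measure (\<nu> i) (A i))"
    and F: "F \<in> borel_measurable (PiM J \<nu>)"
  shows "(\<lambda>p. restrict (y p) J) \<in> restrict_space P E \<rightarrow>\<^sub>M PiM J \<nu>"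
    and "(\<integral>\<^sup>+p. F (restrict (y p) J) * indicator E p \<partial>P) = emeasure P E * (\<integral>\<^sup>+z. F z \<partial>PiM J \<nu>)"
proof -
  interpret P: prob_space P by fact
  interpret Ni: prob_space "\<nu> i" for i by (rule \<nu>)
  interpret N: product_prob_space \<nu> J by unfold_locales
  let ?N = "PiM J \<nu>"
  have spN: "space (\<nu> i) = UNIV" for i using sets_eq_imp_space_eq[OF \<nu>(2)] by simp
  \<comment> \<open>Measurability of \<open>y\<close> is known on \<open>E\<close> only, so it is
    replaced by 0 elsewhere.\<close>
  define y' where "y' p = restrict (if p \<in> E then y p else (\<lambda>_. 0)) J" for p
  have y': "y' \<in> P \<rightarrow>\<^sub>M ?N"
  proof (rule measurable_PiM_single')
    show "y' \<in> space P \<rightarrow> (\<Pi>\<^sub>E i\<in>J. space (\<nu> i))" by (auto simp: y'_def spN)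
    fix i assume i: "i \<in> J"
    show "(\<lambda>p. y' p i) \<in> P \<rightarrow>\<^sub>M \<nu> i"
    proof (rule measurableI)
      fix A assume A: "A \<in> sets (\<nu> i)"
      define A' where "A' j = (if j = i then A else UNIV)" for j
      have "A' j \<in> sets borel" for j using A \<nu>(2) by (auto simp: A'_def)
      then have "{p\<in>space P. p \<in> E \<and> (\<forall>j\<in>J. y p j \<in> A' j)} \<in> sets P" using rect by blast
      also have "{p\<in>space P. p \<in> E \<and> (\<forall>j\<in>J. y p j \<in> A' j)} = {p\<in>space P. p \<in> E \<and> y p i \<in> A}"
        using i by (auto simp: A'_def)
      finally have "{p\<in>space P. p \<in> E \<and> y p i \<in> A} \<in> sets P" .
      then have "{p\<in>space P. p \<in> E \<and> y p i \<in> A} \<union> (if 0 \<in> A then space P - E else {}) \<in> sets P" using E by auto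
      also have "{p\<in>space P. p \<in> E \<and> y p i \<in> A} \<union> (if 0 \<in> A then space P - E else {}) = (\<lambda>p. y' p i) -` A \<inter> space P"
        using i by (auto simp: y'_def split: if_splits)
      finally show "(\<lambda>p. y' p i) -` A \<inter> space P \<in> sets P" .
    qed (simp add: spN)
  qed
  have "y' \<in> restrict_space P E \<rightarrow>\<^sub>M ?N" using y' by (rule measurable_restrict_space1)
  moreover have "y' p = restrict (y p) J" if "p \<in> space (restrict_space P E)" for p
    using that E by (simp add: y'_def space_restrict_space)
  ultimately show "(\<lambda>p. restrict (y p) J) \<in> restrict_space P E \<rightarrow>\<^sub>M ?N"
    by (simp cong: measurable_cong)
  define D where "D = distr (density P (indicator E)) ?N y'"
  have y'd: "y' \<in> density P (indicator E) \<rightarrow>\<^sub>M ?N" using y' by simp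
  have "D = scale_measure (emeasure P E) ?N"
  proof (rule measure_eqI_PiM_finite[OF J])
    show "sets D = sets ?N" "sets (scale_measure (emeasure P E) ?N) = sets ?N" by (simp_all add: D_def)
    have spD: "emeasure D B = emeasure P (E \<inter> (y' -` B \<inter> space P))" if "B \<in> sets ?N" for B
      using that y' E unfolding D_def
      by (subst emeasure_distr[OF y'd]) (auto simp: emeasure_density nn_integral_indicator' indicator_inter_arith[symmetric])
    show "emeasure D (Pi\<^sub>E J A) = emeasure (scale_measure (emeasure P E) ?N) (Pi\<^sub>E J A)"
      if A: "\<And>i. i \<in> J \<Longrightarrow> A i \<in> sets (\<nu> i)" for A
    proof -
      define A' where "A' i = (if i \<in> J then A i else UNIV)" for i
      have A': "A' i \<in> sets borel" for i using A \<nu>(2) by (auto simp: A'_def)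
      have "emeasure D (Pi\<^sub>E J A) = emeasure P (E \<inter> (y' -` Pi\<^sub>E J A \<inter> space P))"
        using A J by (intro spD sets_PiM_I_finite) auto
      also have "E \<inter> (y' -` Pi\<^sub>E J A \<inter> space P) = {p\<in>space P. p \<in> E \<and> (\<forall>i\<in>J. y p i \<in> A' i)}"
        by (auto simp: y'_def A'_def PiE_iff)
      also have "emeasure P \<dots> = ennreal (measure P E * (\<Prod>i\<in>J. measure (\<nu> i) (A' i)))"
        using rect[OF A'] by (simp add: P.emeasure_eq_measure)
      also have "\<dots> = emeasure P E * (\<Prod>i\<in>J. emeasure (\<nu> i) (A i))"
        by (simp add: P.emeasure_eq_measure Ni.emeasure_eq_measure ennreal_mult prod_nonneg prod_ennreal A'_def)
      also have "\<dots> = emeasure P E * emeasure ?N (Pi\<^sub>E J A)"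
        using A J by (simp add: emeasure_PiM_emb[of J \<nu> J A, unfolded prod_emb_PiE_same_index] N.emeasure_PiM)
      finally show ?thesis by simp
    qed
    show "range (\<lambda>_::nat. space ?N) \<subseteq> prod_algebra J \<nu>"
      using prod_algebraI_finite[OF J, of "\<lambda>i. space (\<nu> i)" \<nu>] by (auto simp: space_PiM)
    show "(\<Union>i::nat. space ?N) = space ?N" by simp
    show "emeasure D (space ?N) \<noteq> \<infinity>" for i :: nat
      using spD[OF sets.top[of ?N]] by simp
  qed
  then have "(\<integral>\<^sup>+z. F z \<partial>D) = emeasure P E * (\<integral>\<^sup>+z. F z \<partial>?N)"
    using F by (simp add: nn_integral_scale_measure)
  moreover have "(\<integral>\<^sup>+z. F z \<partial>D) = (\<integral>\<^sup>+p. F (restrict (y p) J) * indicator E p \<partial>P)"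
  proof -
    have "(\<integral>\<^sup>+z. F z \<partial>D) = (\<integral>\<^sup>+p. F (y' p) \<partial>density P (indicator E))"
      unfolding D_def by (rule nn_integral_distr[OF y'd]) (use F in simp)
    also have "\<dots> = (\<integral>\<^sup>+p. indicator E p * F (y' p) \<partial>P)"
      using E measurable_compose[OF y' F] by (subst nn_integral_density) auto
    also have "\<dots> = (\<integral>\<^sup>+p. F (restrict (y p) J) * indicator E p \<partial>P)"
      by (intro nn_integral_cong) (auto simp: y'_def indicator_def)
    finally show ?thesis .
  qed
  ultimately show "(\<integral>\<^sup>+p. F (restrict (y p) J) * indicator E p \<partial>P) = emeasure P E * (\<integral>\<^sup>+z. F z \<partial>?N)" by simp
qed

section \<open>Ball classes as a countable base of the local topology\<close>

definition cls :: "nat \<Rightarrow> 'v mdgraph \<Rightarrow> 'v mdgraph set" where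
  "cls H G = {G'\<in>mdgraphs. rball H G' \<cong>\<^sub>r rball H G}"

lemma cls_refl: "G \<in> mdgraphs \<Longrightarrow> G \<in> cls H G"
  by (simp add: cls_def mdgraph_iso_refl)

lemma mdgraph_rball_sym: "G \<in> mdgraphs \<Longrightarrow> rball H G \<cong>\<^sub>r G' \<Longrightarrow> G' \<cong>\<^sub>r rball H G"
  by (cases G) (auto simp: mdgraphs_def intro: rball_iso_sym)

lemma cls_eq: "G \<in> mdgraphs \<Longrightarrow> G' \<in> cls H G \<Longrightarrow> cls H G' = cls H G"
  using mdgraph_iso_trans mdgraph_rball_sym unfolding cls_def by blast

lemma openin_cls: "G \<in> mdgraphs \<Longrightarrow> openin local_topology (cls H G)"
  unfolding cls_def local_topology_def by (rule topology_generated_by_Basis) blast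

lemma ball_path_map:
  assumes g: "rooted_graph g" and \<phi>: "\<phi> (root g) = root g'"
    "\<And>u v. u \<in> ball_verts H g \<Longrightarrow> v \<in> ball_verts H g \<Longrightarrow> {u, v} \<in> edges g \<Longrightarrow> {\<phi> u, \<phi> v} \<in> edges g'"
  shows "(root g, z) \<in> {(a, b). {a, b} \<in> edges g} ^^ k \<Longrightarrow> k \<le> H + 1 \<Longrightarrow>
    z \<in> ball_verts H g \<and> (root g', \<phi> z) \<in> {(a, b). {a, b} \<in> edges g'} ^^ k"
proof (induction k arbitrary: z)
  case 0
  then show ?case using g \<phi> root_in_ball by auto
next
  case (Suc k)
  from Suc.prems obtain y where y: "(root g, y) \<in> {(a, b). {a, b} \<in> edges g} ^^ k" "{y, z} \<in> edges g" by auto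
  with Suc have IH: "y \<in> ball_verts H g" "(root g', \<phi> y) \<in> {(a, b). {a, b} \<in> edges g'} ^^ k" by auto
  have "z \<in> ball_verts H g"
    using Suc.prems rooted_edge(2)[OF g y(2)] unfolding ball_verts_def by blast
  with IH \<phi>(2)[OF IH(1) _ y(2)] show ?case by (auto intro: relcompI)
qed

text \<open>Paths of length at most \<open>h + 1\<close> from the root stay in the larger ball. The
  isomorphism and its inverse preserve them and hence map the smaller balls onto each other.\<close>

lemma rball_iso_mono:
  assumes g: "rooted_graph g" "rooted_graph g'" and iso: "rball H (g, M) \<cong>\<^sub>r rball H (g', M')" and h: "h \<le> H"
  shows "rball h (g, M) \<cong>\<^sub>r rball h (g', M')"
proof -
  obtain \<phi> where \<phi>: "bij_betw \<phi> (ball_verts H g) (ball_verts H g')" "\<phi> (root g) = root g'"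
    "\<And>u v. u \<in> ball_verts H g \<Longrightarrow> v \<in> ball_verts H g \<Longrightarrow>
        ({u, v} \<in> edges g \<longleftrightarrow> {\<phi> u, \<phi> v} \<in> edges g') \<and> ({u, v} \<in> M \<longleftrightarrow> {\<phi> u, \<phi> v} \<in> M')"
    using iso unfolding rball_iso_iff by blast
  define \<psi> where "\<psi> = inv_into (ball_verts H g) \<phi>"
  have inj: "inj_on \<phi> (ball_verts H g)" using \<phi>(1) by (simp add: bij_betw_def)
  have inv: "\<phi> (\<psi> y) = y" "\<psi> y \<in> ball_verts H g" if "y \<in> ball_verts H g'" for y
    using \<phi>(1) that by (auto simp: \<psi>_def bij_betw_def f_inv_into_f intro: inv_into_into)
  have \<psi>root: "\<psi> (root g') = root g"
    unfolding \<psi>_def \<phi>(2)[symmetric] by (intro inv_into_f_f inj root_in_ball g)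
  have sub: "ball_verts h g \<subseteq> ball_verts H g"
  proof
    fix z assume "z \<in> ball_verts h g"
    then obtain k where k: "z \<in> verts g" "k \<le> h + 1" "(root g, z) \<in> {(a, b). {a, b} \<in> edges g} ^^ k"
      unfolding ball_verts_def by blast
    moreover have "k \<le> H + 1" using k(2) h by simp
    ultimately show "z \<in> ball_verts H g" unfolding ball_verts_def by blast
  qed
  have fwd: "{\<phi> u, \<phi> v} \<in> edges g'" if "u \<in> ball_verts H g" "v \<in> ball_verts H g" "{u, v} \<in> edges g" for u v
    using \<phi>(3)[OF that(1,2)] that(3) by blast
  have "\<phi> ` ball_verts h g = ball_verts h g'"
  proof (intro equalityI subsetI)
    fix z assume "z \<in> \<phi> ` ball_verts h g"
    then obtain u where u: "u \<in> ball_verts h g" "z = \<phi> u" by auto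
    then obtain k where k: "k \<le> h + 1" "(root g, u) \<in> {(a, b). {a, b} \<in> edges g} ^^ k" by (auto simp: ball_verts_def)
    have "(root g', \<phi> u) \<in> {(a, b). {a, b} \<in> edges g'} ^^ k"
      using ball_path_map[where \<phi>=\<phi> and g'=g' and H=H, OF g(1) \<phi>(2) fwd k(2)] k(1) h by auto
    moreover have "\<phi> u \<in> ball_verts H g'" using \<phi>(1) u(1) sub unfolding bij_betw_def by blast
    then have "\<phi> u \<in> verts g'" by (simp add: ball_verts_def)
    ultimately show "z \<in> ball_verts h g'" using k(1) u(2) by (auto simp: ball_verts_def)
  next
    fix z assume z: "z \<in> ball_verts h g'"
    then obtain k where k: "k \<le> h + 1" "(root g', z) \<in> {(a, b). {a, b} \<in> edges g'} ^^ k" by (auto simp: ball_verts_def)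
    have "{\<psi> u, \<psi> v} \<in> edges g" if "u \<in> ball_verts H g'" "v \<in> ball_verts H g'" "{u, v} \<in> edges g'" for u v
      using \<phi>(3)[of "\<psi> u" "\<psi> v"] inv that by simp
    from ball_path_map[where \<phi>=\<psi> and g'=g and H=H, OF g(2) \<psi>root this k(2)] k(1) h
    have *: "z \<in> ball_verts H g'" "(root g, \<psi> z) \<in> {(a, b). {a, b} \<in> edges g} ^^ k" by auto
    then have "\<psi> z \<in> ball_verts h g" using inv(2)[OF *(1)] k(1) by (auto simp: ball_verts_def)
    then show "z \<in> \<phi> ` ball_verts h g" using inv(1)[OF *(1)] by (metis imageI)
  qed
  moreover have "inj_on \<phi> (ball_verts h g)" using inj sub by (rule inj_on_subset)
  ultimately show ?thesis
    unfolding rball_iso_iff using \<phi>(2,3) sub by (intro exI[of _ \<phi>]) (auto simp: bij_betw_def)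
qed

lemma cls_mono: "G \<in> mdgraphs \<Longrightarrow> h \<le> H \<Longrightarrow> cls H G \<subseteq> cls h G"
  unfolding cls_def by (auto simp: mdgraphs_def intro: rball_iso_mono)

text \<open>Induction over the generation of open sets: an intersection is handled by the larger of
  two radii, and a generating class that contains \<open>G\<close> is itself the class of
  \<open>G\<close>.\<close>

lemma open_contains_cls:
  assumes U: "openin local_topology U" and G: "G \<in> U"
  shows "\<exists>H. cls H G \<subseteq> U"
proof -
  have "G \<in> mdgraphs \<longrightarrow> G \<in> U \<longrightarrow> (\<exists>H. cls H G \<subseteq> U)"
    using U unfolding local_topology_def openin_topology_generated_by_iff
  proof (induction rule: generate_topology_on.induct)
    case (Int a b)
    show ?case
    proof (intro impI)
      assume "G \<in> mdgraphs" "G \<in> a \<inter> b"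
      with Int obtain H H' where "cls H G \<subseteq> a" "cls H' G \<subseteq> b" by auto
      with cls_mono[OF \<open>G \<in> mdgraphs\<close>, of H "max H H'"] cls_mono[OF \<open>G \<in> mdgraphs\<close>, of H' "max H H'"]
      show "\<exists>H. cls H G \<subseteq> a \<inter> b" by (intro exI[of _ "max H H'"]) auto
    qed
  next
    case (UN K)
    then show ?case by blast
  next
    case (Basis s)
    then obtain G0 H where s: "s = cls H G0" "G0 \<in> mdgraphs" by (auto simp: cls_def)
    then show ?case using cls_eq by blast
  qed auto
  moreover have "G \<in> mdgraphs" using openin_subset[OF U] G by (auto simp: topspace_local_topology)
  ultimately show ?thesis using G by blast
qed

lemma continuous_map_locally_constant:
  assumes "\<And>G G'. G \<in> mdgraphs \<Longrightarrow> G' \<in> cls H G \<Longrightarrow> f G' = f G"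
  shows "continuous_map local_topology euclideanreal f"
  unfolding continuous_map_def topspace_local_topology
proof (intro conjI allI impI)
  fix U :: "real set"
  show "openin local_topology {x\<in>mdgraphs. f x \<in> U}"
  proof (subst openin_subopen, intro ballI)
    fix G assume G: "G \<in> {x\<in>mdgraphs. f x \<in> U}"
    have "cls H G \<subseteq> {x\<in>mdgraphs. f x \<in> U}"
    proof
      fix G' assume G': "G' \<in> cls H G"
      then have "G' \<in> mdgraphs" by (simp add: cls_def)
      with assms[of G G'] G G' show "G' \<in> {x\<in>mdgraphs. f x \<in> U}" by simp
    qed
    then show "\<exists>T. openin local_topology T \<and> G \<in> T \<and> T \<subseteq> {x\<in>mdgraphs. f x \<in> U}"
      using G by (intro exI[of _ "cls H G"]) (simp add: openin_cls cls_refl)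
  qed
qed auto

lemma finite_ball_verts:
  assumes g: "rooted_graph g"
  shows "finite (ball_verts H g)"
proof -
  let ?R = "{(a, b). {a, b} \<in> edges g}"
  have "finite {z. (root g, z) \<in> ?R ^^ k}" for k
  proof (induction k)
    case 0
    then show ?case by simp
  next
    case (Suc k)
    have "{z. (root g, z) \<in> ?R ^^ Suc k} \<subseteq> (\<Union>y\<in>{z. (root g, z) \<in> ?R ^^ k} \<inter> verts g. {z. {y, z} \<in> edges g})"
      using rooted_edge(1)[OF g] by auto
    moreover have "finite (\<Union>y\<in>{z. (root g, z) \<in> ?R ^^ k} \<inter> verts g. {z. {y, z} \<in> edges g})"
      using Suc finite_nbrs[OF g] by auto
    ultimately show ?case by (rule finite_subset)
  qed
  then have "finite (\<Union>k\<le>H + 1. {z. (root g, z) \<in> ?R ^^ k})" by simp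
  moreover have "ball_verts H g \<subseteq> (\<Union>k\<le>H + 1. {z. (root g, z) \<in> ?R ^^ k})" by (auto simp: ball_verts_def)
  ultimately show ?thesis by (rule finite_subset[rotated])
qed

lemma countable_finite_graphs:
  "countable {g :: 'v::countable rgraph. finite (verts g) \<and> edges g \<subseteq> Pow (verts g)}" (is "countable ?S")
proof -
  let ?F = "{A :: 'v set. finite A}" let ?FF = "{B. finite B \<and> B \<subseteq> ?F}"
  have F: "countable ?F" by (rule countable_Collect_finite)
  then have FF: "countable ?FF" by (rule countable_Collect_finite_subset)
  have "countable ((\<lambda>(V, E, r). \<lparr>verts = V, edges = E, root = r\<rparr>) ` (?F \<times> ?FF \<times> (UNIV :: 'v set)))"
    using F FF by (intro countable_image countable_SIGMA) auto
  moreover have "?S \<subseteq> (\<lambda>(V, E, r). \<lparr>verts = V, edges = E, root = r\<rparr>) ` (?F \<times> ?FF \<times> (UNIV :: 'v set))"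
  proof
    fix g assume "g \<in> ?S"
    then have "finite (verts g)" "edges g \<subseteq> Pow (verts g)" by auto
    then have "verts g \<in> ?F" "edges g \<in> ?FF" by (auto intro: finite_subset)
    then show "g \<in> (\<lambda>(V, E, r). \<lparr>verts = V, edges = E, root = r\<rparr>) ` (?F \<times> ?FF \<times> (UNIV :: 'v set))"
      by (intro image_eqI[of _ _ "(verts g, edges g, root g)"]) auto
  qed
  ultimately show ?thesis by (rule countable_subset[rotated])
qed

text \<open>A class is determined by its radius and a ball, and balls are finite graphs with labels
  from a countable type.\<close>

lemma countable_classes: "countable {cls H G | H (G :: 'v::countable mdgraph). G \<in> mdgraphs}"
proof -
  let ?Gs = "{g :: 'v rgraph. finite (verts g) \<and> edges g \<subseteq> Pow (verts g)}"
  let ?FF = "{B. finite B \<and> B \<subseteq> {A :: 'v set. finite A}}"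
  let ?c = "\<lambda>(H, B). {G' :: 'v mdgraph\<in>mdgraphs. rball H G' \<cong>\<^sub>r B}"
  have "countable (?c ` ((UNIV :: nat set) \<times> ?Gs \<times> ?FF))"
    by (intro countable_image countable_SIGMA countable_finite_graphs countable_Collect_finite_subset countable_Collect_finite) auto
  moreover have "{cls H G | H (G :: 'v mdgraph). G \<in> mdgraphs} \<subseteq> ?c ` ((UNIV :: nat set) \<times> ?Gs \<times> ?FF)"
  proof
    fix S assume "S \<in> {cls H G | H (G :: 'v mdgraph). G \<in> mdgraphs}"
    then obtain H g M where S: "S = cls H (g, M)" "(g, M) \<in> mdgraphs" by auto
    then have g: "rooted_graph g" by (simp add: mdgraphs_def)
    have fb: "finite (ball_verts H g)" by (rule finite_ball_verts[OF g])
    have "{e\<in>M. e \<subseteq> ball_verts H g} \<subseteq> Pow (ball_verts H g)" by auto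
    then have "{e\<in>M. e \<subseteq> ball_verts H g} \<in> ?FF" using fb by (auto intro: finite_subset)
    then have "rball H (g, M) \<in> ?Gs \<times> ?FF" using fb by (auto simp: rball_def)
    then show "S \<in> ?c ` ((UNIV :: nat set) \<times> ?Gs \<times> ?FF)"
      unfolding S cls_def by (intro image_eqI[of _ _ "(H, rball H (g, M))"]) auto
  qed
  ultimately show ?thesis by (rule countable_subset[rotated])
qed

text \<open>Every open set is a union of classes and there are only countably many of them, so Borel
  measurability reduces to events about isomorphism types of balls.\<close>

lemma measurable_borel_of_local:
  fixes Y :: "'p \<Rightarrow> 'v::countable mdgraph"
  assumes Y: "\<And>p. p \<in> space M \<Longrightarrow> Y p \<in> mdgraphs"
    and m: "\<And>H G. G \<in> mdgraphs \<Longrightarrow> {p\<in>space M. Y p \<in> cls H G} \<in> sets M"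
  shows "Y \<in> M \<rightarrow>\<^sub>M borel_of local_topology"
  unfolding borel_of_def
proof (rule measurable_measure_of)
  show "{U. openin local_topology U} \<subseteq> Pow (topspace (local_topology :: 'v mdgraph topology))"
    by (auto dest: openin_subset)
  show "Y \<in> space M \<rightarrow> topspace local_topology" using Y by (simp add: topspace_local_topology)
  fix U :: "'v mdgraph set" assume "U \<in> {U. openin local_topology U}"
  then have U: "openin local_topology U" by simp
  let ?K = "{S \<in> {cls H G | H (G :: 'v mdgraph). G \<in> mdgraphs}. S \<subseteq> U}"
  have c: "countable ?K" using countable_classes by (rule countable_subset[rotated]) auto
  have "Y -` U \<inter> space M = (\<Union>S\<in>?K. {p\<in>space M. Y p \<in> S})"
  proof (intro equalityI subsetI)
    fix p assume p: "p \<in> Y -` U \<inter> space M"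
    then have "Y p \<in> mdgraphs" "Y p \<in> U" using Y by blast+
    then obtain H where "cls H (Y p) \<subseteq> U" using open_contains_cls[OF U] by blast
    moreover have "Y p \<in> cls H (Y p)" by (rule cls_refl) fact
    ultimately show "p \<in> (\<Union>S\<in>?K. {p\<in>space M. Y p \<in> S})" using p Y by blast
  qed auto
  also have "\<dots> \<in> sets M" using c m by (intro sets.countable_UN') auto
  finally show "Y -` U \<inter> space M \<in> sets M" .
qed

lemma continuous_map_measurable_borel_of:
  assumes "continuous_map X euclideanreal f" and "Y \<in> M \<rightarrow>\<^sub>M borel_of X"
  shows "(\<lambda>p. f (Y p)) \<in> borel_measurable M"
proof -
  have "f \<in> borel_measurable (borel_of X)"
  proof (rule borel_measurableI)
    fix S :: "real set" assume "open S"
    then have "openin X {x\<in>topspace X. f x \<in> S}" using assms(1) by (simp add: continuous_map_def)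
    moreover have "space (borel_of X) = topspace X"
      unfolding borel_of_def by (rule space_measure_of) (auto dest: openin_subset)
    moreover have "sets (borel_of X) = sigma_sets (topspace X) {U. openin X U}"
      unfolding borel_of_def by (rule sets_measure_of) (auto dest: openin_subset)
    ultimately show "f -` S \<inter> space (borel_of X) \<in> sets (borel_of X)"
      by (auto simp: vimage_def Int_def conj_commute)
  qed
  from measurable_compose[OF assms(2) this] show ?thesis .
qed

definition cls_inf :: "nat \<Rightarrow> ('v mdgraph \<Rightarrow> real) \<Rightarrow> 'v mdgraph \<Rightarrow> real" where
  "cls_inf h f G = (INF G'\<in>cls h G. f G')"

lemma cls_inf_le:
  assumes "G \<in> mdgraphs" "\<And>G. G \<in> mdgraphs \<Longrightarrow> 0 \<le> f G"
  shows "cls_inf h f G \<le> f G"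
  unfolding cls_inf_def
proof (rule cINF_lower)
  show "bdd_below (f ` cls h G)"
  proof (rule bdd_belowI[of _ 0])
    fix y assume "y \<in> f ` cls h G"
    then obtain G' where "y = f G'" "G' \<in> cls h G" by blast
    then show "0 \<le> y" using assms(2)[of G'] by (simp add: cls_def)
  qed
qed (rule cls_refl[OF assms(1)])

lemma cls_inf_cong: "cls h G = cls h G' \<Longrightarrow> cls_inf h f G = cls_inf h f G'"
  by (simp add: cls_inf_def)

text \<open>By continuity \<open>f\<close> is at least \<open>f G\<close> up to a small error on a
  class of large radius, and larger radii only shrink the class. Non-negativity keeps the infima
  bounded below.\<close>

lemma cls_inf_tendsto:
  assumes f: "continuous_map local_topology euclideanreal f" and nn: "\<And>G. G \<in> mdgraphs \<Longrightarrow> 0 \<le> f G"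
    and G: "G \<in> mdgraphs"
  shows "(\<lambda>h. cls_inf h f G) \<longlonglongrightarrow> f G"
proof (rule LIMSEQ_I)
  fix e :: real assume e: "0 < e"
  have "openin local_topology {x\<in>topspace local_topology. f x \<in> {f G - e / 2<..}}"
    by (rule openin_continuous_map_preimage[OF f]) simp
  moreover have "G \<in> {x\<in>topspace local_topology. f x \<in> {f G - e / 2<..}}"
    using G e by (simp add: topspace_local_topology)
  ultimately obtain H where H: "cls H G \<subseteq> {x\<in>topspace local_topology. f x \<in> {f G - e / 2<..}}"
    using open_contains_cls by blast
  show "\<exists>no. \<forall>n\<ge>no. norm (cls_inf n f G - f G) < e"
  proof (intro exI allI impI)
    fix n assume "H \<le> n"
    have "f G - e / 2 \<le> f G'" if "G' \<in> cls n G" for G'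
    proof -
      have "G' \<in> {x\<in>topspace local_topology. f x \<in> {f G - e / 2<..}}"
        using cls_mono[OF G \<open>H \<le> n\<close>] H that by blast
      then show ?thesis by simp
    qed
    then have "f G - e / 2 \<le> cls_inf n f G"
      unfolding cls_inf_def using cls_refl[OF G, of n] by (intro cINF_greatest) auto
    moreover have "cls_inf n f G \<le> f G" by (rule cls_inf_le[OF G nn])
    ultimately show "norm (cls_inf n f G - f G) < e" using e by (auto simp: abs_le_iff)
  qed
qed

section \<open>Independent weights on finite random graphs\<close>

lemma prod_measure_extend:
  assumes "prob_space M" "space M = UNIV" "finite E" "inj_on q J" "q ` J \<subseteq> E"
  shows "(\<Prod>e\<in>E. measure M (if e \<in> q ` J then A (the_inv_into J q e) else UNIV)) = (\<Prod>v\<in>J. measure M (A v))"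
proof -
  have "measure M UNIV = 1" using prob_space.prob_space[OF assms(1)] assms(2) by simp
  then have "(\<Prod>e\<in>E. measure M (if e \<in> q ` J then A (the_inv_into J q e) else UNIV))
      = (\<Prod>e\<in>q ` J. measure M (if e \<in> q ` J then A (the_inv_into J q e) else UNIV))"
    using assms(3,5) by (intro prod.mono_neutral_right) auto
  also have "\<dots> = (\<Prod>v\<in>J. measure M (A v))"
    using assms(4) by (subst prod.reindex) (auto simp: the_inv_into_f_f intro!: prod.cong)
  finally show ?thesis .
qed

abbreviation weight_law :: "real measure \<Rightarrow> real measure \<Rightarrow> 'a + 'b \<Rightarrow> real measure" where
  "weight_law \<omega> \<xi> \<equiv> case_sum (\<lambda>_. \<omega>) (\<lambda>_. \<xi>)"

lemma weight_law_props:
  assumes "real_distribution \<omega>" "real_distribution \<xi>"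
  shows "prob_space (weight_law \<omega> \<xi> i)" "sets (weight_law \<omega> \<xi> i) = sets borel"
  using assms by (cases i; simp add: real_distribution_def real_distribution_axioms_def)+

text \<open>Only the coordinates picked out by \<open>q\<close> and \<open>r\<close> are
  constrained; the others get the whole line, which has probability 1. It is applied with identities
  for the whole graph and with a chart for a ball.\<close>

lemma iid_weights_rect:
  fixes g :: "'v rgraph" and q :: "'a \<Rightarrow> 'v set" and r :: "'b \<Rightarrow> 'v"
  assumes iid: "iid_weights P G \<omega> \<xi> w x" and dist: "real_distribution \<omega>" "real_distribution \<xi>"
    and fin: "finite (verts g)" "finite (edges g)"
    and q: "finite J1" "inj_on q J1" "q ` J1 \<subseteq> edges g" and r: "finite J2" "inj_on r J2" "r ` J2 \<subseteq> verts g"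
    and A: "\<And>i. A i \<in> sets borel"
  defines "y \<equiv> \<lambda>p. case_sum (\<lambda>v. w p (q v)) (\<lambda>v. x p (r v))" and "E \<equiv> {p\<in>space P. G p = g}"
    and "J \<equiv> Inl ` J1 \<union> Inr ` J2"
  shows "{p\<in>space P. p \<in> E \<and> (\<forall>i\<in>J. y p i \<in> A i)} \<in> sets P
      \<and> measure P {p\<in>space P. p \<in> E \<and> (\<forall>i\<in>J. y p i \<in> A i)} = measure P E * (\<Prod>i\<in>J. measure (weight_law \<omega> \<xi> i) (A i))"
proof -
  define A1 where "A1 e = (if e \<in> q ` J1 then A (Inl (the_inv_into J1 q e)) else UNIV)" for e
  define A2 where "A2 v = (if v \<in> r ` J2 then A (Inr (the_inv_into J2 r v)) else UNIV)" for v
  have "range A1 \<subseteq> sets borel" "range A2 \<subseteq> sets borel" using A by (auto simp: A1_def A2_def)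
  then have *: "{p\<in>space P. G p = g \<and> (\<forall>e\<in>edges g. w p e \<in> A1 e) \<and> (\<forall>v\<in>verts g. x p v \<in> A2 v)} \<in> sets P
      \<and> measure P {p\<in>space P. G p = g \<and> (\<forall>e\<in>edges g. w p e \<in> A1 e) \<and> (\<forall>v\<in>verts g. x p v \<in> A2 v)} = measure P {p\<in>space P. G p = g}
          * (\<Prod>e\<in>edges g. measure \<omega> (A1 e)) * (\<Prod>v\<in>verts g. measure \<xi> (A2 v))"
    using iid unfolding iid_weights_def Let_def by blast
  have A1q: "A1 (q v) = A (Inl v)" if "v \<in> J1" for v using that the_inv_into_f_f[OF q(2) that] by (simp add: A1_def)
  have A2r: "A2 (r v) = A (Inr v)" if "v \<in> J2" for v using that the_inv_into_f_f[OF r(2) that] by (simp add: A2_def)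
  have 1: "(\<forall>e\<in>edges g. w p e \<in> A1 e) \<longleftrightarrow> (\<forall>v\<in>J1. w p (q v) \<in> A (Inl v))" for p
  proof (intro iffI ballI)
    fix v assume *: "\<forall>e\<in>edges g. w p e \<in> A1 e" and v: "v \<in> J1"
    then have "w p (q v) \<in> A1 (q v)" using q(3) by blast
    then show "w p (q v) \<in> A (Inl v)" by (simp only: A1q[OF v])
  next
    fix e assume *: "\<forall>v\<in>J1. w p (q v) \<in> A (Inl v)"
    show "w p e \<in> A1 e"
    proof (cases "e \<in> q ` J1")
      case True
      then obtain v where v: "v \<in> J1" "e = q v" by blast
      then show ?thesis using * A1q[OF v(1)] by simp
    qed (simp add: A1_def)
  qed
  have 2: "(\<forall>v\<in>verts g. x p v \<in> A2 v) \<longleftrightarrow> (\<forall>v\<in>J2. x p (r v) \<in> A (Inr v))" for p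
  proof (intro iffI ballI)
    fix v assume *: "\<forall>v\<in>verts g. x p v \<in> A2 v" and v: "v \<in> J2"
    then have "x p (r v) \<in> A2 (r v)" using r(3) by blast
    then show "x p (r v) \<in> A (Inr v)" by (simp only: A2r[OF v])
  next
    fix z assume *: "\<forall>v\<in>J2. x p (r v) \<in> A (Inr v)"
    show "x p z \<in> A2 z"
    proof (cases "z \<in> r ` J2")
      case True
      then obtain v where v: "v \<in> J2" "z = r v" by blast
      then show ?thesis using * A2r[OF v(1)] by simp
    qed (simp add: A2_def)
  qed
  have set: "{p\<in>space P. G p = g \<and> (\<forall>e\<in>edges g. w p e \<in> A1 e) \<and> (\<forall>v\<in>verts g. x p v \<in> A2 v)}
      = {p\<in>space P. p \<in> E \<and> (\<forall>i\<in>J. y p i \<in> A i)}"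
    unfolding 1 2 by (simp add: y_def E_def J_def ball_Un conj_assoc cong: conj_cong)
  have u: "prob_space \<omega>" "space \<omega> = UNIV" "prob_space \<xi>" "space \<xi> = UNIV"
    using dist real_distribution.space_eq_univ by (auto simp: real_distribution_def)
  have "(\<Prod>i\<in>J. measure (weight_law \<omega> \<xi> i) (A i)) = (\<Prod>i\<in>Inl ` J1. measure (weight_law \<omega> \<xi> i) (A i)) * (\<Prod>i\<in>Inr ` J2. measure (weight_law \<omega> \<xi> i) (A i))"
    unfolding J_def using q(1) r(1) by (intro prod.union_disjoint) auto
  also have "\<dots> = (\<Prod>v\<in>J1. measure \<omega> (A (Inl v))) * (\<Prod>v\<in>J2. measure \<xi> (A (Inr v)))"
    by (simp add: prod.reindex)
  also have "\<dots> = (\<Prod>e\<in>edges g. measure \<omega> (A1 e)) * (\<Prod>v\<in>verts g. measure \<xi> (A2 v))"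
    using prod_measure_extend[OF u(1,2) fin(2) q(2,3), of "\<lambda>v. A (Inl v)"]
      prod_measure_extend[OF u(3,4) fin(1) r(2,3), of "\<lambda>v. A (Inr v)"] by (simp add: A1_def A2_def)
  finally show ?thesis using * unfolding set E_def by (simp add: mult.assoc)
qed

lemma sets_completion_AE_eq:
  assumes D: "D \<in> sets M" and ae: "AE x in M. P x \<longleftrightarrow> x \<in> D"
  shows "{x\<in>space M. P x} \<in> sets (completion M)"
proof -
  have ae1: "AE x in M. \<not> (x \<in> D \<and> \<not> P x)" and ae2: "AE x in M. \<not> (x \<notin> D \<and> P x)" using ae by auto
  have "{x\<in>space (completion M). x \<in> D \<and> \<not> P x} \<in> sets (completion M)"
    using sets_completion_AE[OF ae1] by (simp add: pred_def)
  moreover have "{x\<in>space (completion M). x \<notin> D \<and> P x} \<in> sets (completion M)"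
    using sets_completion_AE[OF ae2] by (simp add: pred_def)
  ultimately
  have "(D - {x\<in>space (completion M). x \<in> D \<and> \<not> P x}) \<union> {x\<in>space (completion M). x \<notin> D \<and> P x} \<in> sets (completion M)"
    using D by auto
  also have "(D - {x\<in>space (completion M). x \<in> D \<and> \<not> P x}) \<union> {x\<in>space (completion M). x \<notin> D \<and> P x} = {x\<in>space M. P x}"
    using sets.sets_into_space[OF D] by auto
  finally show ?thesis .
qed

lemma measurable_PiM_component:
  assumes "\<And>i. sets (\<nu> i) = sets (borel :: real measure)"
  shows "(\<lambda>y. y i) \<in> borel_measurable (PiM J \<nu>)"
proof (cases "i \<in> J")
  case True
  then have "(\<lambda>y. y i) \<in> PiM J \<nu> \<rightarrow>\<^sub>M \<nu> i" by (rule measurable_component_singleton)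
  then show ?thesis using measurable_cong_sets[OF refl assms] by blast
next
  \<comment> \<open>Outside \<open>J\<close> every element of the product takes the value
    \<open>undefined\<close>, so the coordinate is constant.\<close>
  case False
  have "(\<lambda>y. undefined) \<in> borel_measurable (PiM J \<nu>)" by simp
  moreover have "y i = undefined" if "y \<in> space (PiM J \<nu>)" for y
    using that False by (auto simp: space_PiM PiE_def extensional_def)
  ultimately show ?thesis by (subst measurable_cong[where g="\<lambda>_. undefined"])
qed

text \<open>The weight of an edge that distinguishes two configurations is independent of everything
  else, so an atomless law forbids ties.\<close>

lemma AE_values_differ:
  assumes dist: "real_distribution \<omega>" "real_distribution \<xi>" and atomless: "atomless \<omega>"
    and g: "rooted_graph g" "finite (verts g)" and M: "md_config g M" "md_config g M'" "M \<noteq> M'"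
  shows "AE y in PiM (Inl ` edges g \<union> Inr ` verts g) (weight_law \<omega> \<xi>).
    md_value g (\<lambda>e. y (Inl e)) (\<lambda>v. y (Inr v)) M \<noteq> md_value g (\<lambda>e. y (Inl e)) (\<lambda>v. y (Inr v)) M'"
proof -
  interpret finite_rooted_graph g "\<lambda>_. 0" "\<lambda>_. 0" by (rule finite_rooted_graph.intro) fact+
  have *: "AE y in PiM (Inl ` edges g \<union> Inr ` verts g) (weight_law \<omega> \<xi>).
      md_value g (\<lambda>e. y (Inl e)) (\<lambda>v. y (Inr v)) M \<noteq> md_value g (\<lambda>e. y (Inl e)) (\<lambda>v. y (Inr v)) M'"
    if M: "md_config g M" "md_config g M'" "e \<in> M" "e \<notin> M'" for M M' e
  proof -
    note \<nu> = weight_law_props[OF dist]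
    interpret om: real_distribution \<omega> by fact
    let ?\<nu> = "weight_law \<omega> \<xi> :: 'a set + 'a \<Rightarrow> real measure"
    let ?J = "Inl ` edges g \<union> Inr ` verts g :: ('a set + 'a) set"
    let ?J' = "?J - {Inl e}"
    have e: "e \<in> edges g" using M by (auto simp: md_config_def)
    have fM: "finite M" using finite_config M by blast
    define d where "d y = md_value g (\<lambda>e. y (Inl e)) (\<lambda>v. y (Inr v)) M - md_value g (\<lambda>e. y (Inl e)) (\<lambda>v. y (Inr v)) M'" for y :: "'a set + 'a \<Rightarrow> real"
    have shift: "d (y(Inl e := c)) = d (y(Inl e := 0)) + c" for y c
    proof -
      have "(\<Sum>e'\<in>M. (y(Inl e := c)) (Inl e')) = c + (\<Sum>e'\<in>M. (y(Inl e := 0)) (Inl e'))"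
        using fM M(3) by (simp add: sum.remove[of M e])
      moreover have "(\<Sum>e'\<in>M'. (y(Inl e := c)) (Inl e')) = (\<Sum>e'\<in>M'. (y(Inl e := 0)) (Inl e'))"
        using M(4) by (intro sum.cong) auto
      ultimately show ?thesis by (simp add: d_def md_value_def)
    qed
    have pN: "prob_space (PiM ?J' ?\<nu>)" by (intro prob_space_PiM \<nu>)
    have ins: "distr (?\<nu> (Inl e) \<Otimes>\<^sub>M PiM ?J' ?\<nu>) (PiM ?J ?\<nu>) (\<lambda>(z, y). y(Inl e := z)) = PiM ?J ?\<nu>"
    proof -
      have i: "insert (Inl e) ?J' = ?J" using e by blast
      show ?thesis using distr_pair_PiM_eq_PiM[of ?J' ?\<nu> "Inl e", OF \<nu>(1) \<nu>(1)] by (simp only: i)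
    qed
    have m: "(\<lambda>(z, y). y(Inl e := z)) \<in> ?\<nu> (Inl e) \<Otimes>\<^sub>M PiM ?J' ?\<nu> \<rightarrow>\<^sub>M PiM ?J ?\<nu>"
      unfolding split_beta'
      by (rule measurable_fun_upd[where J="?J'"]) (use e in \<open>auto intro: measurable_snd measurable_fst\<close>)
    have dm: "d \<in> borel_measurable (PiM ?J ?\<nu>)"
      unfolding d_def md_value_def
      by (intro borel_measurable_diff borel_measurable_add borel_measurable_sum measurable_PiM_component \<nu>)
    have "AE z in ?\<nu> (Inl e) \<Otimes>\<^sub>M PiM ?J' ?\<nu>. d (case z of (z, y) \<Rightarrow> y(Inl e := z)) \<noteq> 0"
    proof (rule AE_pair_swapI)
      show "{z\<in>space (?\<nu> (Inl e) \<Otimes>\<^sub>M PiM ?J' ?\<nu>). d (case z of (z, y) \<Rightarrow> y(Inl e := z)) \<noteq> 0} \<in> sets (?\<nu> (Inl e) \<Otimes>\<^sub>M PiM ?J' ?\<nu>)"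
        by (rule borel_measurable_neq[OF measurable_compose[OF m dm] measurable_const]) simp
      show "AE y in PiM ?J' ?\<nu>. AE c in ?\<nu> (Inl e). d (case (c, y) of (z, y) \<Rightarrow> y(Inl e := z)) \<noteq> 0"
      proof (rule AE_I2)
        fix y
        have "AE c in \<omega>. c \<noteq> - d (y(Inl e := 0))"
          using atomless by (intro AE_I'[where N="{- d (y(Inl e := 0))}"])
            (auto simp: atomless_def null_sets_def om.emeasure_eq_measure)
        then have "AE c in \<omega>. d (y(Inl e := c)) \<noteq> 0"
        proof eventually_elim
          case (elim c)
          then show ?case using shift[of y c] by linarith
        qed
        then show "AE c in ?\<nu> (Inl e). d (case (c, y) of (z, y) \<Rightarrow> y(Inl e := z)) \<noteq> 0"
          unfolding sum.case prod.case .
      qed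
    qed (rule prob_space_imp_sigma_finite \<nu> pN)+
    moreover have "{y\<in>space (PiM ?J ?\<nu>). d y \<noteq> 0} \<in> sets (PiM ?J ?\<nu>)"
      by (rule borel_measurable_neq[OF dm measurable_const]) simp
    ultimately have "AE y in distr (?\<nu> (Inl e) \<Otimes>\<^sub>M PiM ?J' ?\<nu>) (PiM ?J ?\<nu>) (\<lambda>(z, y). y(Inl e := z)). d y \<noteq> 0"
      by (simp only: AE_distr_iff[OF m])
    then show ?thesis unfolding ins by eventually_elim (simp add: d_def)
  qed
  from M(3) obtain e where "e \<in> M \<and> e \<notin> M' \<or> e \<in> M' \<and> e \<notin> M" by blast
  then show ?thesis
  proof
    assume "e \<in> M' \<and> e \<notin> M"
    with *[OF M(2,1), of e] show ?thesis by (auto simp: eq_commute)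
  qed (use *[OF M(1,2), of e] in blast)
qed

section \<open>Optimal configurations on random finite graphs\<close>

locale weighted_finite_graphs =
  fixes P :: "'p measure" and G :: "'p \<Rightarrow> nat list rgraph" and \<omega> \<xi> :: "real measure"
    and w :: "'p \<Rightarrow> nat list set \<Rightarrow> real" and x :: "'p \<Rightarrow> nat list \<Rightarrow> real" and MD :: "'p \<Rightarrow> nat list set set"
  assumes omega: "real_distribution \<omega>" and xi: "real_distribution \<xi>" and atomless: "atomless \<omega>"
    and P: "prob_space P" and G: "G \<in> P \<rightarrow>\<^sub>M count_space UNIV"
    and graph: "\<And>p. p \<in> space P \<Longrightarrow> rooted_graph (G p) \<and> finite (verts (G p))"
    and iid: "iid_weights P G \<omega> \<xi> w x"
    and optimal: "\<And>p. p \<in> space P \<Longrightarrow> optimal_md (G p) (w p) (x p) (MD p)"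
begin

sublocale P: prob_space P by (rule P)

abbreviation "event g \<equiv> {p\<in>space P. G p = g}"

definition graphs :: "nat list rgraph set" where "graphs = {g. rooted_graph g \<and> finite (verts g)}"

lemma countable_graphs: "countable graphs"
proof (rule countable_subset[OF _ countable_finite_graphs])
  show "graphs \<subseteq> {g. finite (verts g) \<and> edges g \<subseteq> Pow (verts g)}"
    unfolding graphs_def rooted_graph_def by fastforce
qed

lemma G_in_graphs: "p \<in> space P \<Longrightarrow> G p \<in> graphs"
  using graph by (simp add: graphs_def)

lemma sets_event: "event g \<in> sets P"
  using measurable_sets[OF G, of "{g}"] by (simp add: vimage_def Int_def conj_commute)

lemma graph_finite_edges: "g \<in> graphs \<Longrightarrow> finite (edges g)"
  by (rule finite_rooted_graph.finite_edges) (simp add: graphs_def finite_rooted_graph.intro)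

lemma configuration_in_mdgraphs: "p \<in> space P \<Longrightarrow> (G p, MD p) \<in> mdgraphs"
  using graph optimal by (auto simp: mdgraphs_def optimal_md_def)

abbreviation "full_index g \<equiv> Inl ` edges g \<union> Inr ` verts g"
abbreviation "weights p \<equiv> case_sum (w p) (x p)"

lemma full_law:
  assumes g: "g \<in> graphs" and F: "F \<in> borel_measurable (PiM (full_index g) (weight_law \<omega> \<xi>))"
  shows "(\<lambda>p. restrict (weights p) (full_index g)) \<in> restrict_space P (event g) \<rightarrow>\<^sub>M PiM (full_index g) (weight_law \<omega> \<xi>)"
    and "(\<integral>\<^sup>+p. F (restrict (weights p) (full_index g)) * indicator (event g) p \<partial>P)
      = emeasure P (event g) * (\<integral>\<^sup>+z. F z \<partial>PiM (full_index g) (weight_law \<omega> \<xi>))"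
proof -
  have fin: "finite (verts g)" "finite (edges g)" using g graph_finite_edges by (auto simp: graphs_def)
  have fJ: "finite (full_index g)" using fin by simp
  have rect: "{p\<in>space P. p \<in> event g \<and> (\<forall>i\<in>full_index g. weights p i \<in> A i)} \<in> sets P
      \<and> measure P {p\<in>space P. p \<in> event g \<and> (\<forall>i\<in>full_index g. weights p i \<in> A i)}
        = measure P (event g) * (\<Prod>i\<in>full_index g. measure (weight_law \<omega> \<xi> i) (A i))"
    if "\<And>i. A i \<in> sets borel" for A
    using iid_weights_rect[OF iid omega xi fin, of "edges g" "\<lambda>e. e" "verts g" "\<lambda>v. v" A] fin that by (simp add: inj_on_def)
  show "(\<lambda>p. restrict (weights p) (full_index g)) \<in> restrict_space P (event g) \<rightarrow>\<^sub>M PiM (full_index g) (weight_law \<omega> \<xi>)"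
    by (rule nn_integral_conditional_product(1)[OF P fJ weight_law_props[OF omega xi] sets_event rect F])
  show "(\<integral>\<^sup>+p. F (restrict (weights p) (full_index g)) * indicator (event g) p \<partial>P)
      = emeasure P (event g) * (\<integral>\<^sup>+z. F z \<partial>PiM (full_index g) (weight_law \<omega> \<xi>))"
    by (rule nn_integral_conditional_product(2)[OF P fJ weight_law_props[OF omega xi] sets_event rect F])
qed

lemma md_value_restrict:
  assumes "md_config g M"
  shows "md_value g (\<lambda>e. restrict (weights p) (full_index g) (Inl e)) (\<lambda>v. restrict (weights p) (full_index g) (Inr v)) M
    = md_value g (w p) (x p) M"
proof -
  have "M \<subseteq> edges g" using assms by (simp add: md_config_def)
  then show ?thesis unfolding md_value_def
    by (intro arg_cong2[where f="(+)"] sum.cong) (auto simp: restrict_def)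
qed

lemma measurable_md_value:
  "(\<lambda>y. md_value g (\<lambda>e. y (Inl e)) (\<lambda>v. y (Inr v)) M) \<in> borel_measurable (PiM J (weight_law \<omega> \<xi>))"
  unfolding md_value_def
  by (intro borel_measurable_add borel_measurable_sum measurable_PiM_component weight_law_props[OF omega xi])

text \<open>There are countably many finite graphs and finitely many configurations on each. Almost
  surely no two configurations have the same value, so the given optimum is the only one.\<close>

lemma AE_unique_optimum:
  "AE p in P. \<forall>M. optimal_md (G p) (w p) (x p) M \<longrightarrow> M = MD p"
proof -
  have tie: "AE p in P. G p = g \<longrightarrow> md_value g (w p) (x p) M \<noteq> md_value g (w p) (x p) M'"
    if g: "g \<in> graphs" and M: "md_config g M" "md_config g M'" "M \<noteq> M'" for g M M'
  proof -
    let ?N = "PiM (full_index g) (weight_law \<omega> \<xi>)"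
    let ?v = "\<lambda>M y. md_value g (\<lambda>e. y (Inl e)) (\<lambda>v. y (Inr v)) M"
    let ?T = "{y\<in>space ?N. ?v M y = ?v M' y}"
    have T: "?T \<in> sets ?N" by (rule borel_measurable_eq[OF measurable_md_value measurable_md_value])
    have "AE y in ?N. ?v M y \<noteq> ?v M' y"
      using AE_values_differ[OF omega xi atomless _ _ M] g by (simp add: graphs_def)
    then have T0: "emeasure ?N ?T = 0"
      by (subst AE_iff_measurable[symmetric, OF T, where P="\<lambda>y. ?v M y \<noteq> ?v M' y"]) auto
    have "(\<integral>\<^sup>+p. indicator ?T (restrict (weights p) (full_index g)) * indicator (event g) p \<partial>P)
        = emeasure P (event g) * (\<integral>\<^sup>+z. indicator ?T z \<partial>?N)"
      using T by (intro full_law(2)[OF g]) simp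
    also have "\<dots> = 0" using T T0 by simp
    finally have z: "(\<integral>\<^sup>+p. indicator ?T (restrict (weights p) (full_index g)) * indicator (event g) p \<partial>P) = 0" .
    have m: "(\<lambda>p. indicator ?T (restrict (weights p) (full_index g)) * indicator (event g) p :: ennreal) \<in> borel_measurable P"
    proof -
      have "(\<lambda>p. indicator ?T (restrict (weights p) (full_index g)) :: ennreal) \<in> borel_measurable (restrict_space P (event g))"
        using measurable_compose[OF full_law(1)[OF g, of "\<lambda>_. 0"] borel_measurable_indicator[OF T]] by simp
      then show ?thesis
        using sets_event by (subst (asm) borel_measurable_restrict_space_iff_ennreal) auto
    qed
    from z have "AE p in P. indicator ?T (restrict (weights p) (full_index g)) * indicator (event g) p = (0 :: ennreal)"
      by (subst (asm) nn_integral_0_iff_AE[OF m])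
    with AE_space show ?thesis
    proof eventually_elim
      case (elim p)
      show ?case
      proof
        assume "G p = g"
        with elim have nT: "restrict (weights p) (full_index g) \<notin> ?T" by (auto simp: indicator_def split: if_splits)
        have "restrict (weights p) (full_index g) \<in> space ?N"
          using measurable_space[OF full_law(1)[OF g, of "\<lambda>_. 0"], of p] elim(1) \<open>G p = g\<close> by (simp add: space_restrict_space)
        with nT show "md_value g (w p) (x p) M \<noteq> md_value g (w p) (x p) M'"
          using md_value_restrict[OF M(1)] md_value_restrict[OF M(2)] by simp
      qed
    qed
  qed
  have conf: "finite {M. md_config g M}" if "g \<in> graphs" for g
    using finite_subset[of "{M. md_config g M}" "Pow (edges g)"] graph_finite_edges[OF that] by (auto simp: md_config_def)
  have "AE p in P. \<forall>M\<in>{M. md_config g M}. \<forall>M'\<in>{M. md_config g M}. M \<noteq> M' \<longrightarrow> G p = g \<longrightarrow>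
      md_value g (w p) (x p) M \<noteq> md_value g (w p) (x p) M'" if g: "g \<in> graphs" for g
    using conf[OF g] tie[OF g] by (intro AE_finite_allI AE_impI) auto
  then have "AE p in P. \<forall>g\<in>graphs. \<forall>M\<in>{M. md_config g M}. \<forall>M'\<in>{M. md_config g M}. M \<noteq> M' \<longrightarrow> G p = g \<longrightarrow>
      md_value g (w p) (x p) M \<noteq> md_value g (w p) (x p) M'"
    by (subst AE_ball_countable[OF countable_graphs]) blast
  with AE_space show ?thesis
  proof eventually_elim
    case (elim p)
    show ?case
    proof (intro allI impI)
      fix M assume M: "optimal_md (G p) (w p) (x p) M"
      have "md_value (G p) (w p) (x p) M = md_value (G p) (w p) (x p) (MD p)"
        using M optimal[OF elim(1)] unfolding optimal_md_def by (meson antisym)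
      with elim(2) G_in_graphs[OF elim(1)] M optimal[OF elim(1)] show "M = MD p"
        unfolding optimal_md_def by blast
    qed
  qed
qed

lemma sets_optimal:
  assumes g: "g \<in> graphs" and M: "md_config g M"
  shows "{p\<in>space P. G p = g \<and> optimal_md g (w p) (x p) M} \<in> sets P"
proof -
  let ?N = "PiM (full_index g) (weight_law \<omega> \<xi>)"
  let ?v = "\<lambda>M y. md_value g (\<lambda>e. y (Inl e)) (\<lambda>v. y (Inr v)) M"
  have conf: "finite {M. md_config g M}"
    using finite_subset[of "{M. md_config g M}" "Pow (edges g)"] graph_finite_edges[OF g] by (auto simp: md_config_def)
  have "{y\<in>space ?N. \<forall>M'\<in>{M. md_config g M}. ?v M' y \<le> ?v M y} \<in> sets ?N"
    using conf by (intro sets.sets_Collect_finite_All borel_measurable_le measurable_md_value)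
  from measurable_sets[OF full_law(1)[OF g, of "\<lambda>_. 0"] this]
  have "(\<lambda>p. restrict (weights p) (full_index g)) -` {y\<in>space ?N. \<forall>M'\<in>{M. md_config g M}. ?v M' y \<le> ?v M y} \<inter> space (restrict_space P (event g))
      \<in> sets (restrict_space P (event g))" by simp
  also have "(\<lambda>p. restrict (weights p) (full_index g)) -` {y\<in>space ?N. \<forall>M'\<in>{M. md_config g M}. ?v M' y \<le> ?v M y} \<inter> space (restrict_space P (event g))
      = {p\<in>space P. G p = g \<and> optimal_md g (w p) (x p) M}"
  proof (intro equalityI subsetI)
    fix p assume p: "p \<in> {p\<in>space P. G p = g \<and> optimal_md g (w p) (x p) M}"
    then have "restrict (weights p) (full_index g) \<in> space ?N"
      using measurable_space[OF full_law(1)[OF g, of "\<lambda>_. 0"], of p] by (simp add: space_restrict_space)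
    with p M show "p \<in> (\<lambda>p. restrict (weights p) (full_index g)) -` {y\<in>space ?N. \<forall>M'\<in>{M. md_config g M}. ?v M' y \<le> ?v M y} \<inter> space (restrict_space P (event g))"
      using md_value_restrict by (auto simp: space_restrict_space optimal_md_def simp del: restrict_apply)
  next
    fix p assume "p \<in> (\<lambda>p. restrict (weights p) (full_index g)) -` {y\<in>space ?N. \<forall>M'\<in>{M. md_config g M}. ?v M' y \<le> ?v M y} \<inter> space (restrict_space P (event g))"
    then show "p \<in> {p\<in>space P. G p = g \<and> optimal_md g (w p) (x p) M}"
      using M md_value_restrict by (auto simp: space_restrict_space optimal_md_def simp del: restrict_apply)
  qed
  finally have "{p\<in>space P. G p = g \<and> optimal_md g (w p) (x p) M} \<in> sets (restrict_space P (event g))" .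
  then show ?thesis using sets_event by (subst (asm) sets_restrict_space_iff) auto
qed

text \<open>\<open>MD\<close> is an arbitrary selection of optima. Almost sure uniqueness identifies
  its class events, up to null sets, with measurable events that speak of optimality only.\<close>

lemma measurable_configuration: "(\<lambda>p. (G p, MD p)) \<in> completion P \<rightarrow>\<^sub>M borel_of local_topology"
proof (rule measurable_borel_of_local)
  show "(G p, MD p) \<in> mdgraphs" if "p \<in> space (completion P)" for p
    using that configuration_in_mdgraphs by simp
  fix H and G0 :: "nat list mdgraph"
  let ?D = "\<Union>g\<in>graphs. \<Union>M\<in>{M. md_config g M \<and> (g, M) \<in> cls H G0}. {p\<in>space P. G p = g \<and> optimal_md g (w p) (x p) M}"
  have fin: "finite {M. md_config g M \<and> (g, M) \<in> cls H G0}" if "g \<in> graphs" for g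
    using finite_subset[of "{M. md_config g M \<and> (g, M) \<in> cls H G0}" "Pow (edges g)"] graph_finite_edges[OF that]
    by (auto simp: md_config_def)
  have D: "?D \<in> sets P"
    using countable_graphs fin sets_optimal by (intro sets.countable_UN' sets.finite_UN) auto
  have "AE p in P. (G p, MD p) \<in> cls H G0 \<longleftrightarrow> p \<in> ?D"
    using AE_space AE_unique_optimum
  proof eventually_elim
    case (elim p)
    show ?case
    proof
      assume "(G p, MD p) \<in> cls H G0"
      then show "p \<in> ?D" using elim(1) G_in_graphs[OF elim(1)] optimal[OF elim(1)] by (auto simp: optimal_md_def)
    next
      assume "p \<in> ?D"
      then obtain M where "(G p, M) \<in> cls H G0" "optimal_md (G p) (w p) (x p) M" by auto
      with elim(2) show "(G p, MD p) \<in> cls H G0" by blast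
    qed
  qed
  from sets_completion_AE_eq[OF D this]
  show "{p \<in> space (completion P). (G p, MD p) \<in> cls H G0} \<in> sets (completion P)" by simp
qed

end

section \<open>Local lower bounds\<close>

definition decided where
  "decided h k b W X \<longleftrightarrow> (\<forall>v\<in>tree_verts b. v \<noteq> [] \<and> length v \<le> h + 1 \<longrightarrow> edge_yes b W X k v \<or> edge_no b W X k v)"

definition chosen where
  "chosen h k b W X = {v\<in>tree_verts b. v \<noteq> [] \<and> length v \<le> h + 1 \<and> edge_yes b W X k v}"

text \<open>The class is empty if, for instance, the chosen edges near the root do not form a
  monomer-dimer configuration; the value 0 avoids an infimum over the empty set.\<close>

definition class_score :: "nat \<Rightarrow> (nat list mdgraph \<Rightarrow> real) \<Rightarrow> nat list mdgraph \<Rightarrow> ennreal" where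
  "class_score h f G = (if cls h G = {} then 0 else ennreal (cls_inf h f G))"

text \<open>A lower bound for \<open>f\<close> at the optimal configuration that looks at the weights up to
  generation \<open>h + 2 * k + 2\<close> only.\<close>

definition score where
  "score h k f b W X =
    (if decided h k b W X then class_score h f (offspring_tree b, config_of b (chosen h k b W X)) else 0)"

lemma score_cong:
  assumes X: "\<And>u. u \<in> tree_verts b \<Longrightarrow> length u \<le> h + 2 * k + 2 \<Longrightarrow> X u = X' u"
    and W: "\<And>u. u \<in> tree_verts b \<Longrightarrow> length u \<le> h + 2 * k + 2 \<Longrightarrow> u \<noteq> [] \<Longrightarrow> W u = W' u"
  shows "score h k f b W X = score h k f b W' X'"
proof -
  \<comment> \<open>The edges have lower endpoints up to level \<open>h + 1\<close>, and their
    decisions look at most \<open>2 * k + 1\<close> levels further; together this is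
    \<open>h + 2 * k + 2\<close>.\<close>
  have *: "edge_yes b W X k v \<longleftrightarrow> edge_yes b W' X' k v" "edge_no b W X k v \<longleftrightarrow> edge_no b W' X' k v"
    if "v \<in> tree_verts b" "v \<noteq> []" "length v \<le> h + 1" for v
    using that X W by (intro edge_decision_cong[where L="h + 2 * k + 2"]; simp)+
  have "decided h k b W X \<longleftrightarrow> decided h k b W' X'" unfolding decided_def using * by blast
  moreover have "chosen h k b W X = chosen h k b W' X'" unfolding chosen_def using * by blast
  ultimately show ?thesis by (simp add: score_def)
qed

lemma class_score_le:
  assumes G: "G \<in> mdgraphs" and nn: "\<And>G. G \<in> mdgraphs \<Longrightarrow> 0 \<le> f G"
  shows "class_score h f G \<le> ennreal (f G)"
  unfolding class_score_def using cls_inf_le[where f=f, OF G nn] by (simp add: ennreal_leI)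

text \<open>When all edges near the root are decided and \<open>M\<close> obeys the decisions, these
  determine the ball with its configuration up to isomorphism. Finite graphs and the tree are
  treated alike.\<close>

lemma score_eq:
  assumes G: "(g, M) \<in> mdgraphs" and chart: "tree_chart L b \<phi> g" and L: "h + 2 \<le> L"
    and yes: "\<And>v. v \<in> tree_verts b \<Longrightarrow> v \<noteq> [] \<Longrightarrow> length v \<le> h + 1 \<Longrightarrow> edge_yes b W X k v \<Longrightarrow> {\<phi> (butlast v), \<phi> v} \<in> M"
    and no: "\<And>v. v \<in> tree_verts b \<Longrightarrow> v \<noteq> [] \<Longrightarrow> length v \<le> h + 1 \<Longrightarrow> edge_no b W X k v \<Longrightarrow> {\<phi> (butlast v), \<phi> v} \<notin> M"
    and dec: "decided h k b W X"
  shows "score h k f b W X = class_score h f (g, M)"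
proof -
  let ?T = "(offspring_tree b, config_of b (chosen h k b W X))"
  have g: "rooted_graph g" and M: "M \<subseteq> edges g" using G by (auto simp: mdgraphs_def md_config_def)
  have iso: "rball h ?T \<cong>\<^sub>r rball h (g, M)"
  proof (rule rball_iso_of_chart[OF g chart L M])
    fix v assume v: "v \<in> tree_verts b" "v \<noteq> []" "length v \<le> h + 1"
    then have "edge_yes b W X k v \<or> edge_no b W X k v" using dec by (simp add: decided_def)
    with yes[OF v] no[OF v] v show "{\<phi> (butlast v), \<phi> v} \<in> M \<longleftrightarrow> v \<in> chosen h k b W X"
      by (auto simp: chosen_def)
  qed
  have iso': "rball h (g, M) \<cong>\<^sub>r rball h ?T" by (rule rball_iso_sym[OF iso rooted_graph_offspring_tree])
  have "cls h ?T = cls h (g, M)"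
    unfolding cls_def using iso iso' by (blast intro: mdgraph_iso_trans)
  then show ?thesis using dec by (simp add: score_def class_score_def cls_inf_def)
qed

lemma score_le_optimal:
  assumes g: "rooted_graph g" "finite (verts g)" and chart: "tree_chart (h + 2 * k + 2) b \<phi> g"
    and opt: "optimal_md g w x M" and nn: "\<And>G. G \<in> mdgraphs \<Longrightarrow> 0 \<le> f G"
  shows "score h k f b (pull \<phi> w) (\<lambda>v. x (\<phi> v)) \<le> ennreal (f (g, M))"
proof (cases "decided h k b (pull \<phi> w) (\<lambda>v. x (\<phi> v))")
  case True
  have G: "(g, M) \<in> mdgraphs" using g opt by (simp add: mdgraphs_def optimal_md_def)
  have "score h k f b (pull \<phi> w) (\<lambda>v. x (\<phi> v)) = class_score h f (g, M)"
    by (rule score_eq[OF G chart _ _ _ True]; (rule optimal_edge_decision[OF g chart opt])?) simp_all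
  then show ?thesis using class_score_le[OF G nn] by simp
qed (simp add: score_def)

section \<open>Conditional means of scores given the graph\<close>

abbreviation score_index :: "nat \<Rightarrow> (nat list \<Rightarrow> nat) \<Rightarrow> (nat list + nat list) set" where
  "score_index L b \<equiv> Inl ` {v\<in>tree_verts b. v \<noteq> [] \<and> length v \<le> L} \<union> Inr ` {v\<in>tree_verts b. length v \<le> L}"

abbreviation "coded_score h k f b y \<equiv> score h k f b (\<lambda>v. y (Inl v)) (\<lambda>v. y (Inr v))"

lemma coded_score_cong:
  "(\<And>i. i \<in> score_index (h + 2 * k + 2) b \<Longrightarrow> y i = y' i) \<Longrightarrow> coded_score h k f b y = coded_score h k f b y'"
  by (rule score_cong) auto

lemma sets_edge_decision:
  assumes W: "\<And>v. (\<lambda>z. W z v) \<in> borel_measurable M" and X: "\<And>v. (\<lambda>z. X z v) \<in> borel_measurable M"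
  shows "{z\<in>space M. edge_yes b (W z) (X z) k v} \<in> sets M" "{z\<in>space M. edge_no b (W z) (X z) k v} \<in> sets M"
proof -
  have z: "(\<lambda>z. zmsg b (W z) (X z) n v) \<in> borel_measurable M" for n v
    using W X by (intro measurable_zmsg) auto
  have d: "(\<lambda>z. down b (W z) (X z) (\<lambda>s. zmsg b (W z) (X z) (2 * k + of_bool s)) s v) \<in> borel_measurable M" for s v
    using W X z by (intro measurable_down) auto
  show "{z\<in>space M. edge_yes b (W z) (X z) k v} \<in> sets M" "{z\<in>space M. edge_no b (W z) (X z) k v} \<in> sets M"
    unfolding edge_yes_def edge_no_def by (intro borel_measurable_less borel_measurable_add z d W)+
qed

lemma sets_decided:
  assumes W: "\<And>v. (\<lambda>z. W z v) \<in> borel_measurable M" and X: "\<And>v. (\<lambda>z. X z v) \<in> borel_measurable M"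
  shows "{z\<in>space M. decided h k b (W z) (X z)} \<in> sets M"
    and "{z\<in>space M. chosen h k b (W z) (X z) = C} \<in> sets M"
proof -
  let ?E = "{v\<in>tree_verts b. v \<noteq> [] \<and> length v \<le> h + 1}"
  have fin: "finite ?E" by (rule finite_subset[OF _ finite_tree_level[of b "h + 1"]]) auto
  note s = sets_edge_decision[OF W X, where b=b and k=k]
  have "{z\<in>space M. \<forall>v\<in>?E. edge_yes b (W z) (X z) k v \<or> edge_no b (W z) (X z) k v} \<in> sets M"
    by (intro sets.sets_Collect_finite_All sets.sets_Collect_disj s fin)
  also have "{z\<in>space M. \<forall>v\<in>?E. edge_yes b (W z) (X z) k v \<or> edge_no b (W z) (X z) k v} = {z\<in>space M. decided h k b (W z) (X z)}"
    by (simp add: decided_def Ball_def imp_conjL)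
  finally show "{z\<in>space M. decided h k b (W z) (X z)} \<in> sets M" .
  show "{z\<in>space M. chosen h k b (W z) (X z) = C} \<in> sets M"
  proof (cases "C \<subseteq> ?E")
    case True
    have S: "{z\<in>space M. \<forall>v\<in>?E. (v \<in> C \<longrightarrow> edge_yes b (W z) (X z) k v) \<and> (edge_yes b (W z) (X z) k v \<longrightarrow> v \<in> C)} \<in> sets M"
      by (intro sets.sets_Collect_finite_All sets.sets_Collect_conj sets.sets_Collect_imp sets.sets_Collect_const s fin)
    have ch: "chosen h k b (W z) (X z) = {v\<in>?E. edge_yes b (W z) (X z) k v}" for z by (simp add: chosen_def conj_assoc)
    have "(\<forall>v\<in>?E. (v \<in> C \<longrightarrow> p v) \<and> (p v \<longrightarrow> v \<in> C)) \<longleftrightarrow> {v\<in>?E. p v} = C" for p using True by blast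
    from this[of "edge_yes b (W z) (X z) k" for z] show ?thesis
      unfolding ch using S by (simp only:)
  next
    case False
    have "chosen h k b (W z) (X z) \<noteq> C" for z using False by (auto simp: chosen_def)
    then show ?thesis by simp
  qed
qed

lemma measurable_score:
  assumes W: "\<And>v. (\<lambda>z. W z v) \<in> borel_measurable M" and X: "\<And>v. (\<lambda>z. X z v) \<in> borel_measurable M"
  shows "(\<lambda>z. score h k f b (W z) (X z)) \<in> borel_measurable M"
proof -
  let ?E = "{v\<in>tree_verts b. v \<noteq> [] \<and> length v \<le> h + 1}"
  have fin: "finite (Pow ?E)" using finite_subset[OF _ finite_tree_level[of b "h + 1"], of ?E] by auto
  have c: "(\<lambda>z. chosen h k b (W z) (X z)) \<in> M \<rightarrow>\<^sub>M count_space (Pow ?E)"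
    unfolding measurable_count_space_eq2[OF fin]
  proof (intro conjI ballI)
    show "(\<lambda>z. chosen h k b (W z) (X z)) \<in> space M \<rightarrow> Pow ?E" by (auto simp: chosen_def)
    fix C
    have "(\<lambda>z. chosen h k b (W z) (X z)) -` {C} \<inter> space M = {z\<in>space M. chosen h k b (W z) (X z) = C}" by blast
    then show "(\<lambda>z. chosen h k b (W z) (X z)) -` {C} \<inter> space M \<in> sets M"
      using sets_decided(2)[OF W X] by simp
  qed
  have "(\<lambda>C. class_score h f (offspring_tree b, config_of b C)) \<in> count_space (Pow ?E) \<rightarrow>\<^sub>M borel" by simp
  from measurable_compose[OF c this] sets_decided(1)[OF W X] show ?thesis
    unfolding score_def by (intro measurable_If) auto
qed

definition mean_score where
  "mean_score \<omega> \<xi> h k f b = (\<integral>\<^sup>+y. coded_score h k f b y \<partial>PiM (score_index (h + 2 * k + 2) b) (weight_law \<omega> \<xi>))"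

text \<open>The supremum over all trees with the same ball avoids choosing a representative and
  makes the value depend on the isomorphism type only. It is 0 if the ball is not a tree. A ball of
  index \<open>h + 2 * k + 1\<close> reaches distance \<open>h + 2 * k + 2\<close>.\<close>

definition best_mean :: "real measure \<Rightarrow> real measure \<Rightarrow> nat \<Rightarrow> nat \<Rightarrow> (nat list mdgraph \<Rightarrow> real) \<Rightarrow> nat list mdgraph \<Rightarrow> ennreal" where
  "best_mean \<omega> \<xi> h k f G = (SUP b\<in>{b. rball (h + 2 * k + 1) (offspring_tree b, {}) \<cong>\<^sub>r rball (h + 2 * k + 1) G}. mean_score \<omega> \<xi> h k f b)"

lemma best_mean_cong:
  assumes "G \<in> mdgraphs" "G' \<in> cls (h + 2 * k + 1) G"
  shows "best_mean \<omega> \<xi> h k f G' = best_mean \<omega> \<xi> h k f G"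
proof -
  have 1: "rball (h + 2 * k + 1) G' \<cong>\<^sub>r rball (h + 2 * k + 1) G" and G': "G' \<in> mdgraphs" using assms(2) by (auto simp: cls_def)
  note 2 = mdgraph_rball_sym[OF G' 1]
  have "rball (h + 2 * k + 1) T \<cong>\<^sub>r rball (h + 2 * k + 1) G' \<longleftrightarrow> rball (h + 2 * k + 1) T \<cong>\<^sub>r rball (h + 2 * k + 1) G" for T
    using mdgraph_iso_trans[OF _ 1] mdgraph_iso_trans[OF _ 2] by (rule iffI)
  then show ?thesis by (simp add: best_mean_def)
qed

lemma score_bounded:
  assumes "\<And>G. G \<in> mdgraphs \<Longrightarrow> 0 \<le> f G" "\<And>G. G \<in> mdgraphs \<Longrightarrow> f G \<le> B"
  shows "class_score h f G \<le> ennreal B" "score h k f b W X \<le> ennreal B"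
proof -
  show c: "class_score h f G \<le> ennreal B" for G
  proof (cases "cls h G = {}")
    case False
    then obtain G' where G': "G' \<in> cls h G" by blast
    then have m: "G' \<in> mdgraphs" by (simp add: cls_def)
    have "cls_inf h f G \<le> f G'"
      unfolding cls_inf_def using assms(1) by (intro cINF_lower G' bdd_belowI2[of _ 0]) (simp add: cls_def)
    then show ?thesis using False assms(2)[OF m] by (simp add: class_score_def ennreal_leI)
  qed (simp add: class_score_def)
  show "score h k f b W X \<le> ennreal B" using c by (simp add: score_def)
qed

lemma best_mean_bounded:
  assumes dist: "real_distribution \<omega>" "real_distribution \<xi>"
    and f: "\<And>G. G \<in> mdgraphs \<Longrightarrow> 0 \<le> f G" "\<And>G. G \<in> mdgraphs \<Longrightarrow> f G \<le> B"
  shows "best_mean \<omega> \<xi> h k f G \<le> ennreal B"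
  unfolding best_mean_def mean_score_def
proof (rule SUP_least)
  fix b
  interpret N: prob_space "PiM (score_index (h + 2 * k + 2) b) (weight_law \<omega> \<xi>)"
    by (intro prob_space_PiM weight_law_props[OF dist])
  have "(\<integral>\<^sup>+y. coded_score h k f b y \<partial>PiM (score_index (h + 2 * k + 2) b) (weight_law \<omega> \<xi>))
      \<le> (\<integral>\<^sup>+y. ennreal B \<partial>PiM (score_index (h + 2 * k + 2) b) (weight_law \<omega> \<xi>))"
    by (intro nn_integral_mono score_bounded f)
  also have "\<dots> = ennreal B" by (simp only: nn_integral_const N.emeasure_space_1 mult_1_right)
  finally show "(\<integral>\<^sup>+y. coded_score h k f b y \<partial>PiM (score_index (h + 2 * k + 2) b) (weight_law \<omega> \<xi>)) \<le> ennreal B" .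
qed

context weighted_finite_graphs
begin

text \<open>Distinct labels name distinct edges and vertices of \<open>g\<close>, so given the graph
  the weights along the chart have the product law used in \<open>mean_score\<close>. For each
  outcome the score is a lower bound by \<open>score_le_optimal\<close>.\<close>

lemma mean_score_le:
  assumes g: "g \<in> graphs" and chart: "tree_chart (h + 2 * k + 2) b \<phi> g"
    and nn: "\<And>G. G \<in> mdgraphs \<Longrightarrow> 0 \<le> f G"
  shows "mean_score \<omega> \<xi> h k f b * emeasure P (event g) \<le> (\<integral>\<^sup>+p. ennreal (f (G p, MD p)) * indicator (event g) p \<partial>P)"
proof -
  define L where "L = h + 2 * k + 2"
  have chart: "tree_chart L b \<phi> g" using chart by (simp add: L_def)
  have fin: "finite (verts g)" "finite (edges g)" "rooted_graph g" using g graph_finite_edges by (auto simp: graphs_def)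
  define q where "q v = {\<phi> (butlast v), \<phi> v}" for v
  let ?J1 = "{v\<in>tree_verts b. v \<noteq> [] \<and> length v \<le> L}" and ?J2 = "{v\<in>tree_verts b. length v \<le> L}"
  let ?J = "score_index L b"
  let ?y = "\<lambda>p. case_sum (\<lambda>v. w p (q v)) (\<lambda>v. x p (\<phi> v))"
  have fin1: "finite ?J1" and fin2: "finite ?J2"
    using finite_tree_level[of b L] by (auto elim: finite_subset[rotated])
  have inj2: "inj_on \<phi> ?J2" using chart by (simp add: tree_chart_def)
  have inj1: "inj_on q ?J1"
  proof (rule inj_onI)
    fix u v assume u: "u \<in> ?J1" and v: "v \<in> ?J1" and eq: "q u = q v"
    have b: "butlast u \<in> ?J2" "butlast v \<in> ?J2" "u \<in> ?J2" "v \<in> ?J2" using u v tree_verts_butlast by auto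
    have "\<phi> ` {butlast u, u} = \<phi> ` {butlast v, v}" using eq by (simp add: q_def)
    then have "{butlast u, u} = {butlast v, v}" using b by (subst (asm) inj_on_image_eq_iff[OF inj2]) auto
    then show "u = v" using u v by (intro parent_edge_inj) auto
  qed
  have sub1: "q ` ?J1 \<subseteq> edges g"
  proof
    fix e assume "e \<in> q ` ?J1"
    then obtain v where v: "v \<in> ?J1" "e = q v" by blast
    have "v \<noteq> []" using v(1) by simp
    then obtain p c where pc: "v = p @ [c]" by (metis rev_exhaust)
    then have "p \<in> tree_verts b" "c < b p" "length p < L" using v(1) by (auto simp: tree_verts_snoc)
    then show "e \<in> edges g" using chart_nbrs[OF chart, of p] pc v(2) by (auto simp: q_def tnb_def)
  qed
  have sub2: "\<phi> ` ?J2 \<subseteq> verts g" using chart by (simp add: tree_chart_def)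
  have fJ: "finite ?J" using fin1 fin2 by simp
  have rect: "{p\<in>space P. p \<in> event g \<and> (\<forall>i\<in>?J. ?y p i \<in> A i)} \<in> sets P
      \<and> measure P {p\<in>space P. p \<in> event g \<and> (\<forall>i\<in>?J. ?y p i \<in> A i)}
        = measure P (event g) * (\<Prod>i\<in>?J. measure (weight_law \<omega> \<xi> i) (A i))"
    if "\<And>i. A i \<in> sets borel" for A
    by (rule iid_weights_rect[OF iid omega xi fin(1,2) fin1 inj1 sub1 fin2 inj2 sub2 that])
  have m: "coded_score h k f b \<in> borel_measurable (PiM ?J (weight_law \<omega> \<xi>))"
    by (intro measurable_score measurable_PiM_component weight_law_props[OF omega xi])
  have "mean_score \<omega> \<xi> h k f b * emeasure P (event g) = (\<integral>\<^sup>+p. coded_score h k f b (restrict (?y p) ?J) * indicator (event g) p \<partial>P)"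
    using nn_integral_conditional_product(2)[OF P fJ weight_law_props[OF omega xi] sets_event rect m]
    by (simp add: mean_score_def L_def mult.commute)
  also have "\<dots> \<le> (\<integral>\<^sup>+p. ennreal (f (G p, MD p)) * indicator (event g) p \<partial>P)"
  proof (rule nn_integral_mono)
    fix p assume p: "p \<in> space P"
    show "coded_score h k f b (restrict (?y p) ?J) * indicator (event g) p \<le> ennreal (f (G p, MD p)) * indicator (event g) p"
    proof (cases "G p = g")
      case True
      have "coded_score h k f b (restrict (?y p) ?J) = coded_score h k f b (?y p)"
        by (rule coded_score_cong) (simp add: L_def)
      also have "\<dots> = score h k f b (pull \<phi> (w p)) (\<lambda>v. x p (\<phi> v))"
        by (rule score_cong) (simp_all add: q_def pull_def)
      also have "\<dots> \<le> ennreal (f (g, MD p))"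
        using optimal[OF p] True chart by (intro score_le_optimal fin nn) (simp_all add: L_def)
      finally show ?thesis using True by (auto intro: mult_right_mono)
    qed (simp add: indicator_def)
  qed
  finally show ?thesis .
qed

text \<open>For each of the countably many graphs \<open>g\<close>, every tree in the supremum has
  its own chart and gives a bound on the event \<open>G p = g\<close>. So charts need not be chosen
  measurably.\<close>

lemma best_mean_le:
  assumes f: "continuous_map local_topology euclideanreal f" and nn: "\<And>G. G \<in> mdgraphs \<Longrightarrow> 0 \<le> f G"
  shows "(\<integral>\<^sup>+p. best_mean \<omega> \<xi> h k f (G p, {}) \<partial>completion P) \<le> (\<integral>\<^sup>+p. ennreal (f (G p, MD p)) \<partial>completion P)"
proof (rule nn_integral_mono_partition[OF countable_graphs, where X=G])
  show "G p \<in> graphs" if "p \<in> space (completion P)" for p using that G_in_graphs by simp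
  show "{p\<in>space (completion P). G p = g} \<in> sets (completion P)" for g using sets_event by auto
  have "(\<lambda>p. best_mean \<omega> \<xi> h k f (G p, {})) \<in> borel_measurable P"
    by (rule measurable_compose[OF G]) simp
  then show "(\<lambda>p. best_mean \<omega> \<xi> h k f (G p, {})) \<in> borel_measurable (completion P)"
    by (rule measurable_completion)
  show "(\<lambda>p. ennreal (f (G p, MD p))) \<in> borel_measurable (completion P)"
    using continuous_map_measurable_borel_of[OF f measurable_configuration] by simp
  fix g assume g: "g \<in> graphs"
  have "(\<integral>\<^sup>+p. best_mean \<omega> \<xi> h k f (G p, {}) * indicator (event g) p \<partial>P) = (\<integral>\<^sup>+p. best_mean \<omega> \<xi> h k f (g, {}) * indicator (event g) p \<partial>P)"
    by (intro nn_integral_cong) (auto simp: indicator_def)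
  also have "\<dots> = best_mean \<omega> \<xi> h k f (g, {}) * emeasure P (event g)"
    using sets_event by (simp add: nn_integral_cmult_indicator)
  also have "\<dots> = (SUP b\<in>{b. rball (h + 2 * k + 1) (offspring_tree b, {}) \<cong>\<^sub>r rball (h + 2 * k + 1) (g, {})}. mean_score \<omega> \<xi> h k f b * emeasure P (event g))"
    unfolding best_mean_def by (rule SUP_mult_right_ennreal)
  also have "\<dots> \<le> (\<integral>\<^sup>+p. ennreal (f (G p, MD p)) * indicator (event g) p \<partial>P)"
  proof (rule SUP_least)
    fix b assume "b \<in> {b. rball (h + 2 * k + 1) (offspring_tree b, {}) \<cong>\<^sub>r rball (h + 2 * k + 1) (g, {})}"
    then obtain \<phi> where "tree_chart (h + 2 * k + 1 + 1) b \<phi> g"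
      using g chart_of_iso[of g "h + 2 * k + 1" b "{}" "{}"] by (auto simp: graphs_def)
    then have "tree_chart (h + 2 * k + 2) b \<phi> g" by simp
    from mean_score_le[OF g this nn]
    show "mean_score \<omega> \<xi> h k f b * emeasure P (event g) \<le> (\<integral>\<^sup>+p. ennreal (f (G p, MD p)) * indicator (event g) p \<partial>P)" .
  qed
  finally show "(\<integral>\<^sup>+p. best_mean \<omega> \<xi> h k f (G p, {}) * indicator {p\<in>space (completion P). G p = g} p \<partial>completion P)
      \<le> (\<integral>\<^sup>+p. ennreal (f (G p, MD p)) * indicator {p\<in>space (completion P). G p = g} p \<partial>completion P)"
    by (simp add: nn_integral_completion)
qed

end

section \<open>The limiting tree\<close>

text \<open>The event fixes the offspring numbers at the labels of \<open>b\<close> of length less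
  than \<open>L\<close> and nothing else, which makes it a finite intersection of conditions on
  single labels.\<close>

lemma trunc_eq_iff:
  assumes b: "b \<in> range (trunc L)"
  shows "trunc L N = b \<longleftrightarrow> (\<forall>v\<in>tree_verts b. length v < L \<longrightarrow> N v = b v)"
proof
  assume e: "trunc L N = b"
  show "\<forall>v\<in>tree_verts b. length v < L \<longrightarrow> N v = b v"
  proof (intro ballI impI)
    fix v assume "v \<in> tree_verts b" "length v < L"
    then show "N v = b v" unfolding e[symmetric] tree_verts_trunc by (simp add: trunc_def)
  qed
next
  assume *: "\<forall>v\<in>tree_verts b. length v < L \<longrightarrow> N v = b v"
  obtain N0 where N0: "b = trunc L N0" using b by blast
  have len: "length v \<le> L" if "v \<in> tree_verts b" for v using that unfolding N0 tree_verts_trunc by simp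
  have t: "v \<in> tree_verts N \<and> length v \<le> L \<longleftrightarrow> v \<in> tree_verts b" for v
  proof (induction v rule: rev_induct)
    case Nil
    then show ?case by (simp add: tree_verts_Nil)
  next
    case (snoc c p)
    show ?case
    proof
      assume "p @ [c] \<in> tree_verts N \<and> length (p @ [c]) \<le> L"
      then have p: "p \<in> tree_verts N" "c < N p" "length p < L" by (auto simp: tree_verts_snoc)
      then have "p \<in> tree_verts b" using snoc by simp
      with * p show "p @ [c] \<in> tree_verts b" by (simp add: tree_verts_snoc)
    next
      assume pc: "p @ [c] \<in> tree_verts b"
      then have p: "p \<in> tree_verts b" "c < b p" by (auto simp: tree_verts_snoc)
      moreover have "length p < L" using len[OF pc] by simp
      ultimately show "p @ [c] \<in> tree_verts N \<and> length (p @ [c]) \<le> L" using * snoc by (simp add: tree_verts_snoc)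
    qed
  qed
  show "trunc L N = b"
  proof
    fix v
    show "trunc L N v = b v"
    proof (cases "length v < L \<and> v \<in> tree_verts N")
      case True
      then show ?thesis using t[of v] * by (simp add: trunc_def)
    next
      case False
      then have "\<not> (length v < L \<and> v \<in> tree_verts b)" using t[of v] by auto
      then have "b v = 0" unfolding N0 tree_verts_trunc by (auto simp: trunc_def)
      then show ?thesis using False by (auto simp: trunc_def)
    qed
  qed
qed

text \<open>A pruned tree is a function of finite support, determined by its finite graph over that
  support.\<close>

lemma countable_trunc: "countable (range (trunc L))"
proof (rule countable_image_inj_on)
  let ?g = "\<lambda>b :: nat list \<Rightarrow> nat. {(v, b v) | v. b v \<noteq> 0}"
  have "finite (?g (trunc L N))" for N
  proof -
    have "?g (trunc L N) \<subseteq> (\<lambda>v. (v, trunc L N v)) ` {v\<in>tree_verts N. length v \<le> L}"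
      by (auto simp: trunc_def split: if_splits)
    then show ?thesis by (rule finite_subset) (intro finite_imageI finite_tree_level)
  qed
  then have "?g ` range (trunc L) \<subseteq> Collect finite" by auto
  then show "countable (?g ` range (trunc L))" by (rule countable_subset) (rule countable_Collect_finite)
  show "inj_on ?g (range (trunc L))"
  proof (rule inj_onI, rule ext)
    fix b b' :: "nat list \<Rightarrow> nat" and v assume e: "?g b = ?g b'"
    have "(v, b v) \<in> ?g b' \<or> b v = 0" "(v, b' v) \<in> ?g b \<or> b' v = 0" using e by auto
    then show "b v = b' v" by auto
  qed
qed

lemma rball_trunc: "rball H (offspring_tree (trunc (H + 1) N), {}) \<cong>\<^sub>r rball H (offspring_tree N, {})"
  unfolding rball_iso_iff
proof (intro exI[of _ "\<lambda>v. v"] conjI ballI)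
  have B: "ball_verts H (offspring_tree b) = {v\<in>tree_verts b. length v \<le> H + 1}" for b
    using ball_verts_chart[OF rooted_graph_offspring_tree offspring_tree_chart, of H "H + 1" b] by simp
  then have eq: "ball_verts H (offspring_tree (trunc (H + 1) N)) = ball_verts H (offspring_tree N)"
    by (auto simp: tree_verts_trunc)
  show "bij_betw (\<lambda>v. v) (ball_verts H (offspring_tree (trunc (H + 1) N))) (ball_verts H (offspring_tree N))"
    unfolding eq by (simp add: bij_betw_def)
  fix u v assume "u \<in> ball_verts H (offspring_tree (trunc (H + 1) N))" "v \<in> ball_verts H (offspring_tree (trunc (H + 1) N))"
  then have uv: "u \<in> tree_verts N" "length u \<le> H + 1" "v \<in> tree_verts N" "length v \<le> H + 1" unfolding B by (auto simp: tree_verts_trunc)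
  have *: "(u \<in> tree_verts b \<and> v \<in> tnb b u) \<longleftrightarrow> (u \<noteq> [] \<and> v = butlast u) \<or> (v \<noteq> [] \<and> u = butlast v)"
    if t: "u \<in> tree_verts b" "v \<in> tree_verts b" for b
  proof -
    have "(\<exists>i<b u. v = u @ [i]) \<longleftrightarrow> (v \<noteq> [] \<and> u = butlast v)"
    proof
      assume "v \<noteq> [] \<and> u = butlast v"
      then have "v = u @ [last v]" by simp
      moreover from this have "last v < b u" using t(2) tree_verts_snoc[of u "last v" b] by simp
      ultimately show "\<exists>i<b u. v = u @ [i]" by blast
    qed auto
    then show ?thesis using t by (auto simp: tnb_def)
  qed
  show "{u, v} \<in> edges (offspring_tree (trunc (H + 1) N)) \<longleftrightarrow> {u, v} \<in> edges (offspring_tree N)"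
    unfolding offspring_tree_edge using uv by (subst (1 2) *) (simp_all add: tree_verts_trunc)
qed simp_all

locale ubgw_tree = ubgw_law \<pi> \<omega> \<xi> for \<pi> \<omega> \<xi> +
  fixes Q :: "'q measure" and N :: "'q \<Rightarrow> nat list \<Rightarrow> nat"
    and w :: "'q \<Rightarrow> nat list set \<Rightarrow> real" and x :: "'q \<Rightarrow> nat list \<Rightarrow> real"
  assumes ubgw: "weighted_ubgw Q \<pi> \<omega> \<xi> N w x"
begin

sublocale Q: prob_space Q using ubgw by (simp add: weighted_ubgw_def)

abbreviation "W q \<equiv> \<lambda>v. w q {butlast v, v}"
definition "label q v = (N q v, W q v, x q v)"
abbreviation "limit q \<equiv> (offspring_tree (N q), message_md (offspring_tree (N q)) (w q) (x q))"

lemma label_simps: "kids (label q) = N q" "ew (label q) = W q" "vw (label q) = x q"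
  by (simp_all add: label_def kids_def ew_def vw_def fun_eq_iff)

lemma indep: "Q.indep_vars (\<lambda>_. count_space UNIV \<Otimes>\<^sub>M borel \<Otimes>\<^sub>M borel) (\<lambda>v q. label q v) UNIV"
  and distr_label: "distr Q (count_space UNIV \<Otimes>\<^sub>M borel \<Otimes>\<^sub>M borel) (\<lambda>q. label q v) = V v"
  using ubgw by (simp_all add: weighted_ubgw_def label_def V_def)

lemma measurable_label: "(\<lambda>q. label q v) \<in> Q \<rightarrow>\<^sub>M count_space UNIV \<Otimes>\<^sub>M borel \<Otimes>\<^sub>M borel"
  using indep by (simp add: Q.indep_vars_def)

lemma measurable_weights:
  "(\<lambda>q. N q v) \<in> Q \<rightarrow>\<^sub>M count_space UNIV" "(\<lambda>q. W q v) \<in> borel_measurable Q" "(\<lambda>q. x q v) \<in> borel_measurable Q"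
  using measurable_compose[OF measurable_label[of v] measurable_fst]
    measurable_compose[OF measurable_compose[OF measurable_label[of v] measurable_snd] measurable_fst]
    measurable_compose[OF measurable_compose[OF measurable_label[of v] measurable_snd] measurable_snd]
  by (simp_all add: label_def)

lemma distr_tree: "distr Q T label = T" and measurable_tree: "label \<in> Q \<rightarrow>\<^sub>M T"
proof -
  let ?M = "\<lambda>_ :: nat list. (count_space UNIV :: nat measure) \<Otimes>\<^sub>M (borel :: real measure) \<Otimes>\<^sub>M (borel :: real measure)"
  have s: "sets (PiM UNIV ?M) = sets T" by (intro sets_PiM_cong refl sets_V[symmetric])
  have "distr Q (PiM UNIV ?M) (\<lambda>q. \<lambda>v\<in>UNIV. label q v) = PiM UNIV (\<lambda>v. distr Q (?M v) (\<lambda>q. label q v))"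
    using indep by (subst (asm) Q.indep_vars_iff_distr_eq_PiM) (simp_all add: measurable_label)
  then have "distr Q (PiM UNIV ?M) label = T" by (simp add: distr_label restrict_UNIV)
  moreover have "distr Q (PiM UNIV ?M) label = distr Q T label" by (intro distr_cong s refl)
  ultimately show "distr Q T label = T" by simp
  have "(\<lambda>q. \<lambda>v\<in>UNIV. label q v) \<in> Q \<rightarrow>\<^sub>M PiM UNIV ?M" by (intro measurable_restrict measurable_label)
  then have "label \<in> Q \<rightarrow>\<^sub>M PiM UNIV ?M" by (simp add: restrict_UNIV)
  then show "label \<in> Q \<rightarrow>\<^sub>M T" using measurable_cong_sets[OF refl s] by blast
qed

lemma AE_label: "AE t in T. p t \<Longrightarrow> AE q in Q. p (label q)"
  by (rule AE_distrD[OF measurable_tree]) (simp only: distr_tree)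

text \<open>At each edge the truncated thresholds converge to the true one, from which the weight
  differs almost surely; so the edge is decided for large \<open>k\<close>. Only finitely many edges
  are near the root, and pruning at generation \<open>h + 2 * k + 2\<close> does not affect their
  decisions.\<close>

lemma AE_messages: "AE q in Q. (\<exists>!Z. is_messages (offspring_tree (N q)) (w q) (x q) Z)
    \<and> (\<forall>h. \<forall>\<^sub>F k in sequentially. decided h k (trunc (h + 2 * k + 2) (N q)) (W q) (x q))"
  using AE_label[OF AE_lo_eq_hi] AE_label[OF AE_no_edge_ties]
proof eventually_elim
  case (elim q)
  let ?b = "N q" and ?W = "W q" and ?X = "x q"
  have lohi: "zlo ?b ?W ?X v = zhi ?b ?W ?X v" for v using elim(1) by (simp add: label_simps)
  have tie: "?W v \<noteq> zlo ?b ?W ?X v + down ?b ?W ?X (\<lambda>_. zlo ?b ?W ?X) True v" if "v \<noteq> []" for v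
    using elim(2) that by (simp add: label_simps)
  have ex: "\<exists>!Z. is_messages (offspring_tree ?b) (w q) ?X Z"
    by (rule messages_exist_unique[of ?b ?W ?X "w q"]) (use lohi in auto)
  have zd: "(\<lambda>k. zmsg ?b ?W ?X (2 * k + of_bool s) v) \<longlonglongrightarrow> zlo ?b ?W ?X v" for s v
    using tendsto_zlo[of ?b ?W ?X v] tendsto_zhi[of ?b ?W ?X v] lohi by (cases s) simp_all
  have dd: "(\<lambda>k. down ?b ?W ?X (\<lambda>s. zmsg ?b ?W ?X (2 * k + of_bool s)) s v) \<longlonglongrightarrow> down ?b ?W ?X (\<lambda>_. zlo ?b ?W ?X) True v" for s v
    unfolding down_const_flag[of ?b ?W ?X "zlo ?b ?W ?X" True v s] by (rule tendsto_down) (rule zd)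
  have ev: "\<forall>\<^sub>F k in sequentially. edge_yes ?b ?W ?X k v \<or> edge_no ?b ?W ?X k v" if v: "v \<noteq> []" for v
  proof -
    let ?l = "zlo ?b ?W ?X v + down ?b ?W ?X (\<lambda>_. zlo ?b ?W ?X) True v"
    have y: "(\<lambda>k. zmsg ?b ?W ?X (2 * k + 1) v + down ?b ?W ?X (\<lambda>s. zmsg ?b ?W ?X (2 * k + of_bool s)) True v) \<longlonglongrightarrow> ?l"
      using tendsto_add[OF zd[of True v] dd[of True v]] by simp
    have n: "(\<lambda>k. zmsg ?b ?W ?X (2 * k) v + down ?b ?W ?X (\<lambda>s. zmsg ?b ?W ?X (2 * k + of_bool s)) False v) \<longlonglongrightarrow> ?l"
      using tendsto_add[OF zd[of False v] dd[of False v]] by simp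
    from tie[OF v] consider "?l < ?W v" | "?W v < ?l" by linarith
    then show ?thesis
    proof cases
      case 1
      from order_tendstoD(2)[OF y 1] show ?thesis by eventually_elim (simp add: edge_yes_def)
    next
      case 2
      from order_tendstoD(1)[OF n 2] show ?thesis by eventually_elim (simp add: edge_no_def)
    qed
  qed
  have "\<forall>\<^sub>F k in sequentially. decided h k (trunc (h + 2 * k + 2) ?b) ?W ?X" for h
  proof -
    have "\<forall>\<^sub>F k in sequentially. \<forall>v\<in>{v\<in>tree_verts ?b. length v \<le> h + 1}. v \<noteq> [] \<longrightarrow> edge_yes ?b ?W ?X k v \<or> edge_no ?b ?W ?X k v"
      using ev by (intro eventually_ball_finite finite_tree_level ballI) (auto intro: always_eventually)
    then show ?thesis
    proof eventually_elim
      case (elim k)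
      let ?L = "h + 2 * k + 2"
      have ag: "trunc ?L ?b u = ?b u" if "u \<in> tree_verts (trunc ?L ?b)" "length u < ?L" for u
        using that by (simp add: trunc_def tree_verts_trunc)
      show ?case unfolding decided_def
      proof (intro ballI impI)
        fix v assume v: "v \<in> tree_verts (trunc ?L ?b)" "v \<noteq> [] \<and> length v \<le> h + 1"
        then have vb: "v \<in> {v\<in>tree_verts ?b. length v \<le> h + 1}" by (simp add: tree_verts_trunc)
        have "edge_yes (trunc ?L ?b) ?W ?X k v \<longleftrightarrow> edge_yes ?b ?W ?X k v" "edge_no (trunc ?L ?b) ?W ?X k v \<longleftrightarrow> edge_no ?b ?W ?X k v"
          using v ag by (intro edge_decision_cong[where L="?L"]; simp)+
        with elim vb v show "edge_yes (trunc ?L ?b) ?W ?X k v \<or> edge_no (trunc ?L ?b) ?W ?X k v" by simp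
      qed
    qed
  qed
  with ex show ?case by blast
qed

abbreviation "tree_score h k f q \<equiv> score h k f (trunc (h + 2 * k + 2) (N q)) (W q) (x q)"

lemma limit_in_mdgraphs: "limit q \<in> mdgraphs"
  using md_config_message_md[OF rooted_graph_offspring_tree]
  by (simp add: mdgraphs_def rooted_graph_offspring_tree)

lemma AE_tree_score: "AE q in Q. \<forall>h. \<forall>\<^sub>F k in sequentially. tree_score h k f q = ennreal (cls_inf h f (limit q))"
  using AE_messages
proof eventually_elim
  case (elim q)
  show ?case
  proof
    fix h
    from elim have "\<forall>\<^sub>F k in sequentially. decided h k (trunc (h + 2 * k + 2) (N q)) (W q) (x q)" by blast
    then show "\<forall>\<^sub>F k in sequentially. tree_score h k f q = ennreal (cls_inf h f (limit q))"
    proof eventually_elim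
      case (elim k)
      let ?L = "h + 2 * k + 2" and ?g = "offspring_tree (N q)"
      have ex: "\<exists>!Z. is_messages ?g (w q) (x q) Z" using \<open>_ \<and> _\<close> by blast
      have p: "pull (\<lambda>v. v) (w q) = W q" by (simp add: pull_def fun_eq_iff)
      note d = message_edge_decision[OF rooted_graph_offspring_tree trunc_chart[of ?L] ex, unfolded p]
      have "tree_score h k f q = class_score h f (limit q)"
        by (rule score_eq[OF limit_in_mdgraphs trunc_chart _ _ _ elim]; (rule d)?) simp_all
      also have "cls h (limit q) \<noteq> {}" using cls_refl[OF limit_in_mdgraphs] by blast
      then have "class_score h f (limit q) = ennreal (cls_inf h f (limit q))" by (simp add: class_score_def)
      finally show ?case .
    qed
  qed
qed

lemma sets_trunc:
  assumes b: "b \<in> range (trunc L)"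
  shows "{q\<in>space Q. trunc L (N q) = b} \<in> sets Q"
proof -
  have "finite {v\<in>tree_verts b. length v < L}" by (rule finite_subset[OF _ finite_tree_level[of b L]]) auto
  then have "{q\<in>space Q. \<forall>v\<in>{v\<in>tree_verts b. length v < L}. N q v = b v} \<in> sets Q"
    using measurable_sets[OF measurable_weights(1), of "{b v}" v for v]
    by (intro sets.sets_Collect_finite_All) (auto simp: vimage_def Int_def conj_commute)
  also have "{q\<in>space Q. \<forall>v\<in>{v\<in>tree_verts b. length v < L}. N q v = b v} = {q\<in>space Q. trunc L (N q) = b}"
    by (auto simp: trunc_eq_iff[OF b])
  finally show ?thesis .
qed

lemma measurable_trunc: "(\<lambda>q. trunc L (N q)) \<in> Q \<rightarrow>\<^sub>M count_space (range (trunc L))"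
  using sets_trunc by (subst measurable_count_space_eq_countable[OF countable_trunc])
    (auto simp: vimage_def Int_def conj_commute)

lemma measurable_tree_score: "tree_score h k f \<in> borel_measurable Q"
  by (rule measurable_compose_countable'[OF _ measurable_trunc countable_trunc])
    (intro measurable_score measurable_weights)

text \<open>Different labels are independent, and so are the three entries of one label. Hence
  fixing the pruned tree, an event about offspring numbers, leaves the law of the weights on it
  unchanged.\<close>

lemma labels_rect:
  fixes L :: nat
  assumes b: "b \<in> range (trunc L)" and A: "\<And>i. A i \<in> sets borel"
  defines "y \<equiv> \<lambda>q. case_sum (W q) (x q)" and "E \<equiv> {q\<in>space Q. trunc L (N q) = b}"
  shows "{q\<in>space Q. q \<in> E \<and> (\<forall>i\<in>score_index L b. y q i \<in> A i)} \<in> sets Q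
      \<and> measure Q {q\<in>space Q. q \<in> E \<and> (\<forall>i\<in>score_index L b. y q i \<in> A i)}
        = measure Q E * (\<Prod>i\<in>score_index L b. measure (weight_law \<omega> \<xi> i) (A i))"
proof -
  let ?K = "{v\<in>tree_verts b. length v \<le> L}"
  let ?\<rho> = "\<lambda>v :: nat list. measure_pmf (if v = [] then \<pi> else size_biased \<pi>)"
  \<comment> \<open>Offspring numbers are prescribed below generation \<open>L\<close> only; at
    generation \<open>L\<close> pruning discards them.\<close>
  define B where "B v = (if length v < L then {b v} else UNIV)" for v
  \<comment> \<open>The empty label has no edge above it and is absent from the edge part of
    \<open>score_index\<close>, so its edge weight is left free.\<close>
  define D where "D A v = B v \<times> (if v = [] then UNIV else A (Inl v)) \<times> A (Inr v)" for A :: "nat list + nat list \<Rightarrow> real set" and v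
  have "[] \<in> ?K" using tree_verts_Nil by simp
  then have K: "finite ?K" "?K \<noteq> {}" using finite_tree_level by blast+
  have *: "{q\<in>space Q. trunc L (N q) = b \<and> (\<forall>i\<in>score_index L b. y q i \<in> A i)} \<in> sets Q
      \<and> measure Q {q\<in>space Q. trunc L (N q) = b \<and> (\<forall>i\<in>score_index L b. y q i \<in> A i)}
        = (\<Prod>v\<in>?K. measure (?\<rho> v) (B v)) * (\<Prod>i\<in>score_index L b. measure (weight_law \<omega> \<xi> i) (A i))"
    if A: "\<And>i. A i \<in> sets borel" for A
  proof -
    have Ds: "D A v \<in> sets (count_space UNIV \<Otimes>\<^sub>M borel \<Otimes>\<^sub>M borel)" for v
      unfolding D_def using A by (intro pair_measureI) auto
    have eq: "{q\<in>space Q. trunc L (N q) = b \<and> (\<forall>i\<in>score_index L b. y q i \<in> A i)} = (\<Inter>v\<in>?K. (\<lambda>q. label q v) -` D A v \<inter> space Q)"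
    proof (intro equalityI subsetI)
      fix q assume "q \<in> {q\<in>space Q. trunc L (N q) = b \<and> (\<forall>i\<in>score_index L b. y q i \<in> A i)}"
      then show "q \<in> (\<Inter>v\<in>?K. (\<lambda>q. label q v) -` D A v \<inter> space Q)"
        by (auto simp: D_def B_def label_def y_def trunc_eq_iff[OF b] ball_Un)
    next
      fix q assume "q \<in> (\<Inter>v\<in>?K. (\<lambda>q. label q v) -` D A v \<inter> space Q)"
      then have q: "q \<in> space Q" "\<And>v. v \<in> ?K \<Longrightarrow> label q v \<in> D A v" using K(2) by blast+
      have l: "length v < L \<Longrightarrow> N q v = b v" "v \<noteq> [] \<Longrightarrow> W q v \<in> A (Inl v)" "x q v \<in> A (Inr v)"
        if "v \<in> tree_verts b" "length v \<le> L" for v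
        using q(2)[of v] that by (auto simp: D_def B_def label_def)
      show "q \<in> {q\<in>space Q. trunc L (N q) = b \<and> (\<forall>i\<in>score_index L b. y q i \<in> A i)}"
        using q(1) l by (auto simp: y_def trunc_eq_iff[OF b] ball_Un)
    qed
    have "measure Q (\<Inter>v\<in>?K. (\<lambda>q. label q v) -` D A v \<inter> space Q) = (\<Prod>v\<in>?K. measure Q ((\<lambda>q. label q v) -` D A v \<inter> space Q))"
      by (rule Q.indep_varsD[OF indep K(2,1)]) (use Ds in auto)
    also have "\<dots> = (\<Prod>v\<in>?K. measure (?\<rho> v) (B v) * (measure \<omega> (if v = [] then UNIV else A (Inl v)) * measure \<xi> (A (Inr v))))"
    proof (rule prod.cong[OF refl])
      fix v
      interpret OX: pair_prob_space \<omega> \<xi> by unfold_locales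
      have "measure Q ((\<lambda>q. label q v) -` D A v \<inter> space Q) = measure (V v) (D A v)"
        unfolding distr_label[symmetric] by (subst measure_distr[OF measurable_label Ds]) simp
      also have "\<dots> = measure (?\<rho> v) (B v) * (measure \<omega> (if v = [] then UNIV else A (Inl v)) * measure \<xi> (A (Inr v)))"
        unfolding V_def D_def measure_def
      proof -
        let ?A1 = "if v = [] then UNIV else A (Inl v)"
        have s1: "?A1 \<in> sets \<omega>" and s2: "A (Inr v) \<in> sets \<xi>" using A by auto
        have "emeasure (\<omega> \<Otimes>\<^sub>M \<xi>) (?A1 \<times> A (Inr v)) = emeasure \<omega> ?A1 * emeasure \<xi> (A (Inr v))"
          by (rule xi.emeasure_pair_measure_Times[OF s1 s2])
        moreover have "emeasure (?\<rho> v \<Otimes>\<^sub>M \<omega> \<Otimes>\<^sub>M \<xi>) (B v \<times> ?A1 \<times> A (Inr v)) = emeasure (?\<rho> v) (B v) * emeasure (\<omega> \<Otimes>\<^sub>M \<xi>) (?A1 \<times> A (Inr v))"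
          by (intro OX.emeasure_pair_measure_Times pair_measureI s1 s2) simp
        ultimately show "enn2real (emeasure (?\<rho> v \<Otimes>\<^sub>M \<omega> \<Otimes>\<^sub>M \<xi>) (B v \<times> ?A1 \<times> A (Inr v)))
            = enn2real (emeasure (?\<rho> v) (B v)) * (enn2real (emeasure \<omega> ?A1) * enn2real (emeasure \<xi> (A (Inr v))))"
          by (simp only: enn2real_mult)
      qed
      finally show "measure Q ((\<lambda>q. label q v) -` D A v \<inter> space Q)
        = measure (?\<rho> v) (B v) * (measure \<omega> (if v = [] then UNIV else A (Inl v)) * measure \<xi> (A (Inr v)))" .
    qed
    also have "\<dots> = (\<Prod>v\<in>?K. measure (?\<rho> v) (B v)) * ((\<Prod>v\<in>?K. measure \<omega> (if v = [] then UNIV else A (Inl v))) * (\<Prod>v\<in>?K. measure \<xi> (A (Inr v))))"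
      by (simp add: prod.distrib)
    also have "(\<Prod>v\<in>?K. measure \<omega> (if v = [] then UNIV else A (Inl v))) = (\<Prod>v\<in>{v\<in>tree_verts b. v \<noteq> [] \<and> length v \<le> L}. measure \<omega> (if v = [] then UNIV else A (Inl v)))"
      using K(1) omega.prob_space by (intro prod.mono_neutral_right) auto
    also have "\<dots> = (\<Prod>v\<in>{v\<in>tree_verts b. v \<noteq> [] \<and> length v \<le> L}. measure \<omega> (A (Inl v)))"
      by (intro prod.cong) auto
    also have "\<dots> * (\<Prod>v\<in>?K. measure \<xi> (A (Inr v))) = (\<Prod>i\<in>score_index L b. measure (weight_law \<omega> \<xi> i) (A i))"
      using K(1) by (subst prod.union_disjoint) (auto simp: prod.reindex intro: finite_subset[OF _ K(1)])
    finally have "measure Q (\<Inter>v\<in>?K. (\<lambda>q. label q v) -` D A v \<inter> space Q)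
      = (\<Prod>v\<in>?K. measure (?\<rho> v) (B v)) * (\<Prod>i\<in>score_index L b. measure (weight_law \<omega> \<xi> i) (A i))" .
    moreover have "(\<Inter>v\<in>?K. (\<lambda>q. label q v) -` D A v \<inter> space Q) \<in> sets Q"
      by (intro sets.finite_INT K measurable_sets[OF measurable_label Ds])
    ultimately show ?thesis unfolding eq by blast
  qed
  have "(\<Prod>i\<in>score_index L b. measure (weight_law \<omega> \<xi> i) UNIV) = 1"
    using omega.prob_space xi.prob_space by (intro prod.neutral) auto
  with *[of "\<lambda>_. UNIV"] have E: "measure Q E = (\<Prod>v\<in>?K. measure (?\<rho> v) (B v))" by (simp add: E_def)
  have "{q\<in>space Q. q \<in> E \<and> (\<forall>i\<in>score_index L b. y q i \<in> A i)} = {q\<in>space Q. trunc L (N q) = b \<and> (\<forall>i\<in>score_index L b. y q i \<in> A i)}"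
    by (auto simp: E_def)
  with *[OF A] E show ?thesis by simp
qed

text \<open>Given the pruned tree \<open>b\<close>, the score has mean \<open>mean_score\<close> at
  \<open>b\<close>, and \<open>b\<close> is one of the trees in the supremum defining
  \<open>best_mean\<close>.\<close>

lemma tree_score_le:
  "(\<integral>\<^sup>+q. tree_score h k f q \<partial>Q) \<le> (\<integral>\<^sup>+q. best_mean \<omega> \<xi> h k f (offspring_tree (N q), {}) \<partial>Q)"
proof (rule nn_integral_mono_partition[OF countable_trunc])
  define L where "L = h + 2 * k + 2"
  have bm: "best_mean \<omega> \<xi> h k f (offspring_tree (trunc L (N q)), {}) = best_mean \<omega> \<xi> h k f (offspring_tree (N q), {})" for q
    using rball_trunc[of "h + 2 * k + 1" "N q"]
    by (intro best_mean_cong) (simp_all add: cls_def mdgraphs_def rooted_graph_offspring_tree md_config_def L_def)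
  show "trunc L (N q) \<in> range (trunc L)" for q by simp
  show "{q\<in>space Q. trunc L (N q) = b} \<in> sets Q" if "b \<in> range (trunc L)" for b using that by (rule sets_trunc)
  show "tree_score h k f \<in> borel_measurable Q" by (rule measurable_tree_score)
  have "(\<lambda>q. best_mean \<omega> \<xi> h k f (offspring_tree (trunc L (N q)), {})) \<in> borel_measurable Q"
    by (rule measurable_compose[OF measurable_trunc[of L]]) simp
  then show "(\<lambda>q. best_mean \<omega> \<xi> h k f (offspring_tree (N q), {})) \<in> borel_measurable Q" by (simp only: bm)
  fix b assume b: "b \<in> range (trunc L)"
  let ?E = "{q\<in>space Q. trunc L (N q) = b}" and ?y = "\<lambda>q. case_sum (W q) (x q)"
  let ?J = "score_index L b"
  have fJ: "finite ?J"
    using finite_tree_level[of b L] finite_subset[OF _ finite_tree_level[of b L], of "{v\<in>tree_verts b. v \<noteq> [] \<and> length v \<le> L}"] by auto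
  have m: "coded_score h k f b \<in> borel_measurable (PiM ?J (weight_law \<omega> \<xi>))"
    by (intro measurable_score measurable_PiM_component weight_law_props[OF omega xi])
  have "(\<integral>\<^sup>+q. tree_score h k f q * indicator ?E q \<partial>Q) = (\<integral>\<^sup>+q. coded_score h k f b (restrict (?y q) ?J) * indicator ?E q \<partial>Q)"
  proof (rule nn_integral_cong)
    fix q
    have "coded_score h k f b (restrict (?y q) ?J) = coded_score h k f b (?y q)"
      by (rule coded_score_cong) (simp add: L_def)
    then show "tree_score h k f q * indicator ?E q = coded_score h k f b (restrict (?y q) ?J) * indicator ?E q"
      by (simp add: indicator_def L_def)
  qed
  also have "\<dots> = emeasure Q ?E * mean_score \<omega> \<xi> h k f b"
    unfolding mean_score_def L_def[symmetric]
    by (rule nn_integral_conditional_product(2)[OF Q.prob_space_axioms fJ weight_law_props[OF omega xi] sets_trunc[OF b] labels_rect[OF b] m])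
  also have "\<dots> = (\<integral>\<^sup>+q. mean_score \<omega> \<xi> h k f b * indicator ?E q \<partial>Q)"
    using sets_trunc[OF b] by (simp add: nn_integral_cmult_indicator mult.commute)
  also have "\<dots> \<le> (\<integral>\<^sup>+q. best_mean \<omega> \<xi> h k f (offspring_tree (N q), {}) * indicator ?E q \<partial>Q)"
  proof (rule nn_integral_mono)
    fix q
    show "mean_score \<omega> \<xi> h k f b * indicator ?E q \<le> best_mean \<omega> \<xi> h k f (offspring_tree (N q), {}) * indicator ?E q"
    proof (cases "q \<in> ?E")
      case True
      have "rball (h + 2 * k + 1) (offspring_tree b, {}) \<cong>\<^sub>r rball (h + 2 * k + 1) (offspring_tree (N q), {})"
        using rball_trunc[of "h + 2 * k + 1" "N q"] True by (simp add: L_def)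
      then have "mean_score \<omega> \<xi> h k f b \<le> best_mean \<omega> \<xi> h k f (offspring_tree (N q), {})"
        unfolding best_mean_def by (intro SUP_upper) simp
      then show ?thesis by (rule mult_right_mono) simp
    qed simp
  qed
  finally show "(\<integral>\<^sup>+q. tree_score h k f q * indicator ?E q \<partial>Q)
    \<le> (\<integral>\<^sup>+q. best_mean \<omega> \<xi> h k f (offspring_tree (N q), {}) * indicator ?E q \<partial>Q)" .
qed

text \<open>\<open>message_md\<close> is defined through \<open>THE\<close>, so measurability is not
  evident. For the indicator of a ball class, however, the measurable tree scores almost surely
  become equal to its value at the limit, and being eventually equal to 1 is a countable combination
  of measurable events.\<close>

lemma measurable_limit: "limit \<in> completion Q \<rightarrow>\<^sub>M borel_of local_topology"
proof (rule measurable_borel_of_local)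
  show "limit q \<in> mdgraphs" for q by (rule limit_in_mdgraphs)
  fix H and G0 :: "nat list mdgraph" assume G0: "G0 \<in> mdgraphs"
  let ?f = "indicator (cls H G0) :: nat list mdgraph \<Rightarrow> real"
  let ?D = "{q\<in>space Q. \<exists>m. \<forall>k\<in>{m..}. tree_score H k ?f q = 1}"
  have "{q\<in>space Q. tree_score H k ?f q = 1} \<in> sets Q" for k
    by (rule borel_measurable_eq[OF measurable_tree_score measurable_const]) simp
  then have D: "?D \<in> sets Q" by (intro sets.sets_Collect_countable_Ex sets.sets_Collect_countable_Ball) auto
  \<comment> \<open>The indicator is constant on classes of the same radius, so passing to the
    infimum changes nothing.\<close>
  have const: "cls_inf H ?f G = ?f G" if G: "G \<in> mdgraphs" for G
  proof -
    have "?f G' = ?f G" if "G' \<in> cls H G" for G'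
    proof -
      have "G' \<in> mdgraphs" "cls H G' = cls H G" using that cls_eq[OF G] by (auto simp: cls_def)
      then have "G' \<in> cls H G0 \<longleftrightarrow> G \<in> cls H G0"
        using cls_refl[of G' H] cls_refl[OF G, of H] cls_eq[OF G0] by metis
      then show ?thesis by (simp add: indicator_def)
    qed
    then have "cls_inf H ?f G = (INF G'\<in>cls H G. ?f G)" unfolding cls_inf_def by (intro INF_cong) auto
    also have "\<dots> = ?f G" using cls_refl[OF G] by (intro cINF_const) auto
    finally show ?thesis .
  qed
  have "AE q in Q. limit q \<in> cls H G0 \<longleftrightarrow> q \<in> ?D"
    using AE_space AE_tree_score[of ?f]
  proof eventually_elim
    case (elim q)
    from elim(2) have "\<forall>\<^sub>F k in sequentially. tree_score H k ?f q = ennreal (?f (limit q))"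
      unfolding const[OF limit_in_mdgraphs, symmetric] by (rule spec)
    then obtain m where m: "\<And>k. m \<le> k \<Longrightarrow> tree_score H k ?f q = ennreal (?f (limit q))"
      unfolding eventually_sequentially by blast
    show ?case
    proof
      assume "limit q \<in> cls H G0"
      then have "tree_score H k ?f q = 1" if "m \<le> k" for k using m[OF that] by simp
      then show "q \<in> ?D" using elim(1) by auto
    next
      assume "q \<in> ?D"
      then obtain m' where m': "\<And>k. m' \<le> k \<Longrightarrow> tree_score H k ?f q = 1" by auto
      have "ennreal (?f (limit q)) = 1" using m[of "max m m'"] m'[of "max m m'"] by simp
      then show "limit q \<in> cls H G0" by (auto simp: indicator_def split: if_splits)
    qed
  qed
  from sets_completion_AE_eq[OF D this]
  show "{q\<in>space (completion Q). limit q \<in> cls H G0} \<in> sets (completion Q)" by simp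
qed

end

section \<open>Convergence\<close>

context ubgw_tree
begin

text \<open>First \<open>k\<close> grows with \<open>h\<close> fixed, so that the edges get decided;
  then \<open>h\<close> grows, so that the infimum over the class approaches \<open>f\<close>. Both
  passages are dominated by \<open>B\<close>.\<close>

lemma nn_integral_scores_tendsto:
  assumes f: "continuous_map local_topology euclideanreal f"
    and nn: "\<And>G. G \<in> mdgraphs \<Longrightarrow> 0 \<le> f G" and B: "\<And>G. G \<in> mdgraphs \<Longrightarrow> f G \<le> B"
  shows "(\<lambda>k. \<integral>\<^sup>+q. tree_score h k f q \<partial>completion Q) \<longlonglongrightarrow> (\<integral>\<^sup>+q. ennreal (cls_inf h f (limit q)) \<partial>completion Q)"
    and "(\<lambda>h. \<integral>\<^sup>+q. ennreal (cls_inf h f (limit q)) \<partial>completion Q) \<longlonglongrightarrow> (\<integral>\<^sup>+q. ennreal (f (limit q)) \<partial>completion Q)"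
proof -
  have fin: "(\<integral>\<^sup>+q. ennreal B \<partial>completion Q) < \<infinity>"
    by (simp add: nn_integral_completion Q.emeasure_space_1)
  have m: "(\<lambda>q. cls_inf h f (limit q)) \<in> borel_measurable (completion Q)" for h
  proof (rule continuous_map_measurable_borel_of[OF continuous_map_locally_constant measurable_limit])
    fix G G' :: "nat list mdgraph" assume "G \<in> mdgraphs" "G' \<in> cls h G"
    then show "cls_inf h f G' = cls_inf h f G" by (intro cls_inf_cong cls_eq)
  qed
  have mf: "(\<lambda>q. f (limit q)) \<in> borel_measurable (completion Q)"
    by (rule continuous_map_measurable_borel_of[OF f measurable_limit])
  have ae: "AE q in Q. (\<lambda>k. tree_score h k f q) \<longlonglongrightarrow> ennreal (cls_inf h f (limit q))"
    using AE_tree_score[of f]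
  proof eventually_elim
    case (elim q)
    then show ?case by (intro tendsto_eventually) (rule spec)
  qed
  show "(\<lambda>k. \<integral>\<^sup>+q. tree_score h k f q \<partial>completion Q) \<longlonglongrightarrow> (\<integral>\<^sup>+q. ennreal (cls_inf h f (limit q)) \<partial>completion Q)"
  proof (rule nn_integral_dominated_convergence[where w="\<lambda>_. ennreal B"])
    show "AE q in completion Q. (\<lambda>k. tree_score h k f q) \<longlonglongrightarrow> ennreal (cls_inf h f (limit q))" using ae by (rule AE_completion)
  qed (use m fin measurable_completion[OF measurable_tree_score] score_bounded(2)[OF nn B] in auto)
  have le: "cls_inf h f (limit q) \<le> B" for h q
    using cls_inf_le[where f=f, OF limit_in_mdgraphs nn] B[OF limit_in_mdgraphs] by (rule order_trans)
  show "(\<lambda>h. \<integral>\<^sup>+q. ennreal (cls_inf h f (limit q)) \<partial>completion Q) \<longlonglongrightarrow> (\<integral>\<^sup>+q. ennreal (f (limit q)) \<partial>completion Q)"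
    by (rule nn_integral_dominated_convergence[where w="\<lambda>_. ennreal B"])
      (use m mf fin le cls_inf_tendsto[OF f nn limit_in_mdgraphs] in \<open>auto intro!: AE_I2 ennreal_leI tendsto_ennrealI\<close>)
qed

lemma exists_good_score:
  assumes f: "continuous_map local_topology euclideanreal f"
    and nn: "\<And>G. G \<in> mdgraphs \<Longrightarrow> 0 \<le> f G" and B: "\<And>G. G \<in> mdgraphs \<Longrightarrow> f G \<le> B"
    and c: "c < (\<integral>\<^sup>+q. ennreal (f (limit q)) \<partial>completion Q)"
  shows "\<exists>h k. c < (\<integral>\<^sup>+q. best_mean \<omega> \<xi> h k f (offspring_tree (N q), {}) \<partial>completion Q)"
proof -
  note t = nn_integral_scores_tendsto[OF f nn B]
  obtain h where h: "c < (\<integral>\<^sup>+q. ennreal (cls_inf h f (limit q)) \<partial>completion Q)"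
    using order_tendstoD(1)[OF t(2) c] by (auto simp: eventually_sequentially)
  obtain k where "c < (\<integral>\<^sup>+q. tree_score h k f q \<partial>completion Q)"
    using order_tendstoD(1)[OF t(1) h] by (auto simp: eventually_sequentially)
  also have "\<dots> \<le> (\<integral>\<^sup>+q. best_mean \<omega> \<xi> h k f (offspring_tree (N q), {}) \<partial>completion Q)"
    using tree_score_le by (simp add: nn_integral_completion)
  finally show ?thesis by blast
qed

text \<open>\<open>best_mean\<close> depends on the graph alone and is constant on ball classes, so
  it is a bounded continuous test function for the convergence of the bare graphs. Its mean bounds
  that of \<open>f\<close> from below for every \<open>n\<close>, and on the limit it exceeds
  \<open>c\<close> for suitable \<open>h\<close> and \<open>k\<close>.\<close>

lemma eventually_integral_greater:
  fixes P :: "nat \<Rightarrow> 'p measure"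
  assumes graphs: "\<And>n. weighted_finite_graphs (P n) (G n) \<omega> \<xi> (wn n) (xn n) (MD n)"
    and conv: "local_weak_conv P (\<lambda>n p. (G n p, {})) Q (\<lambda>q. (offspring_tree (N q), {}))"
    and f: "continuous_map local_topology euclideanreal f"
    and nn: "\<And>G. G \<in> mdgraphs \<Longrightarrow> 0 \<le> f G" and B: "\<And>G. G \<in> mdgraphs \<Longrightarrow> f G \<le> B"
    and c: "c < (\<integral>q. f (limit q) \<partial>completion Q)"
  shows "\<forall>\<^sub>F n in sequentially. c < (\<integral>p. f (G n p, MD n p) \<partial>completion (P n))"
proof -
  have nint: "(\<integral>\<^sup>+p. ennreal (g (Y p)) \<partial>M) = ennreal (\<integral>p. g (Y p) \<partial>M) \<and> 0 \<le> (\<integral>p. g (Y p) \<partial>M)"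
    if M: "prob_space M" and g: "continuous_map local_topology euclideanreal g"
      "\<And>G. G \<in> mdgraphs \<Longrightarrow> 0 \<le> g G" "\<And>G. G \<in> mdgraphs \<Longrightarrow> g G \<le> B"
      and Y: "Y \<in> M \<rightarrow>\<^sub>M borel_of local_topology" "\<And>p. p \<in> space M \<Longrightarrow> Y p \<in> mdgraphs"
    for M :: "'c measure" and Y :: "'c \<Rightarrow> nat list mdgraph" and g
  proof
    interpret M: prob_space M by fact
    have "AE p in M. norm (g (Y p)) \<le> B" using g(2,3) Y(2) by (intro AE_I2) auto
    then have "integrable M (\<lambda>p. g (Y p))"
      by (rule M.integrable_const_bound) (rule continuous_map_measurable_borel_of[OF g(1) Y(1)])
    then show "(\<integral>\<^sup>+p. ennreal (g (Y p)) \<partial>M) = ennreal (\<integral>p. g (Y p) \<partial>M)"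
      using g(2) Y(2) by (intro nn_integral_eq_integral AE_I2) auto
    show "0 \<le> (\<integral>p. g (Y p) \<partial>M)" using g(2) Y(2) by (intro integral_nonneg_AE AE_I2) auto
  qed
  have cP: "prob_space (completion (P n))" for n
    using weighted_finite_graphs.P[OF graphs] by (rule prob_space.prob_space_completion)
  have cQ: "prob_space (completion Q)" by (rule Q.prob_space_completion)
  have YP: "(\<lambda>p. (G n p, MD n p)) \<in> completion (P n) \<rightarrow>\<^sub>M borel_of local_topology" for n
    by (rule weighted_finite_graphs.measurable_configuration[OF graphs])
  have YPm: "(G n p, MD n p) \<in> mdgraphs" "(G n p, {}) \<in> mdgraphs" if "p \<in> space (completion (P n))" for n p
    using weighted_finite_graphs.configuration_in_mdgraphs[OF graphs, of p n] that by (auto simp: mdgraphs_def md_config_def)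
  note intP = nint[OF cP f nn B YP YPm(1)] and intQ = nint[OF cQ f nn B measurable_limit limit_in_mdgraphs]
  show ?thesis
  proof (cases "c < 0")
    \<comment> \<open>The comparison below runs in \<open>ennreal\<close>, so negative levels are
      settled separately by non-negativity of the integrals.\<close>
    case True
    then show ?thesis using intP by (intro always_eventually allI) (meson less_le_trans)
  next
    case False
    then have "ennreal c < (\<integral>\<^sup>+q. ennreal (f (limit q)) \<partial>completion Q)"
      using intQ c by (simp add: ennreal_less_iff)
    then obtain h k where hk: "ennreal c < (\<integral>\<^sup>+q. best_mean \<omega> \<xi> h k f (offspring_tree (N q), {}) \<partial>completion Q)"
      using exists_good_score[OF f nn B] by blast
    define s where "s G = enn2real (best_mean \<omega> \<xi> h k f G)" for G
    have "0 \<le> B" using nn B limit_in_mdgraphs by (meson order_trans)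
    have fin: "best_mean \<omega> \<xi> h k f G \<le> ennreal B" for G by (rule best_mean_bounded[OF omega xi nn B])
    then have s: "ennreal (s G) = best_mean \<omega> \<xi> h k f G" for G
      unfolding s_def by (intro ennreal_enn2real) (metis ennreal_less_top le_less_trans)
    have s0: "0 \<le> s G" and sB: "s G \<le> B" for G
      using fin[of G] \<open>0 \<le> B\<close> by (simp_all add: s_def enn2real_leI)
    have sc: "continuous_map local_topology euclideanreal s"
      by (rule continuous_map_locally_constant[where H="h + 2 * k + 1"]) (simp only: s_def best_mean_cong)
    have "(\<lambda>n. \<integral>p. s (G n p, {}) \<partial>completion (P n)) \<longlonglongrightarrow> (\<integral>q. s (offspring_tree (N q), {}) \<partial>completion Q)"
    proof -
      have "bounded (s ` topspace local_topology)"
        using s0 sB by (intro boundedI[of _ B]) auto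
      then show ?thesis using conv sc unfolding weakly_converges_in_def by blast
    qed
    moreover have "c < (\<integral>q. s (offspring_tree (N q), {}) \<partial>completion Q)"
    proof -
      have "(\<lambda>q. (offspring_tree (N q), {})) \<in> completion Q \<rightarrow>\<^sub>M borel_of local_topology"
        using conv unfolding weakly_converges_in_def by blast
      moreover have "(offspring_tree (N q), {}) \<in> mdgraphs" for q
        by (simp add: mdgraphs_def md_config_def rooted_graph_offspring_tree)
      ultimately have "ennreal (\<integral>q. s (offspring_tree (N q), {}) \<partial>completion Q) = (\<integral>\<^sup>+q. best_mean \<omega> \<xi> h k f (offspring_tree (N q), {}) \<partial>completion Q)"
        using nint[OF cQ sc s0 sB] by (simp add: s)
      with hk False show ?thesis by (metis ennreal_leI not_le)
    qed
    ultimately have "\<forall>\<^sub>F n in sequentially. c < (\<integral>p. s (G n p, {}) \<partial>completion (P n))" by (rule order_tendstoD(1))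
    then show ?thesis
    proof eventually_elim
      case (elim n)
      have "(\<lambda>p. (G n p, {})) \<in> completion (P n) \<rightarrow>\<^sub>M borel_of local_topology"
        using conv unfolding weakly_converges_in_def by blast
      then have "ennreal (\<integral>p. s (G n p, {}) \<partial>completion (P n)) = (\<integral>\<^sup>+p. best_mean \<omega> \<xi> h k f (G n p, {}) \<partial>completion (P n))"
        using nint[OF cP sc s0 sB _ YPm(2)] by (simp add: s)
      also have "\<dots> \<le> ennreal (\<integral>p. f (G n p, MD n p) \<partial>completion (P n))"
        using weighted_finite_graphs.best_mean_le[OF graphs f nn] intP by simp
      finally have "(\<integral>p. s (G n p, {}) \<partial>completion (P n)) \<le> (\<integral>p. f (G n p, MD n p) \<partial>completion (P n))"
        using intP by (simp add: ennreal_le_iff)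
      with elim show ?case by simp
    qed
  qed
qed

end

theorem corollary1:
  fixes \<pi> :: "nat pmf" and \<omega> \<xi> :: "real measure"
    and Q :: "'q measure" and N :: "'q \<Rightarrow> nat list \<Rightarrow> nat"
    and w :: "'q \<Rightarrow> nat list set \<Rightarrow> real" and x :: "'q \<Rightarrow> nat list \<Rightarrow> real"
    and P :: "nat \<Rightarrow> 'p measure" and G :: "nat \<Rightarrow> 'p \<Rightarrow> nat list rgraph"
    and wn :: "nat \<Rightarrow> 'p \<Rightarrow> nat list set \<Rightarrow> real" and xn :: "nat \<Rightarrow> 'p \<Rightarrow> nat list \<Rightarrow> real"
    and MD :: "nat \<Rightarrow> 'p \<Rightarrow> nat list set set"
  assumes "integrable (measure_pmf \<pi>) real" and "measure_pmf.expectation \<pi> real > 0"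
    and "real_distribution \<omega>" and "real_distribution \<xi>"
    and "bdd_below (msupport \<xi>)" and "atomless \<xi> \<or> only_atom_at_min \<xi>"
    and "atomless \<omega>" and "locally_convex_under_max \<omega>"
    and "integrable (measure_pmf \<pi>) (\<lambda>k. (real k)\<^sup>2)"
    and "weighted_ubgw Q \<pi> \<omega> \<xi> N w x"
    and "\<And>n. prob_space (P n)"
    and "\<And>n. G n \<in> P n \<rightarrow>\<^sub>M count_space UNIV"
    and "\<And>n p. p \<in> space (P n) \<Longrightarrow> rooted_graph (G n p) \<and> finite (verts (G n p))"
    and "local_weak_conv P (\<lambda>n p. (G n p, {})) Q (\<lambda>q. (offspring_tree (N q), {}))"
    and "\<And>n. iid_weights (P n) (G n) \<omega> \<xi> (wn n) (xn n)"
    and "\<And>n p. p \<in> space (P n) \<Longrightarrow> optimal_md (G n p) (wn n p) (xn n p) (MD n p)"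
  shows "local_weak_conv P (\<lambda>n p. (G n p, MD n p)) Q
           (\<lambda>q. (offspring_tree (N q), message_md (offspring_tree (N q)) (w q) (x q)))"
proof -
  interpret ubgw_tree \<pi> \<omega> \<xi> Q N w x
    by (intro ubgw_tree.intro ubgw_law.intro ubgw_tree_axioms.intro) fact+
  have graphs: "weighted_finite_graphs (P n) (G n) \<omega> \<xi> (wn n) (xn n) (MD n)" for n
    by (rule weighted_finite_graphs.intro) fact+
  have YP: "(\<lambda>p. (G n p, MD n p)) \<in> completion (P n) \<rightarrow>\<^sub>M borel_of local_topology" for n
    by (rule weighted_finite_graphs.measurable_configuration[OF graphs])
  have YPm: "(G n p, MD n p) \<in> mdgraphs" if "p \<in> space (completion (P n))" for n p
    using weighted_finite_graphs.configuration_in_mdgraphs[OF graphs, of p n] that by simp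
  have "(\<lambda>n. \<integral>p. f (G n p, MD n p) \<partial>completion (P n)) \<longlonglongrightarrow> (\<integral>q. f (limit q) \<partial>completion Q)"
    if f: "continuous_map local_topology euclideanreal f" and bd: "bounded (f ` topspace local_topology)" for f
  proof -
    obtain C where C: "\<And>G. G \<in> mdgraphs \<Longrightarrow> \<bar>f G\<bar> \<le> C"
      using bd by (auto simp: bounded_iff topspace_local_topology)
    have affine: "(\<integral>p. a * f (Y p) + C \<partial>M) = a * (\<integral>p. f (Y p) \<partial>M) + C"
      if M: "prob_space M" and Y: "Y \<in> M \<rightarrow>\<^sub>M borel_of local_topology" "\<And>p. p \<in> space M \<Longrightarrow> Y p \<in> mdgraphs"
      for M :: "'c measure" and Y :: "'c \<Rightarrow> nat list mdgraph" and a :: real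
    proof -
      interpret M: prob_space M by fact
      have "integrable M (\<lambda>p. f (Y p))"
        using C Y(2) by (intro M.integrable_const_bound[of _ C] AE_I2 continuous_map_measurable_borel_of[OF f Y(1)]) auto
      then show ?thesis by (simp add: M.prob_space)
    qed
    have aP: "(\<integral>p. a * f (G n p, MD n p) + C \<partial>completion (P n)) = a * (\<integral>p. f (G n p, MD n p) \<partial>completion (P n)) + C" for n a
      using prob_space.prob_space_completion[OF weighted_finite_graphs.P[OF graphs]] YP YPm by (rule affine)
    have aQ: "(\<integral>q. a * f (limit q) + C \<partial>completion Q) = a * (\<integral>q. f (limit q) \<partial>completion Q) + C" for a
      using Q.prob_space_completion measurable_limit limit_in_mdgraphs by (rule affine)
    have ev: "\<forall>\<^sub>F n in sequentially. c < a * (\<integral>p. f (G n p, MD n p) \<partial>completion (P n))"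
      if c: "c < a * (\<integral>q. f (limit q) \<partial>completion Q)" and a: "\<bar>a\<bar> = 1" for a c
    proof -
      have ab: "\<bar>a * f G\<bar> \<le> C" if "G \<in> mdgraphs" for G using C[OF that] a by (simp add: abs_mult)
      have "\<forall>\<^sub>F n in sequentially. c + C < (\<integral>p. a * f (G n p, MD n p) + C \<partial>completion (P n))"
      proof (rule eventually_integral_greater[OF graphs assms(14), where B="2 * C"])
        show "continuous_map local_topology euclideanreal (\<lambda>G. a * f G + C)"
          by (intro continuous_map_real_mult continuous_map_add f) simp_all
        show "0 \<le> a * f G + C" "a * f G + C \<le> 2 * C" if "G \<in> mdgraphs" for G using ab[OF that] by auto
        show "c + C < (\<integral>q. a * f (limit q) + C \<partial>completion Q)" using c by (simp only: aQ)
      qed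
      then show ?thesis unfolding aP by simp
    qed
    show ?thesis
    proof (rule order_tendstoI)
      fix c assume "c < (\<integral>q. f (limit q) \<partial>completion Q)"
      then show "\<forall>\<^sub>F n in sequentially. c < (\<integral>p. f (G n p, MD n p) \<partial>completion (P n))" using ev[of c 1] by simp
    next
      fix c assume "(\<integral>q. f (limit q) \<partial>completion Q) < c"
      then show "\<forall>\<^sub>F n in sequentially. (\<integral>p. f (G n p, MD n p) \<partial>completion (P n)) < c" using ev[of "- c" "- 1"] by simp
    qed
  qed
  then show ?thesis unfolding weakly_converges_in_def using YP measurable_limit by blast
qed

end
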